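(* Let $\mathcal{C}$ be a pretriangulated dg category over $\mathbf{k}$, and let $$A \xrightarrow{\;x\;} B \xrightarrow{\;v\;} C \xrightarrow{\;s\;} \Sigma A$$ be a triangle in $\mathcal{C}$. Then there are weak equivalences $$\mathcal{C}/v \simeq R_x(\mathcal{C}) \qquad\text{and}\qquad \mathcal{C}/v \simeq L_s(\mathcal{C})$$ in the under category $\mathcal{C}\downarrow\mathrm{dgCat}$.
   Context: Fix a commutative ring $\mathbf{k}$. Dg modules are homologically graded (the differential lowers degree by one) and $\Sigma$ is the homological suspension. A dg category is a category enriched over dg $\mathbf{k}$-modules; composition is written right to left, so $fg$ means first $g$, then $f$. $\mathrm{dgCat}$ is the category of dg categories and dg functors with Tabuada's model structure, whose weak equivalences are the quasi-equivalences. All dg categories are assumed flat over $\mathbf{k}$. $\mathcal{C}\downarrow\mathrm{dgCat}$ is the category of dg categories equipped with a dg functor from $\mathcal{C}$ (maps are commutative triangles), with the induced model structure. "$\simeq$ in $\mathcal{C}\downarrow\mathrm{dgCat}$" means being connected by a zigzag of quasi-equivalences under $\mathcal{C}$, i.e. isomorphic in the homotopy category of $\mathcal{C}\downarrow\mathrm{dgCat}$. A triangle in a pretriangulated dg category $\mathcal{C}$ consists of closed degree $0$ morphisms whose classes form an exact triangle in the triangulated category $H_0(\mathcal{C})$. Let $v:O_1\to O_2$ be a closed morphism of degree $n$ in a dg category $\mathcal{C}$. Killing: $\mathcal{C}/v$ is the dg category with the same objects as $\mathcal{C}$, obtained from $\mathcal{C}$ by freely adjoining a morphism $w:O_1\to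 O_2$ of degree $n+1$ with $d(w)=v$. Right localization: $R_v(\mathcal{C})$ is obtained from $\mathcal{C}$ by freely adjoining morphisms $w:O_2\to O_1$ of degree $-n$ and $u:O_2\to O_2$ of degree $1$ with $d(w)=0$, $d(u)=vw-1_{O_2}$. Left localization: $L_v(\mathcal{C})$ is obtained from $\mathcal{C}$ by freely adjoining morphisms $w':O_2\to O_1$ of degree $-n$ and $u':O_1\to O_1$ of degree $1$ with $d(w')=0$, $d(u')=w'v-1_{O_1}$. All three are objects of $\mathcal{C}\downarrow\mathrm{dgCat}$ via the evident dg functor from $\mathcal{C}$. Here $R_x$ and $L_s$ are these constructions applied to $x:A\to B$ and $s:C\to\Sigma A$. *)

theory Defs
  imports "HOL-Algebra.Module" "HOL-Algebra.AbelCoset" "HOL-Library.Multiset"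
begin

section \<open>Modules\<close>

definition linear_map ::
    "('k, 'z) ring_scheme \<Rightarrow> ('k, 'a) module \<Rightarrow> ('k, 'b) module \<Rightarrow> ('a \<Rightarrow> 'b) \<Rightarrow> bool" where
  "linear_map k M N f \<longleftrightarrow>
     f \<in> carrier M \<rightarrow> carrier N \<and>
     (\<forall>a\<in>carrier M. \<forall>b\<in>carrier M. f (a \<oplus>\<^bsub>M\<^esub> b) = f a \<oplus>\<^bsub>N\<^esub> f b) \<and>
     (\<forall>r\<in>carrier k. \<forall>a\<in>carrier M. f (r \<odot>\<^bsub>M\<^esub> a) = r \<odot>\<^bsub>N\<^esub> f a)"

text \<open>The element \<open>(-1)\<^sup>n a\<close>.\<close>

definition signed :: "('k, 'a) module \<Rightarrow> int \<Rightarrow> 'a \<Rightarrow> 'a" where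
  "signed M n a = (if even n then a else \<ominus>\<^bsub>M\<^esub> a)"

text \<open>The tensor product \<open>M \<otimes> N\<close> is the set of formal sums of pairs (finite multisets) modulo the
  congruence \<open>tensor_eq\<close>. The empty multiset is the zero, and \<open>(\<ominus>a, b)\<close> is inverse to \<open>(a, b)\<close>.\<close>

inductive tensor_eq ::
    "('k, 'z) ring_scheme \<Rightarrow> ('k, 'a) module \<Rightarrow> ('k, 'b) module \<Rightarrow>
     ('a \<times> 'b) multiset \<Rightarrow> ('a \<times> 'b) multiset \<Rightarrow> bool"
  for k M N where
  refl: "set_mset S \<subseteq> carrier M \<times> carrier N \<Longrightarrow> tensor_eq k M N S S"
| sym: "tensor_eq k M N S T \<Longrightarrow> tensor_eq k M N T S"
| trans: "tensor_eq k M N S T \<Longrightarrow> tensor_eq k M N T U \<Longrightarrow> tensor_eq k M N S U"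
| plus: "tensor_eq k M N S T \<Longrightarrow> tensor_eq k M N S' T' \<Longrightarrow> tensor_eq k M N (S + S') (T + T')"
| zero: "b \<in> carrier N \<Longrightarrow> tensor_eq k M N {#(\<zero>\<^bsub>M\<^esub>, b)#} {#}"
| add_left: "a \<in> carrier M \<Longrightarrow> a' \<in> carrier M \<Longrightarrow> b \<in> carrier N \<Longrightarrow>
    tensor_eq k M N {#(a \<oplus>\<^bsub>M\<^esub> a', b)#} {#(a, b), (a', b)#}"
| add_right: "a \<in> carrier M \<Longrightarrow> b \<in> carrier N \<Longrightarrow> b' \<in> carrier N \<Longrightarrow>
    tensor_eq k M N {#(a, b \<oplus>\<^bsub>N\<^esub> b')#} {#(a, b), (a, b')#}"
| scalar: "r \<in> carrier k \<Longrightarrow> a \<in> carrier M \<Longrightarrow> b \<in> carrier N \<Longrightarrow>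
    tensor_eq k M N {#(r \<odot>\<^bsub>M\<^esub> a, b)#} {#(a, r \<odot>\<^bsub>N\<^esub> b)#}"

text \<open>\<open>M\<close> is flat if \<open>M \<otimes> -\<close> preserves injective linear maps. The test modules have carriers in the
  type \<open>(nat \<Rightarrow> 'k) set\<close>, which up to isomorphism includes all subquotients of the modules
  \<open>k\<^sup>n\<close>, in particular all finitely generated modules; these suffice for flatness.\<close>

definition flat_module :: "('k, 'z) ring_scheme \<Rightarrow> ('k, 'a) module \<Rightarrow> bool" where
  "flat_module k M \<longleftrightarrow>
     (\<forall>(N :: ('k, (nat \<Rightarrow> 'k) set) module) (N' :: ('k, (nat \<Rightarrow> 'k) set) module) f.
        module k N \<and> module k N' \<and> linear_map k N N' f \<and> inj_on f (carrier N) \<longrightarrow>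
        (\<forall>S T. set_mset S \<subseteq> carrier M \<times> carrier N \<and> set_mset T \<subseteq> carrier M \<times> carrier N \<and>
           tensor_eq k M N' (image_mset (map_prod id f) S) (image_mset (map_prod id f) T) \<longrightarrow>
           tensor_eq k M N S T))"


section \<open>Dg categories\<close>

text \<open>\<open>Hom \<C> X Y n\<close> is the degree \<open>n\<close> part of the complex of morphisms \<open>X \<rightarrow> Y\<close>,
  \<open>dif \<C> X Y n\<close> is its differential from degree \<open>n\<close> to degree \<open>n - 1\<close>, and
  \<open>cmp \<C> X Y Z m n g f\<close> is \<open>gf\<close> (first \<open>f\<close>) for \<open>f : X \<rightarrow> Y\<close> of degree \<open>n\<close> and
  \<open>g : Y \<rightarrow> Z\<close> of degree \<open>m\<close>. The multiplicative fields of the record \<open>module\<close> are never used.\<close>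

record ('o, 'k, 'm) dgcat =
  Obj :: "'o set"
  Hom :: "'o \<Rightarrow> 'o \<Rightarrow> int \<Rightarrow> ('k, 'm) module"
  dif :: "'o \<Rightarrow> 'o \<Rightarrow> int \<Rightarrow> 'm \<Rightarrow> 'm"
  cmp :: "'o \<Rightarrow> 'o \<Rightarrow> 'o \<Rightarrow> int \<Rightarrow> int \<Rightarrow> 'm \<Rightarrow> 'm \<Rightarrow> 'm"
  idt :: "'o \<Rightarrow> 'm"

locale dg_category = cring k for k :: "('k, 'z) ring_scheme" (structure) +
  fixes \<C> :: "('o, 'k, 'm) dgcat"
  assumes hom_module: "X \<in> Obj \<C> \<Longrightarrow> Y \<in> Obj \<C> \<Longrightarrow> module k (Hom \<C> X Y n)"
    and dif_linear: "X \<in> Obj \<C> \<Longrightarrow> Y \<in> Obj \<C> \<Longrightarrow>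
      linear_map k (Hom \<C> X Y n) (Hom \<C> X Y (n - 1)) (dif \<C> X Y n)"
    and dif_dif: "X \<in> Obj \<C> \<Longrightarrow> Y \<in> Obj \<C> \<Longrightarrow> f \<in> carrier (Hom \<C> X Y n) \<Longrightarrow>
      dif \<C> X Y (n - 1) (dif \<C> X Y n f) = \<zero>\<^bsub>Hom \<C> X Y (n - 2)\<^esub>"
    and cmp_linear_left: "X \<in> Obj \<C> \<Longrightarrow> Y \<in> Obj \<C> \<Longrightarrow> Z \<in> Obj \<C> \<Longrightarrow>
      f \<in> carrier (Hom \<C> X Y n) \<Longrightarrow>
      linear_map k (Hom \<C> Y Z m) (Hom \<C> X Z (m + n)) (\<lambda>g. cmp \<C> X Y Z m n g f)"
    and cmp_linear_right: "X \<in> Obj \<C> \<Longrightarrow> Y \<in> Obj \<C> \<Longrightarrow> Z \<in> Obj \<C> \<Longrightarrow>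
      g \<in> carrier (Hom \<C> Y Z m) \<Longrightarrow>
      linear_map k (Hom \<C> X Y n) (Hom \<C> X Z (m + n)) (\<lambda>f. cmp \<C> X Y Z m n g f)"
    and cmp_assoc: "W \<in> Obj \<C> \<Longrightarrow> X \<in> Obj \<C> \<Longrightarrow> Y \<in> Obj \<C> \<Longrightarrow> Z \<in> Obj \<C> \<Longrightarrow>
      f \<in> carrier (Hom \<C> W X n) \<Longrightarrow> g \<in> carrier (Hom \<C> X Y m) \<Longrightarrow>
      h \<in> carrier (Hom \<C> Y Z l) \<Longrightarrow>
      cmp \<C> W X Z (l + m) n (cmp \<C> X Y Z l m h g) f =
      cmp \<C> W Y Z l (m + n) h (cmp \<C> W X Y m n g f)"
    and idt_closed: "X \<in> Obj \<C> \<Longrightarrow> idt \<C> X \<in> carrier (Hom \<C> X X 0)"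
    and idt_left: "X \<in> Obj \<C> \<Longrightarrow> Y \<in> Obj \<C> \<Longrightarrow> f \<in> carrier (Hom \<C> X Y n) \<Longrightarrow>
      cmp \<C> X Y Y 0 n (idt \<C> Y) f = f"
    and idt_right: "X \<in> Obj \<C> \<Longrightarrow> Y \<in> Obj \<C> \<Longrightarrow> f \<in> carrier (Hom \<C> X Y n) \<Longrightarrow>
      cmp \<C> X X Y n 0 f (idt \<C> X) = f"
    and leibniz: "X \<in> Obj \<C> \<Longrightarrow> Y \<in> Obj \<C> \<Longrightarrow> Z \<in> Obj \<C> \<Longrightarrow>
      f \<in> carrier (Hom \<C> X Y n) \<Longrightarrow> g \<in> carrier (Hom \<C> Y Z m) \<Longrightarrow>
      dif \<C> X Z (m + n) (cmp \<C> X Y Z m n g f) =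
      cmp \<C> X Y Z (m - 1) n (dif \<C> Y Z m g) f \<oplus>\<^bsub>Hom \<C> X Z (m + n - 1)\<^esub>
      signed (Hom \<C> X Z (m + n - 1)) m (cmp \<C> X Y Z m (n - 1) g (dif \<C> X Y n f))"

definition dg_flat :: "('k, 'z) ring_scheme \<Rightarrow> ('o, 'k, 'm) dgcat \<Rightarrow> bool" where
  "dg_flat k \<C> \<longleftrightarrow> (\<forall>X\<in>Obj \<C>. \<forall>Y\<in>Obj \<C>. \<forall>n. flat_module k (Hom \<C> X Y n))"

record ('o, 'p, 'm, 'n) dgfun =
  on_obj :: "'o \<Rightarrow> 'p"
  on_mor :: "'o \<Rightarrow> 'o \<Rightarrow> int \<Rightarrow> 'm \<Rightarrow> 'n"

definition dg_functor ::
    "('k, 'z) ring_scheme \<Rightarrow> ('o, 'k, 'm) dgcat \<Rightarrow> ('p, 'k, 'n) dgcat \<Rightarrow>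
     ('o, 'p, 'm, 'n) dgfun \<Rightarrow> bool" where
  "dg_functor k \<C> \<D> F \<longleftrightarrow>
     (\<forall>X\<in>Obj \<C>. on_obj F X \<in> Obj \<D>) \<and>
     (\<forall>X\<in>Obj \<C>. \<forall>Y\<in>Obj \<C>. \<forall>n.
        linear_map k (Hom \<C> X Y n) (Hom \<D> (on_obj F X) (on_obj F Y) n) (on_mor F X Y n)) \<and>
     (\<forall>X\<in>Obj \<C>. \<forall>Y\<in>Obj \<C>. \<forall>n. \<forall>f\<in>carrier (Hom \<C> X Y n).
        on_mor F X Y (n - 1) (dif \<C> X Y n f) =
        dif \<D> (on_obj F X) (on_obj F Y) n (on_mor F X Y n f)) \<and>
     (\<forall>X\<in>Obj \<C>. \<forall>Y\<in>Obj \<C>. \<forall>Z\<in>Obj \<C>. \<forall>m n.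
        \<forall>g\<in>carrier (Hom \<C> Y Z m). \<forall>f\<in>carrier (Hom \<C> X Y n).
        on_mor F X Z (m + n) (cmp \<C> X Y Z m n g f) =
        cmp \<D> (on_obj F X) (on_obj F Y) (on_obj F Z) m n (on_mor F Y Z m g) (on_mor F X Y n f)) \<and>
     (\<forall>X\<in>Obj \<C>. on_mor F X X 0 (idt \<C> X) = idt \<D> (on_obj F X))"


section \<open>Homology and quasi-equivalences\<close>

definition cycles :: "('o, 'k, 'm) dgcat \<Rightarrow> 'o \<Rightarrow> 'o \<Rightarrow> int \<Rightarrow> 'm set" where
  "cycles \<C> X Y n = {f \<in> carrier (Hom \<C> X Y n). dif \<C> X Y n f = \<zero>\<^bsub>Hom \<C> X Y (n - 1)\<^esub>}"

definition boundaries :: "('o, 'k, 'm) dgcat \<Rightarrow> 'o \<Rightarrow> 'o \<Rightarrow> int \<Rightarrow> 'm set" where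
  "boundaries \<C> X Y n = dif \<C> X Y (n + 1) ` carrier (Hom \<C> X Y (n + 1))"

definition hclass :: "('o, 'k, 'm) dgcat \<Rightarrow> 'o \<Rightarrow> 'o \<Rightarrow> int \<Rightarrow> 'm \<Rightarrow> 'm set" where
  "hclass \<C> X Y n f = boundaries \<C> X Y n +>\<^bsub>Hom \<C> X Y n\<^esub> f"

definition homology :: "('o, 'k, 'm) dgcat \<Rightarrow> 'o \<Rightarrow> 'o \<Rightarrow> int \<Rightarrow> 'm set set" where
  "homology \<C> X Y n = hclass \<C> X Y n ` cycles \<C> X Y n"

definition homology_map ::
    "('p, 'k, 'n) dgcat \<Rightarrow> ('o, 'p, 'm, 'n) dgfun \<Rightarrow> 'o \<Rightarrow> 'o \<Rightarrow> int \<Rightarrow> 'm set \<Rightarrow> 'n set" where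
  "homology_map \<D> F X Y n c =
     (\<Union>f\<in>c. hclass \<D> (on_obj F X) (on_obj F Y) n (on_mor F X Y n f))"

text \<open>The class of the closed degree \<open>0\<close> morphism \<open>f : X \<rightarrow> Y\<close> is an isomorphism in \<open>H\<^sub>0(\<C>)\<close>.\<close>

definition h0_iso :: "('o, 'k, 'm) dgcat \<Rightarrow> 'o \<Rightarrow> 'o \<Rightarrow> 'm \<Rightarrow> bool" where
  "h0_iso \<C> X Y f \<longleftrightarrow>
     X \<in> Obj \<C> \<and> Y \<in> Obj \<C> \<and> f \<in> cycles \<C> X Y 0 \<and>
     (\<exists>g\<in>cycles \<C> Y X 0.
        hclass \<C> X X 0 (cmp \<C> X Y X 0 0 g f) = hclass \<C> X X 0 (idt \<C> X) \<and>
        hclass \<C> Y Y 0 (cmp \<C> Y X Y 0 0 f g) = hclass \<C> Y Y 0 (idt \<C> Y))"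

definition quasi_equivalence ::
    "('k, 'z) ring_scheme \<Rightarrow> ('o, 'k, 'm) dgcat \<Rightarrow> ('p, 'k, 'n) dgcat \<Rightarrow>
     ('o, 'p, 'm, 'n) dgfun \<Rightarrow> bool" where
  "quasi_equivalence k \<C> \<D> F \<longleftrightarrow>
     dg_functor k \<C> \<D> F \<and>
     (\<forall>X\<in>Obj \<C>. \<forall>Y\<in>Obj \<C>. \<forall>n.
        bij_betw (homology_map \<D> F X Y n)
          (homology \<C> X Y n) (homology \<D> (on_obj F X) (on_obj F Y) n)) \<and>
     (\<forall>Y\<in>Obj \<D>. \<exists>X\<in>Obj \<C>. \<exists>f. h0_iso \<D> (on_obj F X) Y f)"


section \<open>The category of dg categories under \<open>\<C>\<close>\<close>

definition dg_under ::
    "('k, 'z) ring_scheme \<Rightarrow> ('o, 'k, 'm) dgcat \<Rightarrow>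
     ('p, 'k, 'n) dgcat \<times> ('o, 'p, 'm, 'n) dgfun \<Rightarrow> bool" where
  "dg_under k \<C> = (\<lambda>(\<D>, F). dg_category k \<D> \<and> dg_functor k \<C> \<D> F)"

definition quasi_equivalence_under ::
    "('k, 'z) ring_scheme \<Rightarrow> ('o, 'k, 'm) dgcat \<Rightarrow>
     ('p, 'k, 'n) dgcat \<times> ('o, 'p, 'm, 'n) dgfun \<Rightarrow>
     ('p, 'k, 'n) dgcat \<times> ('o, 'p, 'm, 'n) dgfun \<Rightarrow> bool" where
  "quasi_equivalence_under k \<C> = (\<lambda>(\<D>, F) (\<D>', F').
     dg_under k \<C> (\<D>, F) \<and> dg_under k \<C> (\<D>', F') \<and>
     (\<exists>H. quasi_equivalence k \<D> \<D>' H \<and>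
        (\<forall>X\<in>Obj \<C>. on_obj H (on_obj F X) = on_obj F' X) \<and>
        (\<forall>X\<in>Obj \<C>. \<forall>Y\<in>Obj \<C>. \<forall>n. \<forall>f\<in>carrier (Hom \<C> X Y n).
           on_mor H (on_obj F X) (on_obj F Y) n (on_mor F X Y n f) = on_mor F' X Y n f)))"

text \<open>A zigzag of quasi-equivalences under \<open>\<C>\<close>. Its intermediate dg categories are arbitrary objects of
  the model category of dg categories, except that their objects and morphisms are taken from the
  same types \<open>'p\<close> and \<open>'n\<close> as those of the two ends. For ends that are cofibrant under \<open>\<C>\<close>, as are
  free extensions, this is no restriction: all dg categories are fibrant, so an isomorphism in the
  homotopy category is then realized by a single quasi-equivalence.\<close>

definition weakly_equivalent_under ::
    "('k, 'z) ring_scheme \<Rightarrow> ('o, 'k, 'm) dgcat \<Rightarrow>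
     ('p, 'k, 'n) dgcat \<times> ('o, 'p, 'm, 'n) dgfun \<Rightarrow>
     ('p, 'k, 'n) dgcat \<times> ('o, 'p, 'm, 'n) dgfun \<Rightarrow> bool" where
  "weakly_equivalent_under k \<C> P Q \<longleftrightarrow>
     dg_under k \<C> P \<and> dg_under k \<C> Q \<and> equivclp (quasi_equivalence_under k \<C>) P Q"


section \<open>Freely adjoining morphisms\<close>

text \<open>Expressions in morphisms of \<open>\<C>\<close> (\<open>Base X Y n f\<close> stands for \<open>f : X \<rightarrow> Y\<close> of degree \<open>n\<close>) and
  in names \<open>'g\<close> of new morphisms.\<close>

datatype ('k, 'o, 'm, 'g) dgterm =
    Base 'o 'o int 'm
  | Gen 'g
  | Add "('k, 'o, 'm, 'g) dgterm" "('k, 'o, 'm, 'g) dgterm"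
  | Smul 'k "('k, 'o, 'm, 'g) dgterm"
  | Cmp "('k, 'o, 'm, 'g) dgterm" "('k, 'o, 'm, 'g) dgterm"
  | Dif "('k, 'o, 'm, 'g) dgterm"

text \<open>\<open>G g = Some (X, Y, n, b)\<close> means that a morphism \<open>g : X \<rightarrow> Y\<close> of degree \<open>n\<close> with
  \<open>d(g) = b\<close> is adjoined.\<close>

type_synonym ('k, 'o, 'm, 'g) generators =
  "'g \<Rightarrow> ('o \<times> 'o \<times> int \<times> ('k, 'o, 'm, 'g) dgterm) option"

inductive has_type ::
    "('k, 'z) ring_scheme \<Rightarrow> ('o, 'k, 'm) dgcat \<Rightarrow> ('k, 'o, 'm, 'g) generators \<Rightarrow>
     ('k, 'o, 'm, 'g) dgterm \<Rightarrow> 'o \<Rightarrow> 'o \<Rightarrow> int \<Rightarrow> bool"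
  for k \<C> G where
  Base: "X \<in> Obj \<C> \<Longrightarrow> Y \<in> Obj \<C> \<Longrightarrow> f \<in> carrier (Hom \<C> X Y n) \<Longrightarrow>
    has_type k \<C> G (Base X Y n f) X Y n"
| Gen: "G g = Some (X, Y, n, b) \<Longrightarrow> X \<in> Obj \<C> \<Longrightarrow> Y \<in> Obj \<C> \<Longrightarrow> has_type k \<C> G (Gen g) X Y n"
| Add: "has_type k \<C> G s X Y n \<Longrightarrow> has_type k \<C> G t X Y n \<Longrightarrow> has_type k \<C> G (Add s t) X Y n"
| Smul: "r \<in> carrier k \<Longrightarrow> has_type k \<C> G t X Y n \<Longrightarrow> has_type k \<C> G (Smul r t) X Y n"
| Cmp: "has_type k \<C> G s Y Z m \<Longrightarrow> has_type k \<C> G t X Y n \<Longrightarrow>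
    has_type k \<C> G (Cmp s t) X Z (m + n)"
| Dif: "has_type k \<C> G t X Y n \<Longrightarrow> has_type k \<C> G (Dif t) X Y (n - 1)"

text \<open>The least congruence making the expressions modulo it into a dg category under \<open>\<C>\<close> in which
  the generators have the prescribed differentials.\<close>

inductive term_eq ::
    "('k, 'z) ring_scheme \<Rightarrow> ('o, 'k, 'm) dgcat \<Rightarrow> ('k, 'o, 'm, 'g) generators \<Rightarrow>
     'o \<Rightarrow> 'o \<Rightarrow> int \<Rightarrow> ('k, 'o, 'm, 'g) dgterm \<Rightarrow> ('k, 'o, 'm, 'g) dgterm \<Rightarrow> bool"
  for k \<C> G where
  refl: "has_type k \<C> G t X Y n \<Longrightarrow> term_eq k \<C> G X Y n t t"
| sym: "term_eq k \<C> G X Y n s t \<Longrightarrow> term_eq k \<C> G X Y n t s"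
| trans: "term_eq k \<C> G X Y n s t \<Longrightarrow> term_eq k \<C> G X Y n t u \<Longrightarrow> term_eq k \<C> G X Y n s u"
| Add_cong: "term_eq k \<C> G X Y n s s' \<Longrightarrow> term_eq k \<C> G X Y n t t' \<Longrightarrow>
    term_eq k \<C> G X Y n (Add s t) (Add s' t')"
| Smul_cong: "r \<in> carrier k \<Longrightarrow> term_eq k \<C> G X Y n t t' \<Longrightarrow>
    term_eq k \<C> G X Y n (Smul r t) (Smul r t')"
| Cmp_cong: "term_eq k \<C> G Y Z m s s' \<Longrightarrow> term_eq k \<C> G X Y n t t' \<Longrightarrow>
    term_eq k \<C> G X Z (m + n) (Cmp s t) (Cmp s' t')"
| Dif_cong: "term_eq k \<C> G X Y n t t' \<Longrightarrow> term_eq k \<C> G X Y (n - 1) (Dif t) (Dif t')"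
| add_assoc: "has_type k \<C> G s X Y n \<Longrightarrow> has_type k \<C> G t X Y n \<Longrightarrow> has_type k \<C> G u X Y n \<Longrightarrow>
    term_eq k \<C> G X Y n (Add (Add s t) u) (Add s (Add t u))"
| add_comm: "has_type k \<C> G s X Y n \<Longrightarrow> has_type k \<C> G t X Y n \<Longrightarrow>
    term_eq k \<C> G X Y n (Add s t) (Add t s)"
| add_zero: "has_type k \<C> G t X Y n \<Longrightarrow>
    term_eq k \<C> G X Y n (Add t (Base X Y n \<zero>\<^bsub>Hom \<C> X Y n\<^esub>)) t"
| add_neg: "has_type k \<C> G t X Y n \<Longrightarrow>
    term_eq k \<C> G X Y n (Add t (Smul (\<ominus>\<^bsub>k\<^esub> \<one>\<^bsub>k\<^esub>) t)) (Base X Y n \<zero>\<^bsub>Hom \<C> X Y n\<^esub>)"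
| smul_distrib_left: "r \<in> carrier k \<Longrightarrow> r' \<in> carrier k \<Longrightarrow> has_type k \<C> G t X Y n \<Longrightarrow>
    term_eq k \<C> G X Y n (Smul (r \<oplus>\<^bsub>k\<^esub> r') t) (Add (Smul r t) (Smul r' t))"
| smul_distrib_right: "r \<in> carrier k \<Longrightarrow> has_type k \<C> G s X Y n \<Longrightarrow> has_type k \<C> G t X Y n \<Longrightarrow>
    term_eq k \<C> G X Y n (Smul r (Add s t)) (Add (Smul r s) (Smul r t))"
| smul_smul: "r \<in> carrier k \<Longrightarrow> r' \<in> carrier k \<Longrightarrow> has_type k \<C> G t X Y n \<Longrightarrow>
    term_eq k \<C> G X Y n (Smul (r \<otimes>\<^bsub>k\<^esub> r') t) (Smul r (Smul r' t))"
| smul_one: "has_type k \<C> G t X Y n \<Longrightarrow> term_eq k \<C> G X Y n (Smul \<one>\<^bsub>k\<^esub> t) t"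
| cmp_add_left: "has_type k \<C> G s Y Z m \<Longrightarrow> has_type k \<C> G s' Y Z m \<Longrightarrow>
    has_type k \<C> G t X Y n \<Longrightarrow>
    term_eq k \<C> G X Z (m + n) (Cmp (Add s s') t) (Add (Cmp s t) (Cmp s' t))"
| cmp_add_right: "has_type k \<C> G s Y Z m \<Longrightarrow> has_type k \<C> G t X Y n \<Longrightarrow>
    has_type k \<C> G t' X Y n \<Longrightarrow>
    term_eq k \<C> G X Z (m + n) (Cmp s (Add t t')) (Add (Cmp s t) (Cmp s t'))"
| cmp_smul_left: "r \<in> carrier k \<Longrightarrow> has_type k \<C> G s Y Z m \<Longrightarrow> has_type k \<C> G t X Y n \<Longrightarrow>
    term_eq k \<C> G X Z (m + n) (Cmp (Smul r s) t) (Smul r (Cmp s t))"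
| cmp_smul_right: "r \<in> carrier k \<Longrightarrow> has_type k \<C> G s Y Z m \<Longrightarrow> has_type k \<C> G t X Y n \<Longrightarrow>
    term_eq k \<C> G X Z (m + n) (Cmp s (Smul r t)) (Smul r (Cmp s t))"
| cmp_assoc: "has_type k \<C> G s Y Z l \<Longrightarrow> has_type k \<C> G t X Y m \<Longrightarrow> has_type k \<C> G u W X n \<Longrightarrow>
    term_eq k \<C> G W Z (l + m + n) (Cmp (Cmp s t) u) (Cmp s (Cmp t u))"
| idt_left: "has_type k \<C> G t X Y n \<Longrightarrow> term_eq k \<C> G X Y n (Cmp (Base Y Y 0 (idt \<C> Y)) t) t"
| idt_right: "has_type k \<C> G t X Y n \<Longrightarrow> term_eq k \<C> G X Y n (Cmp t (Base X X 0 (idt \<C> X))) t"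
| dif_add: "has_type k \<C> G s X Y n \<Longrightarrow> has_type k \<C> G t X Y n \<Longrightarrow>
    term_eq k \<C> G X Y (n - 1) (Dif (Add s t)) (Add (Dif s) (Dif t))"
| dif_smul: "r \<in> carrier k \<Longrightarrow> has_type k \<C> G t X Y n \<Longrightarrow>
    term_eq k \<C> G X Y (n - 1) (Dif (Smul r t)) (Smul r (Dif t))"
| dif_dif: "has_type k \<C> G t X Y n \<Longrightarrow>
    term_eq k \<C> G X Y (n - 2) (Dif (Dif t)) (Base X Y (n - 2) \<zero>\<^bsub>Hom \<C> X Y (n - 2)\<^esub>)"
| leibniz: "has_type k \<C> G s Y Z m \<Longrightarrow> has_type k \<C> G t X Y n \<Longrightarrow>
    term_eq k \<C> G X Z (m + n - 1) (Dif (Cmp s t))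
      (Add (Cmp (Dif s) t) (Smul (if even m then \<one>\<^bsub>k\<^esub> else \<ominus>\<^bsub>k\<^esub> \<one>\<^bsub>k\<^esub>) (Cmp s (Dif t))))"
| Base_add: "X \<in> Obj \<C> \<Longrightarrow> Y \<in> Obj \<C> \<Longrightarrow>
    f \<in> carrier (Hom \<C> X Y n) \<Longrightarrow> f' \<in> carrier (Hom \<C> X Y n) \<Longrightarrow>
    term_eq k \<C> G X Y n (Base X Y n (f \<oplus>\<^bsub>Hom \<C> X Y n\<^esub> f')) (Add (Base X Y n f) (Base X Y n f'))"
| Base_smul: "X \<in> Obj \<C> \<Longrightarrow> Y \<in> Obj \<C> \<Longrightarrow> r \<in> carrier k \<Longrightarrow> f \<in> carrier (Hom \<C> X Y n) \<Longrightarrow>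
    term_eq k \<C> G X Y n (Base X Y n (r \<odot>\<^bsub>Hom \<C> X Y n\<^esub> f)) (Smul r (Base X Y n f))"
| Base_cmp: "X \<in> Obj \<C> \<Longrightarrow> Y \<in> Obj \<C> \<Longrightarrow> Z \<in> Obj \<C> \<Longrightarrow>
    f \<in> carrier (Hom \<C> X Y n) \<Longrightarrow> g \<in> carrier (Hom \<C> Y Z m) \<Longrightarrow>
    term_eq k \<C> G X Z (m + n)
      (Base X Z (m + n) (cmp \<C> X Y Z m n g f)) (Cmp (Base Y Z m g) (Base X Y n f))"
| Base_dif: "X \<in> Obj \<C> \<Longrightarrow> Y \<in> Obj \<C> \<Longrightarrow> f \<in> carrier (Hom \<C> X Y n) \<Longrightarrow>
    term_eq k \<C> G X Y (n - 1) (Base X Y (n - 1) (dif \<C> X Y n f)) (Dif (Base X Y n f))"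
| Gen_dif: "G g = Some (X, Y, n, b) \<Longrightarrow> has_type k \<C> G (Gen g) X Y n \<Longrightarrow>
    has_type k \<C> G b X Y (n - 1) \<Longrightarrow> term_eq k \<C> G X Y (n - 1) (Dif (Gen g)) b"

definition term_class ::
    "('k, 'z) ring_scheme \<Rightarrow> ('o, 'k, 'm) dgcat \<Rightarrow> ('k, 'o, 'm, 'g) generators \<Rightarrow>
     'o \<Rightarrow> 'o \<Rightarrow> int \<Rightarrow> ('k, 'o, 'm, 'g) dgterm \<Rightarrow> ('k, 'o, 'm, 'g) dgterm set" where
  "term_class k \<C> G X Y n t = {s. term_eq k \<C> G X Y n t s}"

definition adjoin_hom ::
    "('k, 'z) ring_scheme \<Rightarrow> ('o, 'k, 'm) dgcat \<Rightarrow> ('k, 'o, 'm, 'g) generators \<Rightarrow>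
     'o \<Rightarrow> 'o \<Rightarrow> int \<Rightarrow> ('k, ('k, 'o, 'm, 'g) dgterm set) module" where
  "adjoin_hom k \<C> G X Y n =
     \<lparr>carrier = term_class k \<C> G X Y n ` {t. has_type k \<C> G t X Y n},
      monoid.mult = undefined, one = undefined,
      zero = term_class k \<C> G X Y n (Base X Y n \<zero>\<^bsub>Hom \<C> X Y n\<^esub>),
      add = (\<lambda>a b. \<Union>s\<in>a. \<Union>t\<in>b. term_class k \<C> G X Y n (Add s t)),
      smult = (\<lambda>r a. \<Union>t\<in>a. term_class k \<C> G X Y n (Smul r t))\<rparr>"

definition adjoin ::
    "('k, 'z) ring_scheme \<Rightarrow> ('o, 'k, 'm) dgcat \<Rightarrow> ('k, 'o, 'm, 'g) generators \<Rightarrow>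
     ('o, 'k, ('k, 'o, 'm, 'g) dgterm set) dgcat" where
  "adjoin k \<C> G =
     \<lparr>Obj = Obj \<C>,
      Hom = adjoin_hom k \<C> G,
      dif = (\<lambda>X Y n a. \<Union>t\<in>a. term_class k \<C> G X Y (n - 1) (Dif t)),
      cmp = (\<lambda>X Y Z m n a b. \<Union>s\<in>a. \<Union>t\<in>b. term_class k \<C> G X Z (m + n) (Cmp s t)),
      idt = (\<lambda>X. term_class k \<C> G X X 0 (Base X X 0 (idt \<C> X)))\<rparr>"

definition adjoin_functor ::
    "('k, 'z) ring_scheme \<Rightarrow> ('o, 'k, 'm) dgcat \<Rightarrow> ('k, 'o, 'm, 'g) generators \<Rightarrow>
     ('o, 'o, 'm, ('k, 'o, 'm, 'g) dgterm set) dgfun" where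
  "adjoin_functor k \<C> G =
     \<lparr>on_obj = (\<lambda>X. X), on_mor = (\<lambda>X Y n f. term_class k \<C> G X Y n (Base X Y n f))\<rparr>"

definition adjoin_under ::
    "('k, 'z) ring_scheme \<Rightarrow> ('o, 'k, 'm) dgcat \<Rightarrow> ('k, 'o, 'm, 'g) generators \<Rightarrow>
     ('o, 'k, ('k, 'o, 'm, 'g) dgterm set) dgcat \<times>
     ('o, 'o, 'm, ('k, 'o, 'm, 'g) dgterm set) dgfun" where
  "adjoin_under k \<C> G = (adjoin k \<C> G, adjoin_functor k \<C> G)"

datatype new_morphism = GenW | GenU

text \<open>In the following, \<open>v : P \<rightarrow> Q\<close> is a closed morphism of degree \<open>n\<close>.\<close>

definition killing ::
    "('k, 'z) ring_scheme \<Rightarrow> ('o, 'k, 'm) dgcat \<Rightarrow> 'o \<Rightarrow> 'o \<Rightarrow> int \<Rightarrow> 'm \<Rightarrow>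
     ('o, 'k, ('k, 'o, 'm, new_morphism) dgterm set) dgcat \<times>
     ('o, 'o, 'm, ('k, 'o, 'm, new_morphism) dgterm set) dgfun" where
  "killing k \<C> P Q n v =
     adjoin_under k \<C> [GenW \<mapsto> (P, Q, n + 1, Base P Q n v)]"

definition right_localization ::
    "('k, 'z) ring_scheme \<Rightarrow> ('o, 'k, 'm) dgcat \<Rightarrow> 'o \<Rightarrow> 'o \<Rightarrow> int \<Rightarrow> 'm \<Rightarrow>
     ('o, 'k, ('k, 'o, 'm, new_morphism) dgterm set) dgcat \<times>
     ('o, 'o, 'm, ('k, 'o, 'm, new_morphism) dgterm set) dgfun" where
  "right_localization k \<C> P Q n v =
     adjoin_under k \<C>
       [GenW \<mapsto> (Q, P, - n, Base Q P (- n - 1) \<zero>\<^bsub>Hom \<C> Q P (- n - 1)\<^esub>),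
        GenU \<mapsto> (Q, Q, 1, Add (Cmp (Base P Q n v) (Gen GenW))
                              (Smul (\<ominus>\<^bsub>k\<^esub> \<one>\<^bsub>k\<^esub>) (Base Q Q 0 (idt \<C> Q))))]"

definition left_localization ::
    "('k, 'z) ring_scheme \<Rightarrow> ('o, 'k, 'm) dgcat \<Rightarrow> 'o \<Rightarrow> 'o \<Rightarrow> int \<Rightarrow> 'm \<Rightarrow>
     ('o, 'k, ('k, 'o, 'm, new_morphism) dgterm set) dgcat \<times>
     ('o, 'o, 'm, ('k, 'o, 'm, new_morphism) dgterm set) dgfun" where
  "left_localization k \<C> P Q n v =
     adjoin_under k \<C>
       [GenW \<mapsto> (Q, P, - n, Base Q P (- n - 1) \<zero>\<^bsub>Hom \<C> Q P (- n - 1)\<^esub>),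
        GenU \<mapsto> (P, P, 1, Add (Cmp (Gen GenW) (Base P Q n v))
                              (Smul (\<ominus>\<^bsub>k\<^esub> \<one>\<^bsub>k\<^esub>) (Base P P 0 (idt \<C> P))))]"


section \<open>Twisted complexes\<close>

text \<open>A twisted complex is a formal sum \<open>\<Sum>i. \<Sigma>\<^bsup>r\<^sub>i\<^esup> X\<^sub>i\<close>, given by the list of the pairs \<open>(X\<^sub>i, r\<^sub>i)\<close>,
  with a strictly upper triangular matrix \<open>q\<close> of degree \<open>-1\<close> such that \<open>d q + q q = 0\<close>. The entry
  \<open>q i j\<close> is a morphism from the summand \<open>j\<close> to the summand \<open>i\<close>.\<close>

datatype ('o, 'm) twisted = Twisted (parts: "('o \<times> int) list") (twist: "nat \<Rightarrow> nat \<Rightarrow> 'm")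

text \<open>A morphism \<open>\<Sigma>\<^sup>r X \<rightarrow> \<Sigma>\<^sup>s Y\<close> of degree \<open>n\<close> is of the form \<open>\<sigma>\<^sup>s f \<sigma>\<^sup>-\<^sup>r\<close>, with \<open>f : X \<rightarrow> Y\<close> of
  degree \<open>n + r - s\<close> and \<open>\<sigma>\<close> a closed symbol of degree \<open>1\<close>; it is represented by \<open>f\<close>. So the
  differential acquires the sign \<open>(-1)\<^sup>s\<close>, and composition no sign.\<close>

definition shift_hom ::
    "('o, 'k, 'm) dgcat \<Rightarrow> 'o \<times> int \<Rightarrow> 'o \<times> int \<Rightarrow> int \<Rightarrow> ('k, 'm) module" where
  "shift_hom \<C> = (\<lambda>(X, r) (Y, s) n. Hom \<C> X Y (n + r - s))"

definition shift_dif ::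
    "('o, 'k, 'm) dgcat \<Rightarrow> 'o \<times> int \<Rightarrow> 'o \<times> int \<Rightarrow> int \<Rightarrow> 'm \<Rightarrow> 'm" where
  "shift_dif \<C> = (\<lambda>(X, r) (Y, s) n f.
     signed (Hom \<C> X Y (n + r - s - 1)) s (dif \<C> X Y (n + r - s) f))"

definition shift_cmp ::
    "('o, 'k, 'm) dgcat \<Rightarrow> 'o \<times> int \<Rightarrow> 'o \<times> int \<Rightarrow> 'o \<times> int \<Rightarrow> int \<Rightarrow> int \<Rightarrow> 'm \<Rightarrow> 'm \<Rightarrow> 'm" where
  "shift_cmp \<C> = (\<lambda>(X, r) (Y, s) (Z, t) m n g f. cmp \<C> X Y Z (m + s - t) (n + r - s) g f)"

definition matrix :: "nat \<Rightarrow> nat \<Rightarrow> (nat \<Rightarrow> nat \<Rightarrow> 'm) \<Rightarrow> nat \<Rightarrow> nat \<Rightarrow> 'm" where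
  "matrix p q f = (\<lambda>i j. if i < p \<and> j < q then f i j else undefined)"

definition matrix_hom ::
    "('o, 'k, 'm) dgcat \<Rightarrow> ('o \<times> int) list \<Rightarrow> ('o \<times> int) list \<Rightarrow> int \<Rightarrow>
     ('k, nat \<Rightarrow> nat \<Rightarrow> 'm) module" where
  "matrix_hom \<C> ks ls n =
     \<lparr>carrier = {matrix (length ls) (length ks) f | f.
        \<forall>i<length ls. \<forall>j<length ks. f i j \<in> carrier (shift_hom \<C> (ks ! j) (ls ! i) n)},
      monoid.mult = undefined, one = undefined,
      zero = matrix (length ls) (length ks) (\<lambda>i j. \<zero>\<^bsub>shift_hom \<C> (ks ! j) (ls ! i) n\<^esub>),
      add = (\<lambda>f g. matrix (length ls) (length ks)
        (\<lambda>i j. f i j \<oplus>\<^bsub>shift_hom \<C> (ks ! j) (ls ! i) n\<^esub> g i j)),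
      smult = (\<lambda>r f. matrix (length ls) (length ks)
        (\<lambda>i j. r \<odot>\<^bsub>shift_hom \<C> (ks ! j) (ls ! i) n\<^esub> f i j))\<rparr>"

definition matrix_dif ::
    "('o, 'k, 'm) dgcat \<Rightarrow> ('o \<times> int) list \<Rightarrow> ('o \<times> int) list \<Rightarrow> int \<Rightarrow>
     (nat \<Rightarrow> nat \<Rightarrow> 'm) \<Rightarrow> nat \<Rightarrow> nat \<Rightarrow> 'm" where
  "matrix_dif \<C> ks ls n f =
     matrix (length ls) (length ks) (\<lambda>i j. shift_dif \<C> (ks ! j) (ls ! i) n (f i j))"

definition matrix_cmp ::
    "('o, 'k, 'm) dgcat \<Rightarrow> ('o \<times> int) list \<Rightarrow> ('o \<times> int) list \<Rightarrow> ('o \<times> int) list \<Rightarrow> int \<Rightarrow> int \<Rightarrow>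
     (nat \<Rightarrow> nat \<Rightarrow> 'm) \<Rightarrow> (nat \<Rightarrow> nat \<Rightarrow> 'm) \<Rightarrow> nat \<Rightarrow> nat \<Rightarrow> 'm" where
  "matrix_cmp \<C> ks ls ps m n g f = matrix (length ps) (length ks) (\<lambda>i j.
     \<Oplus>\<^bsub>shift_hom \<C> (ks ! j) (ps ! i) (m + n)\<^esub>
       l\<in>{..<length ls}. shift_cmp \<C> (ks ! j) (ls ! l) (ps ! i) m n (g i l) (f l j))"

definition twisted_complexes :: "('o, 'k, 'm) dgcat \<Rightarrow> ('o, 'm) twisted set" where
  "twisted_complexes \<C> = {Twisted ks q | ks q.
     fst ` set ks \<subseteq> Obj \<C> \<and>
     q \<in> carrier (matrix_hom \<C> ks ks (-1)) \<and>
     (\<forall>i<length ks. \<forall>j\<le>i. q i j = \<zero>\<^bsub>shift_hom \<C> (ks ! j) (ks ! i) (-1)\<^esub>) \<and>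
     matrix_dif \<C> ks ks (-1) q \<oplus>\<^bsub>matrix_hom \<C> ks ks (-2)\<^esub> matrix_cmp \<C> ks ks ks (-1) (-1) q q =
       \<zero>\<^bsub>matrix_hom \<C> ks ks (-2)\<^esub>}"

text \<open>The dg category \<open>\<C>\<^sup>p\<^sup>r\<^sup>e\<^sup>t\<^sup>r\<close>; the differential of \<open>f : K \<rightarrow> L\<close> of degree \<open>n\<close> is
  \<open>d f + q\<^sub>L f - (-1)\<^sup>n f q\<^sub>K\<close>.\<close>

definition pretr :: "('o, 'k, 'm) dgcat \<Rightarrow> (('o, 'm) twisted, 'k, nat \<Rightarrow> nat \<Rightarrow> 'm) dgcat" where
  "pretr \<C> =
     \<lparr>Obj = twisted_complexes \<C>,
      Hom = (\<lambda>K L. matrix_hom \<C> (parts K) (parts L)),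
      dif = (\<lambda>K L n f. let M = matrix_hom \<C> (parts K) (parts L) (n - 1) in
        matrix_dif \<C> (parts K) (parts L) n f \<oplus>\<^bsub>M\<^esub>
        matrix_cmp \<C> (parts K) (parts L) (parts L) (-1) n (twist L) f \<ominus>\<^bsub>M\<^esub>
        signed M n (matrix_cmp \<C> (parts K) (parts K) (parts L) n (-1) f (twist K))),
      cmp = (\<lambda>K L P. matrix_cmp \<C> (parts K) (parts L) (parts P)),
      idt = (\<lambda>K. matrix (length (parts K)) (length (parts K)) (\<lambda>i j.
        if i = j then idt \<C> (fst (parts K ! i))
        else \<zero>\<^bsub>shift_hom \<C> (parts K ! j) (parts K ! i) 0\<^esub>))\<rparr>"

text \<open>\<open>shifted \<C> r X\<close> is \<open>\<Sigma>\<^sup>r X\<close> and \<open>single f\<close> is a morphism \<open>\<Sigma>\<^sup>r X \<rightarrow> \<Sigma>\<^sup>r Y\<close> of \<open>\<C>\<^sup>p\<^sup>r\<^sup>e\<^sup>t\<^sup>r\<close>.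
  For \<open>r = 0\<close> this is the embedding of \<open>\<C>\<close>, for \<open>r = 1\<close> and \<open>f\<close> of degree \<open>0\<close> it is \<open>\<Sigma>f\<close>.\<close>

definition shifted :: "('o, 'k, 'm) dgcat \<Rightarrow> int \<Rightarrow> 'o \<Rightarrow> ('o, 'm) twisted" where
  "shifted \<C> r X = Twisted [(X, r)] (matrix 1 1 (\<lambda>i j. \<zero>\<^bsub>Hom \<C> X X (-1)\<^esub>))"

definition single :: "'m \<Rightarrow> nat \<Rightarrow> nat \<Rightarrow> 'm" where
  "single f = matrix 1 1 (\<lambda>i j. f)"

text \<open>The cone of \<open>x : A \<rightarrow> B\<close> is \<open>B \<oplus> \<Sigma>A\<close> with \<open>x\<close> as its twist from \<open>\<Sigma>A\<close> to \<open>B\<close>.\<close>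

definition cone :: "('o, 'k, 'm) dgcat \<Rightarrow> 'o \<Rightarrow> 'o \<Rightarrow> 'm \<Rightarrow> ('o, 'm) twisted" where
  "cone \<C> A B x = (let ks = [(B, 0), (A, 1)] in
     Twisted ks (matrix 2 2 (\<lambda>i j.
       if i = 0 \<and> j = 1 then x else \<zero>\<^bsub>shift_hom \<C> (ks ! j) (ks ! i) (-1)\<^esub>)))"

definition cone_inclusion :: "('o, 'k, 'm) dgcat \<Rightarrow> 'o \<Rightarrow> 'o \<Rightarrow> nat \<Rightarrow> nat \<Rightarrow> 'm" where
  "cone_inclusion \<C> A B = matrix 2 1 (\<lambda>i j.
     if i = 0 then idt \<C> B else \<zero>\<^bsub>shift_hom \<C> (B, 0) (A, 1) 0\<^esub>)"

definition cone_projection :: "('o, 'k, 'm) dgcat \<Rightarrow> 'o \<Rightarrow> 'o \<Rightarrow> nat \<Rightarrow> nat \<Rightarrow> 'm" where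
  "cone_projection \<C> A B = matrix 1 2 (\<lambda>i j.
     if j = 1 then idt \<C> A else \<zero>\<^bsub>shift_hom \<C> (B, 0) (A, 1) 0\<^esub>)"


section \<open>Pretriangulated dg categories and triangles\<close>

text \<open>The full embedding \<open>H\<^sub>0(\<C>) \<rightarrow> H\<^sub>0(\<C>\<^sup>p\<^sup>r\<^sup>e\<^sup>t\<^sup>r)\<close> is an equivalence.\<close>

definition pretriangulated :: "('o, 'k, 'm) dgcat \<Rightarrow> bool" where
  "pretriangulated \<C> \<longleftrightarrow>
     (\<forall>K\<in>Obj (pretr \<C>). \<exists>X\<in>Obj \<C>. \<exists>f. h0_iso (pretr \<C>) (shifted \<C> 0 X) K f)"

text \<open>A suspension functor on \<open>H\<^sub>0(\<C>)\<close>: for each object \<open>X\<close> an object \<open>S X\<close> of \<open>\<C>\<close> representing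
  \<open>\<Sigma>X\<close>, with an isomorphism \<open>\<sigma> X : S X \<rightarrow> \<Sigma>X\<close> in \<open>H\<^sub>0(\<C>\<^sup>p\<^sup>r\<^sup>e\<^sup>t\<^sup>r)\<close>. The action of \<open>S\<close> on morphisms is
  determined by naturality of \<open>\<sigma>\<close>.\<close>

definition suspension ::
    "('o, 'k, 'm) dgcat \<Rightarrow> ('o \<Rightarrow> 'o) \<Rightarrow> ('o \<Rightarrow> nat \<Rightarrow> nat \<Rightarrow> 'm) \<Rightarrow> bool" where
  "suspension \<C> S \<sigma> \<longleftrightarrow>
     (\<forall>X\<in>Obj \<C>. S X \<in> Obj \<C> \<and> h0_iso (pretr \<C>) (shifted \<C> 0 (S X)) (shifted \<C> 1 X) (\<sigma> X))"

text \<open>A triangle \<open>A \<rightarrow> B \<rightarrow> C \<rightarrow> S A\<close> of closed morphisms of degree \<open>0\<close> is exact if it is isomorphic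
  in \<open>H\<^sub>0(\<C>\<^sup>p\<^sup>r\<^sup>e\<^sup>t\<^sup>r)\<close>, by some \<open>(a, b, c)\<close>, to a standard triangle
  \<open>A' \<rightarrow> B' \<rightarrow> cone x' \<rightarrow> \<Sigma>A'\<close>. It suffices to let \<open>A'\<close> and \<open>B'\<close> range over objects of \<open>\<C>\<close>, as
  for pretriangulated \<open>\<C>\<close> these represent all objects of \<open>H\<^sub>0(\<C>\<^sup>p\<^sup>r\<^sup>e\<^sup>t\<^sup>r)\<close>.\<close>

definition exact_triangle ::
    "('o, 'k, 'm) dgcat \<Rightarrow> ('o \<Rightarrow> 'o) \<Rightarrow> ('o \<Rightarrow> nat \<Rightarrow> nat \<Rightarrow> 'm) \<Rightarrow>
     'o \<Rightarrow> 'o \<Rightarrow> 'o \<Rightarrow> 'm \<Rightarrow> 'm \<Rightarrow> 'm \<Rightarrow> bool" where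
  "exact_triangle \<C> S \<sigma> A B C x v s \<longleftrightarrow>
     A \<in> Obj \<C> \<and> B \<in> Obj \<C> \<and> C \<in> Obj \<C> \<and>
     x \<in> cycles \<C> A B 0 \<and> v \<in> cycles \<C> B C 0 \<and> s \<in> cycles \<C> C (S A) 0 \<and>
     (\<exists>A'\<in>Obj \<C>. \<exists>B'\<in>Obj \<C>. \<exists>x'\<in>cycles \<C> A' B' 0. \<exists>a b c.
        h0_iso \<C> A A' a \<and> h0_iso \<C> B B' b \<and>
        h0_iso (pretr \<C>) (shifted \<C> 0 C) (cone \<C> A' B' x') c \<and>
        hclass \<C> A B' 0 (cmp \<C> A B B' 0 0 b x) = hclass \<C> A B' 0 (cmp \<C> A A' B' 0 0 x' a) \<and>
        (let T = pretr \<C>; iB = shifted \<C> 0 B; iB' = shifted \<C> 0 B'; iC = shifted \<C> 0 C;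
             K = cone \<C> A' B' x'; iSA = shifted \<C> 0 (S A);
             \<Sigma>A = shifted \<C> 1 A; \<Sigma>A' = shifted \<C> 1 A' in
          hclass T iB K 0 (cmp T iB iC K 0 0 c (single v)) =
          hclass T iB K 0 (cmp T iB iB' K 0 0 (cone_inclusion \<C> A' B') (single b)) \<and>
          hclass T iC \<Sigma>A' 0
            (cmp T iC \<Sigma>A \<Sigma>A' 0 0 (single a) (cmp T iC iSA \<Sigma>A 0 0 (\<sigma> A) (single s))) =
          hclass T iC \<Sigma>A' 0 (cmp T iC K \<Sigma>A' 0 0 (cone_projection \<C> A' B') c)))"

end

theory Submission
  imports Defs
begin

text \<open>
  Let \<open>D\<close> be a dg category under \<open>\<C>\<close>. By freeness, to extend \<open>\<C> \<rightarrow> D\<close> to \<open>\<C>/v\<close> is to choose in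
  \<open>D\<close> a null homotopy of \<open>v\<close>; to extend it to \<open>R\<^sub>x(\<C>)\<close> is to choose a homotopy right inverse
  of \<open>x\<close>, a pair \<open>(a, b)\<close> with \<open>d a = 0\<close> and \<open>d b = x a - 1\<close>; to extend it to \<open>L\<^sub>s(\<C>)\<close> is to
  choose a homotopy left inverse of \<open>s\<close>. In a triangle these choices correspond to each other
  up to homotopy: since \<open>v x\<close> and \<open>s v\<close> are null homotopic and the triangle is exact, \<open>v = 0\<close>,
  \<open>x\<close> split epi and \<open>s\<close> split mono are the same condition in \<open>H\<^sub>0\<close>. The proof makes this
  precise for the homotopies as well.

  Exactness enters as a finite list of equations in \<open>\<C>\<close> (\<open>contracted_triangle\<close>): there are
  \<open>h\<close>, \<open>g\<close>, \<open>t\<close> with \<open>d h = v x\<close>, \<open>d g = s v\<close>, \<open>d t = x s\<close> such that the three closed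
  morphisms \<open>s h \<plusminus> g x\<close>, \<open>x g \<plusminus> t v\<close> and \<open>v t \<plusminus> h s\<close> are homotopic to \<open>\<plusminus>1\<close>. For a standard
  triangle they are read off from the matrix entries of a homotopy equivalence with the cone
  and of its homotopies (\<open>cone_iso_contracted\<close>). They are then transported along the
  isomorphism of triangles by replacing vertices and edges one at a time
  (\<open>contractible_triangle_vertex\<close>, \<open>contractible_triangle_edge\<close>,
  \<open>exact_triangle_contractible\<close>). Being equations, they hold in every \<open>D\<close> under \<open>\<C>\<close>, no matter
  whether \<open>D\<close> is pretriangulated.

  Given them, a homotopy right inverse \<open>(a, b)\<close> of \<open>x\<close> yields the null homotopy \<open>h a - v b\<close> of
  \<open>v\<close>. By \<open>right_inverse_exists\<close> every null homotopy arises this way up to a boundary, and by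
  \<open>right_inverse_unique\<close> right inverses with homotopic null homotopies are homotopic. On the
  left, \<open>(a, b)\<close> yields \<open>a g - b v\<close>, with the same two properties.

  By freeness this correspondence becomes a pair of dg functors under \<open>\<C>\<close>, \<open>H : \<C>/v \<rightarrow> R\<^sub>x(\<C>)\<close>
  and \<open>K : R\<^sub>x(\<C>) \<rightarrow> \<C>/v\<close>. A homotopy between dg functors is a dg functor into a path object,
  and on a free extension it may be prescribed on the new morphisms alone. In this way
  existence gives a homotopy from \<open>K H\<close> to the identity and uniqueness one from \<open>H K\<close> to the
  identity. Homotopic functors agree on homology (\<open>homotopic_functors_hclass\<close>), so \<open>H\<close>, which
  is the identity on objects, is a quasi-equivalence (\<open>extensions_weakly_equivalent\<close>): the
  zigzag consists of a single arrow.
\<close>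

section \<open>The partial algebra of homogeneous morphisms\<close>

text \<open>A homogeneous morphism together with its source, target and degree; \<open>None\<close> is an undefined
  result. On this type the operations are total, and associativity, commutativity, bilinearity
  and additivity of the differential are equations without side conditions: both sides are
  undefined at the same time. So signed sums of composites can be compared by rewriting, and
  types matter only where a zero or an identity is cancelled.\<close>

type_synonym ('o, 'm) arrow = "('o \<times> 'o \<times> int \<times> 'm) option"

definition arr :: "('o, 'k, 'm) dgcat \<Rightarrow> 'o \<Rightarrow> 'o \<Rightarrow> int \<Rightarrow> 'm \<Rightarrow> ('o, 'm) arrow" where
  "arr D X Y n f =
     (if X \<in> Obj D \<and> Y \<in> Obj D \<and> f \<in> carrier (Hom D X Y n) then Some (X, Y, n, f) else None)"

definition arrows :: "('o, 'k, 'm) dgcat \<Rightarrow> 'o \<Rightarrow> 'o \<Rightarrow> int \<Rightarrow> ('o, 'm) arrow set" where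
  "arrows D X Y n = {a. \<exists>f. a = Some (X, Y, n, f) \<and>
     X \<in> Obj D \<and> Y \<in> Obj D \<and> f \<in> carrier (Hom D X Y n)}"

text \<open>A quadruple that is not a morphism of \<open>D\<close> counts as undefined. Every operation first passes
  its arguments through \<open>chk\<close>, so \<open>chk\<close> is what remains of an operation that does nothing,
  such as a double negation.\<close>

definition chk :: "('o, 'k, 'm) dgcat \<Rightarrow> ('o, 'm) arrow \<Rightarrow> ('o, 'm) arrow" where
  "chk D a = (case a of Some (X, Y, n, f) \<Rightarrow> arr D X Y n f | None \<Rightarrow> None)"

definition aadd :: "('o, 'k, 'm) dgcat \<Rightarrow> ('o, 'm) arrow \<Rightarrow> ('o, 'm) arrow \<Rightarrow> ('o, 'm) arrow" where
  "aadd D a b = (case chk D a of None \<Rightarrow> None | Some (X, Y, n, f) \<Rightarrow>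
     (case chk D b of None \<Rightarrow> None | Some (X', Y', n', f') \<Rightarrow>
       if X = X' \<and> Y = Y' \<and> n = n' then Some (X, Y, n, f \<oplus>\<^bsub>Hom D X Y n\<^esub> f') else None))"

definition aneg :: "('o, 'k, 'm) dgcat \<Rightarrow> ('o, 'm) arrow \<Rightarrow> ('o, 'm) arrow" where
  "aneg D a = (case chk D a of None \<Rightarrow> None | Some (X, Y, n, f) \<Rightarrow>
     Some (X, Y, n, \<ominus>\<^bsub>Hom D X Y n\<^esub> f))"

definition adif :: "('o, 'k, 'm) dgcat \<Rightarrow> ('o, 'm) arrow \<Rightarrow> ('o, 'm) arrow" where
  "adif D a = (case chk D a of None \<Rightarrow> None | Some (X, Y, n, f) \<Rightarrow>
     Some (X, Y, n - 1, dif D X Y n f))"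

definition acmp :: "('o, 'k, 'm) dgcat \<Rightarrow> ('o, 'm) arrow \<Rightarrow> ('o, 'm) arrow \<Rightarrow> ('o, 'm) arrow" where
  "acmp D b a = (case chk D b of None \<Rightarrow> None | Some (Y', Z, m, g) \<Rightarrow>
     (case chk D a of None \<Rightarrow> None | Some (X, Y, n, f) \<Rightarrow>
       if Y = Y' then Some (X, Z, m + n, cmp D X Y Z m n g f) else None))"

text \<open>The arrow \<open>(-1)\<^sup>n a\<close>.\<close>

definition sgn_arrow :: "('o, 'k, 'm) dgcat \<Rightarrow> int \<Rightarrow> ('o, 'm) arrow \<Rightarrow> ('o, 'm) arrow" where
  "sgn_arrow D n a = (if even n then chk D a else aneg D a)"

definition asmul :: "('o, 'k, 'm) dgcat \<Rightarrow> 'k \<Rightarrow> ('o, 'm) arrow \<Rightarrow> ('o, 'm) arrow" where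
  "asmul D r a = (case chk D a of None \<Rightarrow> None | Some (X, Y, n, f) \<Rightarrow>
     Some (X, Y, n, r \<odot>\<^bsub>Hom D X Y n\<^esub> f))"

definition arrow_val :: "('o, 'm) arrow \<Rightarrow> 'm" where
  "arrow_val a = (case a of Some (X, Y, n, f) \<Rightarrow> f)"

definition aidt :: "('o, 'k, 'm) dgcat \<Rightarrow> 'o \<Rightarrow> ('o, 'm) arrow" where
  "aidt D X = arr D X X 0 (idt D X)"

text \<open>There is one zero for each source, target and degree, so that a cancelled sum still has a
  type.\<close>

definition azero :: "('o, 'k, 'm) dgcat \<Rightarrow> 'o \<Rightarrow> 'o \<Rightarrow> int \<Rightarrow> ('o, 'm) arrow" where
  "azero D X Y n = arr D X Y n \<zero>\<^bsub>Hom D X Y n\<^esub>"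

lemma linear_mapD:
  assumes "linear_map k M N f"
  shows "a \<in> carrier M \<Longrightarrow> f a \<in> carrier N"
    and "a \<in> carrier M \<Longrightarrow> b \<in> carrier M \<Longrightarrow> f (a \<oplus>\<^bsub>M\<^esub> b) = f a \<oplus>\<^bsub>N\<^esub> f b"
    and "r \<in> carrier k \<Longrightarrow> a \<in> carrier M \<Longrightarrow> f (r \<odot>\<^bsub>M\<^esub> a) = r \<odot>\<^bsub>N\<^esub> f a"
  using assms unfolding linear_map_def by auto

text \<open>The predicate \<open>linear_map\<close> demands additivity and homogeneity; zero and negatives are
  preserved because the modules are groups.\<close>

lemma linear_map_zero_minus:
  assumes "linear_map k M N f" "module k M" "module k N"
  shows "f \<zero>\<^bsub>M\<^esub> = \<zero>\<^bsub>N\<^esub>"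
    and "a \<in> carrier M \<Longrightarrow> f (\<ominus>\<^bsub>M\<^esub> a) = \<ominus>\<^bsub>N\<^esub> f a"
proof -
  interpret M: module k M by fact
  interpret N: module k N by fact
  have 1: "f \<zero>\<^bsub>M\<^esub> \<oplus>\<^bsub>N\<^esub> f \<zero>\<^bsub>M\<^esub> = f \<zero>\<^bsub>M\<^esub>"
    using linear_mapD(2)[OF assms(1), of "\<zero>\<^bsub>M\<^esub>" "\<zero>\<^bsub>M\<^esub>"] by simp
  then show 0: "f \<zero>\<^bsub>M\<^esub> = \<zero>\<^bsub>N\<^esub>"
    using linear_mapD(1)[OF assms(1) M.M.zero_closed] N.M.add.l_cancel_one by blast
  show "f (\<ominus>\<^bsub>M\<^esub> a) = \<ominus>\<^bsub>N\<^esub> f a" if a: "a \<in> carrier M"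
  proof -
    have "f (\<ominus>\<^bsub>M\<^esub> a) \<oplus>\<^bsub>N\<^esub> f a = \<zero>\<^bsub>N\<^esub>"
      using linear_mapD(2)[OF assms(1), of "\<ominus>\<^bsub>M\<^esub> a" a] a 0 by (simp add: M.M.l_neg)
    then show ?thesis
      using linear_mapD(1)[OF assms(1)] a N.M.minus_equality by auto
  qed
qed

context dg_category
begin

abbreviation add_arrow (infixl "\<uplus>" 65) where "a \<uplus> b \<equiv> aadd \<C> a b"
abbreviation cmp_arrow (infixr "\<cdot>" 72) where "b \<cdot> a \<equiv> acmp \<C> b a"
abbreviation dif_arrow ("\<delta>") where "\<delta> \<equiv> adif \<C>"
abbreviation neg_arrow ("\<sim> _" [80] 80) where "\<sim> a \<equiv> aneg \<C> a"
abbreviation sgn_arr ("\<epsilon>") where "\<epsilon> \<equiv> sgn_arrow \<C>"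
abbreviation idt_arr ("\<i>") where "\<i> \<equiv> aidt \<C>"
abbreviation zero_arr ("\<o>") where "\<o> \<equiv> azero \<C>"
abbreviation hom where "hom \<equiv> arrows \<C>"

lemma hom_abelian_group: "X \<in> Obj \<C> \<Longrightarrow> Y \<in> Obj \<C> \<Longrightarrow> abelian_group (Hom \<C> X Y n)"
  using hom_module module_def by blast

lemma hom_closed [simp]:
  assumes "X \<in> Obj \<C>" "Y \<in> Obj \<C>"
  shows "\<zero>\<^bsub>Hom \<C> X Y n\<^esub> \<in> carrier (Hom \<C> X Y n)"
    and "f \<in> carrier (Hom \<C> X Y n) \<Longrightarrow> f' \<in> carrier (Hom \<C> X Y n) \<Longrightarrow>
      f \<oplus>\<^bsub>Hom \<C> X Y n\<^esub> f' \<in> carrier (Hom \<C> X Y n)"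
    and "f \<in> carrier (Hom \<C> X Y n) \<Longrightarrow> \<ominus>\<^bsub>Hom \<C> X Y n\<^esub> f \<in> carrier (Hom \<C> X Y n)"
    and "f \<in> carrier (Hom \<C> X Y n) \<Longrightarrow> dif \<C> X Y n f \<in> carrier (Hom \<C> X Y (n - 1))"
proof -
  interpret abelian_group "Hom \<C> X Y n" using hom_abelian_group assms .
  show "\<zero>\<^bsub>Hom \<C> X Y n\<^esub> \<in> carrier (Hom \<C> X Y n)"
    "f \<in> carrier (Hom \<C> X Y n) \<Longrightarrow> f' \<in> carrier (Hom \<C> X Y n) \<Longrightarrow>
      f \<oplus>\<^bsub>Hom \<C> X Y n\<^esub> f' \<in> carrier (Hom \<C> X Y n)"
    "f \<in> carrier (Hom \<C> X Y n) \<Longrightarrow> \<ominus>\<^bsub>Hom \<C> X Y n\<^esub> f \<in> carrier (Hom \<C> X Y n)"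
    by simp_all
  show "f \<in> carrier (Hom \<C> X Y n) \<Longrightarrow> dif \<C> X Y n f \<in> carrier (Hom \<C> X Y (n - 1))"
    using linear_mapD(1)[OF dif_linear] assms by blast
qed

lemma cmp_closed [simp]:
  assumes "X \<in> Obj \<C>" "Y \<in> Obj \<C>" "Z \<in> Obj \<C>"
    "f \<in> carrier (Hom \<C> X Y n)" "g \<in> carrier (Hom \<C> Y Z m)" "p = m + n"
  shows "cmp \<C> X Y Z m n g f \<in> carrier (Hom \<C> X Z p)"
  using linear_mapD(1)[OF cmp_linear_left[of X Y Z f n m]] assms by simp

lemmas idt_closed [simp]

lemma cmp_bilinear:
  assumes "X \<in> Obj \<C>" "Y \<in> Obj \<C>" "Z \<in> Obj \<C>"
  shows "f \<in> carrier (Hom \<C> X Y n) \<Longrightarrow> g \<in> carrier (Hom \<C> Y Z m) \<Longrightarrow>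
      g' \<in> carrier (Hom \<C> Y Z m) \<Longrightarrow> cmp \<C> X Y Z m n (g \<oplus>\<^bsub>Hom \<C> Y Z m\<^esub> g') f =
      cmp \<C> X Y Z m n g f \<oplus>\<^bsub>Hom \<C> X Z (m + n)\<^esub> cmp \<C> X Y Z m n g' f"
    and "f \<in> carrier (Hom \<C> X Y n) \<Longrightarrow> g \<in> carrier (Hom \<C> Y Z m) \<Longrightarrow>
      f' \<in> carrier (Hom \<C> X Y n) \<Longrightarrow> cmp \<C> X Y Z m n g (f \<oplus>\<^bsub>Hom \<C> X Y n\<^esub> f') =
      cmp \<C> X Y Z m n g f \<oplus>\<^bsub>Hom \<C> X Z (m + n)\<^esub> cmp \<C> X Y Z m n g f'"
    and "f \<in> carrier (Hom \<C> X Y n) \<Longrightarrow> g \<in> carrier (Hom \<C> Y Z m) \<Longrightarrow>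
      cmp \<C> X Y Z m n (\<ominus>\<^bsub>Hom \<C> Y Z m\<^esub> g) f = \<ominus>\<^bsub>Hom \<C> X Z (m + n)\<^esub> cmp \<C> X Y Z m n g f"
    and "f \<in> carrier (Hom \<C> X Y n) \<Longrightarrow> g \<in> carrier (Hom \<C> Y Z m) \<Longrightarrow>
      cmp \<C> X Y Z m n g (\<ominus>\<^bsub>Hom \<C> X Y n\<^esub> f) = \<ominus>\<^bsub>Hom \<C> X Z (m + n)\<^esub> cmp \<C> X Y Z m n g f"
    and "f \<in> carrier (Hom \<C> X Y n) \<Longrightarrow>
      cmp \<C> X Y Z m n (\<zero>\<^bsub>Hom \<C> Y Z m\<^esub>) f = \<zero>\<^bsub>Hom \<C> X Z (m + n)\<^esub>"
    and "g \<in> carrier (Hom \<C> Y Z m) \<Longrightarrow>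
      cmp \<C> X Y Z m n g (\<zero>\<^bsub>Hom \<C> X Y n\<^esub>) = \<zero>\<^bsub>Hom \<C> X Z (m + n)\<^esub>"
  using linear_mapD(2)[OF cmp_linear_left[OF assms]] linear_mapD(2)[OF cmp_linear_right[OF assms]]
    linear_map_zero_minus[OF cmp_linear_left[OF assms] hom_module[OF assms(2,3)] hom_module[OF assms(1,3)]]
    linear_map_zero_minus[OF cmp_linear_right[OF assms] hom_module[OF assms(1,2)] hom_module[OF assms(1,3)]]
  by simp_all

lemma dif_add_neg:
  assumes "X \<in> Obj \<C>" "Y \<in> Obj \<C>"
  shows "f \<in> carrier (Hom \<C> X Y n) \<Longrightarrow> f' \<in> carrier (Hom \<C> X Y n) \<Longrightarrow>
     dif \<C> X Y n (f \<oplus>\<^bsub>Hom \<C> X Y n\<^esub> f') = dif \<C> X Y n f \<oplus>\<^bsub>Hom \<C> X Y (n - 1)\<^esub> dif \<C> X Y n f'"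
    and "f \<in> carrier (Hom \<C> X Y n) \<Longrightarrow>
     dif \<C> X Y n (\<ominus>\<^bsub>Hom \<C> X Y n\<^esub> f) = \<ominus>\<^bsub>Hom \<C> X Y (n - 1)\<^esub> dif \<C> X Y n f"
    and "dif \<C> X Y n \<zero>\<^bsub>Hom \<C> X Y n\<^esub> = \<zero>\<^bsub>Hom \<C> X Y (n - 1)\<^esub>"
  using linear_mapD(2)[OF dif_linear[OF assms]]
    linear_map_zero_minus[OF dif_linear[OF assms] hom_module[OF assms] hom_module[OF assms]]
  by simp_all

lemma arrow_cases:
  obtains (undef) "chk \<C> a = None"
  | (def) X Y n f where "X \<in> Obj \<C>" "Y \<in> Obj \<C>" "f \<in> carrier (Hom \<C> X Y n)"
      "a = Some (X, Y, n, f)" "chk \<C> a = Some (X, Y, n, f)"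
proof (cases "chk \<C> a")
  case (Some z)
  obtain X Y n f where a: "a = Some (X, Y, n, f)"
    using Some by (cases a) (auto simp: chk_def)
  then have "X \<in> Obj \<C> \<and> Y \<in> Obj \<C> \<and> f \<in> carrier (Hom \<C> X Y n)"
    using Some by (auto simp: chk_def arr_def split: if_splits)
  with a show thesis by (intro def[of X Y f n]) (auto simp: chk_def arr_def)
qed (rule undef)

lemma chk_Some [simp]:
  "X \<in> Obj \<C> \<Longrightarrow> Y \<in> Obj \<C> \<Longrightarrow> f \<in> carrier (Hom \<C> X Y n) \<Longrightarrow>
     chk \<C> (Some (X, Y, n, f)) = Some (X, Y, n, f)"
  by (simp add: chk_def arr_def)

lemma chk_None [simp]: "chk \<C> None = None"
  by (simp add: chk_def)

lemma chk_chk [simp]: "chk \<C> (chk \<C> a) = chk \<C> a"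
  by (cases a rule: arrow_cases) auto

lemma op_chk [simp]:
  "aadd \<C> (chk \<C> a) b = a \<uplus> b" "aadd \<C> a (chk \<C> b) = a \<uplus> b" "\<sim> (chk \<C> a) = \<sim> a" "\<delta> (chk \<C> a) = \<delta> a"
  "acmp \<C> (chk \<C> a) b = a \<cdot> b" "acmp \<C> a (chk \<C> b) = a \<cdot> b"
  unfolding aadd_def aneg_def adif_def acmp_def chk_chk by simp_all

lemma chk_op [simp]:
  "chk \<C> (a \<uplus> b) = a \<uplus> b" "chk \<C> (\<sim> a) = \<sim> a" "chk \<C> (\<delta> a) = \<delta> a" "chk \<C> (a \<cdot> b) = a \<cdot> b"
proof -
  show "chk \<C> (\<sim> a) = \<sim> a" "chk \<C> (\<delta> a) = \<delta> a"
    by (cases a rule: arrow_cases; auto simp: aneg_def adif_def)+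
  show "chk \<C> (a \<uplus> b) = a \<uplus> b"
    by (cases a rule: arrow_cases; cases b rule: arrow_cases; auto simp: aadd_def)
  show "chk \<C> (a \<cdot> b) = a \<cdot> b"
    by (cases a rule: arrow_cases; cases b rule: arrow_cases; auto simp: acmp_def)
qed

lemma add_assoc: "(a \<uplus> b) \<uplus> c = a \<uplus> (b \<uplus> c)"
proof (cases a rule: arrow_cases)
  case (def X Y n f)
  interpret abelian_group "Hom \<C> X Y n" using hom_abelian_group def by blast
  show ?thesis using def
    by (cases b rule: arrow_cases; cases c rule: arrow_cases; auto simp: aadd_def a_assoc)
qed (simp add: aadd_def)

lemma add_commute: "a \<uplus> b = b \<uplus> a"
proof (cases a rule: arrow_cases)
  case (def X Y n f)
  interpret abelian_group "Hom \<C> X Y n" using hom_abelian_group def by blast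
  show ?thesis using def
    by (cases b rule: arrow_cases; auto simp: aadd_def a_comm)
next
  case undef
  then show ?thesis by (cases b rule: arrow_cases; auto simp: aadd_def)
qed

lemma add_left_commute: "a \<uplus> (b \<uplus> c) = b \<uplus> (a \<uplus> c)"
  using add_assoc add_commute by metis

lemmas add_ac = add_assoc add_commute add_left_commute

lemma neg_neg [simp]: "\<sim> (\<sim> a) = chk \<C> a"
proof (cases a rule: arrow_cases)
  case (def X Y n f)
  interpret abelian_group "Hom \<C> X Y n" using hom_abelian_group def by blast
  show ?thesis using def by (simp add: aneg_def)
qed (simp add: aneg_def)

lemma neg_add [simp]: "\<sim> (a \<uplus> b) = \<sim> a \<uplus> \<sim> b"
proof (cases a rule: arrow_cases)
  case (def X Y n f)
  interpret abelian_group "Hom \<C> X Y n" using hom_abelian_group def by blast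
  show ?thesis using def by (cases b rule: arrow_cases; auto simp: aneg_def aadd_def minus_add)
qed (simp add: aneg_def aadd_def)

lemma comp_assoc: "(c \<cdot> b) \<cdot> a = c \<cdot> (b \<cdot> a)"
  by (cases a rule: arrow_cases; cases b rule: arrow_cases; cases c rule: arrow_cases;
      auto simp: acmp_def cmp_assoc add.assoc)

lemma comp_add_left [simp]: "(b \<uplus> c) \<cdot> a = b \<cdot> a \<uplus> c \<cdot> a"
  by (cases a rule: arrow_cases; cases b rule: arrow_cases; cases c rule: arrow_cases;
      auto simp: acmp_def aadd_def cmp_bilinear)

lemma comp_add_right [simp]: "c \<cdot> (a \<uplus> b) = c \<cdot> a \<uplus> c \<cdot> b"
  by (cases a rule: arrow_cases; cases b rule: arrow_cases; cases c rule: arrow_cases;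
      auto simp: acmp_def aadd_def cmp_bilinear)

lemma comp_neg_left [simp]: "(\<sim> b) \<cdot> a = \<sim> (b \<cdot> a)"
  by (cases a rule: arrow_cases; cases b rule: arrow_cases; auto simp: acmp_def aneg_def cmp_bilinear)

lemma comp_neg_right [simp]: "b \<cdot> (\<sim> a) = \<sim> (b \<cdot> a)"
  by (cases a rule: arrow_cases; cases b rule: arrow_cases; auto simp: acmp_def aneg_def cmp_bilinear)

lemma diff_add [simp]: "\<delta> (a \<uplus> b) = \<delta> a \<uplus> \<delta> b"
  by (cases a rule: arrow_cases; cases b rule: arrow_cases; auto simp: adif_def aadd_def dif_add_neg)

lemma diff_neg [simp]: "\<delta> (\<sim> a) = \<sim> (\<delta> a)"
  by (cases a rule: arrow_cases; auto simp: adif_def aneg_def dif_add_neg)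

lemma sgn_ops [simp]:
  "\<epsilon> n (a \<uplus> b) = \<epsilon> n a \<uplus> \<epsilon> n b" "\<epsilon> n (\<sim> a) = \<sim> (\<epsilon> n a)" "\<epsilon> n (\<epsilon> m a) = \<epsilon> (n + m) a"
  "chk \<C> (\<epsilon> n a) = \<epsilon> n a" "\<epsilon> n (chk \<C> a) = \<epsilon> n a"
  "\<delta> (\<epsilon> n a) = \<epsilon> n (\<delta> a)" "(\<epsilon> n b) \<cdot> a = \<epsilon> n (b \<cdot> a)" "b \<cdot> \<epsilon> n a = \<epsilon> n (b \<cdot> a)"
  by (auto simp: sgn_arrow_def)

lemma sgn_even_odd [simp]:
  "even n \<Longrightarrow> \<epsilon> n a = chk \<C> a" "odd n \<Longrightarrow> \<epsilon> n a = \<sim> a"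
  by (simp_all add: sgn_arrow_def)

subsection \<open>Typing\<close>

lemma in_homE:
  assumes "a \<in> hom X Y n"
  obtains f where "a = Some (X, Y, n, f)" "X \<in> Obj \<C>" "Y \<in> Obj \<C>" "f \<in> carrier (Hom \<C> X Y n)"
  using assms unfolding arrows_def by blast

lemma in_hom_chk [simp]: "a \<in> hom X Y n \<Longrightarrow> chk \<C> a = a"
  by (auto elim: in_homE)

lemma in_hom_Obj: "a \<in> hom X Y n \<Longrightarrow> X \<in> Obj \<C>" "a \<in> hom X Y n \<Longrightarrow> Y \<in> Obj \<C>"
  by (auto elim: in_homE)

lemma arr_in_hom [intro]:
  "X \<in> Obj \<C> \<Longrightarrow> Y \<in> Obj \<C> \<Longrightarrow> f \<in> carrier (Hom \<C> X Y n) \<Longrightarrow> arr \<C> X Y n f \<in> hom X Y n"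
  by (simp add: arrows_def arr_def)

lemma add_in_hom [intro]: "a \<in> hom X Y n \<Longrightarrow> b \<in> hom X Y n \<Longrightarrow> a \<uplus> b \<in> hom X Y n"
  by (elim in_homE) (auto simp: aadd_def arrows_def)

lemma neg_in_hom [intro]: "a \<in> hom X Y n \<Longrightarrow> \<sim> a \<in> hom X Y n"
  by (elim in_homE) (auto simp: aneg_def arrows_def)

lemma sgn_in_hom [intro]: "a \<in> hom X Y n \<Longrightarrow> \<epsilon> m a \<in> hom X Y n"
  by (auto simp: sgn_arrow_def)

lemma dif_in_hom [intro]: "a \<in> hom X Y n \<Longrightarrow> p = n - 1 \<Longrightarrow> \<delta> a \<in> hom X Y p"
  by (elim in_homE) (auto simp: adif_def arrows_def)

lemma cmp_in_hom [intro]: "b \<in> hom Y Z m \<Longrightarrow> a \<in> hom X Y n \<Longrightarrow> p = m + n \<Longrightarrow> b \<cdot> a \<in> hom X Z p"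
  by (elim in_homE) (auto simp: acmp_def arrows_def)

lemma idt_in_hom [intro]: "X \<in> Obj \<C> \<Longrightarrow> \<i> X \<in> hom X X 0"
  by (auto simp: aidt_def)

lemma zero_in_hom [intro]: "X \<in> Obj \<C> \<Longrightarrow> Y \<in> Obj \<C> \<Longrightarrow> \<o> X Y n \<in> hom X Y n"
  by (auto simp: azero_def)

lemma chk_arr [simp]: "chk \<C> (arr \<C> X Y n f) = arr \<C> X Y n f"
  by (auto simp: arr_def)

lemma chk_idt_zero [simp]: "chk \<C> (\<i> X) = \<i> X" "chk \<C> (\<o> X Y n) = \<o> X Y n"
  by (auto simp: aidt_def azero_def arr_def)

lemma comp_idt_right [simp]: "a \<in> hom X Y n \<Longrightarrow> a \<cdot> \<i> X = a"
  by (elim in_homE) (simp add: acmp_def aidt_def arr_def idt_right)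

lemma comp_idt_left [simp]: "a \<in> hom X Y n \<Longrightarrow> \<i> Y \<cdot> a = a"
  by (elim in_homE) (simp add: acmp_def aidt_def arr_def idt_left)

text \<open>The sign depends on the degree of the left factor, so this is the factor whose type has to
  be known.\<close>

lemma leibniz_arrow: "b \<in> hom Y Z m \<Longrightarrow> \<delta> (b \<cdot> a) = \<delta> b \<cdot> a \<uplus> \<epsilon> m (b \<cdot> \<delta> a)"
proof (cases a rule: arrow_cases)
  case (def X Y' n f)
  assume "b \<in> hom Y Z m"
  then obtain g where g: "b = Some (Y, Z, m, g)" "Y \<in> Obj \<C>" "Z \<in> Obj \<C>" "g \<in> carrier (Hom \<C> Y Z m)"
    by (elim in_homE)
  have [simp]: "m - 1 + n = m + n - 1" "m + (n - 1) = m + n - 1" by simp_all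
  show ?thesis
    using g def leibniz[of X Y Z f n g m]
    by (cases "Y = Y'") (auto simp: acmp_def adif_def aadd_def sgn_arrow_def aneg_def signed_def)
qed (auto simp: acmp_def adif_def aadd_def sgn_arrow_def aneg_def split: option.splits)

lemma dif_dif_arrow: "a \<in> hom X Y n \<Longrightarrow> p = n - 2 \<Longrightarrow> \<delta> (\<delta> a) = \<o> X Y p"
  by (elim in_homE) (simp add: adif_def azero_def arr_def dif_dif)

text \<open>From \<open>1 = 1 1\<close> the Leibniz rule gives \<open>d 1 = d 1 + d 1\<close>.\<close>

lemma dif_idt [simp]: "X \<in> Obj \<C> \<Longrightarrow> \<delta> (\<i> X) = \<o> X X (- 1)"
proof -
  assume X: "X \<in> Obj \<C>"
  interpret abelian_group "Hom \<C> X X (-1)" using hom_abelian_group X by blast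
  define y where "y = dif \<C> X X 0 (idt \<C> X)"
  have y: "y \<in> carrier (Hom \<C> X X (-1))" using hom_closed(4)[OF X X idt_closed[OF X]] by (simp add: y_def)
  have "y = y \<oplus>\<^bsub>Hom \<C> X X (-1)\<^esub> y"
    using leibniz[OF X X X idt_closed[OF X] idt_closed[OF X]] X y idt_left[of X X "idt \<C> X" 0]
      idt_left[of X X y "-1"] idt_right[of X X y "-1"]
    by (simp add: signed_def y_def)
  then have "y = \<zero>\<^bsub>Hom \<C> X X (-1)\<^esub>" using y by (metis add.l_cancel_one)
  then show ?thesis using X by (simp add: adif_def aidt_def arr_def azero_def y_def)
qed

lemma add_zero [simp]: "a \<in> hom X Y n \<Longrightarrow> a \<uplus> \<o> X Y n = a" "a \<in> hom X Y n \<Longrightarrow> \<o> X Y n \<uplus> a = a"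
proof -
  assume "a \<in> hom X Y n"
  then obtain f where f: "a = Some (X, Y, n, f)" "X \<in> Obj \<C>" "Y \<in> Obj \<C>" "f \<in> carrier (Hom \<C> X Y n)"
    by (elim in_homE)
  interpret abelian_group "Hom \<C> X Y n" using hom_abelian_group f by blast
  show "a \<uplus> \<o> X Y n = a" using f by (simp add: aadd_def azero_def arr_def)
  then show "\<o> X Y n \<uplus> a = a" by (simp add: add_commute)
qed

lemma zero_add_zero [simp]: "\<o> X Y n \<uplus> \<o> X Y n = \<o> X Y n"
proof (cases "X \<in> Obj \<C> \<and> Y \<in> Obj \<C>")
  case True
  then show ?thesis by (intro add_zero(1)) auto
next
  case False
  then show ?thesis by (auto simp: aadd_def azero_def arr_def)
qed

lemma neg_zero [simp]: "\<sim> (\<o> X Y n) = \<o> X Y n"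
proof (cases "X \<in> Obj \<C> \<and> Y \<in> Obj \<C>")
  case True
  then interpret abelian_group "Hom \<C> X Y n" using hom_abelian_group by blast
  show ?thesis using True by (simp add: aneg_def azero_def arr_def)
next
  case False
  then show ?thesis by (auto simp: aneg_def azero_def arr_def)
qed

lemma sgn_zero [simp]: "\<epsilon> m (\<o> X Y n) = \<o> X Y n"
  by (simp add: sgn_arrow_def)

lemma dif_zero [simp]: "\<delta> (\<o> X Y n) = \<o> X Y (n - 1)"
  by (auto simp: adif_def azero_def arr_def dif_add_neg)

lemma add_neg: "a \<in> hom X Y n \<Longrightarrow> a \<uplus> \<sim> a = \<o> X Y n"
proof -
  assume "a \<in> hom X Y n"
  then obtain f where f: "a = Some (X, Y, n, f)" "X \<in> Obj \<C>" "Y \<in> Obj \<C>" "f \<in> carrier (Hom \<C> X Y n)"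
    by (elim in_homE)
  interpret abelian_group "Hom \<C> X Y n" using hom_abelian_group f by blast
  show ?thesis using f by (simp add: aadd_def aneg_def azero_def arr_def r_neg)
qed

lemma comp_zero_left: "a \<in> hom X Y n \<Longrightarrow> Z \<in> Obj \<C> \<Longrightarrow> \<o> Y Z m \<cdot> a = \<o> X Z (m + n)"
  by (elim in_homE) (simp add: acmp_def azero_def arr_def cmp_bilinear)

lemma comp_zero_right: "b \<in> hom Y Z m \<Longrightarrow> X \<in> Obj \<C> \<Longrightarrow> b \<cdot> \<o> X Y n = \<o> X Z (m + n)"
  by (elim in_homE) (simp add: acmp_def azero_def arr_def cmp_bilinear)

lemma add_neg_cancel [simp]:
  assumes "a \<in> hom X Y n" "b \<in> hom X Y n"
  shows "a \<uplus> (\<sim> a \<uplus> b) = b" "\<sim> a \<uplus> (a \<uplus> b) = b"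
  using add_neg[OF assms(1)] assms by (simp_all flip: add_assoc add: add_commute[of "\<sim> a" a])

lemma eq_diff_iff: 
  assumes "a \<in> hom X Y n" "b \<in> hom X Y n" "c \<in> hom X Y n"
  shows "a \<uplus> \<sim> b = c \<longleftrightarrow> a = c \<uplus> b"
proof
  assume *: "a \<uplus> \<sim> b = c"
  have "c \<uplus> b = a \<uplus> (\<sim> b \<uplus> b)" using * by (auto simp: add_assoc)
  also have "\<dots> = a" using assms add_neg[OF assms(2)] by (simp add: add_commute[of "\<sim> b" b])
  finally show "a = c \<uplus> b" ..
next
  assume "a = c \<uplus> b"
  then show "a \<uplus> \<sim> b = c" using assms add_neg[OF assms(2)] by (simp add: add_assoc)
qed

subsection \<open>Scalars\<close>

lemma smul_closed [simp]:
  "X \<in> Obj \<C> \<Longrightarrow> Y \<in> Obj \<C> \<Longrightarrow> r \<in> carrier k \<Longrightarrow> f \<in> carrier (Hom \<C> X Y n) \<Longrightarrow>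
    r \<odot>\<^bsub>Hom \<C> X Y n\<^esub> f \<in> carrier (Hom \<C> X Y n)"
  by (rule module.smult_closed[OF hom_module])

lemma chk_smul [simp]: "r \<in> carrier k \<Longrightarrow> chk \<C> (asmul \<C> r a) = asmul \<C> r a"
  by (cases a rule: arrow_cases; auto simp: asmul_def)

lemma smul_chk [simp]: "asmul \<C> r (chk \<C> a) = asmul \<C> r a"
  unfolding asmul_def chk_chk by simp

lemma smul_in_hom [intro]: "r \<in> carrier k \<Longrightarrow> a \<in> hom X Y n \<Longrightarrow> asmul \<C> r a \<in> hom X Y n"
  by (elim in_homE) (auto simp: asmul_def arrows_def)

lemma smul_laws:
  assumes r: "r \<in> carrier k"
  shows "asmul \<C> r (a \<uplus> b) = asmul \<C> r a \<uplus> asmul \<C> r b"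
    and "r' \<in> carrier k \<Longrightarrow> asmul \<C> (r \<oplus>\<^bsub>k\<^esub> r') a = asmul \<C> r a \<uplus> asmul \<C> r' a"
    and "r' \<in> carrier k \<Longrightarrow> asmul \<C> (r \<otimes>\<^bsub>k\<^esub> r') a = asmul \<C> r (asmul \<C> r' a)"
    and "\<delta> (asmul \<C> r a) = asmul \<C> r (\<delta> a)"
    and "(asmul \<C> r b) \<cdot> a = asmul \<C> r (b \<cdot> a)"
    and "b \<cdot> asmul \<C> r a = asmul \<C> r (b \<cdot> a)"
    and "\<sim> (asmul \<C> r a) = asmul \<C> r (\<sim> a)"
proof -
  show "\<delta> (asmul \<C> r a) = asmul \<C> r (\<delta> a)"
    by (cases a rule: arrow_cases; auto simp: asmul_def adif_def linear_mapD(3)[OF dif_linear] r)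
  show "(asmul \<C> r b) \<cdot> a = asmul \<C> r (b \<cdot> a)"
    by (cases a rule: arrow_cases; cases b rule: arrow_cases;
        auto simp: asmul_def acmp_def linear_mapD(3)[OF cmp_linear_left] r)
  show "b \<cdot> asmul \<C> r a = asmul \<C> r (b \<cdot> a)"
    by (cases a rule: arrow_cases; cases b rule: arrow_cases;
        auto simp: asmul_def acmp_def linear_mapD(3)[OF cmp_linear_right] r)
  show "asmul \<C> r (a \<uplus> b) = asmul \<C> r a \<uplus> asmul \<C> r b"
    by (cases a rule: arrow_cases; cases b rule: arrow_cases;
        auto simp: asmul_def aadd_def module.smult_r_distr[OF hom_module] r)
  show "\<sim> (asmul \<C> r a) = asmul \<C> r (\<sim> a)"
    by (cases a rule: arrow_cases;
        auto simp: asmul_def aneg_def module.smult_r_minus[OF hom_module] r)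
  show "asmul \<C> (r \<oplus>\<^bsub>k\<^esub> r') a = asmul \<C> r a \<uplus> asmul \<C> r' a" if "r' \<in> carrier k"
    using that by (cases a rule: arrow_cases;
        auto simp: asmul_def aadd_def module.smult_l_distr[OF hom_module] r)
  show "asmul \<C> (r \<otimes>\<^bsub>k\<^esub> r') a = asmul \<C> r (asmul \<C> r' a)" if "r' \<in> carrier k"
    using that by (cases a rule: arrow_cases;
        auto simp: asmul_def aadd_def module.smult_assoc1[OF hom_module] r)
qed

lemma smul_sgn [simp]: "r \<in> carrier k \<Longrightarrow> asmul \<C> r (\<epsilon> n a) = \<epsilon> n (asmul \<C> r a)"
  by (simp add: sgn_arrow_def smul_laws)

lemma smul_one_neg_one [simp]: "asmul \<C> \<one>\<^bsub>k\<^esub> a = chk \<C> a" "asmul \<C> (\<ominus>\<^bsub>k\<^esub> \<one>\<^bsub>k\<^esub>) a = \<sim> a"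
proof -
  have 1: "\<one>\<^bsub>k\<^esub> \<odot>\<^bsub>Hom \<C> X Y n\<^esub> f = f"
    "(\<ominus>\<^bsub>k\<^esub> \<one>\<^bsub>k\<^esub>) \<odot>\<^bsub>Hom \<C> X Y n\<^esub> f = \<ominus>\<^bsub>Hom \<C> X Y n\<^esub> f"
    if "X \<in> Obj \<C>" "Y \<in> Obj \<C>" "f \<in> carrier (Hom \<C> X Y n)" for X Y n f
  proof -
    interpret M: module k "Hom \<C> X Y n" using hom_module that by blast
    show "\<one>\<^bsub>k\<^esub> \<odot>\<^bsub>Hom \<C> X Y n\<^esub> f = f"
      "(\<ominus>\<^bsub>k\<^esub> \<one>\<^bsub>k\<^esub>) \<odot>\<^bsub>Hom \<C> X Y n\<^esub> f = \<ominus>\<^bsub>Hom \<C> X Y n\<^esub> f"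
      using that by (simp_all add: M.smult_l_minus)
  qed
  show "asmul \<C> \<one>\<^bsub>k\<^esub> a = chk \<C> a"
    by (cases a rule: arrow_cases) (simp_all add: asmul_def 1)
  show "asmul \<C> (\<ominus>\<^bsub>k\<^esub> \<one>\<^bsub>k\<^esub>) a = \<sim> a"
    by (cases a rule: arrow_cases) (simp_all add: asmul_def aneg_def 1)
qed

lemma smul_zero [simp]: "r \<in> carrier k \<Longrightarrow> asmul \<C> r (\<o> X Y n) = \<o> X Y n"
  by (auto simp: asmul_def azero_def arr_def module.smult_r_null[OF hom_module])

subsection \<open>Arrows and morphisms\<close>

lemma arrow_val_arr [simp]:
  "X \<in> Obj \<C> \<Longrightarrow> Y \<in> Obj \<C> \<Longrightarrow> f \<in> carrier (Hom \<C> X Y n) \<Longrightarrow> arrow_val (arr \<C> X Y n f) = f"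
  by (simp add: arrow_val_def arr_def)

lemma arr_arrow_val [simp]: "a \<in> hom X Y n \<Longrightarrow> arr \<C> X Y n (arrow_val a) = a"
  by (elim in_homE) (simp add: arrow_val_def arr_def)

lemma arrow_val_closed [simp]: "a \<in> hom X Y n \<Longrightarrow> arrow_val a \<in> carrier (Hom \<C> X Y n)"
  by (elim in_homE) (simp add: arrow_val_def)

lemma arr_eq_iff:
  "X \<in> Obj \<C> \<Longrightarrow> Y \<in> Obj \<C> \<Longrightarrow> f \<in> carrier (Hom \<C> X Y n) \<Longrightarrow> f' \<in> carrier (Hom \<C> X Y n) \<Longrightarrow>
    arr \<C> X Y n f = arr \<C> X Y n f' \<longleftrightarrow> f = f'"
  by (simp add: arr_def)

lemma arr_ops:
  assumes "X \<in> Obj \<C>" "Y \<in> Obj \<C>" "f \<in> carrier (Hom \<C> X Y n)"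
  shows "f' \<in> carrier (Hom \<C> X Y n) \<Longrightarrow>
      arr \<C> X Y n (f \<oplus>\<^bsub>Hom \<C> X Y n\<^esub> f') = arr \<C> X Y n f \<uplus> arr \<C> X Y n f'"
    and "arr \<C> X Y n (\<ominus>\<^bsub>Hom \<C> X Y n\<^esub> f) = \<sim> (arr \<C> X Y n f)"
    and "p = n - 1 \<Longrightarrow> arr \<C> X Y p (dif \<C> X Y n f) = \<delta> (arr \<C> X Y n f)"
    and "r \<in> carrier k \<Longrightarrow> arr \<C> X Y n (r \<odot>\<^bsub>Hom \<C> X Y n\<^esub> f) = asmul \<C> r (arr \<C> X Y n f)"
    and "Z \<in> Obj \<C> \<Longrightarrow> g \<in> carrier (Hom \<C> Y Z m) \<Longrightarrow> p = m + n \<Longrightarrow>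
      arr \<C> X Z p (cmp \<C> X Y Z m n g f) = arr \<C> Y Z m g \<cdot> arr \<C> X Y n f"
    and "arr \<C> X Y n (signed (Hom \<C> X Y n) m f) = \<epsilon> m (arr \<C> X Y n f)"
  using assms by (auto simp: arr_def aadd_def aneg_def adif_def acmp_def asmul_def signed_def sgn_arrow_def)

lemma arr_zero: "arr \<C> X Y n \<zero>\<^bsub>Hom \<C> X Y n\<^esub> = \<o> X Y n"
  by (simp add: azero_def)

lemma arr_idt: "arr \<C> X X 0 (idt \<C> X) = \<i> X"
  by (simp add: aidt_def)

end

section \<open>Homology and functors that are the identity on objects\<close>

context dg_category
begin

lemma cycles_iff:
  assumes "X \<in> Obj \<C>" "Y \<in> Obj \<C>"
  shows "f \<in> cycles \<C> X Y n \<longleftrightarrow>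
    f \<in> carrier (Hom \<C> X Y n) \<and> \<delta> (arr \<C> X Y n f) = \<o> X Y (n - 1)"
  using assms by (auto simp: cycles_def arr_ops(3)[symmetric] azero_def arr_eq_iff)

text \<open>Homology classes are cosets of boundaries. The arrow calculus turns equality of classes into
  the existence of a homotopy \<open>y\<close>, which is the form in which all later arguments use it.\<close>

lemma hclass_iff:
  assumes "X \<in> Obj \<C>" "Y \<in> Obj \<C>" "f \<in> carrier (Hom \<C> X Y n)"
  shows "f' \<in> hclass \<C> X Y n f \<longleftrightarrow> f' \<in> carrier (Hom \<C> X Y n) \<and>
    (\<exists>y\<in>hom X Y (n + 1). arr \<C> X Y n f' = \<delta> y \<uplus> arr \<C> X Y n f)"
proof -
  have *: "\<delta> (arr \<C> X Y (n + 1) b) \<uplus> arr \<C> X Y n f = arr \<C> X Y n (dif \<C> X Y (n + 1) b \<oplus>\<^bsub>Hom \<C> X Y n\<^esub> f)"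
    "dif \<C> X Y (n + 1) b \<in> carrier (Hom \<C> X Y n)"
    if "b \<in> carrier (Hom \<C> X Y (n + 1))" for b
    using assms that arr_ops(3)[of X Y b "n + 1" n] hom_closed(4)[of X Y b "n + 1"] by (simp_all add: arr_ops)
  show ?thesis
  proof
    assume "f' \<in> hclass \<C> X Y n f"
    then obtain b where b: "b \<in> carrier (Hom \<C> X Y (n + 1))" "f' = dif \<C> X Y (n + 1) b \<oplus>\<^bsub>Hom \<C> X Y n\<^esub> f"
      by (auto simp: hclass_def a_r_coset_def' boundaries_def)
    with *[OF b(1)] assms show "f' \<in> carrier (Hom \<C> X Y n) \<and>
      (\<exists>y\<in>hom X Y (n + 1). arr \<C> X Y n f' = \<delta> y \<uplus> arr \<C> X Y n f)"
      by (auto intro!: bexI[of _ "arr \<C> X Y (n + 1) b"])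
  next
    assume f': "f' \<in> carrier (Hom \<C> X Y n) \<and>
      (\<exists>y\<in>hom X Y (n + 1). arr \<C> X Y n f' = \<delta> y \<uplus> arr \<C> X Y n f)"
    then obtain y where y: "y \<in> hom X Y (n + 1)" "arr \<C> X Y n f' = \<delta> y \<uplus> arr \<C> X Y n f" by blast
    from y(1) have b: "arrow_val y \<in> carrier (Hom \<C> X Y (n + 1))" "arr \<C> X Y (n + 1) (arrow_val y) = y" by simp_all
    have "f' = dif \<C> X Y (n + 1) (arrow_val y) \<oplus>\<^bsub>Hom \<C> X Y n\<^esub> f"
      using *[OF b(1)] b(2) y(2) f' assms by (simp add: arr_eq_iff)
    with b(1) show "f' \<in> hclass \<C> X Y n f"
      by (auto simp: hclass_def a_r_coset_def' boundaries_def)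
  qed
qed

lemma hclass_eqI:
  assumes "X \<in> Obj \<C>" "Y \<in> Obj \<C>" "f \<in> carrier (Hom \<C> X Y n)" "f' \<in> carrier (Hom \<C> X Y n)"
    and y: "y \<in> hom X Y (n + 1)" "arr \<C> X Y n f' = \<delta> y \<uplus> arr \<C> X Y n f"
  shows "hclass \<C> X Y n f' = hclass \<C> X Y n f"
proof -
  have 1: "hclass \<C> X Y n g' \<subseteq> hclass \<C> X Y n g"
    if gz: "g \<in> carrier (Hom \<C> X Y n)" "g' \<in> carrier (Hom \<C> X Y n)"
      "z \<in> hom X Y (n + 1)" "arr \<C> X Y n g' = \<delta> z \<uplus> arr \<C> X Y n g" for g g' z
  proof
    fix h assume "h \<in> hclass \<C> X Y n g'"
    then obtain y where "h \<in> carrier (Hom \<C> X Y n)" "y \<in> hom X Y (n + 1)"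
      "arr \<C> X Y n h = \<delta> y \<uplus> arr \<C> X Y n g'"
      using hclass_iff assms(1,2) gz(2) by blast
    with gz show "h \<in> hclass \<C> X Y n g"
      using assms(1,2) by (auto simp: hclass_iff add_assoc intro!: bexI[of _ "y \<uplus> z"])
  qed
  have "arr \<C> X Y n f = \<delta> (\<sim> y) \<uplus> arr \<C> X Y n f'"
  proof -
    have "\<delta> y \<in> hom X Y n" "arr \<C> X Y n f \<in> hom X Y n" using y assms by auto
    then show ?thesis using y(2) by simp
  qed
  then show ?thesis
    using 1[OF assms(3,4) y] 1[OF assms(4,3) neg_in_hom[OF y(1)]] by blast
qed

lemma self_in_hclass:
  assumes "X \<in> Obj \<C>" "Y \<in> Obj \<C>" "f \<in> carrier (Hom \<C> X Y n)"
  shows "f \<in> hclass \<C> X Y n f"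
proof -
  have "arr \<C> X Y n f \<in> hom X Y n" using assms by auto
  then show ?thesis using assms by (auto simp: hclass_iff intro!: bexI[of _ "\<o> X Y (n + 1)"])
qed

lemma hclass_eq_iff:
  assumes "X \<in> Obj \<C>" "Y \<in> Obj \<C>" "f \<in> carrier (Hom \<C> X Y n)" "f' \<in> carrier (Hom \<C> X Y n)"
  shows "hclass \<C> X Y n f' = hclass \<C> X Y n f \<longleftrightarrow>
    (\<exists>y\<in>hom X Y (n + 1). arr \<C> X Y n f' = \<delta> y \<uplus> arr \<C> X Y n f)"
  using hclass_eqI[OF assms] self_in_hclass[OF assms(1,2,4)] hclass_iff[OF assms(1-3)] by blast

lemma idt_cycle: "X \<in> Obj \<C> \<Longrightarrow> idt \<C> X \<in> cycles \<C> X X 0"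
  by (simp add: cycles_iff arr_idt)

lemma h0_iso_idt: "X \<in> Obj \<C> \<Longrightarrow> h0_iso \<C> X X (idt \<C> X)"
  using idt_left[of X X "idt \<C> X" 0] idt_cycle
  unfolding h0_iso_def by (auto intro!: bexI[of _ "idt \<C> X"])

end

text \<open>All functors between the dg categories compared here are the identity on objects. The two dg
  categories are part of the predicate, so that a single fact about a functor carries all that
  its action on arrows requires.\<close>

definition id_functor :: "('k, 'z) ring_scheme \<Rightarrow> ('o, 'k, 'm) dgcat \<Rightarrow> ('o, 'k, 'n) dgcat \<Rightarrow>
    ('o, 'o, 'm, 'n) dgfun \<Rightarrow> bool" where
  "id_functor k C D F \<longleftrightarrow> dg_category k C \<and> dg_category k D \<and> Obj C \<subseteq> Obj D \<and>
     dg_functor k C D F \<and> on_obj F = (\<lambda>X. X)"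

definition amap :: "('o, 'k, 'm) dgcat \<Rightarrow> ('o, 'o, 'm, 'n) dgfun \<Rightarrow> ('o, 'm) arrow \<Rightarrow> ('o, 'n) arrow" where
  "amap C F a = (case chk C a of None \<Rightarrow> None | Some (X, Y, n, f) \<Rightarrow> Some (X, Y, n, on_mor F X Y n f))"

lemma id_functorD:
  assumes "id_functor k C D F"
  shows "dg_category k C" "dg_category k D"
    and "X \<in> Obj C \<Longrightarrow> X \<in> Obj D"
    and "X \<in> Obj C \<Longrightarrow> Y \<in> Obj C \<Longrightarrow> linear_map k (Hom C X Y n) (Hom D X Y n) (on_mor F X Y n)"
    and "X \<in> Obj C \<Longrightarrow> Y \<in> Obj C \<Longrightarrow> f \<in> carrier (Hom C X Y n) \<Longrightarrow>
      on_mor F X Y (n - 1) (dif C X Y n f) = dif D X Y n (on_mor F X Y n f)"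
    and "X \<in> Obj C \<Longrightarrow> Y \<in> Obj C \<Longrightarrow> Z \<in> Obj C \<Longrightarrow>
      g \<in> carrier (Hom C Y Z m) \<Longrightarrow> f \<in> carrier (Hom C X Y n) \<Longrightarrow>
      on_mor F X Z (m + n) (cmp C X Y Z m n g f) = cmp D X Y Z m n (on_mor F Y Z m g) (on_mor F X Y n f)"
    and "X \<in> Obj C \<Longrightarrow> on_mor F X X 0 (idt C X) = idt D X"
  using assms unfolding id_functor_def dg_functor_def by auto

lemma id_functor_closed [simp]:
  "id_functor k C D F \<Longrightarrow> X \<in> Obj C \<Longrightarrow> Y \<in> Obj C \<Longrightarrow> f \<in> carrier (Hom C X Y n) \<Longrightarrow>
    on_mor F X Y n f \<in> carrier (Hom D X Y n)"
  by (rule linear_mapD(1)[OF id_functorD(4)])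

lemma amap_laws:
  assumes F: "id_functor k C D F"
  shows "amap C F (aadd C a b) = aadd D (amap C F a) (amap C F b)"
    and "amap C F (acmp C a b) = acmp D (amap C F a) (amap C F b)"
    and "amap C F (aneg C a) = aneg D (amap C F a)"
    and "amap C F (sgn_arrow C n a) = sgn_arrow D n (amap C F a)"
    and "amap C F (adif C a) = adif D (amap C F a)"
    and "r \<in> carrier k \<Longrightarrow> amap C F (asmul C r a) = asmul D r (amap C F a)"
    and "X \<in> Obj C \<Longrightarrow> amap C F (aidt C X) = aidt D X"
    and "X \<in> Obj C \<Longrightarrow> Y \<in> Obj C \<Longrightarrow> amap C F (azero C X Y n) = azero D X Y n"
    and "amap C F (chk C a) = amap C F a"
    and "chk D (amap C F a) = amap C F a"
proof -
  interpret C: dg_category k C using id_functorD(1)[OF F] .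
  interpret D: dg_category k D using id_functorD(2)[OF F] .
  note [simp] = id_functorD(3)[OF F] id_functor_closed[OF F] id_functorD(5-7)[OF F]
    linear_mapD(2,3)[OF id_functorD(4)[OF F]]
    linear_map_zero_minus[OF id_functorD(4)[OF F] C.hom_module D.hom_module]
  show chk: "amap C F (chk C a) = amap C F a" "chk D (amap C F a) = amap C F a" for a
    by (cases a rule: C.arrow_cases; auto simp: amap_def)+
  show neg: "amap C F (aneg C a) = aneg D (amap C F a)"
    by (cases a rule: C.arrow_cases; auto simp: amap_def aneg_def)
  show "amap C F (aadd C a b) = aadd D (amap C F a) (amap C F b)"
    by (cases a rule: C.arrow_cases; cases b rule: C.arrow_cases; auto simp: amap_def aadd_def)
  show "amap C F (acmp C a b) = acmp D (amap C F a) (amap C F b)"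
    by (cases a rule: C.arrow_cases; cases b rule: C.arrow_cases; auto simp: amap_def acmp_def)
  show "amap C F (adif C a) = adif D (amap C F a)"
    by (cases a rule: C.arrow_cases; auto simp: amap_def adif_def)
  show "amap C F (sgn_arrow C n a) = sgn_arrow D n (amap C F a)"
    using neg chk by (simp add: sgn_arrow_def)
  show "r \<in> carrier k \<Longrightarrow> amap C F (asmul C r a) = asmul D r (amap C F a)"
    by (cases a rule: C.arrow_cases; auto simp: amap_def asmul_def)
  show "X \<in> Obj C \<Longrightarrow> amap C F (aidt C X) = aidt D X"
    by (simp add: aidt_def arr_def amap_def)
  show "X \<in> Obj C \<Longrightarrow> Y \<in> Obj C \<Longrightarrow> amap C F (azero C X Y n) = azero D X Y n"
    by (simp add: azero_def arr_def amap_def)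
qed

lemma amap_in_hom: "id_functor k C D F \<Longrightarrow> a \<in> arrows C X Y n \<Longrightarrow> amap C F a \<in> arrows D X Y n"
proof -
  assume F: "id_functor k C D F" and a: "a \<in> arrows C X Y n"
  interpret C: dg_category k C using id_functorD(1)[OF F] .
  show ?thesis using a F by (elim C.in_homE) (auto simp: amap_def arrows_def id_functorD(3))
qed

lemma amap_arr:
  "id_functor k C D F \<Longrightarrow> X \<in> Obj C \<Longrightarrow> Y \<in> Obj C \<Longrightarrow> f \<in> carrier (Hom C X Y n) \<Longrightarrow>
    amap C F (arr C X Y n f) = arr D X Y n (on_mor F X Y n f)"
  by (auto simp: amap_def arr_def chk_def id_functorD(3))

lemma id_functor_cycles:
  assumes F: "id_functor k C D F" and XY: "X \<in> Obj C" "Y \<in> Obj C" and f: "f \<in> cycles C X Y n"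
  shows "on_mor F X Y n f \<in> cycles D X Y n"
proof -
  interpret C: dg_category k C using id_functorD(1)[OF F] .
  interpret D: dg_category k D using id_functorD(2)[OF F] .
  have f': "f \<in> carrier (Hom C X Y n)" and d: "adif C (arr C X Y n f) = azero C X Y (n - 1)"
    using f C.cycles_iff[OF XY] by auto
  have "adif D (arr D X Y n (on_mor F X Y n f)) = azero D X Y (n - 1)"
    using arg_cong[OF d, of "amap C F"] XY f' by (simp add: amap_laws[OF F] amap_arr[OF F])
  then show ?thesis using f' XY F by (simp add: D.cycles_iff id_functorD(3))
qed

lemma id_functor_hclass:
  assumes F: "id_functor k C D F" and XY: "X \<in> Obj C" "Y \<in> Obj C" and f: "f \<in> carrier (Hom C X Y n)"
  shows "homology_map D F X Y n (hclass C X Y n f) = hclass D X Y n (on_mor F X Y n f)"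
proof -
  interpret C: dg_category k C using id_functorD(1)[OF F] .
  interpret D: dg_category k D using id_functorD(2)[OF F] .
  have o: "on_obj F = (\<lambda>X. X)" using F by (simp add: id_functor_def)
  have eq: "hclass D X Y n (on_mor F X Y n f') = hclass D X Y n (on_mor F X Y n f)"
    if "f' \<in> hclass C X Y n f" for f'
  proof -
    obtain y where f': "f' \<in> carrier (Hom C X Y n)" and y: "y \<in> arrows C X Y (n + 1)"
      "arr C X Y n f' = aadd C (adif C y) (arr C X Y n f)"
      using C.hclass_iff[OF XY f] \<open>f' \<in> hclass C X Y n f\<close> by blast
    show ?thesis
      using arg_cong[OF y(2), of "amap C F"] XY f f'
      by (intro D.hclass_eqI[OF _ _ _ _ amap_in_hom[OF F y(1)]])
        (simp_all add: id_functorD(3)[OF F] id_functor_closed[OF F] amap_laws[OF F] amap_arr[OF F])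
  qed
  then show ?thesis using C.self_in_hclass[OF XY f] unfolding homology_map_def o by blast
qed

lemma id_functor_compose:
  assumes F: "id_functor k C D F" and H: "id_functor k D E H"
  shows "id_functor k C E \<lparr>on_obj = (\<lambda>X. X), on_mor = (\<lambda>X Y n f. on_mor H X Y n (on_mor F X Y n f))\<rparr>"
proof -
  have "linear_map k (Hom C X Y n) (Hom E X Y n) (\<lambda>f. on_mor H X Y n (on_mor F X Y n f))"
    if "X \<in> Obj C" "Y \<in> Obj C" for X Y n
    using id_functorD(4)[OF F that, of n]
      id_functorD(4)[OF H id_functorD(3)[OF F that(1)] id_functorD(3)[OF F that(2)], of n]
    unfolding linear_map_def Pi_iff by simp
  then show ?thesis using F H id_functorD(3)[OF F] id_functorD(3)[OF H]
    by (auto simp: id_functor_def[of k C E] dg_functor_def id_functorD(1)[OF F] id_functorD(2)[OF H]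
        id_functorD(5-7)[OF F] id_functorD(5-7)[OF H] id_functor_closed[OF F])
qed

text \<open>Mutually inverse maps on homology are bijective, and essential surjectivity is witnessed by
  identities.\<close>

lemma quasi_equivalence_of_homology_inverse:
  assumes H: "id_functor k C D H" and K: "id_functor k D C K"
    and KH: "\<And>X Y n f. X \<in> Obj C \<Longrightarrow> Y \<in> Obj C \<Longrightarrow> f \<in> cycles C X Y n \<Longrightarrow>
      hclass C X Y n (on_mor K X Y n (on_mor H X Y n f)) = hclass C X Y n f"
    and HK: "\<And>X Y n f. X \<in> Obj D \<Longrightarrow> Y \<in> Obj D \<Longrightarrow> f \<in> cycles D X Y n \<Longrightarrow>
      hclass D X Y n (on_mor H X Y n (on_mor K X Y n f)) = hclass D X Y n f"
  shows "quasi_equivalence k C D H"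
proof -
  interpret C: dg_category k C using id_functorD(1)[OF H] .
  interpret D: dg_category k D using id_functorD(2)[OF H] .
  have o: "on_obj H = (\<lambda>X. X)" using H by (simp add: id_functor_def)
  have obj: "X \<in> Obj C \<longleftrightarrow> X \<in> Obj D" for X using id_functorD(3)[OF H] id_functorD(3)[OF K] by blast
  have c: "f \<in> carrier (Hom C X Y n)" if "f \<in> cycles C X Y n" for X Y n f
    using that by (simp add: cycles_def)
  have d: "f \<in> carrier (Hom D X Y n)" if "f \<in> cycles D X Y n" for X Y n f
    using that by (simp add: cycles_def)
  have "bij_betw (homology_map D H X Y n) (homology C X Y n) (homology D X Y n)"
    if XY: "X \<in> Obj C" "Y \<in> Obj C" for X Y n
  proof (rule bij_betw_byWitness[where f' = "homology_map C K X Y n"])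
    have XY': "X \<in> Obj D" "Y \<in> Obj D" using XY obj by auto
    show "\<forall>a\<in>homology C X Y n. homology_map C K X Y n (homology_map D H X Y n a) = a"
      using XY XY' c KH id_functor_closed[OF H]
      by (auto simp: homology_def id_functor_hclass[OF H] id_functor_hclass[OF K])
    show "\<forall>a\<in>homology D X Y n. homology_map D H X Y n (homology_map C K X Y n a) = a"
      using XY XY' d HK id_functor_closed[OF K]
      by (auto simp: homology_def id_functor_hclass[OF H] id_functor_hclass[OF K])
    show "homology_map D H X Y n ` homology C X Y n \<subseteq> homology D X Y n"
      using XY c id_functor_cycles[OF H]
      by (auto simp: homology_def id_functor_hclass[OF H])
    show "homology_map C K X Y n ` homology D X Y n \<subseteq> homology C X Y n"
      using XY' d id_functor_cycles[OF K]
      by (auto simp: homology_def id_functor_hclass[OF K])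
  qed
  moreover have "\<exists>X\<in>Obj C. \<exists>f. h0_iso D X Y f" if "Y \<in> Obj D" for Y
    using D.h0_iso_idt that obj by blast
  ultimately show ?thesis
    using H o by (simp add: quasi_equivalence_def id_functor_def)
qed

section \<open>The universal property of freely adjoined morphisms\<close>

text \<open>The operations of \<open>adjoin\<close> on classes of expressions are unions over all representatives;
  such a union collapses to one class as soon as all representatives give the same class.\<close>

lemma UN_const: "A \<noteq> {} \<Longrightarrow> (\<And>s. s \<in> A \<Longrightarrow> f s = c) \<Longrightarrow> (\<Union>s\<in>A. f s) = c"
  by auto

context dg_category
begin

context
  fixes G :: "('k, 'o, 'm, 'g) generators"
begin

abbreviation typed where "typed \<equiv> has_type k \<C> G"
abbreviation cls where "cls \<equiv> term_class k \<C> G"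
abbreviation eqv where "eqv \<equiv> term_eq k \<C> G"
abbreviation Adj where "Adj \<equiv> adjoin k \<C> G"

lemma typed_Cmp: "typed s Y Z m \<Longrightarrow> typed t X Y n \<Longrightarrow> p = m + n \<Longrightarrow> typed (dgterm.Cmp s t) X Z p"
  by (simp add: has_type.Cmp)

lemma typed_Dif: "typed t X Y n \<Longrightarrow> p = n - 1 \<Longrightarrow> typed (Dif t) X Y p"
  by (simp add: has_type.Dif)

lemma typed_Obj: "typed t X Y n \<Longrightarrow> X \<in> Obj \<C> \<and> Y \<in> Obj \<C>"
  by (induction rule: has_type.induct) auto

lemma typed_zero: "X \<in> Obj \<C> \<Longrightarrow> Y \<in> Obj \<C> \<Longrightarrow> typed (Base X Y n \<zero>\<^bsub>Hom \<C> X Y n\<^esub>) X Y n"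
  by (simp add: has_type.Base)

lemma typed_idt: "X \<in> Obj \<C> \<Longrightarrow> typed (Base X X 0 (idt \<C> X)) X X 0"
  by (simp add: has_type.Base)

lemma sign_closed [simp]: "\<ominus>\<^bsub>k\<^esub> \<one>\<^bsub>k\<^esub> \<in> carrier k" "(if b then \<one>\<^bsub>k\<^esub> else \<ominus>\<^bsub>k\<^esub> \<one>\<^bsub>k\<^esub>) \<in> carrier k"
  by simp_all

lemma cls_eqI: "eqv X Y n s t \<Longrightarrow> cls X Y n s = cls X Y n t"
  unfolding term_class_def by (blast intro: term_eq.sym term_eq.trans)

lemma self_in_cls: "typed t X Y n \<Longrightarrow> t \<in> cls X Y n t"
  unfolding term_class_def by (blast intro: term_eq.refl)

lemma in_clsD: "s \<in> cls X Y n t \<Longrightarrow> eqv X Y n s t"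
  unfolding term_class_def by (blast intro: term_eq.sym)

lemma Adj_simps [simp]:
  "Obj Adj = Obj \<C>" "Hom Adj X Y n = adjoin_hom k \<C> G X Y n"
  by (simp_all add: adjoin_def)

lemma cls_closed [simp]: "typed t X Y n \<Longrightarrow> cls X Y n t \<in> carrier (adjoin_hom k \<C> G X Y n)"
  by (simp add: adjoin_hom_def)

lemma in_AdjE:
  assumes "c \<in> carrier (adjoin_hom k \<C> G X Y n)"
  obtains t where "typed t X Y n" "c = cls X Y n t"
  using assms by (auto simp: adjoin_hom_def)

lemma cls_add: "typed s X Y n \<Longrightarrow> typed t X Y n \<Longrightarrow>
    cls X Y n s \<oplus>\<^bsub>adjoin_hom k \<C> G X Y n\<^esub> cls X Y n t = cls X Y n (Add s t)"
  unfolding adjoin_hom_def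
  by (auto intro!: UN_const cls_eqI term_eq.Add_cong dest: self_in_cls in_clsD)

lemma cls_smul: "r \<in> carrier k \<Longrightarrow> typed t X Y n \<Longrightarrow>
    r \<odot>\<^bsub>adjoin_hom k \<C> G X Y n\<^esub> cls X Y n t = cls X Y n (Smul r t)"
  unfolding adjoin_hom_def
  by (auto intro!: UN_const cls_eqI term_eq.Smul_cong dest: self_in_cls in_clsD)

lemma cls_zero: "\<zero>\<^bsub>adjoin_hom k \<C> G X Y n\<^esub> = cls X Y n (Base X Y n \<zero>\<^bsub>Hom \<C> X Y n\<^esub>)"
  by (simp add: adjoin_hom_def)

lemma cls_dif: "typed t X Y n \<Longrightarrow> dif Adj X Y n (cls X Y n t) = cls X Y (n - 1) (Dif t)"
  unfolding adjoin_def
  by (auto intro!: UN_const cls_eqI term_eq.Dif_cong dest: self_in_cls in_clsD)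

lemma cls_cmp: "typed s Y Z m \<Longrightarrow> typed t X Y n \<Longrightarrow>
    cmp Adj X Y Z m n (cls Y Z m s) (cls X Y n t) = cls X Z (m + n) (dgterm.Cmp s t)"
  unfolding adjoin_def
  by (auto intro!: UN_const cls_eqI term_eq.Cmp_cong dest: self_in_cls in_clsD)

lemma cls_idt: "idt Adj X = cls X X 0 (Base X X 0 (idt \<C> X))"
  by (simp add: adjoin_def)

lemma adjoin_hom_module:
  assumes "X \<in> Obj \<C>" "Y \<in> Obj \<C>"
  shows "module k (adjoin_hom k \<C> G X Y n)" (is "module k ?M")
proof (rule moduleI)
  note [simp] = cls_add cls_smul cls_zero typed_zero assms has_type.Add has_type.Smul
  show "cring k" by (rule cring_axioms)
  show "abelian_group ?M"
  proof (rule abelian_groupI)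
    fix a b c assume "a \<in> carrier ?M" "b \<in> carrier ?M" "c \<in> carrier ?M"
    then obtain r s t where rst: "typed r X Y n" "typed s X Y n" "typed t X Y n"
      "a = cls X Y n r" "b = cls X Y n s" "c = cls X Y n t" by (elim in_AdjE) blast
    then show "a \<oplus>\<^bsub>?M\<^esub> b \<oplus>\<^bsub>?M\<^esub> c = a \<oplus>\<^bsub>?M\<^esub> (b \<oplus>\<^bsub>?M\<^esub> c)"
      by (simp add: cls_eqI[OF term_eq.add_assoc])
  next
    fix a b assume "a \<in> carrier ?M" "b \<in> carrier ?M"
    then obtain r s where rs: "typed r X Y n" "typed s X Y n"
      "a = cls X Y n r" "b = cls X Y n s" by (elim in_AdjE) blast
    then show "a \<oplus>\<^bsub>?M\<^esub> b \<in> carrier ?M" by simp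
    show "a \<oplus>\<^bsub>?M\<^esub> b = b \<oplus>\<^bsub>?M\<^esub> a" using rs cls_eqI[OF term_eq.add_comm] by simp
  next
    show "\<zero>\<^bsub>?M\<^esub> \<in> carrier ?M" by simp
  next
    fix a assume "a \<in> carrier ?M"
    then obtain r where r: "typed r X Y n" "a = cls X Y n r" by (elim in_AdjE) blast
    have "\<zero>\<^bsub>?M\<^esub> \<oplus>\<^bsub>?M\<^esub> a = cls X Y n (Add (Base X Y n \<zero>\<^bsub>Hom \<C> X Y n\<^esub>) r)"
      using r by simp
    also have "\<dots> = a"
      using cls_eqI[OF term_eq.add_comm[OF r(1) typed_zero]] cls_eqI[OF term_eq.add_zero[OF r(1)]] r(2)
      by simp
    finally show "\<zero>\<^bsub>?M\<^esub> \<oplus>\<^bsub>?M\<^esub> a = a" .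
    show "\<exists>b\<in>carrier ?M. b \<oplus>\<^bsub>?M\<^esub> a = \<zero>\<^bsub>?M\<^esub>"
      using r cls_eqI[OF term_eq.add_comm[OF r(1) has_type.Smul]] cls_eqI[OF term_eq.add_neg[OF r(1)]]
      by (auto intro!: bexI[of _ "cls X Y n (Smul (\<ominus>\<^bsub>k\<^esub> \<one>\<^bsub>k\<^esub>) r)"])
  qed
next
  note [simp] = cls_add cls_smul cls_zero typed_zero assms has_type.Add has_type.Smul
  fix r s a assume rs: "r \<in> carrier k" "s \<in> carrier k" and "a \<in> carrier ?M"
  then obtain t where t: "typed t X Y n" "a = cls X Y n t" by (elim in_AdjE) blast
  show "(r \<oplus>\<^bsub>k\<^esub> s) \<odot>\<^bsub>?M\<^esub> a = r \<odot>\<^bsub>?M\<^esub> a \<oplus>\<^bsub>?M\<^esub> s \<odot>\<^bsub>?M\<^esub> a"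
    using t rs by (simp add: cls_eqI[OF term_eq.smul_distrib_left])
  show "(r \<otimes>\<^bsub>k\<^esub> s) \<odot>\<^bsub>?M\<^esub> a = r \<odot>\<^bsub>?M\<^esub> (s \<odot>\<^bsub>?M\<^esub> a)"
    using t rs by (simp add: cls_eqI[OF term_eq.smul_smul])
next
  note [simp] = cls_add cls_smul cls_zero typed_zero assms has_type.Add has_type.Smul
  fix a assume "a \<in> carrier ?M"
  then obtain t where t: "typed t X Y n" "a = cls X Y n t" by (elim in_AdjE) blast
  then show "\<one>\<^bsub>k\<^esub> \<odot>\<^bsub>?M\<^esub> a = a" by (simp add: cls_eqI[OF term_eq.smul_one])
  fix r assume r: "r \<in> carrier k"
  then show "r \<odot>\<^bsub>?M\<^esub> a \<in> carrier ?M" using t by simp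
  fix b assume "b \<in> carrier ?M"
  then obtain s where s: "typed s X Y n" "b = cls X Y n s" by (elim in_AdjE) blast
  show "r \<odot>\<^bsub>?M\<^esub> (a \<oplus>\<^bsub>?M\<^esub> b) = r \<odot>\<^bsub>?M\<^esub> a \<oplus>\<^bsub>?M\<^esub> r \<odot>\<^bsub>?M\<^esub> b"
    using t s r by (simp add: cls_eqI[OF term_eq.smul_distrib_right])
qed

lemma cls_neg:
  assumes "typed t X Y n"
  shows "\<ominus>\<^bsub>adjoin_hom k \<C> G X Y n\<^esub> cls X Y n t = cls X Y n (Smul (\<ominus>\<^bsub>k\<^esub> \<one>\<^bsub>k\<^esub>) t)"
proof -
  interpret M: module k "adjoin_hom k \<C> G X Y n"
    using adjoin_hom_module typed_Obj[OF assms] by blast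
  show ?thesis
    using M.smult_l_minus[of "\<one>\<^bsub>k\<^esub>" "cls X Y n t"] assms cls_eqI[OF term_eq.smul_one[OF assms]]
    by (simp add: cls_smul)
qed

lemma cls_signed:
  assumes "typed t X Y n"
  shows "signed (adjoin_hom k \<C> G X Y n) m (cls X Y n t) =
    cls X Y n (Smul (if even m then \<one>\<^bsub>k\<^esub> else \<ominus>\<^bsub>k\<^esub> \<one>\<^bsub>k\<^esub>) t)"
  using assms by (simp add: signed_def cls_neg cls_eqI[OF term_eq.smul_one])

text \<open>Each axiom is the class of one of the defining relations of \<open>term_eq\<close>.\<close>

lemma dg_category_adjoin: "dg_category k Adj"
proof (rule dg_category.intro[OF cring_axioms], rule dg_category_axioms.intro)
  note [simp] = cls_add cls_smul cls_dif cls_cmp has_type.Add has_type.Smul typed_Cmp typed_Dif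
    typed_idt adjoin_hom_module
  show "module k (Hom Adj X Y n)" if "X \<in> Obj Adj" "Y \<in> Obj Adj" for X Y n
    using that by simp
  show "linear_map k (Hom Adj X Y n) (Hom Adj X Y (n - 1)) (dif Adj X Y n)"
    if "X \<in> Obj Adj" "Y \<in> Obj Adj" for X Y n
    by (auto simp: linear_map_def cls_eqI[OF term_eq.dif_add] cls_eqI[OF term_eq.dif_smul] elim!: in_AdjE)
  show "dif Adj X Y (n - 1) (dif Adj X Y n f) = \<zero>\<^bsub>Hom Adj X Y (n - 2)\<^esub>"
    if "X \<in> Obj Adj" "Y \<in> Obj Adj" "f \<in> carrier (Hom Adj X Y n)" for X Y f n
    using that cls_eqI[OF term_eq.dif_dif] by (auto simp: cls_zero elim!: in_AdjE)
  show "linear_map k (Hom Adj Y Z m) (Hom Adj X Z (m + n)) (\<lambda>g. cmp Adj X Y Z m n g f)"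
    if "X \<in> Obj Adj" "Y \<in> Obj Adj" "Z \<in> Obj Adj" "f \<in> carrier (Hom Adj X Y n)" for X Y Z f n m
    using that by (auto simp: linear_map_def cls_eqI[OF term_eq.cmp_add_left]
        cls_eqI[OF term_eq.cmp_smul_left] elim!: in_AdjE)
  show "linear_map k (Hom Adj X Y n) (Hom Adj X Z (m + n)) (\<lambda>f. cmp Adj X Y Z m n g f)"
    if "X \<in> Obj Adj" "Y \<in> Obj Adj" "Z \<in> Obj Adj" "g \<in> carrier (Hom Adj Y Z m)" for X Y Z g n m
    using that by (auto simp: linear_map_def cls_eqI[OF term_eq.cmp_add_right]
        cls_eqI[OF term_eq.cmp_smul_right] elim!: in_AdjE)
  show "cmp Adj W X Z (l + m) n (cmp Adj X Y Z l m h g) f = cmp Adj W Y Z l (m + n) h (cmp Adj W X Y m n g f)"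
    if "W \<in> Obj Adj" "X \<in> Obj Adj" "Y \<in> Obj Adj" "Z \<in> Obj Adj" "f \<in> carrier (Hom Adj W X n)"
      "g \<in> carrier (Hom Adj X Y m)" "h \<in> carrier (Hom Adj Y Z l)" for W X Y Z f n g m h l
    using that by (auto simp: cls_eqI[OF term_eq.cmp_assoc] add.assoc[symmetric] elim!: in_AdjE)
  show "idt Adj X \<in> carrier (Hom Adj X X 0)" if "X \<in> Obj Adj" for X
    using that by (simp add: cls_idt)
  show "cmp Adj X Y Y 0 n (idt Adj Y) f = f" "cmp Adj X X Y n 0 f (idt Adj X) = f"
    if "X \<in> Obj Adj" "Y \<in> Obj Adj" "f \<in> carrier (Hom Adj X Y n)" for X Y f n
  proof -
    have "f \<in> carrier (adjoin_hom k \<C> G X Y n)" using that by simp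
    then obtain t where t: "typed t X Y n" "f = cls X Y n t" by (rule in_AdjE)
    have "cmp Adj X Y Y 0 n (idt Adj Y) f = cls X Y (0 + n) (dgterm.Cmp (Base Y Y 0 (idt \<C> Y)) t)"
      "cmp Adj X X Y n 0 f (idt Adj X) = cls X Y (n + 0) (dgterm.Cmp t (Base X X 0 (idt \<C> X)))"
      unfolding t(2) cls_idt using t that by (intro cls_cmp; simp)+
    then show "cmp Adj X Y Y 0 n (idt Adj Y) f = f" "cmp Adj X X Y n 0 f (idt Adj X) = f"
      using t cls_eqI[OF term_eq.idt_left] cls_eqI[OF term_eq.idt_right] by simp_all
  qed
  show "dif Adj X Z (m + n) (cmp Adj X Y Z m n g f) =
      cmp Adj X Y Z (m - 1) n (dif Adj Y Z m g) f \<oplus>\<^bsub>Hom Adj X Z (m + n - 1)\<^esub>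
      signed (Hom Adj X Z (m + n - 1)) m (cmp Adj X Y Z m (n - 1) g (dif Adj X Y n f))"
    if "X \<in> Obj Adj" "Y \<in> Obj Adj" "Z \<in> Obj Adj" "f \<in> carrier (Hom Adj X Y n)"
      "g \<in> carrier (Hom Adj Y Z m)" for X Y Z f n g m
  proof -
    have "f \<in> carrier (adjoin_hom k \<C> G X Y n)" "g \<in> carrier (adjoin_hom k \<C> G Y Z m)"
      using that by simp_all
    then obtain s t where st: "typed t X Y n" "f = cls X Y n t" "typed s Y Z m" "g = cls Y Z m s"
      by (elim in_AdjE) blast
    have d: "m - 1 + n = m + n - 1" "m + (n - 1) = m + n - 1" by simp_all
    have T: "typed (dgterm.Cmp (Dif s) t) X Z (m + n - 1)" "typed (dgterm.Cmp s (Dif t)) X Z (m + n - 1)"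
      using st by (auto intro!: typed_Cmp typed_Dif)
    have "cmp Adj X Y Z (m - 1) n (dif Adj Y Z m g) f = cls X Z (m + n - 1) (dgterm.Cmp (Dif s) t)"
      "cmp Adj X Y Z m (n - 1) g (dif Adj X Y n f) = cls X Z (m + n - 1) (dgterm.Cmp s (Dif t))"
      using st cls_cmp[of "Dif s" Y Z "m - 1" t X n] cls_cmp[of s Y Z m "Dif t" X "n - 1"]
      by (simp_all add: d)
    then show ?thesis
      using st T by (simp add: cls_signed cls_eqI[OF term_eq.leibniz])
  qed
qed

lemma id_functor_adjoin: "id_functor k \<C> Adj (adjoin_functor k \<C> G)"
proof -
  note [simp] = cls_add cls_smul cls_dif cls_cmp has_type.Base
  have "dg_functor k \<C> Adj (adjoin_functor k \<C> G)"
    unfolding dg_functor_def linear_map_def adjoin_functor_def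
    by (auto simp: cls_idt cls_eqI[OF term_eq.Base_add] cls_eqI[OF term_eq.Base_smul]
        cls_eqI[OF term_eq.Base_cmp] cls_eqI[OF term_eq.Base_dif])
  then show ?thesis
    using dg_category_axioms dg_category_adjoin by (simp add: id_functor_def adjoin_functor_def)
qed

end

end

primrec term_eval :: "('o, 'k, 'm) dgcat \<Rightarrow> ('o, 'k, 'n) dgcat \<Rightarrow> ('o, 'o, 'm, 'n) dgfun \<Rightarrow>
    ('g \<Rightarrow> ('o, 'n) arrow) \<Rightarrow> ('k, 'o, 'm, 'g) dgterm \<Rightarrow> ('o, 'n) arrow" where
  "term_eval C D F \<gamma> (Base X Y n f) = amap C F (arr C X Y n f)"
| "term_eval C D F \<gamma> (Gen g) = \<gamma> g"
| "term_eval C D F \<gamma> (Add s t) = aadd D (term_eval C D F \<gamma> s) (term_eval C D F \<gamma> t)"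
| "term_eval C D F \<gamma> (Smul r t) = asmul D r (term_eval C D F \<gamma> t)"
| "term_eval C D F \<gamma> (dgterm.Cmp s t) = acmp D (term_eval C D F \<gamma> s) (term_eval C D F \<gamma> t)"
| "term_eval C D F \<gamma> (Dif t) = adif D (term_eval C D F \<gamma> t)"

text \<open>A class is evaluated at an arbitrary representative; by \<open>ev_cong\<close> below the choice does not
  matter.\<close>

definition adjoin_extension :: "('o, 'k, 'm) dgcat \<Rightarrow> ('o, 'k, 'n) dgcat \<Rightarrow> ('o, 'o, 'm, 'n) dgfun \<Rightarrow>
    ('g \<Rightarrow> ('o, 'n) arrow) \<Rightarrow> ('o, 'o, ('k, 'o, 'm, 'g) dgterm set, 'n) dgfun" where
  "adjoin_extension C D F \<gamma> =
     \<lparr>on_obj = (\<lambda>X. X), on_mor = (\<lambda>X Y n c. arrow_val (term_eval C D F \<gamma> (SOME t. t \<in> c)))\<rparr>"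

text \<open>Freeness: these are exactly the data needed to extend \<open>F\<close> to the new morphisms.\<close>

definition valid_assignment ::
    "('k, 'z) ring_scheme \<Rightarrow> ('o, 'k, 'm) dgcat \<Rightarrow> ('k, 'o, 'm, 'g) generators \<Rightarrow> ('o, 'k, 'n) dgcat \<Rightarrow>
     ('o, 'o, 'm, 'n) dgfun \<Rightarrow> ('g \<Rightarrow> ('o, 'n) arrow) \<Rightarrow> bool" where
  "valid_assignment k C G D F \<gamma> \<longleftrightarrow> (\<forall>g X Y n b. G g = Some (X, Y, n, b) \<longrightarrow>
     \<gamma> g \<in> arrows D X Y n \<and> adif D (\<gamma> g) = term_eval C D F \<gamma> b)"

context dg_category
begin

context
  fixes G :: "('k, 'o, 'm, 'g) generators" and D :: "('o, 'k, 'n) dgcat" and F \<gamma>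
  assumes F: "id_functor k \<C> D F" and \<gamma>: "valid_assignment k \<C> G D F \<gamma>"
begin

interpretation D: dg_category k D using id_functorD(2)[OF F] .

abbreviation ev where "ev \<equiv> term_eval \<C> D F \<gamma>"

lemma ev_in_hom: "has_type k \<C> G t X Y n \<Longrightarrow> ev t \<in> arrows D X Y n"
  by (induction rule: has_type.induct)
    (use \<gamma> in \<open>auto simp: valid_assignment_def intro: amap_in_hom[OF F]\<close>)

text \<open>The relations of \<open>term_eq\<close> are laws of dg categories and of the functor \<open>F\<close>, except
  \<open>Gen_dif\<close>, which is the requirement on \<open>\<gamma>\<close>.\<close>

lemma ev_cong: "term_eq k \<C> G X Y n s t \<Longrightarrow> ev s = ev t"
proof (induction rule: term_eq.induct)
  case (add_zero t X Y n)
  then show ?case using typed_Obj[OF add_zero] ev_in_hom[OF add_zero]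
    by (simp add: arr_zero amap_laws[OF F])
next
  case (add_neg t X Y n)
  then show ?case using typed_Obj[OF add_neg] ev_in_hom[OF add_neg]
    by (simp add: arr_zero amap_laws[OF F] D.add_neg)
next
  case (smul_one t X Y n)
  then show ?case using ev_in_hom[OF smul_one] by simp
next
  case (idt_left t X Y n)
  then show ?case using typed_Obj[OF idt_left] ev_in_hom[OF idt_left]
    by (simp add: arr_idt amap_laws[OF F])
next
  case (idt_right t X Y n)
  then show ?case using typed_Obj[OF idt_right] ev_in_hom[OF idt_right]
    by (simp add: arr_idt amap_laws[OF F])
next
  case (dif_dif t X Y n)
  then show ?case using typed_Obj[OF dif_dif] ev_in_hom[OF dif_dif]
    by (simp add: arr_zero amap_laws[OF F] D.dif_dif_arrow)
next
  case (leibniz s Y Z m t X n)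
  then show ?case using ev_in_hom[OF leibniz(1)] by (simp add: D.leibniz_arrow)
next
  case (Gen_dif g X Y n b)
  then show ?case using \<gamma> by (simp add: valid_assignment_def)
next
  case (add_comm s X Y n t)
  then show ?case by (simp add: D.add_commute)
qed (simp_all add: D.add_assoc D.comp_assoc D.smul_laws arr_ops amap_laws[OF F])

lemma extension_cls:
  assumes "has_type k \<C> G t X Y n"
  shows "on_mor (adjoin_extension \<C> D F \<gamma>) X Y n (term_class k \<C> G X Y n t) = arrow_val (ev t)"
proof -
  have "(SOME s. s \<in> term_class k \<C> G X Y n t) \<in> term_class k \<C> G X Y n t"
    using self_in_cls[OF assms] by (rule someI)
  then show ?thesis using ev_cong[OF in_clsD] by (simp add: adjoin_extension_def)
qed

lemma arr_extension_cls:
  assumes "has_type k \<C> G t X Y n"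
  shows "arr D X Y n (on_mor (adjoin_extension \<C> D F \<gamma>) X Y n (term_class k \<C> G X Y n t)) = ev t"
  using extension_cls[OF assms] ev_in_hom[OF assms] by simp

lemma extension_closed [simp]:
  assumes "has_type k \<C> G t X Y n"
  shows "on_mor (adjoin_extension \<C> D F \<gamma>) X Y n (term_class k \<C> G X Y n t) \<in> carrier (Hom D X Y n)"
  using extension_cls[OF assms] ev_in_hom[OF assms] by simp

lemma id_functor_extension: "id_functor k (adjoin k \<C> G) D (adjoin_extension \<C> D F \<gamma>)"
proof -
  let ?E = "adjoin_extension \<C> D F \<gamma>"
  note [simp] = cls_add cls_smul cls_dif cls_cmp arr_extension_cls id_functorD(3)[OF F]
    has_type.Add has_type.Smul typed_Cmp typed_Dif typed_idt
  have o: "on_obj ?E = (\<lambda>X. X)" by (simp add: adjoin_extension_def)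
  have eqI: "f = f'" if "X \<in> Obj \<C>" "Y \<in> Obj \<C>" "f \<in> carrier (Hom D X Y n)" "f' \<in> carrier (Hom D X Y n)"
    "arr D X Y n f = arr D X Y n f'" for X Y n f f'
    using that D.arr_eq_iff by simp
  have "linear_map k (adjoin_hom k \<C> G X Y n) (Hom D X Y n) (on_mor ?E X Y n)"
    if "X \<in> Obj \<C>" "Y \<in> Obj \<C>" for X Y n
    using that unfolding linear_map_def
    by (auto elim!: in_AdjE intro!: eqI[of X Y _ n, OF that] simp: D.arr_ops)
  moreover have "on_mor ?E X Y (n - 1) (dif (adjoin k \<C> G) X Y n f) = dif D X Y n (on_mor ?E X Y n f)"
    if "X \<in> Obj \<C>" "Y \<in> Obj \<C>" "f \<in> carrier (adjoin_hom k \<C> G X Y n)" for X Y n f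
    using that by (auto elim!: in_AdjE intro!: eqI[of X Y _ "n - 1", OF that(1,2)] simp: D.arr_ops)
  moreover have "on_mor ?E X Z (m + n) (cmp (adjoin k \<C> G) X Y Z m n g f) =
      cmp D X Y Z m n (on_mor ?E Y Z m g) (on_mor ?E X Y n f)"
    if "X \<in> Obj \<C>" "Y \<in> Obj \<C>" "Z \<in> Obj \<C>" "g \<in> carrier (adjoin_hom k \<C> G Y Z m)"
      "f \<in> carrier (adjoin_hom k \<C> G X Y n)" for X Y Z m n g f
    using that by (auto elim!: in_AdjE intro!: eqI[of X Z _ "m + n", OF that(1,3)] simp: D.arr_ops)
  moreover have "on_mor ?E X X 0 (idt (adjoin k \<C> G) X) = idt D X" if "X \<in> Obj \<C>" for X
    using that by (auto intro!: eqI[of X X _ 0, OF that that] simp: cls_idt arr_idt D.arr_idt amap_laws[OF F])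
  ultimately have "dg_functor k (adjoin k \<C> G) D ?E"
    unfolding dg_functor_def o by auto
  then show ?thesis
    using o dg_category_adjoin D.dg_category_axioms by (auto simp: id_functor_def)
qed

lemma extension_Base:
  assumes "X \<in> Obj \<C>" "Y \<in> Obj \<C>" "f \<in> carrier (Hom \<C> X Y n)"
  shows "on_mor (adjoin_extension \<C> D F \<gamma>) X Y n (on_mor (adjoin_functor k \<C> G) X Y n f) = on_mor F X Y n f"
  using assms extension_cls[OF has_type.Base[OF assms]] id_functorD(3)[OF F] id_functor_closed[OF F]
  by (simp add: adjoin_functor_def amap_arr[OF F])

end

text \<open>The uniqueness half of freeness: by induction on expressions, a functor on a free extension
  is determined by what it does to \<open>\<C>\<close> and to the new morphisms.\<close>

lemma functor_on_terms:
  fixes G :: "('k, 'o, 'm, 'g) generators"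
  assumes E: "id_functor k (adjoin k \<C> G) D E"
    and F: "id_functor k \<C> D F"
    and base: "\<And>X Y n f. X \<in> Obj \<C> \<Longrightarrow> Y \<in> Obj \<C> \<Longrightarrow> f \<in> carrier (Hom \<C> X Y n) \<Longrightarrow>
      on_mor E X Y n (on_mor (adjoin_functor k \<C> G) X Y n f) = on_mor F X Y n f"
    and gen: "\<And>g X Y n b. G g = Some (X, Y, n, b) \<Longrightarrow> X \<in> Obj \<C> \<Longrightarrow> Y \<in> Obj \<C> \<Longrightarrow>
      arr D X Y n (on_mor E X Y n (term_class k \<C> G X Y n (Gen g))) = \<gamma> g"
    and t: "has_type k \<C> G t X Y n"
  shows "arr D X Y n (on_mor E X Y n (term_class k \<C> G X Y n t)) = term_eval \<C> D F \<gamma> t"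
proof -
  interpret D: dg_category k D using id_functorD(2)[OF E] .
  interpret A: dg_category k "adjoin k \<C> G" by (rule dg_category_adjoin)
  let ?a = "\<lambda>X Y n t. amap (adjoin k \<C> G) E (arr (adjoin k \<C> G) X Y n (term_class k \<C> G X Y n t))"
  have *: "?a X Y n t = arr D X Y n (on_mor E X Y n (term_class k \<C> G X Y n t))"
    if "has_type k \<C> G t X Y n" for X Y n t
    using that typed_Obj[OF that] amap_arr[OF E] by simp
  have "?a X Y n t = term_eval \<C> D F \<gamma> t" using t
  proof (induction rule: has_type.induct)
    case (Base X Y f n)
    then show ?case using *[OF has_type.Base[OF Base]] base[OF Base] amap_arr[OF F]
      by (simp add: adjoin_functor_def)
  next
    case (Gen g X Y n b)
    then show ?case using *[OF has_type.Gen[where G=G and g=g, OF Gen]] gen[OF Gen] by simp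
  next
    case (Add s X Y n t)
    then show ?case using typed_Obj[OF Add(1)] A.arr_ops(1)[of X Y "term_class k \<C> G X Y n s" n "term_class k \<C> G X Y n t"]
      by (simp add: amap_laws[OF E] cls_add)
  next
    case (Smul r t X Y n)
    then show ?case using typed_Obj[OF Smul(2)] A.arr_ops(4)[of X Y "term_class k \<C> G X Y n t" n r]
      by (simp add: amap_laws[OF E] cls_smul)
  next
    case (Cmp s Y Z m t X n)
    then show ?case using typed_Obj[OF Cmp(1)] typed_Obj[OF Cmp(2)]
        A.arr_ops(5)[of X Y "term_class k \<C> G X Y n t" n Z "term_class k \<C> G Y Z m s" m "m + n"]
      by (simp add: amap_laws[OF E] cls_cmp)
  next
    case (Dif t X Y n)
    then show ?case using typed_Obj[OF Dif(1)] A.arr_ops(3)[of X Y "term_class k \<C> G X Y n t" n "n - 1"]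
      by (simp add: amap_laws[OF E] cls_dif)
  qed
  then show ?thesis using *[OF t] by simp
qed

end

section \<open>Path objects and homotopies of dg functors\<close>

definition path_hom :: "('o, 'k, 'm) dgcat \<Rightarrow> 'o \<Rightarrow> 'o \<Rightarrow> int \<Rightarrow> ('k, 'm \<times> 'm \<times> 'm) module" where
  "path_hom D X Y n =
     \<lparr>carrier = carrier (Hom D X Y n) \<times> carrier (Hom D X Y (n + 1)) \<times> carrier (Hom D X Y n),
      monoid.mult = undefined, one = undefined,
      zero = (\<zero>\<^bsub>Hom D X Y n\<^esub>, \<zero>\<^bsub>Hom D X Y (n + 1)\<^esub>, \<zero>\<^bsub>Hom D X Y n\<^esub>),
      add = (\<lambda>(f, h, f') (g, k, g').
        (f \<oplus>\<^bsub>Hom D X Y n\<^esub> g, h \<oplus>\<^bsub>Hom D X Y (n + 1)\<^esub> k, f' \<oplus>\<^bsub>Hom D X Y n\<^esub> g')),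
      smult = (\<lambda>r (f, h, f').
        (r \<odot>\<^bsub>Hom D X Y n\<^esub> f, r \<odot>\<^bsub>Hom D X Y (n + 1)\<^esub> h, r \<odot>\<^bsub>Hom D X Y n\<^esub> f'))\<rparr>"

text \<open>A morphism \<open>(f, h, f')\<close> consists of two morphisms and a homotopy between them: the
  differential \<open>(d f, f - f' - d h, d f')\<close> vanishes iff \<open>f\<close> and \<open>f'\<close> are closed and differ by
  \<open>d h\<close>. The product \<open>(g, h, g') (f, k, f') = (g f, h f' + (-1)\<^sup>m g k, g' f')\<close> is the standard
  homotopy between two composites. The middle components are written with arrows in order to
  reuse their laws.\<close>

definition path_object :: "('o, 'k, 'm) dgcat \<Rightarrow> ('o, 'k, 'm \<times> 'm \<times> 'm) dgcat" where
  "path_object D =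
     \<lparr>Obj = Obj D,
      Hom = path_hom D,
      dif = (\<lambda>X Y n (f, h, f').
        (dif D X Y n f,
         arrow_val (aadd D (aadd D (arr D X Y n f) (aneg D (arr D X Y n f')))
           (aneg D (adif D (arr D X Y (n + 1) h)))),
         dif D X Y n f')),
      cmp = (\<lambda>X Y Z m n (g, h, g') (f, k, f').
        (cmp D X Y Z m n g f,
         arrow_val (aadd D (acmp D (arr D Y Z (m + 1) h) (arr D X Y n f'))
           (sgn_arrow D m (acmp D (arr D Y Z m g) (arr D X Y (n + 1) k)))),
         cmp D X Y Z m n g' f')),
      idt = (\<lambda>X. (idt D X, \<zero>\<^bsub>Hom D X X 1\<^esub>, idt D X))\<rparr>"

definition path_source :: "('o, 'o, 'm \<times> 'm \<times> 'm, 'm) dgfun" where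
  "path_source = \<lparr>on_obj = (\<lambda>X. X), on_mor = (\<lambda>X Y n F. fst F)\<rparr>"

definition path_target :: "('o, 'o, 'm \<times> 'm \<times> 'm, 'm) dgfun" where
  "path_target = \<lparr>on_obj = (\<lambda>X. X), on_mor = (\<lambda>X Y n F. snd (snd F))\<rparr>"

definition path_homotopy :: "('o, 'k, 'm) dgcat \<Rightarrow> ('o, 'm \<times> 'm \<times> 'm) arrow \<Rightarrow> ('o, 'm) arrow" where
  "path_homotopy D a = (case a of None \<Rightarrow> None | Some (X, Y, n, F) \<Rightarrow> arr D X Y (n + 1) (fst (snd F)))"

text \<open>The constant homotopy of \<open>F\<close>. Homotopies of functors under \<open>\<C>\<close> are required to restrict to
  it.\<close>

definition constant_path :: "('o, 'k, 'n) dgcat \<Rightarrow> ('o, 'o, 'm, 'n) dgfun \<Rightarrow>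
    ('o, 'o, 'm, 'n \<times> 'n \<times> 'n) dgfun" where
  "constant_path D F = \<lparr>on_obj = (\<lambda>X. X), on_mor = (\<lambda>X Y n f.
     (on_mor F X Y n f, \<zero>\<^bsub>Hom D X Y (n + 1)\<^esub>, on_mor F X Y n f))\<rparr>"

context dg_category
begin

abbreviation Path where "Path \<equiv> path_object \<C>"
abbreviation p0 where "p0 X Y n F \<equiv> arr \<C> X Y n (fst F)"
abbreviation p1 where "p1 X Y n F \<equiv> arr \<C> X Y (n + 1) (fst (snd F))"
abbreviation p2 where "p2 X Y n F \<equiv> arr \<C> X Y n (snd (snd F))"

lemma Path_simps [simp]: "Obj Path = Obj \<C>" "Hom Path = path_hom \<C>"
  by (simp_all add: path_object_def)

lemma path_eqI:
  assumes "X \<in> Obj \<C>" "Y \<in> Obj \<C>" "F \<in> carrier (path_hom \<C> X Y n)" "F' \<in> carrier (path_hom \<C> X Y n)"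
    "p0 X Y n F = p0 X Y n F'" "p1 X Y n F = p1 X Y n F'" "p2 X Y n F = p2 X Y n F'"
  shows "F = F'"
  using assms by (auto simp: path_hom_def arr_eq_iff)

lemma path_in_hom:
  assumes "X \<in> Obj \<C>" "Y \<in> Obj \<C>" "F \<in> carrier (path_hom \<C> X Y n)"
  shows "p0 X Y n F \<in> hom X Y n" "p1 X Y n F \<in> hom X Y (n + 1)" "p2 X Y n F \<in> hom X Y n"
  using assms by (auto simp: path_hom_def)

lemma path_add:
  assumes "X \<in> Obj \<C>" "Y \<in> Obj \<C>" "F \<in> carrier (path_hom \<C> X Y n)" "F' \<in> carrier (path_hom \<C> X Y n)"
  shows "F \<oplus>\<^bsub>path_hom \<C> X Y n\<^esub> F' \<in> carrier (path_hom \<C> X Y n)"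
    "p0 X Y n (F \<oplus>\<^bsub>path_hom \<C> X Y n\<^esub> F') = p0 X Y n F \<uplus> p0 X Y n F'"
    "q = n + 1 \<Longrightarrow> arr \<C> X Y q (fst (snd (F \<oplus>\<^bsub>path_hom \<C> X Y n\<^esub> F'))) = p1 X Y n F \<uplus> p1 X Y n F'"
    "p2 X Y n (F \<oplus>\<^bsub>path_hom \<C> X Y n\<^esub> F') = p2 X Y n F \<uplus> p2 X Y n F'"
  using assms by (auto simp: path_hom_def arr_ops)

lemma path_smul:
  assumes "X \<in> Obj \<C>" "Y \<in> Obj \<C>" "F \<in> carrier (path_hom \<C> X Y n)" "r \<in> carrier k"
  shows "r \<odot>\<^bsub>path_hom \<C> X Y n\<^esub> F \<in> carrier (path_hom \<C> X Y n)"
    "p0 X Y n (r \<odot>\<^bsub>path_hom \<C> X Y n\<^esub> F) = asmul \<C> r (p0 X Y n F)"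
    "q = n + 1 \<Longrightarrow> arr \<C> X Y q (fst (snd (r \<odot>\<^bsub>path_hom \<C> X Y n\<^esub> F))) = asmul \<C> r (p1 X Y n F)"
    "p2 X Y n (r \<odot>\<^bsub>path_hom \<C> X Y n\<^esub> F) = asmul \<C> r (p2 X Y n F)"
  using assms by (auto simp: path_hom_def arr_ops)

lemma path_zero:
  assumes "X \<in> Obj \<C>" "Y \<in> Obj \<C>"
  shows "\<zero>\<^bsub>path_hom \<C> X Y n\<^esub> \<in> carrier (path_hom \<C> X Y n)"
    "p0 X Y n \<zero>\<^bsub>path_hom \<C> X Y n\<^esub> = \<o> X Y n"
    "q = n + 1 \<Longrightarrow> arr \<C> X Y q (fst (snd \<zero>\<^bsub>path_hom \<C> X Y n\<^esub>)) = \<o> X Y (n + 1)"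
    "p2 X Y n \<zero>\<^bsub>path_hom \<C> X Y n\<^esub> = \<o> X Y n"
  using assms by (auto simp: path_hom_def arr_zero)

lemma path_dif:
  assumes "X \<in> Obj \<C>" "Y \<in> Obj \<C>" "F \<in> carrier (path_hom \<C> X Y n)" "p = n - 1"
  shows "dif Path X Y n F \<in> carrier (path_hom \<C> X Y p)"
    "p0 X Y p (dif Path X Y n F) = \<delta> (p0 X Y n F)"
    "q = n \<Longrightarrow> arr \<C> X Y q (fst (snd (dif Path X Y n F))) = p0 X Y n F \<uplus> \<sim> (p2 X Y n F) \<uplus> \<sim> (\<delta> (p1 X Y n F))"
    "p2 X Y p (dif Path X Y n F) = \<delta> (p2 X Y n F)"
proof -
  obtain f h f' where F: "F = (f, h, f')" by (cases F)
  then have c: "f \<in> carrier (Hom \<C> X Y n)" "h \<in> carrier (Hom \<C> X Y (n + 1))" "f' \<in> carrier (Hom \<C> X Y n)"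
    using assms by (auto simp: path_hom_def)
  have "arr \<C> X Y n f \<uplus> \<sim> (arr \<C> X Y n f') \<uplus> \<sim> (\<delta> (arr \<C> X Y (n + 1) h)) \<in> hom X Y n"
    using assms(1,2) c by (intro add_in_hom neg_in_hom dif_in_hom[of _ _ _ "n + 1"] arr_in_hom) auto
  then show "dif Path X Y n F \<in> carrier (path_hom \<C> X Y p)"
    "p0 X Y p (dif Path X Y n F) = \<delta> (p0 X Y n F)"
    "q = n \<Longrightarrow> arr \<C> X Y q (fst (snd (dif Path X Y n F))) = p0 X Y n F \<uplus> \<sim> (p2 X Y n F) \<uplus> \<sim> (\<delta> (p1 X Y n F))"
    "p2 X Y p (dif Path X Y n F) = \<delta> (p2 X Y n F)"
    using assms c by (auto simp: F path_object_def path_hom_def arr_ops)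
qed

lemma path_cmp:
  assumes "X \<in> Obj \<C>" "Y \<in> Obj \<C>" "Z \<in> Obj \<C>" "F \<in> carrier (path_hom \<C> X Y n)"
    "G \<in> carrier (path_hom \<C> Y Z m)" "p = m + n"
  shows "cmp Path X Y Z m n G F \<in> carrier (path_hom \<C> X Z p)"
    "p0 X Z p (cmp Path X Y Z m n G F) = p0 Y Z m G \<cdot> p0 X Y n F"
    "q = m + n + 1 \<Longrightarrow> arr \<C> X Z q (fst (snd (cmp Path X Y Z m n G F))) = p1 Y Z m G \<cdot> p2 X Y n F \<uplus> \<epsilon> m (p0 Y Z m G \<cdot> p1 X Y n F)"
    "p2 X Z p (cmp Path X Y Z m n G F) = p2 Y Z m G \<cdot> p2 X Y n F"
proof -
  obtain f l f' g h g' where FG: "F = (f, l, f')" "G = (g, h, g')" by (cases F, cases G)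
  then have c: "f \<in> carrier (Hom \<C> X Y n)" "l \<in> carrier (Hom \<C> X Y (n + 1))" "f' \<in> carrier (Hom \<C> X Y n)"
    "g \<in> carrier (Hom \<C> Y Z m)" "h \<in> carrier (Hom \<C> Y Z (m + 1))" "g' \<in> carrier (Hom \<C> Y Z m)"
    using assms by (auto simp: path_hom_def)
  have "arr \<C> Y Z (m + 1) h \<cdot> arr \<C> X Y n f' \<uplus> \<epsilon> m (arr \<C> Y Z m g \<cdot> arr \<C> X Y (n + 1) l) \<in> hom X Z (p + 1)"
    using assms c
    by (intro add_in_hom sgn_in_hom cmp_in_hom[of _ Y Z "m + 1" _ X n] cmp_in_hom[of _ Y Z m _ X "n + 1"]
        arr_in_hom) auto
  then show "cmp Path X Y Z m n G F \<in> carrier (path_hom \<C> X Z p)"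
    "p0 X Z p (cmp Path X Y Z m n G F) = p0 Y Z m G \<cdot> p0 X Y n F"
    "q = m + n + 1 \<Longrightarrow> arr \<C> X Z q (fst (snd (cmp Path X Y Z m n G F))) = p1 Y Z m G \<cdot> p2 X Y n F \<uplus> \<epsilon> m (p0 Y Z m G \<cdot> p1 X Y n F)"
    "p2 X Z p (cmp Path X Y Z m n G F) = p2 Y Z m G \<cdot> p2 X Y n F"
    using assms c by (auto simp: FG path_object_def path_hom_def arr_ops)
qed

lemma path_idt:
  assumes "X \<in> Obj \<C>"
  shows "idt Path X \<in> carrier (path_hom \<C> X X 0)"
    "p0 X X 0 (idt Path X) = \<i> X" "arr \<C> X X 1 (fst (snd (idt Path X))) = \<o> X X 1" "p2 X X 0 (idt Path X) = \<i> X"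
  using assms by (auto simp: path_object_def path_hom_def arr_idt arr_zero)

lemmas path_closed = path_add(1) path_smul(1) path_zero(1) path_dif(1) path_cmp(1) path_idt(1)
lemmas path_proj = path_add(2-) path_smul(2-) path_zero(2-) path_dif(2-) path_cmp(2-) path_idt(2-)

lemma path_hom_module:
  assumes XY: "X \<in> Obj \<C>" "Y \<in> Obj \<C>"
  shows "module k (path_hom \<C> X Y n)" (is "module k ?M")
proof (rule moduleI)
  note [simp] = path_closed path_proj XY smul_laws path_in_hom[OF XY]
  note eq = path_eqI[OF XY]
  show "cring k" by (rule cring_axioms)
  show "abelian_group ?M"
  proof (rule abelian_groupI)
    show "a \<oplus>\<^bsub>?M\<^esub> b \<in> carrier ?M" if "a \<in> carrier ?M" "b \<in> carrier ?M" for a b using that by simp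
    show "\<zero>\<^bsub>?M\<^esub> \<in> carrier ?M" by simp
    show "a \<oplus>\<^bsub>?M\<^esub> b \<oplus>\<^bsub>?M\<^esub> c = a \<oplus>\<^bsub>?M\<^esub> (b \<oplus>\<^bsub>?M\<^esub> c)"
      if "a \<in> carrier ?M" "b \<in> carrier ?M" "c \<in> carrier ?M" for a b c
      using that by (intro eq[of _ n]) (simp_all add: add_assoc)
    show "a \<oplus>\<^bsub>?M\<^esub> b = b \<oplus>\<^bsub>?M\<^esub> a" if "a \<in> carrier ?M" "b \<in> carrier ?M" for a b
      using that by (intro eq[of _ n]) (simp_all add: add_commute)
    show "\<zero>\<^bsub>?M\<^esub> \<oplus>\<^bsub>?M\<^esub> a = a" if "a \<in> carrier ?M" for a
      using that by (intro eq[of _ n]) simp_all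
    show "\<exists>b\<in>carrier ?M. b \<oplus>\<^bsub>?M\<^esub> a = \<zero>\<^bsub>?M\<^esub>" if a: "a \<in> carrier ?M" for a
    proof -
      have "(\<ominus>\<^bsub>k\<^esub> \<one>\<^bsub>k\<^esub>) \<odot>\<^bsub>?M\<^esub> a \<oplus>\<^bsub>?M\<^esub> a = \<zero>\<^bsub>?M\<^esub>"
        using a by (intro eq[of _ n]) (simp_all add: add_commute[of "\<sim> _"] add_neg)
      then show ?thesis using a path_smul(1)[OF XY a sign_closed(1)] by blast
    qed
  qed
  show "r \<odot>\<^bsub>?M\<^esub> a \<in> carrier ?M" if "r \<in> carrier k" "a \<in> carrier ?M" for r a using that by simp
  show "(r \<oplus>\<^bsub>k\<^esub> s) \<odot>\<^bsub>?M\<^esub> a = r \<odot>\<^bsub>?M\<^esub> a \<oplus>\<^bsub>?M\<^esub> s \<odot>\<^bsub>?M\<^esub> a"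
    "(r \<otimes>\<^bsub>k\<^esub> s) \<odot>\<^bsub>?M\<^esub> a = r \<odot>\<^bsub>?M\<^esub> (s \<odot>\<^bsub>?M\<^esub> a)"
    if "r \<in> carrier k" "s \<in> carrier k" "a \<in> carrier ?M" for r s a
    using that by (intro eq[of _ n]; simp)+
  show "r \<odot>\<^bsub>?M\<^esub> (a \<oplus>\<^bsub>?M\<^esub> b) = r \<odot>\<^bsub>?M\<^esub> a \<oplus>\<^bsub>?M\<^esub> r \<odot>\<^bsub>?M\<^esub> b"
    if "r \<in> carrier k" "a \<in> carrier ?M" "b \<in> carrier ?M" for r a b
    using that by (intro eq[of _ n]; simp)
  show "\<one>\<^bsub>k\<^esub> \<odot>\<^bsub>?M\<^esub> a = a" if "a \<in> carrier ?M" for a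
    using that by (intro eq[of _ n]; simp)
qed

lemma path_signed:
  assumes XY: "X \<in> Obj \<C>" "Y \<in> Obj \<C>" and F: "F \<in> carrier (path_hom \<C> X Y n)"
  shows "signed (path_hom \<C> X Y n) m F \<in> carrier (path_hom \<C> X Y n)"
    "p0 X Y n (signed (path_hom \<C> X Y n) m F) = \<epsilon> m (p0 X Y n F)"
    "q = n + 1 \<Longrightarrow> arr \<C> X Y q (fst (snd (signed (path_hom \<C> X Y n) m F))) = \<epsilon> m (p1 X Y n F)"
    "p2 X Y n (signed (path_hom \<C> X Y n) m F) = \<epsilon> m (p2 X Y n F)"
proof -
  interpret M: module k "path_hom \<C> X Y n" by (rule path_hom_module[OF XY])
  have "\<ominus>\<^bsub>path_hom \<C> X Y n\<^esub> F = (\<ominus>\<^bsub>k\<^esub> \<one>\<^bsub>k\<^esub>) \<odot>\<^bsub>path_hom \<C> X Y n\<^esub> F"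
    using M.smult_l_minus[of "\<one>\<^bsub>k\<^esub>" F] F by simp
  then show "signed (path_hom \<C> X Y n) m F \<in> carrier (path_hom \<C> X Y n)"
    "p0 X Y n (signed (path_hom \<C> X Y n) m F) = \<epsilon> m (p0 X Y n F)"
    "q = n + 1 \<Longrightarrow> arr \<C> X Y q (fst (snd (signed (path_hom \<C> X Y n) m F))) = \<epsilon> m (p1 X Y n F)"
    "p2 X Y n (signed (path_hom \<C> X Y n) m F) = \<epsilon> m (p2 X Y n F)"
    using path_smul[OF XY F] path_in_hom[OF XY F] F by (auto simp: signed_def sgn_arrow_def)
qed

lemma path_linearI:
  assumes "X \<in> Obj \<C>" "Y \<in> Obj \<C>" "X' \<in> Obj \<C>" "Y' \<in> Obj \<C>"
    and "\<And>F. F \<in> carrier (path_hom \<C> X Y n) \<Longrightarrow> \<phi> F \<in> carrier (path_hom \<C> X' Y' n')"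
    and "\<And>F F'. F \<in> carrier (path_hom \<C> X Y n) \<Longrightarrow> F' \<in> carrier (path_hom \<C> X Y n) \<Longrightarrow>
      \<phi> (F \<oplus>\<^bsub>path_hom \<C> X Y n\<^esub> F') = \<phi> F \<oplus>\<^bsub>path_hom \<C> X' Y' n'\<^esub> \<phi> F'"
    and "\<And>r F. r \<in> carrier k \<Longrightarrow> F \<in> carrier (path_hom \<C> X Y n) \<Longrightarrow>
      \<phi> (r \<odot>\<^bsub>path_hom \<C> X Y n\<^esub> F) = r \<odot>\<^bsub>path_hom \<C> X' Y' n'\<^esub> \<phi> F"
  shows "linear_map k (path_hom \<C> X Y n) (path_hom \<C> X' Y' n') \<phi>"
  using assms by (auto simp: linear_map_def)

text \<open>The Leibniz rule of the path object in its middle component, the only one that is not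
  inherited. Expanding the right-hand side yields the left-hand side and one cancelling pair
  \<open>g f' - g f'\<close>.\<close>

lemma path_leibniz_homotopy:
  assumes g: "g \<in> hom Y Z m" "g' \<in> hom Y Z m" "h \<in> hom Y Z (m + 1)"
    and f: "f \<in> hom X Y n" "f' \<in> hom X Y n" "l \<in> hom X Y (n + 1)"
  shows "g \<cdot> f \<uplus> \<sim> (g' \<cdot> f') \<uplus> \<sim> (\<delta> (h \<cdot> f' \<uplus> \<epsilon> m (g \<cdot> l))) =
    (g \<uplus> \<sim> g' \<uplus> \<sim> (\<delta> h)) \<cdot> f' \<uplus> \<epsilon> (m - 1) (\<delta> g \<cdot> l) \<uplus>
    \<epsilon> m (h \<cdot> \<delta> f' \<uplus> \<epsilon> m (g \<cdot> (f \<uplus> \<sim> f' \<uplus> \<sim> (\<delta> l))))"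
    (is "?L = ?R")
proof -
  have gf': "g \<cdot> f' \<in> hom X Z (m + n)" using g f by auto
  have L: "?L \<in> hom X Z (m + n)"
    using g f
    by (intro add_in_hom neg_in_hom dif_in_hom[of _ _ _ "m + n + 1"] sgn_in_hom cmp_in_hom[OF g(1) f(1)]
        cmp_in_hom[OF g(2) f(2)] cmp_in_hom[OF g(3) f(2)] cmp_in_hom[OF g(1) f(3)]) auto
  have "?R = ?L \<uplus> (g \<cdot> f' \<uplus> \<sim> (g \<cdot> f'))"
    by (cases "even m") (simp_all add: leibniz_arrow[OF g(1)] leibniz_arrow[OF g(3)] add_ac)
  also have "\<dots> = ?L" using L add_neg[OF gf'] by simp
  finally show ?thesis ..
qed

lemma dg_category_path: "dg_category k Path"
proof (rule dg_category.intro[OF cring_axioms], rule dg_category_axioms.intro; unfold Path_simps)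
  note [simp] = path_closed path_proj smul_laws path_in_hom path_signed
  show "module k (path_hom \<C> X Y n)" if "X \<in> Obj \<C>" "Y \<in> Obj \<C>" for X Y n
    using that by (rule path_hom_module)
  show "linear_map k (path_hom \<C> X Y n) (path_hom \<C> X Y (n - 1)) (dif Path X Y n)"
    if "X \<in> Obj \<C>" "Y \<in> Obj \<C>" for X Y n
    using that by (intro path_linearI path_eqI[of X Y _ "n - 1"]) (simp_all add: add_ac)
  show "dif Path X Y (n - 1) (dif Path X Y n F) = \<zero>\<^bsub>path_hom \<C> X Y (n - 2)\<^esub>"
    if XY: "X \<in> Obj \<C>" "Y \<in> Obj \<C>" and F: "F \<in> carrier (path_hom \<C> X Y n)" for X Y F n
  proof (rule path_eqI[OF XY, of _ "n - 2"])
    have d: "dif Path X Y n F \<in> carrier (path_hom \<C> X Y (n - 1))" using XY F by simp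
    note T = path_in_hom[OF XY F]
    let ?e = "\<delta> (p0 X Y n F) \<uplus> \<sim> (\<delta> (p2 X Y n F))"
    have e: "?e \<in> hom X Y (n - 1)" using T by auto
    have "arr \<C> X Y (n - 1) (fst (snd (dif Path X Y (n - 1) (dif Path X Y n F)))) =
        (?e \<uplus> \<sim> ?e) \<uplus> \<delta> (\<delta> (p1 X Y n F))"
      using XY F d by (simp add: add_ac)
    also have "\<dots> = \<o> X Y (n - 1)"
      using e add_neg[OF e] dif_dif_arrow[OF T(2), of "n - 1"] zero_in_hom[OF XY, of "n - 1"] by simp
    finally show "p1 X Y (n - 2) (dif Path X Y (n - 1) (dif Path X Y n F)) =
        p1 X Y (n - 2) \<zero>\<^bsub>path_hom \<C> X Y (n - 2)\<^esub>"
      using XY by simp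
  qed (use XY F in \<open>simp_all add: dif_dif_arrow[OF path_in_hom(1)] dif_dif_arrow[OF path_in_hom(3)]\<close>)
  show "linear_map k (path_hom \<C> Y Z m) (path_hom \<C> X Z (m + n)) (\<lambda>G. cmp Path X Y Z m n G F)"
    if "X \<in> Obj \<C>" "Y \<in> Obj \<C>" "Z \<in> Obj \<C>" "F \<in> carrier (path_hom \<C> X Y n)" for X Y Z F n m
    using that by (intro path_linearI path_eqI[of X Z _ "m + n"]) (simp_all add: add_ac)
  show "linear_map k (path_hom \<C> X Y n) (path_hom \<C> X Z (m + n)) (\<lambda>F. cmp Path X Y Z m n G F)"
    if "X \<in> Obj \<C>" "Y \<in> Obj \<C>" "Z \<in> Obj \<C>" "G \<in> carrier (path_hom \<C> Y Z m)" for X Y Z G n m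
    using that by (intro path_linearI path_eqI[of X Z _ "m + n"]) (simp_all add: add_ac)
  show "cmp Path W X Z (l + m) n (cmp Path X Y Z l m H G) F = cmp Path W Y Z l (m + n) H (cmp Path W X Y m n G F)"
    if "W \<in> Obj \<C>" "X \<in> Obj \<C>" "Y \<in> Obj \<C>" "Z \<in> Obj \<C>" "F \<in> carrier (path_hom \<C> W X n)"
      "G \<in> carrier (path_hom \<C> X Y m)" "H \<in> carrier (path_hom \<C> Y Z l)" for W X Y Z F n G m H l
    using that by (intro path_eqI[of W Z _ "l + m + n"]) (simp_all add: comp_assoc add_ac ac_simps)
  show "idt Path X \<in> carrier (path_hom \<C> X X 0)" if "X \<in> Obj \<C>" for X
    using that by simp
  show "cmp Path X Y Y 0 n (idt Path Y) F = F" "cmp Path X X Y n 0 F (idt Path X) = F"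
    if XY: "X \<in> Obj \<C>" "Y \<in> Obj \<C>" and F: "F \<in> carrier (path_hom \<C> X Y n)" for X Y F n
  proof -
    note T = path_in_hom[OF XY F]
    show "cmp Path X Y Y 0 n (idt Path Y) F = F"
      using XY F comp_idt_left[OF T(1)] comp_idt_left[OF T(2)] comp_idt_left[OF T(3)]
        comp_zero_left[OF T(3) XY(2)] by (intro path_eqI[OF XY, of _ n]) (simp_all add: add.commute[of 1 n] add_zero(2)[OF T(2)])
    show "cmp Path X X Y n 0 F (idt Path X) = F"
      using XY F comp_idt_right[OF T(1)] comp_idt_right[OF T(2)] comp_idt_right[OF T(3)]
        comp_zero_right[OF T(1) XY(1)] by (intro path_eqI[OF XY, of _ n]) simp_all
  qed
  show "dif Path X Z (m + n) (cmp Path X Y Z m n G F) =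
      cmp Path X Y Z (m - 1) n (dif Path Y Z m G) F \<oplus>\<^bsub>path_hom \<C> X Z (m + n - 1)\<^esub>
      signed (path_hom \<C> X Z (m + n - 1)) m (cmp Path X Y Z m (n - 1) G (dif Path X Y n F))"
    if XYZ: "X \<in> Obj \<C>" "Y \<in> Obj \<C>" "Z \<in> Obj \<C>" and F: "F \<in> carrier (path_hom \<C> X Y n)"
      and G: "G \<in> carrier (path_hom \<C> Y Z m)" for X Y Z F n G m
  proof -
    note TF = path_in_hom[OF XYZ(1,2) F] and TG = path_in_hom[OF XYZ(2,3) G]
    have c: "cmp Path X Y Z (m - 1) n (dif Path Y Z m G) F \<in> carrier (path_hom \<C> X Z (m + n - 1))"
      "cmp Path X Y Z m (n - 1) G (dif Path X Y n F) \<in> carrier (path_hom \<C> X Z (m + n - 1))"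
      using XYZ F G by simp_all
    show ?thesis
      using XYZ F G c leibniz_arrow[OF TG(1)] leibniz_arrow[OF TG(3)]
        path_leibniz_homotopy[OF TG(1,3,2) TF(1,3,2)]
        path_dif(3)[OF XYZ(1,3) path_cmp(1)[OF XYZ F G HOL.refl], of "m + n - 1"]
        path_cmp(3)[OF XYZ F G, of "m + n"]
        path_cmp(3)[OF XYZ F path_dif(1)[OF XYZ(2,3) G HOL.refl], of "m + n - 1"]
        path_cmp(3)[OF XYZ path_dif(1)[OF XYZ(1,2) F HOL.refl] G, of "m + n - 1"]
        path_dif(3)[OF XYZ(2,3) G, of "m - 1"] path_dif(3)[OF XYZ(1,2) F, of "n - 1"]
      by (intro path_eqI[OF XYZ(1,3), of _ "m + n - 1"]) simp_all
  qed
qed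

lemma id_functor_path_source: "id_functor k Path \<C> path_source"
  and id_functor_path_target: "id_functor k Path \<C> path_target"
proof -
  have "dg_functor k Path \<C> path_source" "dg_functor k Path \<C> path_target"
    by (auto simp: dg_functor_def linear_map_def path_source_def path_target_def path_object_def path_hom_def)
  then show "id_functor k Path \<C> path_source" "id_functor k Path \<C> path_target"
    using dg_category_path dg_category_axioms
    by (simp_all add: id_functor_def path_source_def path_target_def)
qed

lemma id_functor_constant_path:
  assumes F: "id_functor k B \<C> F"
  shows "id_functor k B Path (constant_path \<C> F)"
proof -
  interpret B: dg_category k B using id_functorD(1)[OF F] .
  note [simp] = id_functorD(3)[OF F] id_functor_closed[OF F] id_functorD(5-7)[OF F]
    linear_mapD(2,3)[OF id_functorD(4)[OF F]]
  have o: "on_obj (constant_path \<C> F) = (\<lambda>X. X)" by (simp add: constant_path_def)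
  have const: "on_mor (constant_path \<C> F) X Y n f = (on_mor F X Y n f, \<zero>\<^bsub>Hom \<C> X Y (n + 1)\<^esub>, on_mor F X Y n f)"
    for X Y n f by (simp add: constant_path_def)
  have c: "on_mor (constant_path \<C> F) X Y n f \<in> carrier (path_hom \<C> X Y n)"
    if "X \<in> Obj B" "Y \<in> Obj B" "f \<in> carrier (Hom B X Y n)" for X Y n f
    using that by (simp add: const path_hom_def)
  have p: "p0 X Y n (on_mor (constant_path \<C> F) X Y n f) = arr \<C> X Y n (on_mor F X Y n f)"
    "q = n + 1 \<Longrightarrow> arr \<C> X Y q (fst (snd (on_mor (constant_path \<C> F) X Y n f))) = \<o> X Y (n + 1)"
    "p2 X Y n (on_mor (constant_path \<C> F) X Y n f) = arr \<C> X Y n (on_mor F X Y n f)"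
    if "X \<in> Obj B" "Y \<in> Obj B" "f \<in> carrier (Hom B X Y n)" for X Y n f q
    using that by (simp_all add: const arr_zero)
  note [simp] = c p path_closed path_proj
  have lin: "linear_map k (Hom B X Y n) (path_hom \<C> X Y n) (on_mor (constant_path \<C> F) X Y n)"
    if "X \<in> Obj B" "Y \<in> Obj B" for X Y n
    unfolding linear_map_def
  proof (intro conjI ballI)
    show "on_mor (constant_path \<C> F) X Y n \<in> carrier (Hom B X Y n) \<rightarrow> carrier (path_hom \<C> X Y n)"
      using that by simp
    note z = zero_in_hom[of X Y "n + 1"]
    show "on_mor (constant_path \<C> F) X Y n (a \<oplus>\<^bsub>Hom B X Y n\<^esub> b) =
      on_mor (constant_path \<C> F) X Y n a \<oplus>\<^bsub>path_hom \<C> X Y n\<^esub> on_mor (constant_path \<C> F) X Y n b"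
      if "a \<in> carrier (Hom B X Y n)" "b \<in> carrier (Hom B X Y n)" for a b
      using that \<open>X \<in> Obj B\<close> \<open>Y \<in> Obj B\<close> z by (intro path_eqI[of X Y _ n]) (simp_all add: arr_ops)
    show "on_mor (constant_path \<C> F) X Y n (r \<odot>\<^bsub>Hom B X Y n\<^esub> a) =
      r \<odot>\<^bsub>path_hom \<C> X Y n\<^esub> on_mor (constant_path \<C> F) X Y n a"
      if "r \<in> carrier k" "a \<in> carrier (Hom B X Y n)" for r a
      using that \<open>X \<in> Obj B\<close> \<open>Y \<in> Obj B\<close> z
      by (intro path_eqI[of X Y _ n]) (simp_all add: arr_ops)
  qed
  have dif: "on_mor (constant_path \<C> F) X Y (n - 1) (dif B X Y n f) =
      dif Path X Y n (on_mor (constant_path \<C> F) X Y n f)"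
    if "X \<in> Obj B" "Y \<in> Obj B" "f \<in> carrier (Hom B X Y n)" for X Y n f
  proof -
    have "arr \<C> X Y n (on_mor F X Y n f) \<in> hom X Y n" using that by auto
    from add_neg[OF this] show ?thesis
      using that zero_in_hom[of X Y n] by (intro path_eqI[of X Y _ "n - 1"]) (simp_all add: arr_ops)
  qed
  have cmp: "on_mor (constant_path \<C> F) X Z (m + n) (cmp B X Y Z m n g f) =
      cmp Path X Y Z m n (on_mor (constant_path \<C> F) Y Z m g) (on_mor (constant_path \<C> F) X Y n f)"
    if "X \<in> Obj B" "Y \<in> Obj B" "Z \<in> Obj B" "g \<in> carrier (Hom B Y Z m)" "f \<in> carrier (Hom B X Y n)"
    for X Y Z m n g f
  proof -
    have "arr \<C> X Y n (on_mor F X Y n f) \<in> hom X Y n" "arr \<C> Y Z m (on_mor F Y Z m g) \<in> hom Y Z m"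
      using that by auto
    then show ?thesis
      using that zero_in_hom[of X Z "m + n + 1"]
        comp_zero_left[of "arr \<C> X Y n (on_mor F X Y n f)" X Y n Z "m + 1"]
        comp_zero_right[of "arr \<C> Y Z m (on_mor F Y Z m g)" Y Z m X "n + 1"]
      by (intro path_eqI[of X Z _ "m + n"]) (simp_all add: arr_ops algebra_simps)
  qed
  have idt: "on_mor (constant_path \<C> F) X X 0 (idt B X) = idt Path X" if "X \<in> Obj B" for X
    using that by (simp add: const path_object_def)
  show ?thesis
    using F lin dif cmp idt dg_category_path unfolding id_functor_def dg_functor_def o by simp
qed

lemma path_arrowE:
  assumes "a \<in> arrows Path X Y n"
  obtains F where "a = Some (X, Y, n, F)" "X \<in> Obj \<C>" "Y \<in> Obj \<C>" "F \<in> carrier (path_hom \<C> X Y n)"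
  using assms by (auto simp: arrows_def)

lemma path_arrow_projections:
  assumes "X \<in> Obj \<C>" "Y \<in> Obj \<C>" "F \<in> carrier (path_hom \<C> X Y n)"
  shows "amap Path path_source (Some (X, Y, n, F)) = p0 X Y n F"
    "path_homotopy \<C> (Some (X, Y, n, F)) = p1 X Y n F"
    "amap Path path_target (Some (X, Y, n, F)) = p2 X Y n F"
  using assms path_in_hom[OF assms]
  by (auto simp: amap_def path_homotopy_def chk_def arr_def path_source_def path_target_def arrows_def split: if_splits)

lemma path_homotopy_in_hom: "a \<in> arrows Path X Y n \<Longrightarrow> path_homotopy \<C> a \<in> hom X Y (n + 1)"
  by (elim path_arrowE) (simp add: path_arrow_projections path_in_hom)

lemma path_arrow_eqI:
  assumes "a \<in> arrows Path X Y n" "b \<in> arrows Path X Y n"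
    "amap Path path_source a = amap Path path_source b" "path_homotopy \<C> a = path_homotopy \<C> b"
    "amap Path path_target a = amap Path path_target b"
  shows "a = b"
proof -
  obtain F where F: "a = Some (X, Y, n, F)" "X \<in> Obj \<C>" "Y \<in> Obj \<C>" "F \<in> carrier (path_hom \<C> X Y n)"
    using assms(1) by (rule path_arrowE)
  obtain F' where F': "b = Some (X, Y, n, F')" "F' \<in> carrier (path_hom \<C> X Y n)"
    using assms(2) by (rule path_arrowE)
  have "F = F'"
    using assms(3-5) F F' by (intro path_eqI[OF F(2-4) F'(2)]) (simp_all add: path_arrow_projections)
  then show ?thesis using F F' by simp
qed

lemma path_homotopy_ops:
  assumes a: "a \<in> arrows Path X Y n"
  shows "path_homotopy \<C> (adif Path a) =
      amap Path path_source a \<uplus> \<sim> (amap Path path_target a) \<uplus> \<sim> (\<delta> (path_homotopy \<C> a))"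
    and "b \<in> arrows Path X Y n \<Longrightarrow>
      path_homotopy \<C> (aadd Path a b) = path_homotopy \<C> a \<uplus> path_homotopy \<C> b"
    and "r \<in> carrier k \<Longrightarrow> path_homotopy \<C> (asmul Path r a) = asmul \<C> r (path_homotopy \<C> a)"
    and "c \<in> arrows Path Y Z m \<Longrightarrow> path_homotopy \<C> (acmp Path c a) =
      path_homotopy \<C> c \<cdot> amap Path path_target a \<uplus>
      \<epsilon> m (amap Path path_source c \<cdot> path_homotopy \<C> a)"
proof -
  note [simp] = path_arrow_projections path_closed path_proj
  obtain F where F: "a = Some (X, Y, n, F)" "X \<in> Obj \<C>" "Y \<in> Obj \<C>" "F \<in> carrier (path_hom \<C> X Y n)"
    using a by (rule path_arrowE)
  have chk: "chk Path a = a" using F by (simp add: chk_def arr_def)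
  show "path_homotopy \<C> (adif Path a) =
      amap Path path_source a \<uplus> \<sim> (amap Path path_target a) \<uplus> \<sim> (\<delta> (path_homotopy \<C> a))"
    using F chk by (simp add: adif_def)
  show "r \<in> carrier k \<Longrightarrow> path_homotopy \<C> (asmul Path r a) = asmul \<C> r (path_homotopy \<C> a)"
    using F chk by (simp add: asmul_def)
  show "path_homotopy \<C> (aadd Path a b) = path_homotopy \<C> a \<uplus> path_homotopy \<C> b"
    if b: "b \<in> arrows Path X Y n"
  proof -
    obtain F' where "b = Some (X, Y, n, F')" "F' \<in> carrier (path_hom \<C> X Y n)"
      using b by (rule path_arrowE)
    moreover from this have "chk Path b = b" using F by (simp add: chk_def arr_def)
    ultimately show ?thesis using F chk by (simp add: aadd_def)
  qed
  show "path_homotopy \<C> (acmp Path c a) =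
      path_homotopy \<C> c \<cdot> amap Path path_target a \<uplus>
      \<epsilon> m (amap Path path_source c \<cdot> path_homotopy \<C> a)" if c: "c \<in> arrows Path Y Z m"
  proof -
    obtain G where "c = Some (Y, Z, m, G)" "Z \<in> Obj \<C>" "G \<in> carrier (path_hom \<C> Y Z m)"
      using c by (rule path_arrowE)
    moreover from this have "chk Path c = c" using F by (simp add: chk_def arr_def)
    ultimately show ?thesis using F chk by (simp add: acmp_def)
  qed
qed

lemma amap_constant_path:
  assumes F: "id_functor k B \<C> F" and a: "a \<in> arrows B X Y n"
  shows "amap B (constant_path \<C> F) a \<in> arrows Path X Y n"
    "amap Path path_source (amap B (constant_path \<C> F) a) = amap B F a"
    "path_homotopy \<C> (amap B (constant_path \<C> F) a) = \<o> X Y (n + 1)"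
    "amap Path path_target (amap B (constant_path \<C> F) a) = amap B F a"
proof -
  interpret B: dg_category k B using id_functorD(1)[OF F] .
  show c: "amap B (constant_path \<C> F) a \<in> arrows Path X Y n"
    using amap_in_hom[OF id_functor_constant_path[OF F] a] .
  obtain f where f: "a = Some (X, Y, n, f)" "X \<in> Obj B" "Y \<in> Obj B" "f \<in> carrier (Hom B X Y n)"
    using a by (rule B.in_homE)
  have chk: "chk B a = a" using a by simp
  have "on_mor (constant_path \<C> F) X Y n f \<in> carrier (path_hom \<C> X Y n)"
    using c f chk by (auto simp: amap_def arrows_def)
  then show "amap Path path_source (amap B (constant_path \<C> F) a) = amap B F a"
    "path_homotopy \<C> (amap B (constant_path \<C> F) a) = \<o> X Y (n + 1)"
    "amap Path path_target (amap B (constant_path \<C> F) a) = amap B F a"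
    using f chk id_functorD(3)[OF F] id_functor_closed[OF F]
    by (simp_all add: amap_def[of B] path_arrow_projections constant_path_def arr_zero)
      (simp_all add: arr_def)
qed

lemma path_arrow_exists:
  assumes "a \<in> hom X Y n" "h \<in> hom X Y (n + 1)" "b \<in> hom X Y n"
  obtains p where "p \<in> arrows Path X Y n" "amap Path path_source p = a" "path_homotopy \<C> p = h"
    "amap Path path_target p = b"
proof -
  have c: "(arrow_val a, arrow_val h, arrow_val b) \<in> carrier (path_hom \<C> X Y n)" "X \<in> Obj \<C>" "Y \<in> Obj \<C>"
    using assms in_hom_Obj[OF assms(1)] by (auto simp: path_hom_def)
  let ?p = "Some (X, Y, n, (arrow_val a, arrow_val h, arrow_val b))"
  have "?p \<in> arrows Path X Y n" using c by (simp add: arrows_def)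
  then show thesis using assms c by (intro that[of ?p]) (simp_all add: path_arrow_projections)
qed

end

text \<open>The assignment \<open>\<gamma>\<close> extends the constant homotopy of \<open>F\<close> to a homotopy on the free extension,
  whose two ends are \<open>E1\<close> and \<open>E2\<close> by uniqueness. It sends a cycle \<open>c\<close> to a closed triple
  \<open>(f, h, f')\<close>, and the middle component of its differential says \<open>f - f' = d h\<close>.\<close>

lemma homotopic_functors_hclass:
  fixes G :: "('k, 'o, 'm, 'g) generators"
  assumes C: "dg_category k C" and F: "id_functor k C D F"
    and E1: "id_functor k (adjoin k C G) D E1" and E2: "id_functor k (adjoin k C G) D E2"
    and base1: "\<And>X Y n f. X \<in> Obj C \<Longrightarrow> Y \<in> Obj C \<Longrightarrow> f \<in> carrier (Hom C X Y n) \<Longrightarrow>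
      on_mor E1 X Y n (on_mor (adjoin_functor k C G) X Y n f) = on_mor F X Y n f"
    and base2: "\<And>X Y n f. X \<in> Obj C \<Longrightarrow> Y \<in> Obj C \<Longrightarrow> f \<in> carrier (Hom C X Y n) \<Longrightarrow>
      on_mor E2 X Y n (on_mor (adjoin_functor k C G) X Y n f) = on_mor F X Y n f"
    and \<gamma>: "valid_assignment k C G (path_object D) (constant_path D F) \<gamma>"
    and gen1: "\<And>g X Y n b. G g = Some (X, Y, n, b) \<Longrightarrow> X \<in> Obj C \<Longrightarrow> Y \<in> Obj C \<Longrightarrow>
      arr D X Y n (on_mor E1 X Y n (term_class k C G X Y n (Gen g))) =
      amap (path_object D) path_source (\<gamma> g)"
    and gen2: "\<And>g X Y n b. G g = Some (X, Y, n, b) \<Longrightarrow> X \<in> Obj C \<Longrightarrow> Y \<in> Obj C \<Longrightarrow>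
      arr D X Y n (on_mor E2 X Y n (term_class k C G X Y n (Gen g))) =
      amap (path_object D) path_target (\<gamma> g)"
    and XY: "X \<in> Obj C" "Y \<in> Obj C" and c: "c \<in> cycles (adjoin k C G) X Y n"
  shows "hclass D X Y n (on_mor E1 X Y n c) = hclass D X Y n (on_mor E2 X Y n c)"
proof -
  interpret C: dg_category k C by fact
  interpret D: dg_category k D using id_functorD(2)[OF F] .
  interpret A: dg_category k "adjoin k C G" by (rule C.dg_category_adjoin)
  interpret P: dg_category k "path_object D" by (rule D.dg_category_path)
  let ?P = "path_object D" and ?K = "constant_path D F"
  note K = D.id_functor_constant_path[OF F]
  note ps = D.id_functor_path_source and pt = D.id_functor_path_target
  have proj: "amap ?P path_source (term_eval C ?P ?K \<gamma> t) = term_eval C D F (\<lambda>g. amap ?P path_source (\<gamma> g)) t \<and>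
      amap ?P path_target (term_eval C ?P ?K \<gamma> t) = term_eval C D F (\<lambda>g. amap ?P path_target (\<gamma> g)) t"
    if "has_type k C G t X Y n" for t X Y n
    using that
  proof (induction rule: has_type.induct)
    case (Base X Y f n)
    then have "arr C X Y n f \<in> arrows C X Y n" by auto
    then show ?case by (simp add: D.amap_constant_path[OF F])
  qed (simp_all add: amap_laws[OF ps] amap_laws[OF pt])
  have "c \<in> carrier (adjoin_hom k C G X Y n)" using c by (simp add: cycles_def)
  then obtain t where t: "has_type k C G t X Y n" "c = term_class k C G X Y n t"
    by (rule C.in_AdjE)
  let ?q = "term_eval C ?P ?K \<gamma> t"
  have q: "?q \<in> arrows ?P X Y n" by (rule C.ev_in_hom[OF K \<gamma> t(1)])
  have e1: "arr D X Y n (on_mor E1 X Y n c) = amap ?P path_source ?q"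
    and e2: "arr D X Y n (on_mor E2 X Y n c) = amap ?P path_target ?q"
    using proj[OF t(1)] C.functor_on_terms[OF E1 F base1 gen1 t(1)]
      C.functor_on_terms[OF E2 F base2 gen2 t(1)] t(2) by simp_all
  have XY': "X \<in> Obj D" "Y \<in> Obj D" using XY id_functorD(3)[OF F] by auto
  have Ac: "c \<in> carrier (Hom (adjoin k C G) X Y n)" using c by (simp add: cycles_def)
  have XYA: "X \<in> Obj (adjoin k C G)" "Y \<in> Obj (adjoin k C G)" using XY by simp_all
  have "adif ?P ?q = azero ?P X Y (n - 1)"
  proof -
    note X = C.id_functor_extension[OF K \<gamma>]
    have "?q = amap (adjoin k C G) (adjoin_extension C ?P ?K \<gamma>) (arr (adjoin k C G) X Y n c)"
      using C.arr_extension_cls[OF K \<gamma> t(1)] amap_arr[OF X XYA Ac] t(2) by simp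
    moreover have "adif (adjoin k C G) (arr (adjoin k C G) X Y n c) = azero (adjoin k C G) X Y (n - 1)"
      using c A.cycles_iff[OF XYA] by simp
    ultimately show ?thesis
      using amap_laws(5)[OF X, of "arr (adjoin k C G) X Y n c"] amap_laws(8)[OF X XYA] by simp
  qed
  moreover have "path_homotopy D (azero ?P X Y (n - 1)) = azero D X Y n"
  proof -
    have "azero ?P X Y (n - 1) = Some (X, Y, n - 1, \<zero>\<^bsub>path_hom D X Y (n - 1)\<^esub>)"
      using XY' D.path_zero(1)[OF XY'] by (simp add: azero_def arr_def)
    then show ?thesis using XY' by (simp add: D.path_arrow_projections D.path_zero)
  qed
  ultimately have h: "aadd D (aadd D (amap ?P path_source ?q) (aneg D (amap ?P path_target ?q)))
      (aneg D (adif D (path_homotopy D ?q))) = azero D X Y n"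
    using D.path_homotopy_ops(1)[OF q] by simp
  have T: "amap ?P path_source ?q \<in> arrows D X Y n" "amap ?P path_target ?q \<in> arrows D X Y n"
    "path_homotopy D ?q \<in> arrows D X Y (n + 1)"
    using amap_in_hom[OF ps q] amap_in_hom[OF pt q] D.path_homotopy_in_hom[OF q] by auto
  have d: "adif D (path_homotopy D ?q) \<in> arrows D X Y n" using T(3) by auto
  have "aadd D (amap ?P path_source ?q) (aneg D (amap ?P path_target ?q)) =
      aadd D (azero D X Y n) (adif D (path_homotopy D ?q))"
    using h T d XY' by (intro D.eq_diff_iff[THEN iffD1, of _ X Y n]) auto
  then have "amap ?P path_source ?q =
      aadd D (aadd D (azero D X Y n) (adif D (path_homotopy D ?q))) (amap ?P path_target ?q)"
    using T d XY' D.add_neg[OF d] by (intro D.eq_diff_iff[THEN iffD1, of _ X Y n]) auto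
  then have "amap ?P path_source ?q = aadd D (adif D (path_homotopy D ?q)) (amap ?P path_target ?q)"
    using d by simp
  then have "arr D X Y n (on_mor E1 X Y n c) =
      aadd D (adif D (path_homotopy D ?q)) (arr D X Y n (on_mor E2 X Y n c))"
    by (simp only: e1 e2)
  then show ?thesis
    using id_functor_closed[OF E1 XYA Ac] id_functor_closed[OF E2 XYA Ac]
    by (intro D.hclass_eqI[OF XY' _ _ T(3)])
qed

section \<open>Triangles with contracting homotopies\<close>

text \<open>For closed \<open>x\<close>, \<open>v\<close>, \<open>s\<close> of degrees \<open>i\<close>, \<open>j\<close>, \<open>l\<close> the homotopies \<open>h\<close>, \<open>g\<close>, \<open>t\<close> make each
  twofold composite null. Then \<open>s h\<close> and \<open>g x\<close> are two null homotopies of \<open>s v x\<close> up to sign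
  and combine to a closed endomorphism of \<open>A\<close>, and similarly at \<open>B\<close> and \<open>C\<close>; the last three
  equations say that these endomorphisms are \<open>\<plusminus>1\<close> up to homotopy.

  The degrees vary, with sum \<open>-1\<close>, because \<open>\<Sigma>A\<close> is represented by the object \<open>S A\<close> in one of
  the two equivalences and by a shift in degree of \<open>A\<close> in the other. The signs \<open>(-1)\<^sup>p\<close>,
  \<open>(-1)\<^sup>q\<close>, \<open>(-1)\<^sup>r\<close> vary because a change of vertex of odd degree reverses one of them.\<close>

definition contracted_triangle where
  "contracted_triangle D = (\<lambda>(A, B, C) (i, j, l) (x, v, s) (h, g, t) (\<alpha>, \<beta>, \<gamma>) (p, q, r).
     i + j + l = - 1 \<and>
     x \<in> arrows D A B i \<and> v \<in> arrows D B C j \<and> s \<in> arrows D C A l \<and>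
     h \<in> arrows D A C (- l) \<and> g \<in> arrows D B A (- i) \<and> t \<in> arrows D C B (- j) \<and>
     \<alpha> \<in> arrows D A A 1 \<and> \<beta> \<in> arrows D B B 1 \<and> \<gamma> \<in> arrows D C C 1 \<and>
     adif D x = azero D A B (i - 1) \<and> adif D v = azero D B C (j - 1) \<and> adif D s = azero D C A (l - 1) \<and>
     adif D h = acmp D v x \<and> adif D g = acmp D s v \<and> adif D t = acmp D x s \<and>
     aadd D (acmp D s h) (sgn_arrow D (l + 1) (acmp D g x)) =
       aadd D (sgn_arrow D p (aidt D A)) (adif D \<alpha>) \<and>
     aadd D (acmp D x g) (sgn_arrow D (i + 1) (acmp D t v)) =
       aadd D (sgn_arrow D q (aidt D B)) (adif D \<beta>) \<and>
     aadd D (acmp D v t) (sgn_arrow D (j + 1) (acmp D h s)) =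
       aadd D (sgn_arrow D r (aidt D C)) (adif D \<gamma>))"

definition contractible_triangle where
  "contractible_triangle D V d f \<longleftrightarrow> (\<exists>H K P. contracted_triangle D V d f H K (P :: int \<times> int \<times> int))"

text \<open>The data are equations between composites, sums and differentials, so every dg functor
  preserves them.\<close>

lemma contracted_triangle_functor:
  assumes F: "id_functor k C D F"
    and T: "contracted_triangle C V d (x, v, s) (h, g, t) (\<alpha>, \<beta>, \<gamma>) P"
  shows "contracted_triangle D V d (amap C F x, amap C F v, amap C F s) (amap C F h, amap C F g, amap C F t)
    (amap C F \<alpha>, amap C F \<beta>, amap C F \<gamma>) P"
proof -
  interpret C: dg_category k C using id_functorD(1)[OF F] .
  obtain X Y Z i j l p q r where V: "V = (X, Y, Z)" "d = (i, j, l)" "P = (p, q, r)"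
    by (cases V, cases d, cases P)
  have obj: "X \<in> Obj C" "Y \<in> Obj C" "Z \<in> Obj C"
    using T by (auto simp: V contracted_triangle_def dest: C.in_hom_Obj)
  note [simp] = amap_in_hom[OF F]
  have eqs: "amap C F a = amap C F b" if "a = b" for a b using that by simp
  from T show ?thesis
    unfolding V contracted_triangle_def
    by (auto simp: amap_laws[OF F] obj simp flip: amap_laws(2,5)[OF F] dest!: eqs)
qed

context dg_category
begin

text \<open>The Leibniz rule with a closed factor loses one term. The other factor may be undefined or
  not composable, so these are unconditional rewrite rules for it.\<close>

lemma dif_closed_left:
  assumes "x \<in> hom Y Z m" "\<delta> x = \<o> Y Z p"
  shows "\<delta> (x \<cdot> b) = \<epsilon> m (x \<cdot> \<delta> b)"
proof (cases b rule: arrow_cases)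
  case undef
  then show ?thesis by (simp add: leibniz_arrow[OF assms(1)] acmp_def adif_def aadd_def sgn_arrow_def aneg_def
        split: option.splits)
next
  case (def X Y' n f)
  then have b: "b \<in> hom X Y' n" by (simp add: arrows_def)
  show ?thesis
  proof (cases "Y' = Y")
    case True
    with b assms(1) have "x \<cdot> b \<in> hom X Z (m + n)" by auto
    have p: "p = m - 1"
      using assms(2) dif_in_hom[OF assms(1), of "m - 1"] in_hom_Obj[OF assms(1)]
      by (auto simp: arrows_def azero_def arr_def split: if_splits)
    have "x \<cdot> \<delta> b \<in> hom X Z (m + n - 1)" using True b assms(1) by (auto intro!: cmp_in_hom[OF assms(1)])
    then have "\<epsilon> m (x \<cdot> \<delta> b) \<in> hom X Z (m + n - 1)" by auto
    then show ?thesis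
      using comp_zero_left[of b X Y n Z p] b in_hom_Obj[OF assms(1)] True
      by (simp add: leibniz_arrow[OF assms(1)] assms(2) p diff_add_eq)
  next
    case False
    then show ?thesis using b assms(1)
      by (auto simp: acmp_def adif_def sgn_arrow_def aneg_def chk_def arr_def arrows_def)
  qed
qed

lemma dif_closed_right:
  assumes "x \<in> hom X Y n" "\<delta> x = \<o> X Y p"
  shows "\<delta> (b \<cdot> x) = \<delta> b \<cdot> x"
proof (cases b rule: arrow_cases)
  case undef
  then show ?thesis by (simp add: acmp_def adif_def)
next
  case (def Y' Z m f)
  then have b: "b \<in> hom Y' Z m" by (simp add: arrows_def)
  show ?thesis
  proof (cases "Y' = Y")
    case True
    have p: "p = n - 1"
      using assms(2) dif_in_hom[OF assms(1), of "n - 1"] in_hom_Obj[OF assms(1)]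
      by (auto simp: arrows_def azero_def arr_def split: if_splits)
    have "\<delta> b \<in> hom Y Z (m - 1)" using True b by auto
    then have "\<delta> b \<cdot> x \<in> hom X Z (m + n - 1)" using assms(1) by (auto intro!: cmp_in_hom[OF _ assms(1)])
    then show ?thesis
      using comp_zero_right[of b Y Z m X p] b in_hom_Obj[OF assms(1)] True
      by (simp add: leibniz_arrow[OF b] assms(2) p add_diff_eq)
  next
    case False
    then show ?thesis using b assms(1)
      by (auto simp: acmp_def adif_def chk_def arr_def arrows_def)
  qed
qed

lemma cmp_typed: "b \<in> hom Y Z m \<Longrightarrow> a \<in> hom X Y n \<Longrightarrow> b \<cdot> a \<in> hom X Z (m + n)"
  by (rule cmp_in_hom) simp_all

text \<open>The definition is symmetric under rotation; so vertices and edges need to be replaced in one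
  position only.\<close>

lemma contractible_triangle_rotate:
  assumes "contractible_triangle \<C> (A, B, C) (i, j, l) (x, v, s)"
  shows "contractible_triangle \<C> (B, C, A) (j, l, i) (v, s, x)"
proof -
  obtain h g t \<alpha> \<beta> \<gamma> p q r where
    "contracted_triangle \<C> (A, B, C) (i, j, l) (x, v, s) (h, g, t) (\<alpha>, \<beta>, \<gamma>) (p, q, r)"
    using assms unfolding contractible_triangle_def by (metis prod_cases3)
  then have "contracted_triangle \<C> (B, C, A) (j, l, i) (v, s, x) (g, t, h) (\<beta>, \<gamma>, \<alpha>) (q, r, p)"
    unfolding contracted_triangle_def by auto
  then show ?thesis unfolding contractible_triangle_def by blast
qed

text \<open>Replace \<open>A\<close> by a homotopy equivalent \<open>A\<^sub>1\<close>. Composition with \<open>a\<close> and \<open>a'\<close> gives the new \<open>h\<close>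
  and \<open>g\<close>, but \<open>(x a) (a' s) = x s + x (d \<nu>) s\<close>, so \<open>t\<close> has to be corrected by \<open>x \<nu> s\<close>. The
  same correction, composed with \<open>g\<close> and \<open>h\<close>, enters the homotopies at \<open>B\<close> and \<open>C\<close>.\<close>

lemma contractible_triangle_vertex:
  assumes "contractible_triangle \<C> (A, B, C) (i, j, l) (x, v, s)"
    and a: "a \<in> hom A1 A m" "\<delta> a = \<o> A1 A (m - 1)"
    and a': "a' \<in> hom A A1 (- m)" "\<delta> a' = \<o> A A1 (- m - 1)"
    and \<mu>: "\<mu> \<in> hom A1 A1 1" "a' \<cdot> a = \<i> A1 \<uplus> \<delta> \<mu>"
    and \<nu>: "\<nu> \<in> hom A A 1" "a \<cdot> a' = \<i> A \<uplus> \<delta> \<nu>"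
  shows "contractible_triangle \<C> (A1, B, C) (i + m, j, l - m) (x \<cdot> a, v, a' \<cdot> s)"
proof -
  obtain h g t \<alpha> \<beta> \<gamma> p q r where T:
    "contracted_triangle \<C> (A, B, C) (i, j, l) (x, v, s) (h, g, t) (\<alpha>, \<beta>, \<gamma>) (p, q, r)"
    using assms(1) unfolding contractible_triangle_def by (metis prod_cases3)
  then have ijl: "i + j + l = - 1"
    and x: "x \<in> hom A B i" "\<delta> x = \<o> A B (i - 1)" and v: "v \<in> hom B C j" "\<delta> v = \<o> B C (j - 1)"
    and s: "s \<in> hom C A l" "\<delta> s = \<o> C A (l - 1)"
    and h: "h \<in> hom A C (- l)" "\<delta> h = v \<cdot> x" and g: "g \<in> hom B A (- i)" "\<delta> g = s \<cdot> v"
    and \<tau>: "t \<in> hom C B (- j)" "\<delta> t = x \<cdot> s"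
    and \<alpha>: "\<alpha> \<in> hom A A 1" and \<beta>: "\<beta> \<in> hom B B 1" and \<gamma>: "\<gamma> \<in> hom C C 1"
    and eqA: "s \<cdot> h \<uplus> \<epsilon> (l + 1) (g \<cdot> x) = \<epsilon> p (\<i> A) \<uplus> \<delta> \<alpha>"
    and eqB: "x \<cdot> g \<uplus> \<epsilon> (i + 1) (t \<cdot> v) = \<epsilon> q (\<i> B) \<uplus> \<delta> \<beta>"
    and eqC: "v \<cdot> t \<uplus> \<epsilon> (j + 1) (h \<cdot> s) = \<epsilon> r (\<i> C) \<uplus> \<delta> \<gamma>"
    unfolding contracted_triangle_def by auto
  note closed = dif_closed_left[OF x] dif_closed_left[OF s] dif_closed_left[OF v]
    dif_closed_left[OF a] dif_closed_left[OF a']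
    dif_closed_right[OF a] dif_closed_right[OF s] 
  note ops = comp_assoc closed leibniz_arrow[OF \<nu>(1)] leibniz_arrow[OF h(1)] h(2) g(2) \<tau>(2)
  have A1: "A1 \<in> Obj \<C>" using a in_hom_Obj by blast
  have aa': "a \<cdot> a' \<cdot> b = \<i> A \<cdot> b \<uplus> \<delta> \<nu> \<cdot> b" for b
    using \<nu>(2) by (simp flip: comp_assoc)
  have l: "l = - 1 - i - j" using ijl by simp
  let ?g = "\<epsilon> m (a' \<cdot> g)" and ?t = "t \<uplus> \<epsilon> i (x \<cdot> \<nu> \<cdot> s)" and ?h = "h \<cdot> a"
  let ?\<alpha> = "\<epsilon> p \<mu> \<uplus> \<epsilon> m (a' \<cdot> \<alpha> \<cdot> a)" and ?\<beta> = "\<epsilon> m (\<beta> \<uplus> \<epsilon> i (x \<cdot> \<nu> \<cdot> g))"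
    and ?\<gamma> = "\<gamma> \<uplus> \<epsilon> i (h \<cdot> \<nu> \<cdot> s)"
  have ty: "x \<cdot> a \<in> hom A1 B (i + m)" "a' \<cdot> s \<in> hom C A1 (l - m)" "?h \<in> hom A1 C (- (l - m))"
    "?g \<in> hom B A1 (- (i + m))" "?t \<in> hom C B (- j)" "?\<alpha> \<in> hom A1 A1 1" "?\<beta> \<in> hom B B 1" "?\<gamma> \<in> hom C C 1"
  proof -
    have 1: "\<nu> \<cdot> s \<in> hom C A (1 + l)" "\<nu> \<cdot> g \<in> hom B A (1 + - i)" "\<alpha> \<cdot> a \<in> hom A1 A (1 + m)"
      using cmp_typed[OF \<nu>(1) s(1)] cmp_typed[OF \<nu>(1) g(1)] cmp_typed[OF \<alpha> a(1)] by auto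
    show "x \<cdot> a \<in> hom A1 B (i + m)" "a' \<cdot> s \<in> hom C A1 (l - m)" "?h \<in> hom A1 C (- (l - m))"
      "?g \<in> hom B A1 (- (i + m))" "?t \<in> hom C B (- j)" "?\<alpha> \<in> hom A1 A1 1" "?\<beta> \<in> hom B B 1" "?\<gamma> \<in> hom C C 1"
      using \<beta> \<gamma> \<mu>(1) \<tau>(1) l
      by (auto intro!: add_in_hom sgn_in_hom cmp_in_hom[OF x(1) a(1)] cmp_in_hom[OF a'(1) s(1)]
          cmp_in_hom[OF h(1) a(1)] cmp_in_hom[OF a'(1) g(1)] cmp_in_hom[OF x(1) 1(1)]
          cmp_in_hom[OF a'(1) 1(3)] cmp_in_hom[OF x(1) 1(2)] cmp_in_hom[OF h(1) 1(1)])
  qed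
  have cl: "\<delta> (x \<cdot> a) = \<o> A1 B (i + m - 1)" "\<delta> (a' \<cdot> s) = \<o> C A1 (l - m - 1)"
    using comp_zero_left[OF a(1), of B "i - 1"] comp_zero_left[OF s(1) A1, of "- m - 1"]
      in_hom_Obj[OF x(1)] a'(2) x(2)
    by (simp_all add: dif_closed_right[OF a] dif_closed_right[OF s] algebra_simps)
  have hgt: "\<delta> ?h = v \<cdot> x \<cdot> a" "\<delta> ?g = (a' \<cdot> s) \<cdot> v" "\<delta> ?t = (x \<cdot> a) \<cdot> a' \<cdot> s"
    by (simp_all add: ops aa' comp_idt_left[OF s(1)])
  have A: "(a' \<cdot> s) \<cdot> ?h \<uplus> \<epsilon> (l - m + 1) (?g \<cdot> x \<cdot> a) = \<epsilon> p (\<i> A1) \<uplus> \<delta> ?\<alpha>"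
  proof -
    have "(a' \<cdot> s) \<cdot> ?h \<uplus> \<epsilon> (l - m + 1) (?g \<cdot> x \<cdot> a) = a' \<cdot> (s \<cdot> h \<uplus> \<epsilon> (l + 1) (g \<cdot> x)) \<cdot> a"
      by (cases "even l"; cases "even m"; simp add: comp_assoc)
    also have "\<dots> = a' \<cdot> (\<epsilon> p (\<i> A) \<uplus> \<delta> \<alpha>) \<cdot> a" by (simp only: eqA)
    also have "\<dots> = \<epsilon> p (a' \<cdot> a) \<uplus> a' \<cdot> \<delta> \<alpha> \<cdot> a" by (simp add: comp_idt_left[OF a(1)])
    also have "\<dots> = \<epsilon> p (\<i> A1) \<uplus> \<delta> ?\<alpha>"
      by (cases "even m"; simp add: \<mu> ops add_ac)
    finally show ?thesis .
  qed
  have B: "(x \<cdot> a) \<cdot> ?g \<uplus> \<epsilon> (i + m + 1) (?t \<cdot> v) = \<epsilon> (m + q) (\<i> B) \<uplus> \<delta> ?\<beta>"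
  proof -
    let ?R = "\<epsilon> m (x \<cdot> \<delta> \<nu> \<cdot> g \<uplus> \<sim> (x \<cdot> \<nu> \<cdot> s \<cdot> v))"
    have "(x \<cdot> a) \<cdot> ?g \<uplus> \<epsilon> (i + m + 1) (?t \<cdot> v) = \<epsilon> m (x \<cdot> g \<uplus> \<epsilon> (i + 1) (t \<cdot> v)) \<uplus> ?R"
      by (cases "even i"; cases "even m"; simp add: comp_assoc aa' comp_idt_left[OF g(1)] add_ac)
    also have "\<dots> = \<epsilon> m (\<epsilon> q (\<i> B) \<uplus> \<delta> \<beta>) \<uplus> ?R" by (simp only: eqB)
    also have "\<dots> = \<epsilon> (m + q) (\<i> B) \<uplus> \<delta> ?\<beta>"
      by (cases "even i"; cases "even m"; simp add: ops add_ac)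
    finally show ?thesis .
  qed
  have C: "v \<cdot> ?t \<uplus> \<epsilon> (j + 1) (?h \<cdot> a' \<cdot> s) = \<epsilon> r (\<i> C) \<uplus> \<delta> ?\<gamma>"
  proof -
    let ?R = "\<epsilon> i (v \<cdot> x \<cdot> \<nu> \<cdot> s) \<uplus> \<epsilon> (j + 1) (h \<cdot> \<delta> \<nu> \<cdot> s)"
    have "v \<cdot> ?t \<uplus> \<epsilon> (j + 1) (?h \<cdot> a' \<cdot> s) = (v \<cdot> t \<uplus> \<epsilon> (j + 1) (h \<cdot> s)) \<uplus> ?R"
      by (simp add: comp_assoc aa' comp_idt_left[OF s(1)] add_ac)
    also have "\<dots> = (\<epsilon> r (\<i> C) \<uplus> \<delta> \<gamma>) \<uplus> ?R" by (simp only: eqC)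
    also have "\<dots> = \<epsilon> r (\<i> C) \<uplus> \<delta> ?\<gamma>"
      by (cases "even i"; cases "even j"; simp add: ops add_ac l)
    finally show ?thesis .
  qed
  have "contracted_triangle \<C> (A1, B, C) (i + m, j, l - m) (x \<cdot> a, v, a' \<cdot> s) (?h, ?g, ?t)
      (?\<alpha>, ?\<beta>, ?\<gamma>) (p, m + q, r)"
    unfolding contracted_triangle_def using ty cl hgt A B C v ijl by simp
  then show ?thesis unfolding contractible_triangle_def by blast
qed

text \<open>If \<open>x\<close> changes by \<open>d y\<close>, then \<open>h\<close> and \<open>t\<close> change by \<open>v y\<close> and \<open>y s\<close> up to sign. In the
  relations at \<open>A\<close> and \<open>B\<close> the new terms add up to the boundaries of \<open>g y\<close> and \<open>y g\<close>; at \<open>C\<close>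
  the two terms \<open>v y s\<close> cancel.\<close>

lemma contractible_triangle_edge:
  assumes "contractible_triangle \<C> (A, B, C) (i, j, l) (x, v, s)"
    and y: "y \<in> hom A B (i + 1)" and x': "x' = x \<uplus> \<delta> y"
  shows "contractible_triangle \<C> (A, B, C) (i, j, l) (x', v, s)"
proof -
  obtain h g t \<alpha> \<beta> \<gamma> p q r where T:
    "contracted_triangle \<C> (A, B, C) (i, j, l) (x, v, s) (h, g, t) (\<alpha>, \<beta>, \<gamma>) (p, q, r)"
    using assms(1) unfolding contractible_triangle_def by (metis prod_cases3)
  then have ijl: "i + j + l = - 1"
    and x: "x \<in> hom A B i" "\<delta> x = \<o> A B (i - 1)" and v: "v \<in> hom B C j" "\<delta> v = \<o> B C (j - 1)"
    and s: "s \<in> hom C A l" "\<delta> s = \<o> C A (l - 1)"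
    and h: "h \<in> hom A C (- l)" "\<delta> h = v \<cdot> x" and g: "g \<in> hom B A (- i)" "\<delta> g = s \<cdot> v"
    and \<tau>: "t \<in> hom C B (- j)" "\<delta> t = x \<cdot> s"
    and \<alpha>: "\<alpha> \<in> hom A A 1" and \<beta>: "\<beta> \<in> hom B B 1" and \<gamma>: "\<gamma> \<in> hom C C 1"
    and eqA: "s \<cdot> h \<uplus> \<epsilon> (l + 1) (g \<cdot> x) = \<epsilon> p (\<i> A) \<uplus> \<delta> \<alpha>"
    and eqB: "x \<cdot> g \<uplus> \<epsilon> (i + 1) (t \<cdot> v) = \<epsilon> q (\<i> B) \<uplus> \<delta> \<beta>"
    and eqC: "v \<cdot> t \<uplus> \<epsilon> (j + 1) (h \<cdot> s) = \<epsilon> r (\<i> C) \<uplus> \<delta> \<gamma>"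
    unfolding contracted_triangle_def by auto
  note ops = comp_assoc dif_closed_left[OF v] dif_closed_right[OF s] leibniz_arrow[OF g(1)]
    leibniz_arrow[OF y] h(2) g(2) \<tau>(2)
  have l: "l = - 1 - i - j" using ijl by simp
  let ?h = "h \<uplus> \<epsilon> j (v \<cdot> y)" and ?t = "t \<uplus> y \<cdot> s"
  let ?\<alpha> = "\<alpha> \<uplus> \<epsilon> j (g \<cdot> y)" and ?\<beta> = "\<beta> \<uplus> y \<cdot> g"
  have ty: "x' \<in> hom A B i" "?h \<in> hom A C (- l)" "?t \<in> hom C B (- j)" "?\<alpha> \<in> hom A A 1" "?\<beta> \<in> hom B B 1"
    using x y h(1) \<tau>(1) \<alpha> \<beta> l unfolding x'
    by (auto intro!: add_in_hom sgn_in_hom cmp_in_hom[OF v(1) y] cmp_in_hom[OF y s(1)]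
        cmp_in_hom[OF g(1) y] cmp_in_hom[OF y g(1)])
  have cl: "\<delta> x' = \<o> A B (i - 1)"
    using x(2) dif_dif_arrow[OF y, of "i - 1"] zero_in_hom[OF in_hom_Obj[OF x(1)]] unfolding x' by simp
  have ht: "\<delta> ?h = v \<cdot> x'" "\<delta> ?t = x' \<cdot> s"
    unfolding x' by (cases "even j"; simp add: ops)+
  have A: "s \<cdot> ?h \<uplus> \<epsilon> (l + 1) (g \<cdot> x') = \<epsilon> p (\<i> A) \<uplus> \<delta> ?\<alpha>"
  proof -
    have "s \<cdot> ?h \<uplus> \<epsilon> (l + 1) (g \<cdot> x') = (s \<cdot> h \<uplus> \<epsilon> (l + 1) (g \<cdot> x)) \<uplus> \<epsilon> j (\<delta> (g \<cdot> y))"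
      unfolding x' by (cases "even i"; cases "even j"; simp add: ops add_ac l)
    then show ?thesis by (simp add: eqA add_ac)
  qed
  have B: "x' \<cdot> g \<uplus> \<epsilon> (i + 1) (?t \<cdot> v) = \<epsilon> q (\<i> B) \<uplus> \<delta> ?\<beta>"
  proof -
    have "x' \<cdot> g \<uplus> \<epsilon> (i + 1) (?t \<cdot> v) = (x \<cdot> g \<uplus> \<epsilon> (i + 1) (t \<cdot> v)) \<uplus> \<delta> (y \<cdot> g)"
      unfolding x' by (simp add: ops add_ac)
    then show ?thesis by (simp add: eqB add_ac)
  qed
  have C: "v \<cdot> ?t \<uplus> \<epsilon> (j + 1) (?h \<cdot> s) = \<epsilon> r (\<i> C) \<uplus> \<delta> \<gamma>"
  proof -
    have vys: "v \<cdot> y \<cdot> s \<in> hom C C 0" using cmp_typed[OF v(1) cmp_typed[OF y s(1)]] by (simp add: l)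
    have "v \<cdot> ?t \<uplus> \<epsilon> (j + 1) (?h \<cdot> s) =
        (v \<cdot> t \<uplus> \<epsilon> (j + 1) (h \<cdot> s)) \<uplus> (v \<cdot> y \<cdot> s \<uplus> \<sim> (v \<cdot> y \<cdot> s))"
      by (cases "even j"; simp add: comp_assoc add_ac)
    also have "\<dots> = (\<epsilon> r (\<i> C) \<uplus> \<delta> \<gamma>) \<uplus> \<o> C C 0" using eqC add_neg[OF vys] by simp
    also have "\<dots> = \<epsilon> r (\<i> C) \<uplus> \<delta> \<gamma>"
      using in_hom_Obj[OF v(1)]
      by (intro add_zero(1) add_in_hom sgn_in_hom idt_in_hom dif_in_hom[OF \<gamma>]) auto
    finally show ?thesis .
  qed
  have "contracted_triangle \<C> (A, B, C) (i, j, l) (x', v, s) (?h, g, ?t) (?\<alpha>, ?\<beta>, \<gamma>) (p, q, r)"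
    unfolding contracted_triangle_def using ty cl ht A B C v s g \<gamma> ijl by simp
  then show ?thesis unfolding contractible_triangle_def by blast
qed

subsection \<open>Null homotopies and one-sided inverses\<close>

lemma sum_move:
  assumes "a \<uplus> b = c" "a \<in> hom X Y n" "b \<in> hom X Y n"
  shows "a = c \<uplus> \<sim> b"
proof -
  have "c \<uplus> \<sim> b = a \<uplus> (b \<uplus> \<sim> b)" by (simp only: assms(1)[symmetric] add_assoc)
  also have "\<dots> = a" using add_neg[OF assms(3)] assms(2) by simp
  finally show ?thesis ..
qed

lemma sum_move_neg:
  assumes "a \<uplus> \<sim> b = c" "a \<in> hom X Y n" "b \<in> hom X Y n"
  shows "a = c \<uplus> b"
  using sum_move[OF assms(1,2) neg_in_hom[OF assms(3)]] assms(3) by (simp add: in_hom_chk)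

text \<open>From \<open>d w = v\<close> it follows that \<open>g + s w\<close> is closed, and the relation at \<open>B\<close>,
  \<open>x g - t v = \<plusminus>1 + d \<beta>\<close>, makes \<open>\<beta> + t w\<close> a homotopy from \<open>\<plusminus>1\<close> to \<open>x (g + s w)\<close>. This first
  choice of \<open>(a, b)\<close> may have a null homotopy \<open>h a - v b\<close> other than \<open>w\<close>, but the difference
  \<open>z\<close> is closed. Adding \<open>(\<plusminus>s z, \<plusminus>t z)\<close> to \<open>(a, b)\<close> subtracts \<open>\<plusminus>(v t - h s) z\<close> from the null
  homotopy, which is \<open>z\<close> up to a boundary by the relation at \<open>C\<close>.\<close>

lemma right_inverse_exists:
  assumes T: "contracted_triangle \<C> (A, B, C) (0, 0, - 1) (x, v, s) (h, g, t) (\<alpha>, \<beta>, \<gamma>) (p, q, r)"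
    and w: "w \<in> hom B C 1" "\<delta> w = v"
  obtains a b y where "a \<in> hom B A 0" "\<delta> a = \<o> B A (- 1)" "b \<in> hom B B 1" "\<delta> b = x \<cdot> a \<uplus> \<sim> (\<i> B)"
    "y \<in> hom B C 2" "h \<cdot> a \<uplus> \<sim> (v \<cdot> b) = w \<uplus> \<delta> y"
proof -
  from T have x: "x \<in> hom A B 0" "\<delta> x = \<o> A B (- 1)" and v: "v \<in> hom B C 0" "\<delta> v = \<o> B C (- 1)"
    and s: "s \<in> hom C A (- 1)" "\<delta> s = \<o> C A (- 2)"
    and h: "h \<in> hom A C 1" "\<delta> h = v \<cdot> x" and g: "g \<in> hom B A 0" "\<delta> g = s \<cdot> v"
    and t: "t \<in> hom C B 0" "\<delta> t = x \<cdot> s"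
    and \<beta>: "\<beta> \<in> hom B B 1" and \<gamma>: "\<gamma> \<in> hom C C 1"
    and eqB: "x \<cdot> g \<uplus> \<sim> (t \<cdot> v) = \<epsilon> q (\<i> B) \<uplus> \<delta> \<beta>"
    and eqC: "v \<cdot> t \<uplus> \<sim> (h \<cdot> s) = \<epsilon> r (\<i> C) \<uplus> \<delta> \<gamma>"
    unfolding contracted_triangle_def by auto
  note [intro] = cmp_in_hom add_in_hom neg_in_hom sgn_in_hom
  have obj: "A \<in> Obj \<C>" "B \<in> Obj \<C>" "C \<in> Obj \<C>" using in_hom_Obj x(1) v(1) by auto
  note closed = dif_closed_left[OF x] dif_closed_left[OF s] dif_closed_left[OF v]
    leibniz_arrow[OF t(1)] leibniz_arrow[OF h(1)] h(2) g(2) t(2) w(2) comp_assoc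
  let ?a = "\<epsilon> q (g \<uplus> s \<cdot> w)" and ?b = "\<epsilon> q (\<beta> \<uplus> t \<cdot> w)"
  have sw: "s \<cdot> w \<in> hom B A 0" and tw: "t \<cdot> w \<in> hom B B 1" and sv: "s \<cdot> v \<in> hom B A (- 1)"
    and tv: "t \<cdot> v \<in> hom B B 0"
    using cmp_typed[OF s(1) w(1)] cmp_typed[OF t(1) w(1)] cmp_typed[OF s(1) v(1)] cmp_typed[OF t(1) v(1)]
    by simp_all
  have a: "?a \<in> hom B A 0" using g sw by auto
  have b: "?b \<in> hom B B 1" using \<beta> tw by auto
  have da: "\<delta> ?a = \<o> B A (- 1)"
  proof -
    have "\<delta> ?a = \<epsilon> q (s \<cdot> v \<uplus> \<sim> (s \<cdot> v))" by (simp add: closed)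
    then show ?thesis unfolding add_neg[OF sv] by simp
  qed
  have db: "\<delta> ?b = x \<cdot> ?a \<uplus> \<sim> (\<i> B)"
  proof -
    have q: "\<epsilon> q (\<i> B) \<in> hom B B 0" "\<delta> \<beta> \<in> hom B B 0" using obj \<beta> by auto
    have "\<delta> \<beta> \<uplus> \<epsilon> q (\<i> B) = x \<cdot> g \<uplus> \<sim> (t \<cdot> v)"
      using eqB by (simp only: add_commute)
    then have "\<delta> \<beta> = x \<cdot> g \<uplus> \<sim> (t \<cdot> v) \<uplus> \<sim> (\<epsilon> q (\<i> B))"
      using q(2,1) by (rule sum_move)
    then have "\<delta> ?b = (x \<cdot> ?a \<uplus> \<sim> (\<i> B)) \<uplus> \<epsilon> q (t \<cdot> v \<uplus> \<sim> (t \<cdot> v))"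
      by (simp add: closed add_ac)
    also have "\<dots> = x \<cdot> ?a \<uplus> \<sim> (\<i> B)"
      unfolding add_neg[OF tv] sgn_zero using cmp_typed[OF x(1) a] obj by (intro add_zero(1)) auto
    finally show ?thesis .
  qed
  (* The difference between the null homotopy of the first choice and \<open>w\<close>. *)
  let ?z = "h \<cdot> ?a \<uplus> \<sim> (v \<cdot> ?b) \<uplus> \<sim> w"
  have ha: "h \<cdot> ?a \<in> hom B C 1" and vb: "v \<cdot> ?b \<in> hom B C 1"
    using cmp_typed[OF h(1) a] cmp_typed[OF v(1) b] by simp_all
  have z: "?z \<in> hom B C 1" by (intro add_in_hom neg_in_hom ha vb w(1))
  have dz: "\<delta> ?z = \<o> B C 0"
  proof -
    have xa: "v \<cdot> x \<cdot> ?a \<in> hom B C 0" using cmp_typed[OF v(1) cmp_typed[OF x(1) a]] by simp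
    have hda: "h \<cdot> \<delta> ?a = \<o> B C 0" unfolding da using comp_zero_right[OF h(1) obj(2), of "- 1"] by simp
    have "\<delta> ?z = (\<delta> (h \<cdot> ?a) \<uplus> \<sim> (\<delta> (v \<cdot> ?b))) \<uplus> \<sim> v" unfolding diff_add diff_neg w(2) ..
    also have "\<delta> (h \<cdot> ?a) = v \<cdot> x \<cdot> ?a"
      unfolding leibniz_arrow[OF h(1)] h(2) hda using xa by (simp only: comp_assoc sgn_zero add_zero)
    also have "\<delta> (v \<cdot> ?b) = v \<cdot> x \<cdot> ?a \<uplus> \<sim> v"
      unfolding dif_closed_left[OF v] db using v(1) by simp
    also have "v \<cdot> x \<cdot> ?a \<uplus> \<sim> (v \<cdot> x \<cdot> ?a \<uplus> \<sim> v) \<uplus> \<sim> v =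
        (v \<cdot> x \<cdot> ?a \<uplus> \<sim> (v \<cdot> x \<cdot> ?a)) \<uplus> (v \<uplus> \<sim> v)"
      unfolding neg_add neg_neg in_hom_chk[OF v(1)] by (simp only: add_ac)
    also have "\<dots> = \<o> B C 0" unfolding add_neg[OF xa] add_neg[OF v(1)] using obj by (intro add_zero(1)) auto
    finally show ?thesis .
  qed
  define z where "z = ?z"
  note z = z[folded z_def] and dz = dz[folded z_def]
  define a1 b1 where "a1 = ?a \<uplus> \<epsilon> r (s \<cdot> z)" and "b1 = ?b \<uplus> \<epsilon> r (t \<cdot> z)"
  have sz: "s \<cdot> z \<in> hom B A 0" and tz: "t \<cdot> z \<in> hom B B 1" and xsz: "x \<cdot> s \<cdot> z \<in> hom B B 0"
    and \<gamma>z: "\<gamma> \<cdot> z \<in> hom B C 2"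
    using cmp_typed[OF s(1) z] cmp_typed[OF t(1) z] cmp_typed[OF x(1) cmp_typed[OF s(1) z]]
      cmp_typed[OF \<gamma> z] by simp_all
  have a1: "a1 \<in> hom B A 0" and b1: "b1 \<in> hom B B 1" unfolding a1_def b1_def using a b sz tz by auto
  have "\<delta> (s \<cdot> z) = \<o> B A (- 1)"
    using comp_zero_right[OF s(1) obj(2), of 0] by (simp add: dif_closed_left[OF s] dz)
  then have da1: "\<delta> a1 = \<o> B A (- 1)"
    unfolding a1_def diff_add[of ?a] da using obj by simp
  have "\<delta> (t \<cdot> z) = x \<cdot> s \<cdot> z"
    using comp_zero_right[OF t(1) obj(2), of 0] xsz by (simp add: leibniz_arrow[OF t(1)] t(2) dz comp_assoc)
  then have db1: "\<delta> b1 = x \<cdot> a1 \<uplus> \<sim> (\<i> B)"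
    unfolding b1_def a1_def diff_add[of ?b] db by (simp add: add_ac)
  have "h \<cdot> a1 \<uplus> \<sim> (v \<cdot> b1) =
      (h \<cdot> ?a \<uplus> \<sim> (v \<cdot> ?b)) \<uplus> \<sim> (\<epsilon> r ((v \<cdot> t \<uplus> \<sim> (h \<cdot> s)) \<cdot> z))"
    unfolding a1_def b1_def comp_add_right neg_add sgn_ops comp_add_left comp_assoc comp_neg_left neg_neg
    by (simp add: add_ac)
  also have "h \<cdot> ?a \<uplus> \<sim> (v \<cdot> ?b) = z \<uplus> w"
    using z_def[symmetric] by (rule sum_move_neg[OF _ add_in_hom[OF ha neg_in_hom[OF vb]] w(1)])
  also have "\<sim> (\<epsilon> r ((v \<cdot> t \<uplus> \<sim> (h \<cdot> s)) \<cdot> z)) = \<sim> z \<uplus> \<delta> (\<sim> (\<epsilon> r (\<gamma> \<cdot> z)))"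
  proof -
    have "\<delta> (\<gamma> \<cdot> z) = \<delta> \<gamma> \<cdot> z"
      using dif_closed_right[OF z dz] .
    then show ?thesis unfolding eqC using z by simp
  qed
  also have "z \<uplus> w \<uplus> (\<sim> z \<uplus> \<delta> (\<sim> (\<epsilon> r (\<gamma> \<cdot> z)))) = (w \<uplus> \<delta> (\<sim> (\<epsilon> r (\<gamma> \<cdot> z)))) \<uplus> (z \<uplus> \<sim> z)"
    by (simp only: add_ac)
  also have "\<dots> = w \<uplus> \<delta> (\<sim> (\<epsilon> r (\<gamma> \<cdot> z)))"
    unfolding add_neg[OF z] using w \<gamma>z dif_in_hom[OF \<gamma>z, of 1] by (intro add_zero(1)) auto
  finally have "h \<cdot> a1 \<uplus> \<sim> (v \<cdot> b1) = w \<uplus> \<delta> (\<sim> (\<epsilon> r (\<gamma> \<cdot> z)))" .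
  moreover have "\<sim> (\<epsilon> r (\<gamma> \<cdot> z)) \<in> hom B C 2" using \<gamma>z by auto
  ultimately show thesis using that a1 da1 b1 db1 by blast
qed

text \<open>Here \<open>(a, b)\<close> is the difference of two homotopy right inverses of \<open>x\<close>, and \<open>y\<close> shows that
  they induce homotopic null homotopies of \<open>v\<close>. By the relation at \<open>A\<close>, \<open>\<plusminus>a\<close> is homotopic to
  \<open>s h a + g x a\<close>, where \<open>h a = v b + d y\<close> and \<open>x a = d b\<close>; so \<open>a\<close> is a boundary \<open>d z\<close>. What
  is left of \<open>b\<close> is the cycle \<open>c = b - x z\<close>, and \<open>v c\<close> is a boundary. The relation at \<open>B\<close> then
  shows that \<open>c\<close> factors through \<open>x\<close> up to a boundary.\<close>

lemma right_inverse_unique: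
  assumes T: "contracted_triangle \<C> (A, B, C) (0, 0, - 1) (x, v, s) (h, g, t) (\<alpha>, \<beta>, \<gamma>) (p, q, r)"
    and a: "a \<in> hom B A 0" "\<delta> a = \<o> B A (- 1)" and b: "b \<in> hom B B 1" "\<delta> b = x \<cdot> a"
    and y: "y \<in> hom B C 2" "h \<cdot> a \<uplus> \<sim> (v \<cdot> b) = \<delta> y"
  obtains z y' where "z \<in> hom B A 1" "\<delta> z = a" "y' \<in> hom B B 2" "b = x \<cdot> z \<uplus> \<delta> y'"
proof -
  from T have x: "x \<in> hom A B 0" "\<delta> x = \<o> A B (- 1)" and v: "v \<in> hom B C 0" "\<delta> v = \<o> B C (- 1)"
    and s: "s \<in> hom C A (- 1)" "\<delta> s = \<o> C A (- 2)"
    and h: "h \<in> hom A C 1" "\<delta> h = v \<cdot> x" and g: "g \<in> hom B A 0" "\<delta> g = s \<cdot> v"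
    and t: "t \<in> hom C B 0" "\<delta> t = x \<cdot> s"
    and \<alpha>: "\<alpha> \<in> hom A A 1" and \<beta>: "\<beta> \<in> hom B B 1"
    and eqA: "s \<cdot> h \<uplus> g \<cdot> x = \<epsilon> p (\<i> A) \<uplus> \<delta> \<alpha>"
    and eqB: "x \<cdot> g \<uplus> \<sim> (t \<cdot> v) = \<epsilon> q (\<i> B) \<uplus> \<delta> \<beta>"
    unfolding contracted_triangle_def by auto
  have obj: "A \<in> Obj \<C>" "B \<in> Obj \<C>" "C \<in> Obj \<C>" using in_hom_Obj x(1) v(1) by auto
  have ty: "h \<cdot> a \<in> hom B C 1" "v \<cdot> b \<in> hom B C 1" "s \<cdot> y \<in> hom B A 1" "g \<cdot> b \<in> hom B A 1"
    "\<alpha> \<cdot> a \<in> hom B A 1" "\<delta> y \<in> hom B C 1"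
    using cmp_typed[OF h(1) a(1)] cmp_typed[OF v(1) b(1)] cmp_typed[OF s(1) y(1)] cmp_typed[OF g(1) b(1)]
      cmp_typed[OF \<alpha> a(1)] dif_in_hom[OF y(1), of 1] by simp_all
  have ha: "h \<cdot> a = \<delta> y \<uplus> v \<cdot> b"
    using sum_move_neg[OF y(2) ty(1,2)] .
  (* Collects the homotopies in the computation of \<open>\<plusminus>a\<close> from the relation at \<open>A\<close>. *)
  define z where "z = \<epsilon> p (\<sim> (s \<cdot> y) \<uplus> g \<cdot> b \<uplus> \<sim> (\<alpha> \<cdot> a))"
  have z: "z \<in> hom B A 1" unfolding z_def using ty by auto
  have dz: "\<delta> z = a"
  proof -
    have "\<epsilon> p a \<uplus> \<delta> (\<alpha> \<cdot> a) = (\<epsilon> p (\<i> A) \<uplus> \<delta> \<alpha>) \<cdot> a"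
      using dif_closed_right[OF a] a(1) by simp
    also have "\<dots> = s \<cdot> h \<cdot> a \<uplus> g \<cdot> x \<cdot> a" unfolding eqA[symmetric] by (simp add: comp_assoc)
    also have "\<dots> = s \<cdot> \<delta> y \<uplus> s \<cdot> v \<cdot> b \<uplus> g \<cdot> \<delta> b" unfolding ha b(2) by simp
    also have "\<dots> = \<delta> (\<sim> (s \<cdot> y) \<uplus> g \<cdot> b)"
      by (simp add: dif_closed_left[OF s] leibniz_arrow[OF g(1)] g(2) comp_assoc add_ac)
    finally have "\<epsilon> p a \<uplus> \<delta> (\<alpha> \<cdot> a) = \<delta> (\<sim> (s \<cdot> y) \<uplus> g \<cdot> b)" .
    moreover have "\<epsilon> p a \<in> hom B A 0" "\<delta> (\<alpha> \<cdot> a) \<in> hom B A 0" using a(1) ty(5) by auto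
    ultimately have "\<epsilon> p a = \<delta> (\<sim> (s \<cdot> y) \<uplus> g \<cdot> b) \<uplus> \<sim> (\<delta> (\<alpha> \<cdot> a))"
      by (rule sum_move)
    then have "\<epsilon> p (\<epsilon> p a) = \<epsilon> p (\<delta> (\<sim> (s \<cdot> y) \<uplus> g \<cdot> b) \<uplus> \<sim> (\<delta> (\<alpha> \<cdot> a)))"
      by (rule arg_cong)
    then show ?thesis using a(1) unfolding z_def by simp
  qed
  (* The part of \<open>b\<close> not accounted for by \<open>z\<close>; \<open>Q\<close> bounds \<open>v c\<close> up to sign. *)
  define c where "c = b \<uplus> \<sim> (x \<cdot> z)"
  have xz: "x \<cdot> z \<in> hom B B 1" and hz: "h \<cdot> z \<in> hom B C 2" and vxz: "v \<cdot> x \<cdot> z \<in> hom B C 1"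
    using cmp_typed[OF x(1) z] cmp_typed[OF h(1) z] cmp_typed[OF v(1) cmp_typed[OF x(1) z]] by simp_all
  have c: "c \<in> hom B B 1" unfolding c_def using b xz by auto
  have xa: "x \<cdot> a \<in> hom B B 0" using cmp_typed[OF x(1) a(1)] by simp
  have dc: "\<delta> c = \<o> B B 0" unfolding c_def using add_neg[OF xa] by (simp add: dif_closed_left[OF x] b(2) dz)
  define Q where "Q = y \<uplus> h \<cdot> z"
  have Q: "Q \<in> hom B C 2" unfolding Q_def using y hz by auto
  have vc: "v \<cdot> c = \<sim> (\<delta> Q)"
  proof -
    have "\<delta> (h \<cdot> z) = v \<cdot> x \<cdot> z \<uplus> \<sim> (h \<cdot> a)"
      by (simp add: leibniz_arrow[OF h(1)] h(2) dz comp_assoc)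
    then have "\<sim> (\<delta> Q) = (v \<cdot> b \<uplus> \<sim> (v \<cdot> x \<cdot> z)) \<uplus> (\<delta> y \<uplus> \<sim> (\<delta> y))"
      unfolding Q_def by (simp add: ha add_ac)
    also have "\<dots> = v \<cdot> b \<uplus> \<sim> (v \<cdot> x \<cdot> z)"
      unfolding add_neg[OF ty(6)] using ty(2) vxz by (intro add_zero(1)) auto
    finally show ?thesis unfolding c_def by simp
  qed
  have ty2: "g \<cdot> c \<in> hom B A 1" "s \<cdot> Q \<in> hom B A 1" "t \<cdot> Q \<in> hom B B 2" "\<beta> \<cdot> c \<in> hom B B 2"
    "x \<cdot> s \<cdot> Q \<in> hom B B 1" "t \<cdot> \<delta> Q \<in> hom B B 1" "x \<cdot> g \<cdot> c \<in> hom B B 1" "s \<cdot> \<delta> Q \<in> hom B A 0"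
    using cmp_typed[OF g(1) c] cmp_typed[OF s(1) Q] cmp_typed[OF t(1) Q] cmp_typed[OF \<beta> c]
      cmp_typed[OF x(1) cmp_typed[OF s(1) Q]] cmp_typed[OF t(1) dif_in_hom[OF Q, of 1]]
      cmp_typed[OF x(1) cmp_typed[OF g(1) c]] cmp_typed[OF s(1) dif_in_hom[OF Q, of 1]]
    by simp_all
  (* As \<open>d g = s v\<close>, \<open>s Q\<close> is what has to be subtracted from \<open>g c\<close> to obtain a cycle. *)
  define e where "e = g \<cdot> c \<uplus> \<sim> (s \<cdot> Q)"
  have e: "e \<in> hom B A 1" unfolding e_def using ty2 by auto
  have de: "\<delta> e = \<o> B A 0"
  proof -
    have "\<delta> (g \<cdot> c) = \<sim> (s \<cdot> \<delta> Q)"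
      using comp_zero_right[OF g(1) obj(2), of 0] neg_in_hom[OF ty2(8)]
      by (simp add: leibniz_arrow[OF g(1)] g(2) dc comp_assoc vc)
    then show ?thesis unfolding e_def using add_neg[OF ty2(8)]
      by (simp add: dif_closed_left[OF s] add_commute)
  qed
  define y' where "y' = \<epsilon> q (t \<cdot> Q \<uplus> \<sim> (\<beta> \<cdot> c))"
  have y': "y' \<in> hom B B 2" unfolding y'_def using ty2 by auto
  have c_eq: "c = x \<cdot> \<epsilon> q e \<uplus> \<delta> y'"
  proof -
    have tQ: "\<delta> (t \<cdot> Q) = x \<cdot> s \<cdot> Q \<uplus> t \<cdot> \<delta> Q" by (simp add: leibniz_arrow[OF t(1)] t(2) comp_assoc)
    then have tQ': "t \<cdot> \<delta> Q = \<delta> (t \<cdot> Q) \<uplus> \<sim> (x \<cdot> s \<cdot> Q)"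
      by (intro sum_move[OF _ ty2(6,5)]) (simp add: add_commute)
    have "\<epsilon> q c \<uplus> \<delta> (\<beta> \<cdot> c) = (\<epsilon> q (\<i> B) \<uplus> \<delta> \<beta>) \<cdot> c"
      using dif_closed_right[OF c dc] c by simp
    also have "\<dots> = x \<cdot> g \<cdot> c \<uplus> \<sim> (t \<cdot> v \<cdot> c)" unfolding eqB[symmetric] by (simp add: comp_assoc)
    also have "\<dots> = x \<cdot> g \<cdot> c \<uplus> t \<cdot> \<delta> Q" unfolding vc by simp
    also have "\<dots> = x \<cdot> e \<uplus> \<delta> (t \<cdot> Q)" unfolding tQ' e_def by (simp add: add_ac)
    finally have *: "\<epsilon> q c \<uplus> \<delta> (\<beta> \<cdot> c) = x \<cdot> e \<uplus> \<delta> (t \<cdot> Q)" .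
    have "\<epsilon> q c \<in> hom B B 1" "\<delta> (\<beta> \<cdot> c) \<in> hom B B 1" using c ty2(4) by auto
    from sum_move[OF * this] have "\<epsilon> q (\<epsilon> q c) = \<epsilon> q (x \<cdot> e \<uplus> \<delta> (t \<cdot> Q) \<uplus> \<sim> (\<delta> (\<beta> \<cdot> c)))"
      by (rule arg_cong)
    then show ?thesis using c unfolding y'_def by (simp add: add_ac)
  qed
  have "b = c \<uplus> x \<cdot> z"
    using c_def b(1) xz by (intro sum_move_neg) auto
  then have "b = x \<cdot> (z \<uplus> \<epsilon> q e) \<uplus> \<delta> y'"
    by (subst (asm) c_eq) (simp add: add_ac)
  moreover have "z \<uplus> \<epsilon> q e \<in> hom B A 1" using z e by auto
  moreover have "\<delta> (z \<uplus> \<epsilon> q e) = a" using dz de a(1) by simp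
  ultimately show thesis using that y' by blast
qed

text \<open>The mirror image of \<open>right_inverse_exists\<close>, with all compositions reversed: the relation at
  \<open>C\<close> provides the first choice, the relation at \<open>B\<close> the correction by \<open>z\<close>.\<close>

lemma left_inverse_exists:
  assumes T: "contracted_triangle \<C> (A, B, C) (- 1, 0, 0) (x, v, s) (h, g, t) (\<alpha>, \<beta>, \<gamma>) (p, q, r)"
    and w: "w \<in> hom B C 1" "\<delta> w = v"
  obtains a b y where "a \<in> hom A C 0" "\<delta> a = \<o> A C (- 1)" "b \<in> hom C C 1" "\<delta> b = a \<cdot> s \<uplus> \<sim> (\<i> C)"
    "y \<in> hom B C 2" "a \<cdot> g \<uplus> \<sim> (b \<cdot> v) = w \<uplus> \<delta> y"
proof -
  from T have x: "x \<in> hom A B (- 1)" "\<delta> x = \<o> A B (- 2)" and v: "v \<in> hom B C 0" "\<delta> v = \<o> B C (- 1)"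
    and s: "s \<in> hom C A 0" "\<delta> s = \<o> C A (- 1)"
    and h: "h \<in> hom A C 0" "\<delta> h = v \<cdot> x" and g: "g \<in> hom B A 1" "\<delta> g = s \<cdot> v"
    and t: "t \<in> hom C B 0" "\<delta> t = x \<cdot> s"
    and \<beta>: "\<beta> \<in> hom B B 1" and \<gamma>: "\<gamma> \<in> hom C C 1"
    and eqB: "x \<cdot> g \<uplus> t \<cdot> v = \<epsilon> q (\<i> B) \<uplus> \<delta> \<beta>"
    and eqC: "v \<cdot> t \<uplus> \<sim> (h \<cdot> s) = \<epsilon> r (\<i> C) \<uplus> \<delta> \<gamma>"
    unfolding contracted_triangle_def by auto
  note [intro] = add_in_hom neg_in_hom sgn_in_hom
  have obj: "A \<in> Obj \<C>" "B \<in> Obj \<C>" "C \<in> Obj \<C>" using in_hom_Obj x(1) v(1) by auto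
  note closed = dif_closed_right[OF x] dif_closed_right[OF s] dif_closed_right[OF v]
    leibniz_arrow[OF w(1)] h(2) g(2) t(2) w(2) comp_assoc
  let ?a = "\<sim> (\<epsilon> r (h \<uplus> \<sim> (w \<cdot> x)))" and ?b = "\<epsilon> r (\<gamma> \<uplus> \<sim> (w \<cdot> t))"
  have ty: "w \<cdot> x \<in> hom A C 0" "w \<cdot> t \<in> hom C C 1" "v \<cdot> x \<in> hom A C (- 1)" "v \<cdot> t \<in> hom C C 0"
    "h \<cdot> s \<in> hom C C 0"
    using cmp_typed[OF w(1) x(1)] cmp_typed[OF w(1) t(1)] cmp_typed[OF v(1) x(1)] cmp_typed[OF v(1) t(1)]
      cmp_typed[OF h(1) s(1)] by simp_all
  have a: "?a \<in> hom A C 0" using h(1) ty by auto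
  have b: "?b \<in> hom C C 1" using \<gamma> ty by auto
  have da: "\<delta> ?a = \<o> A C (- 1)"
  proof -
    have "\<delta> ?a = \<sim> (\<epsilon> r (v \<cdot> x \<uplus> \<sim> (v \<cdot> x)))" by (simp add: closed)
    then show ?thesis unfolding add_neg[OF ty(3)] by simp
  qed
  have db: "\<delta> ?b = ?a \<cdot> s \<uplus> \<sim> (\<i> C)"
  proof -
    have r: "\<epsilon> r (\<i> C) \<in> hom C C 0" "\<delta> \<gamma> \<in> hom C C 0" using obj \<gamma> by auto
    have "\<delta> \<gamma> \<uplus> \<epsilon> r (\<i> C) = v \<cdot> t \<uplus> \<sim> (h \<cdot> s)"
      using eqC by (simp only: add_commute)
    then have "\<delta> \<gamma> = v \<cdot> t \<uplus> \<sim> (h \<cdot> s) \<uplus> \<sim> (\<epsilon> r (\<i> C))"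
      using r(2,1) by (rule sum_move)
    then have "\<delta> ?b = (?a \<cdot> s \<uplus> \<sim> (\<i> C)) \<uplus> \<epsilon> r (v \<cdot> t \<uplus> \<sim> (v \<cdot> t))"
      by (simp add: closed add_ac)
    also have "\<dots> = ?a \<cdot> s \<uplus> \<sim> (\<i> C)"
      unfolding add_neg[OF ty(4)] sgn_zero using cmp_typed[OF a s(1)] obj by (intro add_zero(1)) auto
    finally show ?thesis .
  qed
  let ?z = "?a \<cdot> g \<uplus> \<sim> (?b \<cdot> v) \<uplus> \<sim> w"
  have ag: "?a \<cdot> g \<in> hom B C 1" and bv: "?b \<cdot> v \<in> hom B C 1"
    using cmp_typed[OF a g(1)] cmp_typed[OF b v(1)] by simp_all
  have z: "?z \<in> hom B C 1" by (intro add_in_hom neg_in_hom ag bv w(1))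
  have dz: "\<delta> ?z = \<o> B C 0"
  proof -
    have asv: "?a \<cdot> s \<cdot> v \<in> hom B C 0" using cmp_typed[OF a cmp_typed[OF s(1) v(1)]] by simp
    have "\<delta> ?z = (\<delta> (?a \<cdot> g) \<uplus> \<sim> (\<delta> (?b \<cdot> v))) \<uplus> \<sim> v" unfolding diff_add diff_neg w(2) ..
    also have "\<delta> (?a \<cdot> g) = ?a \<cdot> s \<cdot> v"
      unfolding dif_closed_left[OF a da] g(2) using asv by (simp only: sgn_even_odd even_zero in_hom_chk)
    also have "\<delta> (?b \<cdot> v) = ?a \<cdot> s \<cdot> v \<uplus> \<sim> v"
      unfolding dif_closed_right[OF v] db using v(1) by (simp only: comp_add_left comp_assoc comp_neg_left comp_idt_left)
    also have "?a \<cdot> s \<cdot> v \<uplus> \<sim> (?a \<cdot> s \<cdot> v \<uplus> \<sim> v) \<uplus> \<sim> v =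
        (?a \<cdot> s \<cdot> v \<uplus> \<sim> (?a \<cdot> s \<cdot> v)) \<uplus> (v \<uplus> \<sim> v)"
      unfolding neg_add neg_neg in_hom_chk[OF v(1)] by (simp only: add_ac)
    also have "\<dots> = \<o> B C 0" unfolding add_neg[OF asv] add_neg[OF v(1)] using obj by (intro add_zero(1)) auto
    finally show ?thesis .
  qed
  define z where "z = ?z"
  note z = z[folded z_def] and dz = dz[folded z_def]
  define a1 b1 where "a1 = ?a \<uplus> \<sim> (\<epsilon> q (z \<cdot> x))" and "b1 = ?b \<uplus> \<epsilon> q (z \<cdot> t)"
  have ty2: "z \<cdot> x \<in> hom A C 0" "z \<cdot> t \<in> hom C C 1" "z \<cdot> x \<cdot> s \<in> hom C C 0" "z \<cdot> \<beta> \<in> hom B C 2"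
    using cmp_typed[OF z x(1)] cmp_typed[OF z t(1)] cmp_typed[OF z cmp_typed[OF x(1) s(1)]]
      cmp_typed[OF z \<beta>] by simp_all
  have a1: "a1 \<in> hom A C 0" and b1: "b1 \<in> hom C C 1" unfolding a1_def b1_def using a b ty2 by auto
  have "\<delta> (z \<cdot> x) = \<o> A C (- 1)"
    using comp_zero_left[OF x(1) obj(3), of 0] by (simp add: dif_closed_right[OF x] dz)
  then have da1: "\<delta> a1 = \<o> A C (- 1)"
    unfolding a1_def diff_add[of ?a] da using obj by simp
  have "\<delta> (z \<cdot> t) = \<sim> (z \<cdot> x \<cdot> s)" by (simp add: dif_closed_left[OF z dz] t(2))
  then have db1: "\<delta> b1 = a1 \<cdot> s \<uplus> \<sim> (\<i> C)"
    unfolding b1_def a1_def diff_add[of ?b] db by (simp add: add_ac comp_assoc)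
  have "a1 \<cdot> g \<uplus> \<sim> (b1 \<cdot> v) =
      (?a \<cdot> g \<uplus> \<sim> (?b \<cdot> v)) \<uplus> \<sim> (\<epsilon> q (z \<cdot> (x \<cdot> g \<uplus> t \<cdot> v)))"
    unfolding a1_def b1_def comp_add_right neg_add sgn_ops comp_add_left comp_assoc comp_neg_left neg_neg
    by (simp add: add_ac)
  also have "?a \<cdot> g \<uplus> \<sim> (?b \<cdot> v) = z \<uplus> w"
    using z_def[symmetric] by (rule sum_move_neg[OF _ add_in_hom[OF ag neg_in_hom[OF bv]] w(1)])
  also have "\<sim> (\<epsilon> q (z \<cdot> (x \<cdot> g \<uplus> t \<cdot> v))) = \<sim> z \<uplus> \<delta> (\<epsilon> q (z \<cdot> \<beta>))"
    unfolding eqB using z by (simp add: dif_closed_left[OF z dz])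
  also have "z \<uplus> w \<uplus> (\<sim> z \<uplus> \<delta> (\<epsilon> q (z \<cdot> \<beta>))) = (w \<uplus> \<delta> (\<epsilon> q (z \<cdot> \<beta>))) \<uplus> (z \<uplus> \<sim> z)"
    by (simp only: add_ac)
  also have "\<dots> = w \<uplus> \<delta> (\<epsilon> q (z \<cdot> \<beta>))"
    unfolding add_neg[OF z] using w ty2 dif_in_hom[OF ty2(4), of 1] by (intro add_zero(1)) auto
  finally have "a1 \<cdot> g \<uplus> \<sim> (b1 \<cdot> v) = w \<uplus> \<delta> (\<epsilon> q (z \<cdot> \<beta>))" .
  moreover have "\<epsilon> q (z \<cdot> \<beta>) \<in> hom B C 2" using ty2 by auto
  ultimately show thesis using that a1 da1 b1 db1 by blast
qed

text \<open>The mirror image of \<open>right_inverse_unique\<close>: the relation at \<open>A\<close> makes \<open>a\<close> a boundary, and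
  the relation at \<open>C\<close> lets the remaining cycle \<open>c\<close> factor through \<open>s\<close> up to a boundary.\<close>

lemma left_inverse_unique:
  assumes T: "contracted_triangle \<C> (A, B, C) (- 1, 0, 0) (x, v, s) (h, g, t) (\<alpha>, \<beta>, \<gamma>) (p, q, r)"
    and a: "a \<in> hom A C 0" "\<delta> a = \<o> A C (- 1)" and b: "b \<in> hom C C 1" "\<delta> b = a \<cdot> s"
    and y: "y \<in> hom B C 2" "a \<cdot> g \<uplus> \<sim> (b \<cdot> v) = \<delta> y"
  obtains z y' where "z \<in> hom A C 1" "\<delta> z = a" "y' \<in> hom C C 2" "b = z \<cdot> s \<uplus> \<delta> y'"
proof -
  from T have x: "x \<in> hom A B (- 1)" "\<delta> x = \<o> A B (- 2)" and v: "v \<in> hom B C 0" "\<delta> v = \<o> B C (- 1)"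
    and s: "s \<in> hom C A 0" "\<delta> s = \<o> C A (- 1)"
    and h: "h \<in> hom A C 0" "\<delta> h = v \<cdot> x" and g: "g \<in> hom B A 1" "\<delta> g = s \<cdot> v"
    and t: "t \<in> hom C B 0" "\<delta> t = x \<cdot> s"
    and \<alpha>: "\<alpha> \<in> hom A A 1" and \<gamma>: "\<gamma> \<in> hom C C 1"
    and eqA: "s \<cdot> h \<uplus> \<sim> (g \<cdot> x) = \<epsilon> p (\<i> A) \<uplus> \<delta> \<alpha>"
    and eqC: "v \<cdot> t \<uplus> \<sim> (h \<cdot> s) = \<epsilon> r (\<i> C) \<uplus> \<delta> \<gamma>"
    unfolding contracted_triangle_def by auto
  have ty: "a \<cdot> g \<in> hom B C 1" "b \<cdot> v \<in> hom B C 1" "y \<cdot> x \<in> hom A C 1" "b \<cdot> h \<in> hom A C 1"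
    "a \<cdot> \<alpha> \<in> hom A C 1" "\<delta> y \<in> hom B C 1" "b \<cdot> v \<cdot> x \<in> hom A C 0" "a \<cdot> s \<in> hom C C 0"
    using cmp_typed[OF a(1) g(1)] cmp_typed[OF b(1) v(1)] cmp_typed[OF y(1) x(1)] cmp_typed[OF b(1) h(1)]
      cmp_typed[OF a(1) \<alpha>] dif_in_hom[OF y(1), of 1] cmp_typed[OF b(1) cmp_typed[OF v(1) x(1)]]
      cmp_typed[OF a(1) s(1)] by simp_all
  have ag: "a \<cdot> g = \<delta> y \<uplus> b \<cdot> v"
    using sum_move_neg[OF y(2) ty(1,2)] .
  define z where "z = \<epsilon> p (b \<cdot> h \<uplus> \<sim> (y \<cdot> x) \<uplus> \<sim> (a \<cdot> \<alpha>))"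
  have z: "z \<in> hom A C 1" unfolding z_def using ty by auto
  have dz: "\<delta> z = a"
  proof -
    have bh: "\<delta> (b \<cdot> h) = a \<cdot> s \<cdot> h \<uplus> \<sim> (b \<cdot> v \<cdot> x)"
      by (simp add: leibniz_arrow[OF b(1)] b(2) h(2) comp_assoc)
    have "\<epsilon> p a \<uplus> \<delta> (a \<cdot> \<alpha>) = a \<cdot> (\<epsilon> p (\<i> A) \<uplus> \<delta> \<alpha>)"
      using dif_closed_left[OF a] a(1) by simp
    also have "\<dots> = a \<cdot> s \<cdot> h \<uplus> \<sim> ((a \<cdot> g) \<cdot> x)" unfolding eqA[symmetric] by (simp add: comp_assoc)
    also have "\<dots> = \<delta> (b \<cdot> h) \<uplus> \<delta> (\<sim> (y \<cdot> x))"
      unfolding ag bh by (simp add: dif_closed_right[OF x] comp_assoc add_ac)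
    finally have "\<epsilon> p a \<uplus> \<delta> (a \<cdot> \<alpha>) = \<delta> (b \<cdot> h) \<uplus> \<delta> (\<sim> (y \<cdot> x))" .
    moreover have "\<epsilon> p a \<in> hom A C 0" "\<delta> (a \<cdot> \<alpha>) \<in> hom A C 0" using a(1) ty(5) by auto
    ultimately have "\<epsilon> p a = \<delta> (b \<cdot> h) \<uplus> \<delta> (\<sim> (y \<cdot> x)) \<uplus> \<sim> (\<delta> (a \<cdot> \<alpha>))"
      by (rule sum_move)
    then have "\<epsilon> p (\<epsilon> p a) = \<epsilon> p (\<delta> (b \<cdot> h) \<uplus> \<delta> (\<sim> (y \<cdot> x)) \<uplus> \<sim> (\<delta> (a \<cdot> \<alpha>)))"
      by (rule arg_cong)
    then show ?thesis using a(1) unfolding z_def by simp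
  qed
  define c where "c = b \<uplus> \<sim> (z \<cdot> s)"
  have ty1: "z \<cdot> s \<in> hom C C 1" "z \<cdot> g \<in> hom B C 2" "z \<cdot> s \<cdot> v \<in> hom B C 1"
    using cmp_typed[OF z s(1)] cmp_typed[OF z g(1)] cmp_typed[OF z cmp_typed[OF s(1) v(1)]] by simp_all
  have c: "c \<in> hom C C 1" unfolding c_def using b ty1 by auto
  have dc: "\<delta> c = \<o> C C 0"
    unfolding c_def using add_neg[OF ty(8)] by (simp add: dif_closed_right[OF s] b(2) dz)
  define Q where "Q = z \<cdot> g \<uplus> \<sim> y"
  have Q: "Q \<in> hom B C 2" unfolding Q_def using y ty1 by auto
  have cv: "c \<cdot> v = \<delta> Q"
  proof -
    have "\<delta> Q = (b \<cdot> v \<uplus> \<sim> (z \<cdot> s \<cdot> v)) \<uplus> (\<delta> y \<uplus> \<sim> (\<delta> y))"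
      unfolding Q_def by (simp add: leibniz_arrow[OF z] g(2) dz ag add_ac)
    also have "\<dots> = b \<cdot> v \<uplus> \<sim> (z \<cdot> s \<cdot> v)"
      unfolding add_neg[OF ty(6)] using ty(2) ty1 by (intro add_zero(1)) auto
    finally show ?thesis unfolding c_def by (simp add: comp_assoc)
  qed
  have ty2: "Q \<cdot> x \<in> hom A C 1" "c \<cdot> h \<in> hom A C 1" "Q \<cdot> t \<in> hom C C 2" "c \<cdot> \<gamma> \<in> hom C C 2"
    "Q \<cdot> x \<cdot> s \<in> hom C C 1" "\<delta> Q \<cdot> t \<in> hom C C 1" "c \<cdot> h \<cdot> s \<in> hom C C 1" "\<delta> Q \<cdot> x \<in> hom A C 0"
    "c \<cdot> v \<cdot> x \<in> hom A C 0"
    using cmp_typed[OF Q x(1)] cmp_typed[OF c h(1)] cmp_typed[OF Q t(1)] cmp_typed[OF c \<gamma>]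
      cmp_typed[OF Q cmp_typed[OF x(1) s(1)]] cmp_typed[OF dif_in_hom[OF Q, of 1] t(1)]
      cmp_typed[OF c cmp_typed[OF h(1) s(1)]] cmp_typed[OF dif_in_hom[OF Q, of 1] x(1)]
      cmp_typed[OF c cmp_typed[OF v(1) x(1)]]
    by simp_all
  define e where "e = Q \<cdot> x \<uplus> c \<cdot> h"
  have e: "e \<in> hom A C 1" unfolding e_def using ty2 by auto
  have de: "\<delta> e = \<o> A C 0"
  proof -
    have "\<delta> (c \<cdot> h) = \<sim> (\<delta> Q \<cdot> x)"
      by (simp add: dif_closed_left[OF c dc] h(2) cv flip: comp_assoc)
    then show ?thesis unfolding e_def using add_neg[OF ty2(8)]
      by (simp add: dif_closed_right[OF x])
  qed
  define y' where "y' = \<epsilon> r (Q \<cdot> t \<uplus> c \<cdot> \<gamma>)"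
  have y': "y' \<in> hom C C 2" unfolding y'_def using ty2 by auto
  have c_eq: "c = \<sim> (\<epsilon> r e \<cdot> s) \<uplus> \<delta> y'"
  proof -
    have "\<delta> (Q \<cdot> t) = \<delta> Q \<cdot> t \<uplus> Q \<cdot> x \<cdot> s" by (simp add: leibniz_arrow[OF Q] t(2))
    then have Qt: "\<delta> Q \<cdot> t = \<delta> (Q \<cdot> t) \<uplus> \<sim> (Q \<cdot> x \<cdot> s)"
      by (intro sum_move[OF _ ty2(6,5)]) simp
    have "\<epsilon> r c \<uplus> \<delta> (\<sim> (c \<cdot> \<gamma>)) = c \<cdot> (\<epsilon> r (\<i> C) \<uplus> \<delta> \<gamma>)"
      using dif_closed_left[OF c dc] c by simp
    also have "\<dots> = (c \<cdot> v) \<cdot> t \<uplus> \<sim> (c \<cdot> h \<cdot> s)" unfolding eqC[symmetric] by (simp add: comp_assoc)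
    also have "\<dots> = \<sim> (e \<cdot> s) \<uplus> \<delta> (Q \<cdot> t)" unfolding cv Qt e_def by (simp add: comp_assoc add_ac)
    finally have *: "\<epsilon> r c \<uplus> \<delta> (\<sim> (c \<cdot> \<gamma>)) = \<sim> (e \<cdot> s) \<uplus> \<delta> (Q \<cdot> t)" .
    have "\<epsilon> r c \<in> hom C C 1" "\<delta> (\<sim> (c \<cdot> \<gamma>)) \<in> hom C C 1"
      using c ty2(4) dif_in_hom[OF neg_in_hom[OF ty2(4)], of 1] by auto
    from sum_move[OF * this]
    have "\<epsilon> r (\<epsilon> r c) = \<epsilon> r (\<sim> (e \<cdot> s) \<uplus> \<delta> (Q \<cdot> t) \<uplus> \<sim> (\<delta> (\<sim> (c \<cdot> \<gamma>))))"
      by (rule arg_cong)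
    then show ?thesis using c unfolding y'_def by (simp add: add_ac)
  qed
  have "b = c \<uplus> z \<cdot> s"
    using c_def b(1) ty1 by (intro sum_move_neg) auto
  then have "b = (z \<uplus> \<sim> (\<epsilon> r e)) \<cdot> s \<uplus> \<delta> y'"
    by (subst (asm) c_eq) (simp add: add_ac)
  moreover have "z \<uplus> \<sim> (\<epsilon> r e) \<in> hom A C 1" using z e by auto
  moreover have "\<delta> (z \<uplus> \<sim> (\<epsilon> r e)) = a" using dz de a(1) by simp
  ultimately show thesis using that y' by blast
qed

end

section \<open>Matrices of morphisms\<close>

context dg_category
begin

text \<open>The entry of a morphism of degree \<open>n\<close> from the summand \<open>\<Sigma>\<^bsup>r\<^esup>X\<close> to the summand \<open>\<Sigma>\<^bsup>s\<^esup>Y\<close> is a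
  morphism \<open>X \<rightarrow> Y\<close> of degree \<open>n + r - s\<close>. As arrows of \<open>\<C>\<close>, the entries of products and
  differentials of matrices become expressions of the arrow calculus.\<close>

definition entry :: "('o \<times> int) list \<Rightarrow> ('o \<times> int) list \<Rightarrow> int \<Rightarrow> (nat \<Rightarrow> nat \<Rightarrow> 'm) \<Rightarrow> nat \<Rightarrow> nat \<Rightarrow> ('o, 'm) arrow" where
  "entry ks ls n f i j =
     arr \<C> (fst (ks ! j)) (fst (ls ! i)) (n + snd (ks ! j) - snd (ls ! i)) (f i j)"

context
  fixes ks ls :: "('o \<times> int) list"
  assumes ks: "fst ` set ks \<subseteq> Obj \<C>" and ls: "fst ` set ls \<subseteq> Obj \<C>"
begin

lemma part_Obj: "j < length ks \<Longrightarrow> fst (ks ! j) \<in> Obj \<C>" "i < length ls \<Longrightarrow> fst (ls ! i) \<in> Obj \<C>"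
  using ks ls by (metis image_subset_iff nth_mem)+

lemma shift_hom_abelian_group:
  "i < length ls \<Longrightarrow> j < length ks \<Longrightarrow> abelian_group (shift_hom \<C> (ks ! j) (ls ! i) n)"
  unfolding shift_hom_def by (simp add: split_beta hom_abelian_group part_Obj)

lemma matrix_hom_carrier:
  "f \<in> carrier (matrix_hom \<C> ks ls n) \<longleftrightarrow> f = matrix (length ls) (length ks) f \<and>
    (\<forall>i<length ls. \<forall>j<length ks. f i j \<in> carrier (shift_hom \<C> (ks ! j) (ls ! i) n))"
  by (auto simp: matrix_hom_def matrix_def fun_eq_iff)

lemma matrix_eqI:
  assumes "f = matrix p q f" "g = matrix p q g" "\<And>i j. i < p \<Longrightarrow> j < q \<Longrightarrow> f i j = g i j"
  shows "f = g"
  by (subst assms(1), subst assms(2)) (auto simp: matrix_def assms(3) fun_eq_iff)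

text \<open>Matrices form a group entrywise. This is needed because the differential of \<open>\<C>\<^sup>p\<^sup>r\<^sup>e\<^sup>t\<^sup>r\<close>
  involves a subtraction in this group.\<close>

lemma matrix_hom_abelian_group: "abelian_group (matrix_hom \<C> ks ls n)" (is "abelian_group ?M")
proof (rule abelian_groupI)
  let ?H = "\<lambda>i j. shift_hom \<C> (ks ! j) (ls ! i) n"
  note G = shift_hom_abelian_group
  have add: "f \<oplus>\<^bsub>?M\<^esub> g = matrix (length ls) (length ks) (\<lambda>i j. f i j \<oplus>\<^bsub>?H i j\<^esub> g i j)" for f g
    by (simp add: matrix_hom_def)
  have zero: "\<zero>\<^bsub>?M\<^esub> = matrix (length ls) (length ks) (\<lambda>i j. \<zero>\<^bsub>?H i j\<^esub>)"
    by (simp add: matrix_hom_def)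
  note c = matrix_hom_carrier
  have m [simp]: "matrix p q f i j = f i j" if "i < p" "j < q" for p q f i j using that by (simp add: matrix_def)
  have mm [simp]: "matrix p q (matrix p q f) = matrix p q f" for p q f by (auto simp: matrix_def fun_eq_iff)
  have [simp]: "f i j \<in> carrier (?H i j)" if "f \<in> carrier ?M" "i < length ls" "j < length ks" for f i j
    using that by (simp add: c)
  have m': "f = matrix (length ls) (length ks) f" if "f \<in> carrier ?M" for f using that c by blast
  note eqI = matrix_eqI[of _ "length ls" "length ks"]
  show "f \<oplus>\<^bsub>?M\<^esub> g \<in> carrier ?M" if "f \<in> carrier ?M" "g \<in> carrier ?M" for f g
    using that abelian_groupE(1)[OF G] by (intro c[THEN iffD2]) (simp add: add)
  show "\<zero>\<^bsub>?M\<^esub> \<in> carrier ?M"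
    using abelian_groupE(2)[OF G] by (intro c[THEN iffD2]) (simp add: zero)
  show "f \<oplus>\<^bsub>?M\<^esub> g \<oplus>\<^bsub>?M\<^esub> h = f \<oplus>\<^bsub>?M\<^esub> (g \<oplus>\<^bsub>?M\<^esub> h)"
    if fgh: "f \<in> carrier ?M" "g \<in> carrier ?M" "h \<in> carrier ?M" for f g h
  proof (rule eqI)
    fix i j assume "i < length ls" "j < length ks"
    then show "(f \<oplus>\<^bsub>?M\<^esub> g \<oplus>\<^bsub>?M\<^esub> h) i j = (f \<oplus>\<^bsub>?M\<^esub> (g \<oplus>\<^bsub>?M\<^esub> h)) i j"
      using abelian_groupE(3)[OF G[of i j n], of "f i j" "g i j" "h i j"] fgh by (simp add: add)
  qed (simp_all add: add)
  show "f \<oplus>\<^bsub>?M\<^esub> g = g \<oplus>\<^bsub>?M\<^esub> f" if fg: "f \<in> carrier ?M" "g \<in> carrier ?M" for f g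
  proof (rule eqI)
    fix i j assume "i < length ls" "j < length ks"
    then show "(f \<oplus>\<^bsub>?M\<^esub> g) i j = (g \<oplus>\<^bsub>?M\<^esub> f) i j"
      using abelian_groupE(4)[OF G[of i j n], of "f i j" "g i j"] fg by (simp add: add)
  qed (simp_all add: add)
  show "\<zero>\<^bsub>?M\<^esub> \<oplus>\<^bsub>?M\<^esub> f = f" if f: "f \<in> carrier ?M" for f
  proof (rule eqI)
    fix i j assume "i < length ls" "j < length ks"
    then show "(\<zero>\<^bsub>?M\<^esub> \<oplus>\<^bsub>?M\<^esub> f) i j = f i j"
      using abelian_groupE(5)[OF G[of i j n], of "f i j"] f by (simp add: add zero)
  qed (use m'[OF f] in \<open>simp_all add: add\<close>)
  show "\<exists>g\<in>carrier ?M. g \<oplus>\<^bsub>?M\<^esub> f = \<zero>\<^bsub>?M\<^esub>" if f: "f \<in> carrier ?M" for f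
  proof
    let ?g = "matrix (length ls) (length ks) (\<lambda>i j. \<ominus>\<^bsub>?H i j\<^esub> f i j)"
    show "?g \<in> carrier ?M"
      using f abelian_group.a_inv_closed[OF G] by (intro c[THEN iffD2]) simp
    show "?g \<oplus>\<^bsub>?M\<^esub> f = \<zero>\<^bsub>?M\<^esub>"
    proof (rule eqI)
      fix i j assume "i < length ls" "j < length ks"
      then show "(?g \<oplus>\<^bsub>?M\<^esub> f) i j = \<zero>\<^bsub>?M\<^esub> i j"
        using abelian_group.l_neg[OF G[of i j n], of "f i j"] f by (simp add: add zero)
    qed (simp_all add: add zero)
  qed
qed

lemma entry_in_hom:
  assumes "f \<in> carrier (matrix_hom \<C> ks ls n)" "i < length ls" "j < length ks"
  shows "entry ks ls n f i j \<in> hom (fst (ks ! j)) (fst (ls ! i)) (n + snd (ks ! j) - snd (ls ! i))"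
    and "f i j \<in> carrier (Hom \<C> (fst (ks ! j)) (fst (ls ! i)) (n + snd (ks ! j) - snd (ls ! i)))"
proof -
  show *: "f i j \<in> carrier (Hom \<C> (fst (ks ! j)) (fst (ls ! i)) (n + snd (ks ! j) - snd (ls ! i)))"
    using assms by (auto simp: matrix_hom_carrier shift_hom_def split_beta)
  show "entry ks ls n f i j \<in> hom (fst (ks ! j)) (fst (ls ! i)) (n + snd (ks ! j) - snd (ls ! i))"
    unfolding entry_def using part_Obj assms * by auto
qed

lemma entry_add:
  assumes "f \<in> carrier (matrix_hom \<C> ks ls n)" "g \<in> carrier (matrix_hom \<C> ks ls n)"
    "i < length ls" "j < length ks"
  shows "entry ks ls n (f \<oplus>\<^bsub>matrix_hom \<C> ks ls n\<^esub> g) i j = entry ks ls n f i j \<uplus> entry ks ls n g i j"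
proof -
  have "(f \<oplus>\<^bsub>matrix_hom \<C> ks ls n\<^esub> g) i j = f i j \<oplus>\<^bsub>shift_hom \<C> (ks ! j) (ls ! i) n\<^esub> g i j"
    using assms by (simp add: matrix_hom_def matrix_def)
  then show ?thesis
    using assms entry_in_hom(2) part_Obj by (simp add: entry_def shift_hom_def split_beta arr_ops)
qed

lemma entry_zero:
  assumes "i < length ls" "j < length ks"
  shows "entry ks ls n \<zero>\<^bsub>matrix_hom \<C> ks ls n\<^esub> i j =
    \<o> (fst (ks ! j)) (fst (ls ! i)) (n + snd (ks ! j) - snd (ls ! i))"
  using assms by (simp add: entry_def matrix_hom_def matrix_def shift_hom_def split_beta arr_zero)

lemma entry_neg:
  assumes f: "f \<in> carrier (matrix_hom \<C> ks ls n)" and ij: "i < length ls" "j < length ks"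
  shows "entry ks ls n (\<ominus>\<^bsub>matrix_hom \<C> ks ls n\<^esub> f) i j = \<sim> (entry ks ls n f i j)"
proof -
  interpret M: abelian_group "matrix_hom \<C> ks ls n" by (rule matrix_hom_abelian_group)
  let ?d = "n + snd (ks ! j) - snd (ls ! i)"
  have "entry ks ls n (\<ominus>\<^bsub>matrix_hom \<C> ks ls n\<^esub> f) i j \<uplus> entry ks ls n f i j = \<o> (fst (ks ! j)) (fst (ls ! i)) ?d"
    using f ij M.l_neg[OF f] entry_zero[OF ij] by (simp flip: entry_add)
  from sum_move[OF this entry_in_hom(1) entry_in_hom(1)] f ij M.a_inv_closed[OF f]
  have "entry ks ls n (\<ominus>\<^bsub>matrix_hom \<C> ks ls n\<^esub> f) i j = \<o> (fst (ks ! j)) (fst (ls ! i)) ?d \<uplus> \<sim> (entry ks ls n f i j)"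
    by simp
  then show ?thesis using entry_in_hom(1)[OF f ij] by (simp add: neg_in_hom)
qed

lemma entry_signed:
  assumes "f \<in> carrier (matrix_hom \<C> ks ls n)" "i < length ls" "j < length ks"
  shows "entry ks ls n (signed (matrix_hom \<C> ks ls n) m f) i j = \<epsilon> m (entry ks ls n f i j)"
  using entry_in_hom(1)[OF assms] entry_neg[OF assms] by (simp add: signed_def sgn_arrow_def)

lemma signed_closed:
  assumes "f \<in> carrier (matrix_hom \<C> ks ls n)"
  shows "signed (matrix_hom \<C> ks ls n) m f \<in> carrier (matrix_hom \<C> ks ls n)"
  using abelian_group.a_inv_closed[OF matrix_hom_abelian_group assms] assms by (simp add: signed_def)

lemma entry_matrix_dif:
  assumes f: "f \<in> carrier (matrix_hom \<C> ks ls n)"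
  shows "matrix_dif \<C> ks ls n f \<in> carrier (matrix_hom \<C> ks ls (n - 1))"
    and "i < length ls \<Longrightarrow> j < length ks \<Longrightarrow>
      entry ks ls (n - 1) (matrix_dif \<C> ks ls n f) i j = \<epsilon> (snd (ls ! i)) (\<delta> (entry ks ls n f i j))"
proof -
  have deg: "n + snd (ks ! j) - snd (ls ! i) - 1 = n - 1 + snd (ks ! j) - snd (ls ! i)" for i j by simp
  have d: "dif \<C> (fst (ks ! j)) (fst (ls ! i)) (n + snd (ks ! j) - snd (ls ! i)) (f i j) \<in>
      carrier (Hom \<C> (fst (ks ! j)) (fst (ls ! i)) (n - 1 + snd (ks ! j) - snd (ls ! i)))"
    if "i < length ls" "j < length ks" for i j
    using hom_closed(4)[OF part_Obj(1)[OF that(2)] part_Obj(2)[OF that(1)] entry_in_hom(2)[OF f that]] deg by metis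
  have s: "shift_dif \<C> (ks ! j) (ls ! i) n (f i j) =
      signed (Hom \<C> (fst (ks ! j)) (fst (ls ! i)) (n - 1 + snd (ks ! j) - snd (ls ! i))) (snd (ls ! i))
        (dif \<C> (fst (ks ! j)) (fst (ls ! i)) (n + snd (ks ! j) - snd (ls ! i)) (f i j))" for i j
    unfolding shift_dif_def split_beta deg ..
  show "matrix_dif \<C> ks ls n f \<in> carrier (matrix_hom \<C> ks ls (n - 1))"
    using d part_Obj unfolding matrix_hom_carrier matrix_dif_def s
    by (auto simp: matrix_def fun_eq_iff signed_def shift_hom_def split_beta)
  show "entry ks ls (n - 1) (matrix_dif \<C> ks ls n f) i j = \<epsilon> (snd (ls ! i)) (\<delta> (entry ks ls n f i j))"
    if "i < length ls" "j < length ks"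
  proof -
    have "entry ks ls (n - 1) (matrix_dif \<C> ks ls n f) i j =
        arr \<C> (fst (ks ! j)) (fst (ls ! i)) (n - 1 + snd (ks ! j) - snd (ls ! i)) (shift_dif \<C> (ks ! j) (ls ! i) n (f i j))"
      using that by (simp add: entry_def matrix_dif_def matrix_def)
    also have "\<dots> = \<epsilon> (snd (ls ! i)) (\<delta> (entry ks ls n f i j))"
      unfolding s entry_def using d[OF that] part_Obj that entry_in_hom(2)[OF f that]
      by (simp add: arr_ops)
    finally show ?thesis .
  qed
qed

end

lemma matrix_cmp_term:
  assumes "fst ` set ks \<subseteq> Obj \<C>" "fst ` set ls \<subseteq> Obj \<C>" "fst ` set ps \<subseteq> Obj \<C>"
    and "f \<in> carrier (matrix_hom \<C> ks ls n)" "g \<in> carrier (matrix_hom \<C> ls ps m)"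
    and "i < length ps" "j < length ks" "l < length ls" "d = m + n"
  shows "shift_cmp \<C> (ks ! j) (ls ! l) (ps ! i) m n (g i l) (f l j) \<in>
      carrier (Hom \<C> (fst (ks ! j)) (fst (ps ! i)) (d + snd (ks ! j) - snd (ps ! i)))"
    and "arr \<C> (fst (ks ! j)) (fst (ps ! i)) (d + snd (ks ! j) - snd (ps ! i))
      (shift_cmp \<C> (ks ! j) (ls ! l) (ps ! i) m n (g i l) (f l j)) =
      entry ls ps m g i l \<cdot> entry ks ls n f l j"
  using assms entry_in_hom(2)[OF assms(1,2,4) assms(8,7)] entry_in_hom(2)[OF assms(2,3,5) assms(6,8)]
    part_Obj[OF assms(1,2)] part_Obj[OF assms(2,3)]
  by (auto simp: shift_cmp_def split_beta entry_def arr_ops)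

text \<open>Only products over one or two middle summands occur, since the twisted complexes in question
  are shifts and cones.\<close>

lemma entry_matrix_cmp:
  assumes obj: "fst ` set ks \<subseteq> Obj \<C>" "fst ` set ls \<subseteq> Obj \<C>" "fst ` set ps \<subseteq> Obj \<C>"
    and f: "f \<in> carrier (matrix_hom \<C> ks ls n)" and g: "g \<in> carrier (matrix_hom \<C> ls ps m)" and d: "d = m + n"
  shows "matrix_cmp \<C> ks ls ps m n g f \<in> carrier (matrix_hom \<C> ks ps d)"
    and "length ls = 1 \<Longrightarrow> i < length ps \<Longrightarrow> j < length ks \<Longrightarrow>
      entry ks ps d (matrix_cmp \<C> ks ls ps m n g f) i j = entry ls ps m g i 0 \<cdot> entry ks ls n f 0 j"
    and "length ls = 2 \<Longrightarrow> i < length ps \<Longrightarrow> j < length ks \<Longrightarrow>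
      entry ks ps d (matrix_cmp \<C> ks ls ps m n g f) i j =
        entry ls ps m g i 0 \<cdot> entry ks ls n f 0 j \<uplus> entry ls ps m g i 1 \<cdot> entry ks ls n f 1 j"
proof -
  let ?t = "\<lambda>i j l. shift_cmp \<C> (ks ! j) (ls ! l) (ps ! i) m n (g i l) (f l j)"
  let ?H = "\<lambda>i j. Hom \<C> (fst (ks ! j)) (fst (ps ! i)) (d + snd (ks ! j) - snd (ps ! i))"
  note t = matrix_cmp_term[OF obj f g _ _ _ d]
  have G: "abelian_group (?H i j)" if "i < length ps" "j < length ks" for i j
    using that part_Obj[OF obj(1,3)] hom_abelian_group by blast
  have e: "matrix_cmp \<C> ks ls ps m n g f i j = (\<Oplus>\<^bsub>?H i j\<^esub>l\<in>{..<length ls}. ?t i j l)"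
    if "i < length ps" "j < length ks" for i j
    using that by (simp add: matrix_cmp_def matrix_def shift_hom_def split_beta d)
  have closed: "matrix_cmp \<C> ks ls ps m n g f i j \<in> carrier (?H i j)" if "i < length ps" "j < length ks" for i j
  proof -
    interpret abelian_group "?H i j" by (rule G[OF that])
    show ?thesis unfolding e[OF that] using t(1)[OF that] by (intro finsum_closed) auto
  qed
  then show "matrix_cmp \<C> ks ls ps m n g f \<in> carrier (matrix_hom \<C> ks ps d)"
    unfolding matrix_hom_carrier[OF obj(1,3)]
    by (auto simp: shift_hom_def split_beta) (auto simp: matrix_cmp_def matrix_def fun_eq_iff)
  assume i: "i < length ps" and j: "j < length ks"
  interpret abelian_group "?H i j" by (rule G[OF i j])
  show "entry ks ps d (matrix_cmp \<C> ks ls ps m n g f) i j = entry ls ps m g i 0 \<cdot> entry ks ls n f 0 j"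
    if "length ls = 1"
  proof -
    have "matrix_cmp \<C> ks ls ps m n g f i j = ?t i j 0"
      using e[OF i j] t(1)[OF i j, of 0] that by (simp add: lessThan_Suc)
    then show ?thesis using t(2)[OF i j, of 0] that by (simp add: entry_def)
  qed
  show "entry ks ps d (matrix_cmp \<C> ks ls ps m n g f) i j =
      entry ls ps m g i 0 \<cdot> entry ks ls n f 0 j \<uplus> entry ls ps m g i 1 \<cdot> entry ks ls n f 1 j"
    if "length ls = 2"
  proof -
    have "matrix_cmp \<C> ks ls ps m n g f i j = ?t i j 1 \<oplus>\<^bsub>?H i j\<^esub> ?t i j 0"
      using e[OF i j] t(1)[OF i j, of 0] t(1)[OF i j, of 1] that by (simp add: numeral_2_eq_2 lessThan_Suc)
    then show ?thesis
      using t[OF i j, of 0] t[OF i j, of 1] that part_Obj(1)[OF obj(1,3) j] part_Obj(2)[OF obj(1,3) i]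
      by (simp add: entry_def[of ks ps] arr_ops add_commute)
  qed
qed

subsection \<open>Entries of morphisms of twisted complexes\<close>

abbreviation Pre where "Pre \<equiv> pretr \<C>"

lemma Pre_simps [simp]:
  "Obj Pre = twisted_complexes \<C>" "Hom Pre K L n = matrix_hom \<C> (parts K) (parts L) n"
  "cmp Pre K L M m n = matrix_cmp \<C> (parts K) (parts L) (parts M) m n"
  by (simp_all add: pretr_def)

text \<open>The typing of a twist, which makes the entries of the differential sums of composites of
  arrows.\<close>

definition graded_twist :: "('o, 'm) twisted \<Rightarrow> bool" where
  "graded_twist K \<longleftrightarrow> fst ` set (parts K) \<subseteq> Obj \<C> \<and>
     twist K \<in> carrier (matrix_hom \<C> (parts K) (parts K) (- 1))"

lemma graded_twistD:
  assumes "graded_twist K"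
  shows "fst ` set (parts K) \<subseteq> Obj \<C>" "twist K \<in> carrier (matrix_hom \<C> (parts K) (parts K) (- 1))"
  using assms by (simp_all add: graded_twist_def)

abbreviation pentry where "pentry K L \<equiv> entry (parts K) (parts L)"

lemma entry_pretr_dif:
  assumes K: "graded_twist K" and L: "graded_twist L"
    and f: "f \<in> carrier (matrix_hom \<C> (parts K) (parts L) n)"
  shows "dif Pre K L n f \<in> carrier (matrix_hom \<C> (parts K) (parts L) (n - 1))"
    and "i < length (parts L) \<Longrightarrow> j < length (parts K) \<Longrightarrow>
      pentry K L (n - 1) (dif Pre K L n f) i j =
      \<epsilon> (snd (parts L ! i)) (\<delta> (pentry K L n f i j)) \<uplus>
      pentry K L (n - 1) (matrix_cmp \<C> (parts K) (parts L) (parts L) (- 1) n (twist L) f) i j \<uplus>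
      \<sim> (\<epsilon> n (pentry K L (n - 1) (matrix_cmp \<C> (parts K) (parts K) (parts L) n (- 1) f (twist K)) i j))"
proof -
  let ?M = "matrix_hom \<C> (parts K) (parts L) (n - 1)"
  note K' = graded_twistD[OF K] and L' = graded_twistD[OF L]
  interpret M: abelian_group ?M by (rule matrix_hom_abelian_group[OF K'(1) L'(1)])
  let ?a = "matrix_dif \<C> (parts K) (parts L) n f"
  let ?b = "matrix_cmp \<C> (parts K) (parts L) (parts L) (- 1) n (twist L) f"
  let ?c = "matrix_cmp \<C> (parts K) (parts K) (parts L) n (- 1) f (twist K)"
  have d: "dif Pre K L n f = ?a \<oplus>\<^bsub>?M\<^esub> ?b \<oplus>\<^bsub>?M\<^esub> \<ominus>\<^bsub>?M\<^esub> (signed ?M n ?c)"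
    by (simp add: pretr_def Let_def a_minus_def)
  have c: "?a \<in> carrier ?M" "?b \<in> carrier ?M" "?c \<in> carrier ?M"
    using entry_matrix_dif(1)[OF K'(1) L'(1) f] entry_matrix_cmp(1)[OF K'(1) L'(1) L'(1) f L'(2), of "n - 1"]
      entry_matrix_cmp(1)[OF K'(1) K'(1) L'(1) K'(2) f, of "n - 1"] by simp_all
  note s = signed_closed[OF K'(1) L'(1) c(3), of n]
  show "dif Pre K L n f \<in> carrier ?M" unfolding d using c s by simp
  assume ij: "i < length (parts L)" "j < length (parts K)"
  show "pentry K L (n - 1) (dif Pre K L n f) i j =
      \<epsilon> (snd (parts L ! i)) (\<delta> (pentry K L n f i j)) \<uplus> pentry K L (n - 1) ?b i j \<uplus>
      \<sim> (\<epsilon> n (pentry K L (n - 1) ?c i j))"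
    unfolding d using c s ij entry_matrix_dif(2)[OF K'(1) L'(1) f ij]
    by (simp add: entry_add[OF K'(1) L'(1)] entry_neg[OF K'(1) L'(1)] entry_signed[OF K'(1) L'(1)])
qed

lemma pretr_cycle_entry:
  assumes K: "graded_twist K" and L: "graded_twist L" and f: "f \<in> cycles Pre K L n"
    and ij: "i < length (parts L)" "j < length (parts K)"
  shows "f \<in> carrier (matrix_hom \<C> (parts K) (parts L) n)"
    and "pentry K L (n - 1) (dif Pre K L n f) i j =
      \<o> (fst (parts K ! j)) (fst (parts L ! i)) (n - 1 + snd (parts K ! j) - snd (parts L ! i))"
  using f entry_zero[OF graded_twistD(1)[OF K] graded_twistD(1)[OF L] ij, of "n - 1"] by (auto simp: cycles_def)

lemma pretr_dif_zero_entry: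
  assumes K: "graded_twist K" and L: "graded_twist L"
    and len: "length (parts K) \<in> {1, 2}" "length (parts L) \<in> {1, 2}"
    and ij: "i < length (parts L)" "j < length (parts K)"
  shows "pentry K L (n - 1) (dif Pre K L n \<zero>\<^bsub>matrix_hom \<C> (parts K) (parts L) n\<^esub>) i j =
    \<o> (fst (parts K ! j)) (fst (parts L ! i)) (n - 1 + snd (parts K ! j) - snd (parts L ! i))"
proof -
  note K' = graded_twistD[OF K] and L' = graded_twistD[OF L]
  let ?z = "\<zero>\<^bsub>matrix_hom \<C> (parts K) (parts L) n\<^esub>"
  let ?o = "\<o> (fst (parts K ! j)) (fst (parts L ! i)) (n - 1 + snd (parts K ! j) - snd (parts L ! i))"
  interpret M: abelian_group "matrix_hom \<C> (parts K) (parts L) n"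
    by (rule matrix_hom_abelian_group[OF K'(1) L'(1)])
  note z = M.zero_closed
  have o: "?o \<uplus> ?o = ?o" by simp
  have 1: "pentry L L (- 1) (twist L) i l \<cdot> pentry K L n ?z l j = ?o" if "l < length (parts L)" for l
    using comp_zero_right[OF entry_in_hom(1)[OF L'(1) L'(1) L'(2) ij(1) that] part_Obj(1)[OF K'(1) L'(1) ij(2)]]
    by (simp add: entry_zero[OF K'(1) L'(1) that ij(2)] algebra_simps)
  have 2: "pentry K L n ?z i l \<cdot> pentry K K (- 1) (twist K) l j = ?o" if "l < length (parts K)" for l
    using comp_zero_left[OF entry_in_hom(1)[OF K'(1) K'(1) K'(2) that ij(2)] part_Obj(2)[OF K'(1) L'(1) ij(1)]]
    by (simp add: entry_zero[OF K'(1) L'(1) ij(1) that] algebra_simps)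
  have "pentry K L (n - 1) (matrix_cmp \<C> (parts K) (parts L) (parts L) (- 1) n (twist L) ?z) i j = ?o"
    using entry_matrix_cmp(2,3)[OF K'(1) L'(1) L'(1) z L'(2), of "n - 1" i j] len(2) ij 1[of 0] 1[of 1] o by auto
  moreover have "pentry K L (n - 1) (matrix_cmp \<C> (parts K) (parts K) (parts L) n (- 1) ?z (twist K)) i j = ?o"
    using entry_matrix_cmp(2,3)[OF K'(1) K'(1) L'(1) K'(2) z, of "n - 1" i j] len(1) ij 2[of 0] 2[of 1] o by auto
  moreover have "\<epsilon> (snd (parts L ! i)) (\<delta> (pentry K L n ?z i j)) = ?o"
    by (simp add: entry_zero[OF K'(1) L'(1) ij] algebra_simps)
  ultimately show ?thesis
    unfolding entry_pretr_dif(2)[OF K L z ij] by simp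
qed

text \<open>Equal homology classes in \<open>\<C>\<^sup>p\<^sup>r\<^sup>e\<^sup>t\<^sup>r\<close> yield a homotopy, entry by entry. To know that \<open>f\<close>
  lies in its own coset one uses that \<open>d 0 = 0\<close>, by the previous lemma.\<close>

lemma pretr_hclass_eq:
  assumes K: "graded_twist K" and L: "graded_twist L"
    and f: "f \<in> carrier (matrix_hom \<C> (parts K) (parts L) 0)"
      "f' \<in> carrier (matrix_hom \<C> (parts K) (parts L) 0)"
    and len: "length (parts K) \<in> {1, 2}" "length (parts L) \<in> {1, 2}"
    and eq: "hclass Pre K L 0 f = hclass Pre K L 0 f'"
  obtains y where "y \<in> carrier (matrix_hom \<C> (parts K) (parts L) 1)"
    "\<And>i j. i < length (parts L) \<Longrightarrow> j < length (parts K) \<Longrightarrow>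
      pentry K L 0 f i j = pentry K L 0 (dif Pre K L 1 y) i j \<uplus> pentry K L 0 f' i j"
proof -
  let ?M = "matrix_hom \<C> (parts K) (parts L) 0"
  note K' = graded_twistD[OF K] and L' = graded_twistD[OF L]
  interpret M: abelian_group ?M by (rule matrix_hom_abelian_group[OF K'(1) L'(1)])
  interpret M1: abelian_group "matrix_hom \<C> (parts K) (parts L) 1"
    by (rule matrix_hom_abelian_group[OF K'(1) L'(1)])
  let ?z = "dif Pre K L 1 \<zero>\<^bsub>matrix_hom \<C> (parts K) (parts L) 1\<^esub>"
  have z: "?z \<in> carrier ?M" using entry_pretr_dif(1)[OF K L M1.zero_closed] by simp
  have "?z \<in> boundaries Pre K L 0"
    unfolding boundaries_def by (rule image_eqI[of _ _ "\<zero>\<^bsub>matrix_hom \<C> (parts K) (parts L) 1\<^esub>"]) simp_all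
  then have "?z \<oplus>\<^bsub>?M\<^esub> f \<in> hclass Pre K L 0 f"
    by (auto simp: hclass_def a_r_coset_def')
  then obtain y where y: "y \<in> carrier (matrix_hom \<C> (parts K) (parts L) 1)"
    "?z \<oplus>\<^bsub>?M\<^esub> f = dif Pre K L 1 y \<oplus>\<^bsub>?M\<^esub> f'"
    unfolding eq by (auto simp: hclass_def a_r_coset_def' boundaries_def)
  have dy: "dif Pre K L 1 y \<in> carrier ?M" using entry_pretr_dif(1)[OF K L y(1)] by simp
  show thesis
  proof (rule that[OF y(1)])
    fix i j assume ij: "i < length (parts L)" "j < length (parts K)"
    have "pentry K L 0 f i j = pentry K L 0 (?z \<oplus>\<^bsub>?M\<^esub> f) i j"
      using pretr_dif_zero_entry[OF K L len ij, of 1] entry_in_hom(1)[OF K'(1) L'(1) f(1) ij] z f ij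
      by (simp add: entry_add[OF K'(1) L'(1)])
    also have "\<dots> = pentry K L 0 (dif Pre K L 1 y) i j \<uplus> pentry K L 0 f' i j"
      unfolding y(2) using dy f ij by (simp add: entry_add[OF K'(1) L'(1)])
    finally show "pentry K L 0 f i j = pentry K L 0 (dif Pre K L 1 y) i j \<uplus> pentry K L 0 f' i j" .
  qed
qed

subsection \<open>Shifts and cones\<close>

lemma zero_comp': "a \<in> hom X Y n \<Longrightarrow> Z \<in> Obj \<C> \<Longrightarrow> d = m + n \<Longrightarrow> \<o> Y Z m \<cdot> a = \<o> X Z d"
  by (simp add: comp_zero_left)

lemma comp_zero': "b \<in> hom Y Z m \<Longrightarrow> X \<in> Obj \<C> \<Longrightarrow> d = m + n \<Longrightarrow> b \<cdot> \<o> X Y n = \<o> X Z d"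
  by (simp add: comp_zero_right)

lemma parts_shifted [simp]: "parts (shifted \<C> r X) = [(X, r)]"
  by (simp add: shifted_def)

lemma parts_cone [simp]: "parts (cone \<C> A B x) = [(B, 0), (A, 1)]"
  by (simp add: cone_def Let_def)

lemma graded_twist_shifted: "X \<in> Obj \<C> \<Longrightarrow> graded_twist (shifted \<C> r X)"
  unfolding graded_twist_def
  by (auto simp: matrix_hom_carrier shifted_def shift_hom_def matrix_def fun_eq_iff)

lemma graded_twist_cone:
  assumes "A \<in> Obj \<C>" "B \<in> Obj \<C>" "x \<in> carrier (Hom \<C> A B 0)"
  shows "graded_twist (cone \<C> A B x)"
proof -
  have "{i. i < Suc (Suc 0)} = {0, 1}" by auto
  then show ?thesis using assms unfolding graded_twist_def
    by (auto simp: matrix_hom_carrier cone_def Let_def shift_hom_def matrix_def fun_eq_iff less_Suc_eq)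
qed

lemma entry_twist:
  "X \<in> Obj \<C> \<Longrightarrow> entry [(X, r)] [(X, r)] (- 1) (twist (shifted \<C> r X)) 0 0 = \<o> X X (- 1)"
  "entry [(B, 0), (A, 1)] [(B, 0), (A, 1)] (- 1) (twist (cone \<C> A B x)) 0 0 = \<o> B B (- 1)"
  "entry [(B, 0), (A, 1)] [(B, 0), (A, 1)] (- 1) (twist (cone \<C> A B x)) 0 (Suc 0) = arr \<C> A B 0 x"
  "entry [(B, 0), (A, 1)] [(B, 0), (A, 1)] (- 1) (twist (cone \<C> A B x)) (Suc 0) 0 = \<o> B A (- 2)"
  "entry [(B, 0), (A, 1)] [(B, 0), (A, 1)] (- 1) (twist (cone \<C> A B x)) (Suc 0) (Suc 0) = \<o> A A (- 1)"
  by (simp_all add: entry_def shifted_def cone_def Let_def matrix_def shift_hom_def arr_zero)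

text \<open>Shifts have zero twist, so only the sign of the target shift remains.\<close>

lemma pretr_dif_shifted_shifted:
  assumes XY: "X \<in> Obj \<C>" "Y \<in> Obj \<C>" and f: "f \<in> carrier (matrix_hom \<C> [(X, r)] [(Y, s)] n)"
  shows "entry [(X, r)] [(Y, s)] (n - 1) (dif Pre (shifted \<C> r X) (shifted \<C> s Y) n f) 0 0 =
    \<epsilon> s (\<delta> (entry [(X, r)] [(Y, s)] n f 0 0))"
proof -
  note K = graded_twist_shifted[OF XY(1), of r] and L = graded_twist_shifted[OF XY(2), of s]
  let ?e = "entry [(X, r)] [(Y, s)] n f 0 0"
  have e: "?e \<in> hom X Y (n + r - s)" using entry_in_hom(1)[of "[(X, r)]" "[(Y, s)]" f n 0 0] XY f by simp
  have d: "\<epsilon> s (\<delta> ?e) \<in> hom X Y (n + r - s - 1)" using e by auto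
  have z: "\<o> Y Y (- 1) \<cdot> ?e = \<o> X Y (n + r - s - 1)" "?e \<cdot> \<o> X X (- 1) = \<o> X Y (n + r - s - 1)"
    using zero_comp'[OF e XY(2)] comp_zero'[OF e XY(1)] by simp_all
  show ?thesis
    using XY f K L d z entry_pretr_dif(2)[OF K L, of f n 0 0]
      entry_matrix_cmp(2)[of "[(X, r)]" "[(Y, s)]" "[(Y, s)]" f n "twist (shifted \<C> s Y)" "- 1" "n - 1" 0 0]
      entry_matrix_cmp(2)[of "[(X, r)]" "[(X, r)]" "[(Y, s)]" "twist (shifted \<C> r X)" "- 1" f n "n - 1" 0 0]
      graded_twistD(2)[OF K] graded_twistD(2)[OF L]
    by (simp add: entry_twist)
qed

text \<open>The twist \<open>x : \<Sigma>A \<rightarrow> B\<close> of the cone feeds the second component into the first; the sign of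
  the second component is that of the shift \<open>\<Sigma>A\<close>.\<close>

lemma pretr_dif_shifted_cone:
  assumes obj: "X \<in> Obj \<C>" "A \<in> Obj \<C>" "B \<in> Obj \<C>" and x: "x \<in> carrier (Hom \<C> A B 0)"
    and f: "f \<in> carrier (matrix_hom \<C> [(X, 0)] [(B, 0), (A, 1)] n)"
  shows "entry [(X, 0)] [(B, 0), (A, 1)] n f 0 0 \<in> hom X B n"
    "entry [(X, 0)] [(B, 0), (A, 1)] n f (Suc 0) 0 \<in> hom X A (n - 1)"
    "entry [(X, 0)] [(B, 0), (A, 1)] (n - 1) (dif Pre (shifted \<C> 0 X) (cone \<C> A B x) n f) 0 0 =
    \<delta> (entry [(X, 0)] [(B, 0), (A, 1)] n f 0 0) \<uplus> arr \<C> A B 0 x \<cdot> entry [(X, 0)] [(B, 0), (A, 1)] n f (Suc 0) 0"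
    "entry [(X, 0)] [(B, 0), (A, 1)] (n - 1) (dif Pre (shifted \<C> 0 X) (cone \<C> A B x) n f) (Suc 0) 0 =
    \<sim> (\<delta> (entry [(X, 0)] [(B, 0), (A, 1)] n f (Suc 0) 0))"
proof -
  note K = graded_twist_shifted[OF obj(1), of 0] and L = graded_twist_cone[OF obj(2,3) x]
  let ?k = "[(X, 0)]" and ?l = "[(B, 0), (A, 1)]"
  let ?e0 = "entry ?k ?l n f 0 0" and ?e1 = "entry ?k ?l n f (Suc 0) 0"
  show e: "?e0 \<in> hom X B n" "?e1 \<in> hom X A (n - 1)"
    using entry_in_hom(1)[of ?k ?l f n 0 0] entry_in_hom(1)[of ?k ?l f n 1 0] obj f by simp_all
  have ax: "arr \<C> A B 0 x \<in> hom A B 0" using obj x by auto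
  have t: "arr \<C> A B 0 x \<cdot> ?e1 \<in> hom X B (n - 1)" using cmp_typed[OF ax e(2)] by simp
  have d: "\<delta> ?e0 \<in> hom X B (n - 1)" "\<sim> (\<delta> ?e1) \<in> hom X A (n - 2)"
    using dif_in_hom[OF e(1)] neg_in_hom[OF dif_in_hom[OF e(2)]] by simp_all
  have dt: "\<delta> ?e0 \<uplus> arr \<C> A B 0 x \<cdot> ?e1 \<in> hom X B (n - 1)" using d t by auto
  have z: "\<o> B B (- 1) \<cdot> ?e0 = \<o> X B (n - 1)" "?e0 \<cdot> \<o> X X (- 1) = \<o> X B (n - 1)"
    "\<o> B A (- 2) \<cdot> ?e0 = \<o> X A (n - 2)" "\<o> A A (- 1) \<cdot> ?e1 = \<o> X A (n - 2)" "?e1 \<cdot> \<o> X X (- 1) = \<o> X A (n - 2)"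
    using zero_comp'[OF e(1)] comp_zero'[OF e(1) obj(1)] zero_comp'[OF e(2)] comp_zero'[OF e(2) obj(1)] obj by simp_all
  note facts = graded_twistD(2)[OF K] graded_twistD(2)[OF L] f obj
  note c1 = entry_matrix_cmp(3)[of ?k ?l ?l f n "twist (cone \<C> A B x)" "- 1" "n - 1" _ 0]
  note c2 = entry_matrix_cmp(2)[of ?k ?k ?l "twist (shifted \<C> 0 X)" "- 1" f n "n - 1" _ 0]
  show "entry ?k ?l (n - 1) (dif Pre (shifted \<C> 0 X) (cone \<C> A B x) n f) 0 0 =
      \<delta> ?e0 \<uplus> arr \<C> A B 0 x \<cdot> ?e1"
    using facts d t dt z entry_pretr_dif(2)[OF K L, of f n 0 0] c1[of 0] c2[of 0] by (simp add: entry_twist)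
  show "entry ?k ?l (n - 1) (dif Pre (shifted \<C> 0 X) (cone \<C> A B x) n f) (Suc 0) 0 = \<sim> (\<delta> ?e1)"
    using facts d z entry_pretr_dif(2)[OF K L, of f n 1 0] c1[of 1] c2[of 1] by (simp add: entry_twist)
qed

lemma pretr_dif_cone_shifted:
  assumes obj: "Y \<in> Obj \<C>" "A \<in> Obj \<C>" "B \<in> Obj \<C>" and x: "x \<in> carrier (Hom \<C> A B 0)"
    and f: "f \<in> carrier (matrix_hom \<C> [(B, 0), (A, 1)] [(Y, 0)] n)"
  shows "entry [(B, 0), (A, 1)] [(Y, 0)] n f 0 0 \<in> hom B Y n"
    "entry [(B, 0), (A, 1)] [(Y, 0)] n f 0 (Suc 0) \<in> hom A Y (n + 1)"
    "entry [(B, 0), (A, 1)] [(Y, 0)] (n - 1) (dif Pre (cone \<C> A B x) (shifted \<C> 0 Y) n f) 0 0 =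
    \<delta> (entry [(B, 0), (A, 1)] [(Y, 0)] n f 0 0)"
    "entry [(B, 0), (A, 1)] [(Y, 0)] (n - 1) (dif Pre (cone \<C> A B x) (shifted \<C> 0 Y) n f) 0 (Suc 0) =
    \<delta> (entry [(B, 0), (A, 1)] [(Y, 0)] n f 0 (Suc 0)) \<uplus>
    \<sim> (\<epsilon> n (entry [(B, 0), (A, 1)] [(Y, 0)] n f 0 0 \<cdot> arr \<C> A B 0 x))"
proof -
  note L = graded_twist_shifted[OF obj(1), of 0] and K = graded_twist_cone[OF obj(2,3) x]
  let ?l = "[(Y, 0)]" and ?k = "[(B, 0), (A, 1)]"
  let ?e0 = "entry ?k ?l n f 0 0" and ?e1 = "entry ?k ?l n f 0 (Suc 0)"
  show e: "?e0 \<in> hom B Y n" "?e1 \<in> hom A Y (n + 1)"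
    using entry_in_hom(1)[of ?k ?l f n 0 0] entry_in_hom(1)[of ?k ?l f n 0 1] obj f by simp_all
  have ax: "arr \<C> A B 0 x \<in> hom A B 0" using obj x by auto
  have t: "?e0 \<cdot> arr \<C> A B 0 x \<in> hom A Y n" using cmp_typed[OF e(1) ax] by simp
  have d: "\<delta> ?e0 \<in> hom B Y (n - 1)" "\<delta> ?e1 \<in> hom A Y n" using e by auto
  have z: "\<o> Y Y (- 1) \<cdot> ?e0 = \<o> B Y (n - 1)" "?e0 \<cdot> \<o> B B (- 1) = \<o> B Y (n - 1)"
    "?e1 \<cdot> \<o> B A (- 2) = \<o> B Y (n - 1)" "\<o> Y Y (- 1) \<cdot> ?e1 = \<o> A Y n" "?e1 \<cdot> \<o> A A (- 1) = \<o> A Y n"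
    using zero_comp'[OF e(1) obj(1)] comp_zero'[OF e(1)] zero_comp'[OF e(2) obj(1)] comp_zero'[OF e(2)] obj by simp_all
  note facts = graded_twistD(2)[OF K] graded_twistD(2)[OF L] f obj
  note c1 = entry_matrix_cmp(2)[of ?k ?l ?l f n "twist (shifted \<C> 0 Y)" "- 1" "n - 1" 0]
  note c2 = entry_matrix_cmp(3)[of ?k ?k ?l "twist (cone \<C> A B x)" "- 1" f n "n - 1" 0]
  show "entry ?k ?l (n - 1) (dif Pre (cone \<C> A B x) (shifted \<C> 0 Y) n f) 0 0 = \<delta> ?e0"
    using facts d z entry_pretr_dif(2)[OF K L, of f n 0 0] c1[of 0] c2[of 0] by (simp add: entry_twist)
  show "entry ?k ?l (n - 1) (dif Pre (cone \<C> A B x) (shifted \<C> 0 Y) n f) 0 (Suc 0) =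
      \<delta> ?e1 \<uplus> \<sim> (\<epsilon> n (?e0 \<cdot> arr \<C> A B 0 x))"
    using facts d t z entry_pretr_dif(2)[OF K L, of f n 0 1] c1[of 1] c2[of 1] by (simp add: entry_twist)
qed

text \<open>The entry from \<open>\<Sigma>A\<close> to \<open>B\<close> is omitted: it would describe a homotopy between composites of
  degree \<open>1\<close>, while a contracted triangle records those of degrees \<open>0\<close> and \<open>-1\<close>.\<close>

lemma pretr_dif_cone_cone:
  assumes obj: "A \<in> Obj \<C>" "B \<in> Obj \<C>" and x: "x \<in> carrier (Hom \<C> A B 0)"
    and f: "f \<in> carrier (matrix_hom \<C> [(B, 0), (A, 1)] [(B, 0), (A, 1)] 1)"
  defines "e \<equiv> entry [(B, 0), (A, 1)] [(B, 0), (A, 1)] 1 f"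
    and "d \<equiv> entry [(B, 0), (A, 1)] [(B, 0), (A, 1)] 0 (dif Pre (cone \<C> A B x) (cone \<C> A B x) 1 f)"
  shows "e 0 0 \<in> hom B B 1" "e (Suc 0) 0 \<in> hom B A 0" "e (Suc 0) (Suc 0) \<in> hom A A 1"
    "d 0 0 = \<delta> (e 0 0) \<uplus> arr \<C> A B 0 x \<cdot> e (Suc 0) 0"
    "d (Suc 0) 0 = \<sim> (\<delta> (e (Suc 0) 0))"
    "d (Suc 0) (Suc 0) = \<sim> (\<delta> (e (Suc 0) (Suc 0))) \<uplus> e (Suc 0) 0 \<cdot> arr \<C> A B 0 x"
proof -
  note K = graded_twist_cone[OF obj x]
  let ?k = "[(B, 0), (A, 1)]"
  show e: "e 0 0 \<in> hom B B 1" "e (Suc 0) 0 \<in> hom B A 0" "e (Suc 0) (Suc 0) \<in> hom A A 1"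
    using entry_in_hom(1)[of ?k ?k f 1 0 0] entry_in_hom(1)[of ?k ?k f 1 1 0] entry_in_hom(1)[of ?k ?k f 1 1 1] obj f
    by (simp_all add: e_def)
  have e': "e 0 (Suc 0) \<in> hom A B 2"
    using entry_in_hom(1)[of ?k ?k f 1 0 1] obj f by (simp add: e_def)
  have ax: "arr \<C> A B 0 x \<in> hom A B 0" using obj x by auto
  have t: "arr \<C> A B 0 x \<cdot> e (Suc 0) 0 \<in> hom B B 0" "e (Suc 0) 0 \<cdot> arr \<C> A B 0 x \<in> hom A A 0"
    using cmp_typed[OF ax e(2)] cmp_typed[OF e(2) ax] by simp_all
  have dd: "\<delta> (e 0 0) \<in> hom B B 0" "\<sim> (\<delta> (e (Suc 0) 0)) \<in> hom B A (- 1)" "\<sim> (\<delta> (e (Suc 0) (Suc 0))) \<in> hom A A 0"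
    using dif_in_hom[OF e(1)] neg_in_hom[OF dif_in_hom[OF e(2)]] neg_in_hom[OF dif_in_hom[OF e(3)]] by simp_all
  have dt: "\<delta> (e 0 0) \<uplus> arr \<C> A B 0 x \<cdot> e (Suc 0) 0 \<in> hom B B 0"
    "\<sim> (\<delta> (e (Suc 0) (Suc 0))) \<uplus> e (Suc 0) 0 \<cdot> arr \<C> A B 0 x \<in> hom A A 0"
    using dd t by auto
  have z: "\<o> B B (- 1) \<cdot> e 0 0 = \<o> B B 0" "e 0 0 \<cdot> \<o> B B (- 1) = \<o> B B 0" "e 0 (Suc 0) \<cdot> \<o> B A (- 2) = \<o> B B 0"
    "\<o> B A (- 2) \<cdot> e 0 0 = \<o> B A (- 1)" "\<o> A A (- 1) \<cdot> e (Suc 0) 0 = \<o> B A (- 1)"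
    "e (Suc 0) 0 \<cdot> \<o> B B (- 1) = \<o> B A (- 1)" "e (Suc 0) (Suc 0) \<cdot> \<o> B A (- 2) = \<o> B A (- 1)"
    "\<o> B A (- 2) \<cdot> e 0 (Suc 0) = \<o> A A 0" "\<o> A A (- 1) \<cdot> e (Suc 0) (Suc 0) = \<o> A A 0"
    "e (Suc 0) (Suc 0) \<cdot> \<o> A A (- 1) = \<o> A A 0"
    using zero_comp'[OF e(1)] comp_zero'[OF e(1)] zero_comp'[OF e(2)] comp_zero'[OF e(2)]
      zero_comp'[OF e(3)] comp_zero'[OF e(3)] zero_comp'[OF e'] comp_zero'[OF e'] obj by simp_all
  note facts = graded_twistD(2)[OF K] f obj
  note c1 = entry_matrix_cmp(3)[of ?k ?k ?k f 1 "twist (cone \<C> A B x)" "- 1" 0]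
  note c2 = entry_matrix_cmp(3)[of ?k ?k ?k "twist (cone \<C> A B x)" "- 1" f 1 0]
  show "d 0 0 = \<delta> (e 0 0) \<uplus> arr \<C> A B 0 x \<cdot> e (Suc 0) 0"
    using facts dd t dt z entry_pretr_dif(2)[OF K K, of f 1 0 0] c1[of 0 0] c2[of 0 0]
    by (simp add: entry_twist e_def d_def)
  show "d (Suc 0) 0 = \<sim> (\<delta> (e (Suc 0) 0))"
    using facts dd z entry_pretr_dif(2)[OF K K, of f 1 1 0] c1[of 1 0] c2[of 1 0]
    by (simp add: entry_twist e_def d_def)
  show "d (Suc 0) (Suc 0) = \<sim> (\<delta> (e (Suc 0) (Suc 0))) \<uplus> e (Suc 0) 0 \<cdot> arr \<C> A B 0 x"
    using facts dd t dt z entry_pretr_dif(2)[OF K K, of f 1 1 1] c1[of 1 1] c2[of 1 1]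
    by (simp add: entry_twist e_def d_def)
qed

section \<open>From exact triangles to contracted triangles\<close>

lemma h0_isoE:
  assumes "h0_iso \<C> X Y a"
  obtains a' \<mu> \<nu> where "X \<in> Obj \<C>" "Y \<in> Obj \<C>"
    "arr \<C> X Y 0 a \<in> hom X Y 0" "\<delta> (arr \<C> X Y 0 a) = \<o> X Y (- 1)"
    "a' \<in> hom Y X 0" "\<delta> a' = \<o> Y X (- 1)"
    "\<mu> \<in> hom X X 1" "a' \<cdot> arr \<C> X Y 0 a = \<i> X \<uplus> \<delta> \<mu>"
    "\<nu> \<in> hom Y Y 1" "arr \<C> X Y 0 a \<cdot> a' = \<i> Y \<uplus> \<delta> \<nu>"
proof -
  from assms obtain b where XY: "X \<in> Obj \<C>" "Y \<in> Obj \<C>" and a: "a \<in> cycles \<C> X Y 0" and b: "b \<in> cycles \<C> Y X 0"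
    and h: "hclass \<C> X X 0 (cmp \<C> X Y X 0 0 b a) = hclass \<C> X X 0 (idt \<C> X)"
      "hclass \<C> Y Y 0 (cmp \<C> Y X Y 0 0 a b) = hclass \<C> Y Y 0 (idt \<C> Y)"
    unfolding h0_iso_def by blast
  have ab: "a \<in> carrier (Hom \<C> X Y 0)" "b \<in> carrier (Hom \<C> Y X 0)"
    "\<delta> (arr \<C> X Y 0 a) = \<o> X Y (- 1)" "\<delta> (arr \<C> Y X 0 b) = \<o> Y X (- 1)"
    using a b XY by (simp_all add: cycles_iff)
  obtain \<mu> where "\<mu> \<in> hom X X 1" "arr \<C> X X 0 (cmp \<C> X Y X 0 0 b a) = \<delta> \<mu> \<uplus> arr \<C> X X 0 (idt \<C> X)"
    using h(1) ab XY by (subst (asm) hclass_eq_iff) auto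
  moreover obtain \<nu> where "\<nu> \<in> hom Y Y 1" "arr \<C> Y Y 0 (cmp \<C> Y X Y 0 0 a b) = \<delta> \<nu> \<uplus> arr \<C> Y Y 0 (idt \<C> Y)"
    using h(2) ab XY by (subst (asm) hclass_eq_iff) auto
  ultimately show thesis
    using ab XY by (intro that[of "arr \<C> Y X 0 b" \<mu> \<nu>]) (auto simp: arr_ops arr_idt add_commute)
qed

lemma idt_pretr_entry:
  assumes "fst ` set (parts K) \<subseteq> Obj \<C>"
  shows "idt Pre K \<in> carrier (matrix_hom \<C> (parts K) (parts K) 0)"
    and "i < length (parts K) \<Longrightarrow> j < length (parts K) \<Longrightarrow>
      pentry K K 0 (idt Pre K) i j = (if i = j then \<i> (fst (parts K ! i))
        else \<o> (fst (parts K ! j)) (fst (parts K ! i)) (snd (parts K ! j) - snd (parts K ! i)))"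
proof -
  have obj: "i < length (parts K) \<Longrightarrow> fst (parts K ! i) \<in> Obj \<C>" for i
    using assms by (metis image_subset_iff nth_mem)
  then show "idt Pre K \<in> carrier (matrix_hom \<C> (parts K) (parts K) 0)"
    unfolding matrix_hom_carrier[OF assms assms]
    by (auto simp: pretr_def matrix_def fun_eq_iff shift_hom_def split_beta)
  show "i < length (parts K) \<Longrightarrow> j < length (parts K) \<Longrightarrow>
      pentry K K 0 (idt Pre K) i j = (if i = j then \<i> (fst (parts K ! i))
        else \<o> (fst (parts K ! j)) (fst (parts K ! i)) (snd (parts K ! j) - snd (parts K ! i)))"
    by (simp add: pretr_def entry_def matrix_def shift_hom_def split_beta arr_idt arr_zero)
qed

lemma pretr_h0_isoE:
  assumes "h0_iso Pre K L c" and K: "graded_twist K" "length (parts K) \<in> {1, 2}"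
    and L: "graded_twist L" "length (parts L) \<in> {1, 2}"
  obtains b y z where
    "c \<in> carrier (matrix_hom \<C> (parts K) (parts L) 0)" "b \<in> carrier (matrix_hom \<C> (parts L) (parts K) 0)"
    "y \<in> carrier (matrix_hom \<C> (parts K) (parts K) 1)" "z \<in> carrier (matrix_hom \<C> (parts L) (parts L) 1)"
    "\<And>i j. i < length (parts L) \<Longrightarrow> j < length (parts K) \<Longrightarrow> pentry K L (- 1) (dif Pre K L 0 c) i j =
      \<o> (fst (parts K ! j)) (fst (parts L ! i)) (- 1 + snd (parts K ! j) - snd (parts L ! i))"
    "\<And>i j. i < length (parts K) \<Longrightarrow> j < length (parts L) \<Longrightarrow> pentry L K (- 1) (dif Pre L K 0 b) i j =
      \<o> (fst (parts L ! j)) (fst (parts K ! i)) (- 1 + snd (parts L ! j) - snd (parts K ! i))"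
    "\<And>i j. i < length (parts K) \<Longrightarrow> j < length (parts K) \<Longrightarrow>
      pentry K K 0 (matrix_cmp \<C> (parts K) (parts L) (parts K) 0 0 b c) i j =
      pentry K K 0 (dif Pre K K 1 y) i j \<uplus> pentry K K 0 (idt Pre K) i j"
    "\<And>i j. i < length (parts L) \<Longrightarrow> j < length (parts L) \<Longrightarrow>
      pentry L L 0 (matrix_cmp \<C> (parts L) (parts K) (parts L) 0 0 c b) i j =
      pentry L L 0 (dif Pre L L 1 z) i j \<uplus> pentry L L 0 (idt Pre L) i j"
proof -
  from assms(1) obtain b where c: "c \<in> cycles Pre K L 0" and b: "b \<in> cycles Pre L K 0"
    and h: "hclass Pre K K 0 (matrix_cmp \<C> (parts K) (parts L) (parts K) 0 0 b c) = hclass Pre K K 0 (idt Pre K)"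
      "hclass Pre L L 0 (matrix_cmp \<C> (parts L) (parts K) (parts L) 0 0 c b) = hclass Pre L L 0 (idt Pre L)"
    unfolding h0_iso_def by auto
  have cb: "c \<in> carrier (matrix_hom \<C> (parts K) (parts L) 0)" "b \<in> carrier (matrix_hom \<C> (parts L) (parts K) 0)"
    using b c by (simp_all add: cycles_def)
  note K' = graded_twistD(1)[OF K(1)] and L' = graded_twistD(1)[OF L(1)]
  have m: "matrix_cmp \<C> (parts K) (parts L) (parts K) 0 0 b c \<in> carrier (matrix_hom \<C> (parts K) (parts K) 0)"
    "matrix_cmp \<C> (parts L) (parts K) (parts L) 0 0 c b \<in> carrier (matrix_hom \<C> (parts L) (parts L) 0)"
    using entry_matrix_cmp(1)[OF K' L' K' cb] entry_matrix_cmp(1)[OF L' K' L' cb(2,1)] by simp_all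
  obtain y where y: "y \<in> carrier (matrix_hom \<C> (parts K) (parts K) 1)"
    "\<And>i j. i < length (parts K) \<Longrightarrow> j < length (parts K) \<Longrightarrow>
      pentry K K 0 (matrix_cmp \<C> (parts K) (parts L) (parts K) 0 0 b c) i j =
      pentry K K 0 (dif Pre K K 1 y) i j \<uplus> pentry K K 0 (idt Pre K) i j"
    using pretr_hclass_eq[OF K(1) K(1) m(1) idt_pretr_entry(1)[OF K'] K(2) K(2) h(1)] by blast
  obtain z where z: "z \<in> carrier (matrix_hom \<C> (parts L) (parts L) 1)"
    "\<And>i j. i < length (parts L) \<Longrightarrow> j < length (parts L) \<Longrightarrow>
      pentry L L 0 (matrix_cmp \<C> (parts L) (parts K) (parts L) 0 0 c b) i j =
      pentry L L 0 (dif Pre L L 1 z) i j \<uplus> pentry L L 0 (idt Pre L) i j"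
    using pretr_hclass_eq[OF L(1) L(1) m(2) idt_pretr_entry(1)[OF L'] L(2) L(2) h(2)] by blast
  show thesis
    using that[OF cb y(1) z(1) _ _ y(2) z(2)]
      pretr_cycle_entry(2)[OF K(1) L(1) c] pretr_cycle_entry(2)[OF L(1) K(1) b] by simp
qed

text \<open>An isomorphism of \<open>Y\<close> with \<open>\<Sigma>X\<close> is a single entry, a homotopy equivalence \<open>Y \<rightarrow> X\<close> of degree
  \<open>-1\<close>.\<close>

lemma suspension_isoE:
  assumes X: "X \<in> Obj \<C>" and Y: "Y \<in> Obj \<C>" and iso: "h0_iso Pre (shifted \<C> 0 Y) (shifted \<C> 1 X) c"
  defines "a \<equiv> arr \<C> Y X (- 1) (c 0 0)"
  obtains a' \<mu> \<nu> where "c \<in> carrier (matrix_hom \<C> [(Y, 0)] [(X, 1)] 0)"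
    "a \<in> hom Y X (- 1)" "\<delta> a = \<o> Y X (- 2)" "a' \<in> hom X Y 1" "\<delta> a' = \<o> X Y 0"
    "\<mu> \<in> hom Y Y 1" "a' \<cdot> a = \<i> Y \<uplus> \<delta> \<mu>" "\<nu> \<in> hom X X 1" "a \<cdot> a' = \<i> X \<uplus> \<delta> \<nu>"
proof -
  show thesis
  proof (rule pretr_h0_isoE[OF iso graded_twist_shifted[OF Y] _ graded_twist_shifted[OF X]], goal_cases)
  case (3 b y z)
  let ?k = "[(Y, 0)]" and ?l = "[(X, 1)]"
  note c = 3(1)[simplified] and b = 3(2)[simplified] and y = 3(3)[simplified] and z = 3(4)[simplified]
  have a: "a = entry ?k ?l 0 c 0 0" by (simp add: a_def entry_def)
  define a' where "a' = entry ?l ?k 0 b 0 0"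
  have ty: "a \<in> hom Y X (- 1)" "a' \<in> hom X Y 1" "entry ?k ?k 1 y 0 0 \<in> hom Y Y 1" "entry ?l ?l 1 z 0 0 \<in> hom X X 1"
    using entry_in_hom(1)[of ?k ?l c 0 0 0] entry_in_hom(1)[of ?l ?k b 0 0 0]
      entry_in_hom(1)[of ?k ?k y 1 0 0] entry_in_hom(1)[of ?l ?l z 1 0 0] X Y c b y z by (simp_all add: a a'_def)
  have "\<sim> (\<delta> a) = \<o> Y X (- 2)"
    using 3(5)[of 0 0] pretr_dif_shifted_shifted[OF Y X c] by (simp add: a)
  then have "\<sim> (\<sim> (\<delta> a)) = \<o> Y X (- 2)" by (simp only: neg_zero)
  then have da: "\<delta> a = \<o> Y X (- 2)" by simp
  have da': "\<delta> a' = \<o> X Y 0"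
    using 3(6)[of 0 0] pretr_dif_shifted_shifted[OF X Y b] by (simp add: a'_def)
  have e1: "a' \<cdot> a = \<i> Y \<uplus> \<delta> (entry ?k ?k 1 y 0 0)"
    using 3(7)[of 0 0] pretr_dif_shifted_shifted[OF Y Y y] idt_pretr_entry(2)[of "shifted \<C> 0 Y" 0 0]
      entry_matrix_cmp(2)[of ?k ?l ?k c 0 b 0 0 0 0] X Y c b by (simp add: a a'_def add_commute)
  have e2: "a \<cdot> a' = \<i> X \<uplus> \<delta> (\<sim> (entry ?l ?l 1 z 0 0))"
    using 3(8)[of 0 0] pretr_dif_shifted_shifted[OF X X z] idt_pretr_entry(2)[of "shifted \<C> 1 X" 0 0]
      entry_matrix_cmp(2)[of ?l ?k ?l b 0 c 0 0 0 0] X Y c b by (simp add: a a'_def add_commute)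
  show ?case by (rule that[OF c ty(1) da ty(2) da' ty(3) e1 neg_in_hom[OF ty(4)] e2])
  qed simp_all
qed

text \<open>Let \<open>c = (c0, c1)\<close> be a homotopy equivalence \<open>C \<rightarrow> cone x\<close> with homotopy inverse \<open>(e0, e1)\<close>.
  That both are closed says, among others, \<open>d c0 = - x c1\<close> and \<open>d e1 = e0 x\<close>; so \<open>- c0\<close> and
  \<open>e1\<close> serve as \<open>t\<close> and \<open>h\<close>. The homotopy from \<open>e0 c0 + e1 c1\<close> to \<open>1\<close> is the relation at \<open>C\<close>.
  In the homotopy on the cone, the two diagonal entries are the relations at \<open>B\<close> and \<open>A\<close>, and
  the entry \<open>\<theta>1\<close> from \<open>B\<close> to \<open>\<Sigma>A\<close> satisfies \<open>c1 e0 = - d \<theta>1\<close>, so \<open>- \<theta>1\<close> serves as \<open>g\<close>.\<close>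

lemma cone_iso_contracted:
  assumes obj: "A \<in> Obj \<C>" "B \<in> Obj \<C>" "C \<in> Obj \<C>" and x: "x \<in> cycles \<C> A B 0"
    and iso: "h0_iso Pre (shifted \<C> 0 C) (cone \<C> A B x) c"
  defines "c0 \<equiv> arr \<C> C B 0 (c 0 0)" and "c1 \<equiv> arr \<C> C A (- 1) (c 1 0)"
  obtains e0 e1 \<eta> where "c \<in> carrier (matrix_hom \<C> [(C, 0)] [(B, 0), (A, 1)] 0)"
    "c0 \<in> hom C B 0" "c1 \<in> hom C A (- 1)" "\<delta> c1 = \<o> C A (- 2)"
    "e0 \<in> hom B C 0" "\<delta> e0 = \<o> B C (- 1)" "e1 \<in> hom A C 1" "\<delta> e1 = e0 \<cdot> arr \<C> A B 0 x"
    "\<eta> \<in> hom C C 1" "e0 \<cdot> c0 \<uplus> e1 \<cdot> c1 = \<i> C \<uplus> \<delta> \<eta>"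
    "contractible_triangle \<C> (A, B, C) (0, 0, - 1) (arr \<C> A B 0 x, e0, c1)"
proof -
  have xc: "x \<in> carrier (Hom \<C> A B 0)" and dx: "\<delta> (arr \<C> A B 0 x) = \<o> A B (- 1)"
    using x obj by (simp_all add: cycles_iff)
  have ax: "arr \<C> A B 0 x \<in> hom A B 0" using obj xc by auto
  show thesis
  proof (rule pretr_h0_isoE[OF iso graded_twist_shifted[OF obj(3)] _ graded_twist_cone[OF obj(1,2) xc]], goal_cases)
    case (3 b y z)
    let ?k = "[(C, 0)]" and ?l = "[(B, 0), (A, 1)]" and ?x = "arr \<C> A B 0 x"
    note c = 3(1)[simplified] and b = 3(2)[simplified] and y = 3(3)[simplified] and z = 3(4)[simplified]
    have cc: "c0 = entry ?k ?l 0 c 0 0" "c1 = entry ?k ?l 0 c (Suc 0) 0"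
      by (simp_all add: c0_def c1_def entry_def)
    define e0 e1 where "e0 = entry ?l ?k 0 b 0 0" and "e1 = entry ?l ?k 0 b 0 (Suc 0)"
    define \<eta> where "\<eta> = entry ?k ?k 1 y 0 0"
    define \<theta>0 \<theta>1 \<theta>2 where "\<theta>0 = entry ?l ?l 1 z 0 0" and "\<theta>1 = entry ?l ?l 1 z (Suc 0) 0"
      and "\<theta>2 = entry ?l ?l 1 z (Suc 0) (Suc 0)"
    note dc = pretr_dif_shifted_cone[OF obj(3,1,2) xc c]
    note db = pretr_dif_cone_shifted[OF obj(3,1,2) xc b]
    note dz = pretr_dif_cone_cone[OF obj(1,2) xc z]
    have ty: "c0 \<in> hom C B 0" "c1 \<in> hom C A (- 1)" "e0 \<in> hom B C 0" "e1 \<in> hom A C 1" "\<eta> \<in> hom C C 1"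
      "\<theta>0 \<in> hom B B 1" "\<theta>1 \<in> hom B A 0" "\<theta>2 \<in> hom A A 1"
      using dc db dz entry_in_hom(1)[of ?k ?k y 1 0 0] obj y
      by (simp_all add: cc e0_def e1_def \<eta>_def \<theta>0_def \<theta>1_def \<theta>2_def)
    have "\<sim> (\<delta> c1) = \<o> C A (- 2)" using 3(5)[of 1 0] dc(4) by (simp add: cc)
    then have "\<sim> (\<sim> (\<delta> c1)) = \<o> C A (- 2)" by (simp only: neg_zero)
    then have dc1: "\<delta> c1 = \<o> C A (- 2)" by simp
    have dc0: "\<delta> c0 \<uplus> ?x \<cdot> c1 = \<o> C B (- 1)" using 3(5)[of 0 0] dc(3) by (simp add: cc)
    have xc1: "?x \<cdot> c1 \<in> hom C B (- 1)" using cmp_typed[OF ax ty(2)] by simp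
    have dc0: "\<delta> c0 = \<sim> (?x \<cdot> c1)"
      using sum_move[OF dc0 dif_in_hom[OF ty(1)] xc1] neg_in_hom[OF xc1] by simp
    have de0: "\<delta> e0 = \<o> B C (- 1)" using 3(6)[of 0 0] db(3) by (simp add: e0_def)
    have de1: "\<delta> e1 \<uplus> \<sim> (e0 \<cdot> ?x) = \<o> A C 0" using 3(6)[of 0 1] db(4) by (simp add: e0_def e1_def)
    have e0x: "e0 \<cdot> ?x \<in> hom A C 0" using cmp_typed[OF ty(3) ax] by simp
    have de1: "\<delta> e1 = e0 \<cdot> ?x"
      using sum_move_neg[OF de1 dif_in_hom[OF ty(4)] e0x] e0x by simp
    have ec: "e0 \<cdot> c0 \<uplus> e1 \<cdot> c1 = \<i> C \<uplus> \<delta> \<eta>"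
      using 3(7)[of 0 0] pretr_dif_shifted_shifted[OF obj(3) obj(3) y] idt_pretr_entry(2)[of "shifted \<C> 0 C" 0 0]
        entry_matrix_cmp(3)[of ?k ?l ?k c 0 b 0 0 0 0] obj c b
      by (simp add: cc e0_def e1_def \<eta>_def add_commute)
    have ce: "i < 2 \<Longrightarrow> j < 2 \<Longrightarrow> entry ?k ?l 0 c i 0 \<cdot> entry ?l ?k 0 b 0 j =
        entry ?l ?l 0 (dif Pre (cone \<C> A B x) (cone \<C> A B x) 1 z) i j \<uplus>
        entry ?l ?l 0 (idt Pre (cone \<C> A B x)) i j" for i j
      using 3(8)[of i j] entry_matrix_cmp(2)[of ?l ?k ?l b 0 c 0 0 i j] obj c b by simp
    have id: "entry ?l ?l 0 (idt Pre (cone \<C> A B x)) 0 0 = \<i> B"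
      "entry ?l ?l 0 (idt Pre (cone \<C> A B x)) (Suc 0) 0 = \<o> B A (- 1)"
      "entry ?l ?l 0 (idt Pre (cone \<C> A B x)) (Suc 0) (Suc 0) = \<i> A"
      using idt_pretr_entry(2)[of "cone \<C> A B x" 0 0] idt_pretr_entry(2)[of "cone \<C> A B x" 1 0]
        idt_pretr_entry(2)[of "cone \<C> A B x" 1 1] obj by simp_all
    have d\<theta>1: "\<sim> (\<delta> \<theta>1) \<in> hom B A (- 1)" using neg_in_hom[OF dif_in_hom[OF ty(7)]] by simp
    have ce00: "c0 \<cdot> e0 = \<delta> \<theta>0 \<uplus> ?x \<cdot> \<theta>1 \<uplus> \<i> B"
      using ce[of 0 0] dz(4) id(1) by (simp add: cc e0_def \<theta>0_def \<theta>1_def)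
    have ce10: "c1 \<cdot> e0 = \<sim> (\<delta> \<theta>1)"
      using ce[of 1 0] dz(5) id(2) d\<theta>1 by (simp add: cc e0_def \<theta>1_def)
    have ce11: "c1 \<cdot> e1 = \<sim> (\<delta> \<theta>2) \<uplus> \<theta>1 \<cdot> ?x \<uplus> \<i> A"
      using ce[of 1 1] dz(6) id(3) by (simp add: cc e1_def \<theta>1_def \<theta>2_def)
    have x\<theta>: "?x \<cdot> \<theta>1 \<in> hom B B 0" "\<theta>1 \<cdot> ?x \<in> hom A A 0"
      using cmp_typed[OF ax ty(7)] cmp_typed[OF ty(7) ax] by simp_all
    have TA: "c1 \<cdot> e1 \<uplus> \<epsilon> (- 1 + 1) ((\<sim> \<theta>1) \<cdot> ?x) = \<epsilon> 0 (\<i> A) \<uplus> \<delta> (\<sim> \<theta>2)"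
    proof -
      have "c1 \<cdot> e1 \<uplus> \<epsilon> (- 1 + 1) ((\<sim> \<theta>1) \<cdot> ?x) = (\<i> A \<uplus> \<sim> (\<delta> \<theta>2)) \<uplus> (\<theta>1 \<cdot> ?x \<uplus> \<sim> (\<theta>1 \<cdot> ?x))"
        unfolding ce11 by (simp add: add_ac)
      also have "\<dots> = \<i> A \<uplus> \<sim> (\<delta> \<theta>2)"
        unfolding add_neg[OF x\<theta>(2)] using idt_in_hom[OF obj(1)] neg_in_hom[OF dif_in_hom[OF ty(8)]]
        by (intro add_zero(1) add_in_hom) auto
      finally show ?thesis by simp
    qed
    have TB: "?x \<cdot> (\<sim> \<theta>1) \<uplus> \<epsilon> (0 + 1) ((\<sim> c0) \<cdot> e0) = \<epsilon> 0 (\<i> B) \<uplus> \<delta> \<theta>0"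
    proof -
      have "?x \<cdot> (\<sim> \<theta>1) \<uplus> \<epsilon> (0 + 1) ((\<sim> c0) \<cdot> e0) = (\<i> B \<uplus> \<delta> \<theta>0) \<uplus> (?x \<cdot> \<theta>1 \<uplus> \<sim> (?x \<cdot> \<theta>1))"
        by (simp add: ce00 add_ac)
      also have "\<dots> = \<i> B \<uplus> \<delta> \<theta>0"
        unfolding add_neg[OF x\<theta>(1)] using idt_in_hom[OF obj(2)] dif_in_hom[OF ty(6)]
        by (intro add_zero(1) add_in_hom) auto
      finally show ?thesis by simp
    qed
    have TC: "e0 \<cdot> (\<sim> c0) \<uplus> \<epsilon> (0 + 1) (e1 \<cdot> c1) = \<epsilon> 1 (\<i> C) \<uplus> \<delta> (\<sim> \<eta>)"
    proof -
      have "e0 \<cdot> (\<sim> c0) \<uplus> \<epsilon> (0 + 1) (e1 \<cdot> c1) = \<sim> (e0 \<cdot> c0 \<uplus> e1 \<cdot> c1)" by simp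
      then show ?thesis unfolding ec by simp
    qed
    have "contracted_triangle \<C> (A, B, C) (0, 0, - 1) (?x, e0, c1) (e1, \<sim> \<theta>1, \<sim> c0) (\<sim> \<theta>2, \<theta>0, \<sim> \<eta>) (0, 0, 1)"
      unfolding contracted_triangle_def split
      using TA TB TC ty ax dx de0 dc1 de1 ce10 dc0
      by (simp add: neg_in_hom)
    then have "contractible_triangle \<C> (A, B, C) (0, 0, - 1) (?x, e0, c1)"
      unfolding contractible_triangle_def by blast
    then show ?case using that[OF c ty(1,2) dc1 ty(3) de0 ty(4) de1 ty(5) ec] by blast
  qed simp_all
qed

lemma single_entry:
  assumes "X \<in> Obj \<C>" "Y \<in> Obj \<C>" "f \<in> carrier (Hom \<C> X Y 0)"
  shows "single f \<in> carrier (matrix_hom \<C> [(X, r)] [(Y, r)] 0)"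
    "entry [(X, r)] [(Y, r)] 0 (single f) 0 0 = arr \<C> X Y 0 f"
  using assms by (auto simp: matrix_hom_carrier single_def shift_hom_def matrix_def fun_eq_iff entry_def)

lemma cone_inclusion_entry:
  assumes "A \<in> Obj \<C>" "B \<in> Obj \<C>"
  shows "cone_inclusion \<C> A B \<in> carrier (matrix_hom \<C> [(B, 0)] [(B, 0), (A, 1)] 0)"
    "entry [(B, 0)] [(B, 0), (A, 1)] 0 (cone_inclusion \<C> A B) 0 0 = \<i> B"
    "entry [(B, 0)] [(B, 0), (A, 1)] 0 (cone_inclusion \<C> A B) (Suc 0) 0 = \<o> B A (- 1)"
  using assms by (auto simp: matrix_hom_carrier cone_inclusion_def shift_hom_def matrix_def fun_eq_iff entry_def
      arr_idt arr_zero less_Suc_eq)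

lemma cone_projection_entry:
  assumes "A \<in> Obj \<C>" "B \<in> Obj \<C>"
  shows "cone_projection \<C> A B \<in> carrier (matrix_hom \<C> [(B, 0), (A, 1)] [(A, 1)] 0)"
    "entry [(B, 0), (A, 1)] [(A, 1)] 0 (cone_projection \<C> A B) 0 0 = \<o> B A (- 1)"
    "entry [(B, 0), (A, 1)] [(A, 1)] 0 (cone_projection \<C> A B) 0 (Suc 0) = \<i> A"
  using assms by (auto simp: matrix_hom_carrier cone_projection_def shift_hom_def matrix_def fun_eq_iff entry_def
      arr_idt arr_zero less_Suc_eq)

text \<open>Start with the contracted standard triangle, replace \<open>A'\<close> and \<open>B'\<close> by the equivalent \<open>A\<close> and
  \<open>B\<close>, and correct the three edges by the homotopies of the given isomorphism of triangles.
  The result is the first triangle, with edge \<open>\<tau> s\<close> of degree \<open>-1\<close> to \<open>A\<close>, where \<open>\<tau> : S A \<rightarrow> A\<close>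
  is the entry of \<open>\<sigma>\<close>. Replacing \<open>A\<close> by \<open>S A\<close> along \<open>\<tau>\<close> and correcting \<open>\<tau>' \<tau> s\<close> to \<open>s\<close> gives
  the second. The first has \<open>x\<close>, the second \<open>s\<close>, as an edge of degree \<open>0\<close>.\<close>

lemma exact_triangle_contractible:
  assumes susp: "suspension \<C> S \<sigma>" and exact: "exact_triangle \<C> S \<sigma> A B C x v s"
  shows "contractible_triangle \<C> (A, B, C) (0, 0, - 1)
      (arr \<C> A B 0 x, arr \<C> B C 0 v, arr \<C> (S A) A (- 1) (\<sigma> A 0 0) \<cdot> arr \<C> C (S A) 0 s)"
    and "contractible_triangle \<C> (S A, B, C) (- 1, 0, 0)
      (arr \<C> A B 0 x \<cdot> arr \<C> (S A) A (- 1) (\<sigma> A 0 0), arr \<C> B C 0 v, arr \<C> C (S A) 0 s)"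
proof -
  obtain A' B' x' a b c where obj: "A \<in> Obj \<C>" "B \<in> Obj \<C>" "C \<in> Obj \<C>" "A' \<in> Obj \<C>" "B' \<in> Obj \<C>"
    and x: "x \<in> cycles \<C> A B 0" and v: "v \<in> cycles \<C> B C 0" and s: "s \<in> cycles \<C> C (S A) 0"
    and x': "x' \<in> cycles \<C> A' B' 0" and a: "h0_iso \<C> A A' a" and b: "h0_iso \<C> B B' b"
    and c: "h0_iso Pre (shifted \<C> 0 C) (cone \<C> A' B' x') c"
    and hx: "hclass \<C> A B' 0 (cmp \<C> A B B' 0 0 b x) = hclass \<C> A B' 0 (cmp \<C> A A' B' 0 0 x' a)"
    and hv: "hclass Pre (shifted \<C> 0 B) (cone \<C> A' B' x') 0
        (cmp Pre (shifted \<C> 0 B) (shifted \<C> 0 C) (cone \<C> A' B' x') 0 0 c (single v)) =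
      hclass Pre (shifted \<C> 0 B) (cone \<C> A' B' x') 0
        (cmp Pre (shifted \<C> 0 B) (shifted \<C> 0 B') (cone \<C> A' B' x') 0 0 (cone_inclusion \<C> A' B') (single b))"
    and hs: "hclass Pre (shifted \<C> 0 C) (shifted \<C> 1 A') 0
        (cmp Pre (shifted \<C> 0 C) (shifted \<C> 1 A) (shifted \<C> 1 A') 0 0 (single a)
          (cmp Pre (shifted \<C> 0 C) (shifted \<C> 0 (S A)) (shifted \<C> 1 A) 0 0 (\<sigma> A) (single s))) =
      hclass Pre (shifted \<C> 0 C) (shifted \<C> 1 A') 0
        (cmp Pre (shifted \<C> 0 C) (cone \<C> A' B' x') (shifted \<C> 1 A') 0 0 (cone_projection \<C> A' B') c)"
    using exact unfolding exact_triangle_def Let_def by blast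
  have SA: "S A \<in> Obj \<C>" and \<sigma>: "h0_iso Pre (shifted \<C> 0 (S A)) (shifted \<C> 1 A) (\<sigma> A)"
    using susp obj(1) unfolding suspension_def by auto
  define X where "X = arr \<C> A B 0 x"
  define V where "V = arr \<C> B C 0 v"
  define W where "W = arr \<C> C (S A) 0 s"
  define X' where "X' = arr \<C> A' B' 0 x'"
  define \<alpha> where "\<alpha> = arr \<C> A A' 0 a"
  define \<beta> where "\<beta> = arr \<C> B B' 0 b"
  define \<tau> where "\<tau> = arr \<C> (S A) A (- 1) (\<sigma> A 0 0)"
  have carr: "x \<in> carrier (Hom \<C> A B 0)" "v \<in> carrier (Hom \<C> B C 0)" "s \<in> carrier (Hom \<C> C (S A) 0)"
    "x' \<in> carrier (Hom \<C> A' B' 0)" "a \<in> carrier (Hom \<C> A A' 0)" "b \<in> carrier (Hom \<C> B B' 0)"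
    using x v s x' a b by (auto simp: cycles_def h0_iso_def)
  have X: "X \<in> hom A B 0" "\<delta> X = \<o> A B (- 1)" and V: "V \<in> hom B C 0" "\<delta> V = \<o> B C (- 1)"
    and W: "W \<in> hom C (S A) 0" "\<delta> W = \<o> C (S A) (- 1)" and X': "X' \<in> hom A' B' 0" "\<delta> X' = \<o> A' B' (- 1)"
    using x v s x' obj SA carr unfolding X_def V_def W_def X'_def by (auto simp: cycles_iff)
  obtain \<alpha>' \<mu>a \<nu>a where \<alpha>: "\<alpha> \<in> hom A A' 0" "\<delta> \<alpha> = \<o> A A' (- 1)" "\<alpha>' \<in> hom A' A 0" "\<delta> \<alpha>' = \<o> A' A (- 1)"
    "\<mu>a \<in> hom A A 1" "\<alpha>' \<cdot> \<alpha> = \<i> A \<uplus> \<delta> \<mu>a" "\<nu>a \<in> hom A' A' 1" "\<alpha> \<cdot> \<alpha>' = \<i> A' \<uplus> \<delta> \<nu>a"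
    using h0_isoE[OF a] unfolding \<alpha>_def by metis
  obtain \<beta>' \<mu>b \<nu>b where \<beta>: "\<beta> \<in> hom B B' 0" "\<delta> \<beta> = \<o> B B' (- 1)" "\<beta>' \<in> hom B' B 0" "\<delta> \<beta>' = \<o> B' B (- 1)"
    "\<mu>b \<in> hom B B 1" "\<beta>' \<cdot> \<beta> = \<i> B \<uplus> \<delta> \<mu>b" "\<nu>b \<in> hom B' B' 1" "\<beta> \<cdot> \<beta>' = \<i> B' \<uplus> \<delta> \<nu>b"
    using h0_isoE[OF b] unfolding \<beta>_def by metis
  obtain \<tau>' \<mu>t \<nu>t where \<sigma>c: "\<sigma> A \<in> carrier (matrix_hom \<C> [(S A, 0)] [(A, 1)] 0)"
    and \<tau>: "\<tau> \<in> hom (S A) A (- 1)" "\<delta> \<tau> = \<o> (S A) A (- 2)" "\<tau>' \<in> hom A (S A) 1" "\<delta> \<tau>' = \<o> A (S A) 0"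
    "\<mu>t \<in> hom (S A) (S A) 1" "\<tau>' \<cdot> \<tau> = \<i> (S A) \<uplus> \<delta> \<mu>t" "\<nu>t \<in> hom A A 1" "\<tau> \<cdot> \<tau>' = \<i> A \<uplus> \<delta> \<nu>t"
    using suspension_isoE[OF obj(1) SA \<sigma>] unfolding \<tau>_def by metis
  define c0 where "c0 = arr \<C> C B' 0 (c 0 0)"
  define c1 where "c1 = arr \<C> C A' (- 1) (c 1 0)"
  obtain e0 e1 \<eta> where cc: "c \<in> carrier (matrix_hom \<C> [(C, 0)] [(B', 0), (A', 1)] 0)"
    and ce: "c0 \<in> hom C B' 0" "c1 \<in> hom C A' (- 1)" "\<delta> c1 = \<o> C A' (- 2)"
    "e0 \<in> hom B' C 0" "\<delta> e0 = \<o> B' C (- 1)" "e1 \<in> hom A' C 1" "\<delta> e1 = e0 \<cdot> X'"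
    "\<eta> \<in> hom C C 1" "e0 \<cdot> c0 \<uplus> e1 \<cdot> c1 = \<i> C \<uplus> \<delta> \<eta>"
    and T0: "contractible_triangle \<C> (A', B', C) (0, 0, - 1) (X', e0, c1)"
    using cone_iso_contracted[OF obj(4,5,3) x' c] unfolding X'_def c0_def c1_def by metis
  have c_entry: "entry [(C, 0)] [(B', 0), (A', 1)] 0 c 0 0 = c0" "entry [(C, 0)] [(B', 0), (A', 1)] 0 c (Suc 0) 0 = c1"
    by (simp_all add: entry_def c0_def c1_def)
  (* Each edge agrees up to a boundary with the edge that the transported cone will have: compose the
     given homotopy with a homotopy inverse and absorb the homotopy \<open>\<mu>b\<close>, \<open>\<eta>\<close> or \<open>\<mu>a\<close>. *)
  obtain y where y: "y \<in> hom A B 1" "X = \<beta>' \<cdot> X' \<cdot> \<alpha> \<uplus> \<delta> y"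
  proof -
    obtain y where y: "y \<in> hom A B' 1" "arr \<C> A B' 0 (cmp \<C> A B B' 0 0 b x) = \<delta> y \<uplus> arr \<C> A B' 0 (cmp \<C> A A' B' 0 0 x' a)"
      using hx carr obj by (subst (asm) hclass_eq_iff) auto
    then have eq: "\<beta> \<cdot> X = \<delta> y \<uplus> X' \<cdot> \<alpha>"
      using carr obj by (simp add: arr_ops X_def X'_def \<alpha>_def \<beta>_def)
    have ty: "\<mu>b \<cdot> X \<in> hom A B 1" "\<beta>' \<cdot> y \<in> hom A B 1"
      using cmp_typed[OF \<beta>(5) X(1)] cmp_typed[OF \<beta>(3) y(1)] by simp_all
    have "X \<uplus> \<delta> (\<mu>b \<cdot> X) = (\<beta>' \<cdot> \<beta>) \<cdot> X"
      unfolding \<beta>(6) using X(1) by (simp add: dif_closed_right[OF X])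
    also have "\<dots> = \<beta>' \<cdot> X' \<cdot> \<alpha> \<uplus> \<delta> (\<beta>' \<cdot> y)"
      by (simp add: comp_assoc eq dif_closed_left[OF \<beta>(3,4)] add_commute)
    finally have "X = \<beta>' \<cdot> X' \<cdot> \<alpha> \<uplus> \<delta> (\<beta>' \<cdot> y) \<uplus> \<sim> (\<delta> (\<mu>b \<cdot> X))"
      using X(1) dif_in_hom[OF ty(1), of 0] by (intro sum_move) auto
    then have "X = \<beta>' \<cdot> X' \<cdot> \<alpha> \<uplus> \<delta> (\<beta>' \<cdot> y \<uplus> \<sim> (\<mu>b \<cdot> X))" by (simp only: diff_add diff_neg add_assoc)
    then show thesis using ty by (intro that[of "\<beta>' \<cdot> y \<uplus> \<sim> (\<mu>b \<cdot> X)"]) auto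
  qed
  obtain z where z: "z \<in> hom B C 1" "V = e0 \<cdot> \<beta> \<uplus> \<delta> z"
  proof -
    let ?l = "[(B', 0), (A', 1)]"
    note sv = single_entry[OF obj(2,3) carr(2), of 0] and sb = single_entry[OF obj(2,5) carr(6), of 0]
    note inc = cone_inclusion_entry[OF obj(4,5)]
    have m: "matrix_cmp \<C> [(B, 0)] [(C, 0)] ?l 0 0 c (single v) \<in> carrier (matrix_hom \<C> [(B, 0)] ?l 0)"
      "matrix_cmp \<C> [(B, 0)] [(B', 0)] ?l 0 0 (cone_inclusion \<C> A' B') (single b) \<in> carrier (matrix_hom \<C> [(B, 0)] ?l 0)"
      using entry_matrix_cmp(1)[of "[(B, 0)]" "[(C, 0)]" ?l "single v" 0 c 0 0] sv cc obj
        entry_matrix_cmp(1)[of "[(B, 0)]" "[(B', 0)]" ?l "single b" 0 "cone_inclusion \<C> A' B'" 0 0] sb inc by simp_all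
    obtain f where f: "f \<in> carrier (matrix_hom \<C> [(B, 0)] ?l 1)"
      "\<And>i j. i < length ?l \<Longrightarrow> j < length [(B, 0 :: int)] \<Longrightarrow> entry [(B, 0)] ?l 0 (matrix_cmp \<C> [(B, 0)] [(C, 0)] ?l 0 0 c (single v)) i j =
        entry [(B, 0)] ?l 0 (dif Pre (shifted \<C> 0 B) (cone \<C> A' B' x') 1 f) i j \<uplus>
        entry [(B, 0)] ?l 0 (matrix_cmp \<C> [(B, 0)] [(B', 0)] ?l 0 0 (cone_inclusion \<C> A' B') (single b)) i j"
      by (rule pretr_hclass_eq[OF graded_twist_shifted[OF obj(2)] graded_twist_cone[OF obj(4,5) carr(4)],
          unfolded parts_shifted parts_cone, OF m _ _ hv[unfolded Pre_simps parts_shifted parts_cone]])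
        simp_all
    define \<zeta>0 where "\<zeta>0 = entry [(B, 0)] ?l 1 f 0 0"
    define \<zeta>1 where "\<zeta>1 = entry [(B, 0)] ?l 1 f (Suc 0) 0"
    note df = pretr_dif_shifted_cone[OF obj(2,4,5) carr(4) f(1), folded \<zeta>0_def \<zeta>1_def X'_def, simplified]
    have \<beta>id: "\<i> B' \<cdot> \<beta> = \<beta>" using \<beta>(1) by simp
    have o\<beta>: "\<o> B' A' (- 1) \<cdot> \<beta> = \<o> B A' (- 1)" using zero_comp'[OF \<beta>(1) obj(4)] by simp
    have d\<zeta>1: "\<sim> (\<delta> \<zeta>1) \<in> hom B A' (- 1)" using neg_in_hom[OF dif_in_hom[OF df(2)]] by simp
    have 0: "c0 \<cdot> V = \<delta> \<zeta>0 \<uplus> X' \<cdot> \<zeta>1 \<uplus> \<beta>"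
      using f(2)[of 0 0] df(3) entry_matrix_cmp(2)[of "[(B, 0)]" "[(C, 0)]" ?l "single v" 0 c 0 0 0 0] sv cc obj
        entry_matrix_cmp(2)[of "[(B, 0)]" "[(B', 0)]" ?l "single b" 0 "cone_inclusion \<C> A' B'" 0 0 0 0] sb inc \<beta>id
      by (simp add: c_entry V_def \<beta>_def)
    have 1: "c1 \<cdot> V = \<sim> (\<delta> \<zeta>1)"
      using f(2)[of 1 0] df(4) entry_matrix_cmp(2)[of "[(B, 0)]" "[(C, 0)]" ?l "single v" 0 c 0 0 1 0] sv cc obj
        entry_matrix_cmp(2)[of "[(B, 0)]" "[(B', 0)]" ?l "single b" 0 "cone_inclusion \<C> A' B'" 0 0 1 0] sb inc o\<beta> d\<zeta>1
      by (simp add: c_entry V_def \<beta>_def)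
    have ty: "e0 \<cdot> \<zeta>0 \<in> hom B C 1" "e1 \<cdot> \<zeta>1 \<in> hom B C 1" "\<eta> \<cdot> V \<in> hom B C 1"
      using cmp_typed[OF ce(4) df(1)] cmp_typed[OF ce(6) df(2)] cmp_typed[OF ce(8) V(1)] by simp_all
    have "V \<uplus> \<delta> (\<eta> \<cdot> V) = (e0 \<cdot> c0 \<uplus> e1 \<cdot> c1) \<cdot> V"
      unfolding ce(9) using V(1) by (simp add: dif_closed_right[OF V])
    also have "\<dots> = e0 \<cdot> \<beta> \<uplus> \<delta> (e0 \<cdot> \<zeta>0 \<uplus> e1 \<cdot> \<zeta>1)"
      by (simp add: comp_assoc 0 1 dif_closed_left[OF ce(4,5)] leibniz_arrow[OF ce(6)] ce(7) add_ac)
    finally have "V = e0 \<cdot> \<beta> \<uplus> \<delta> (e0 \<cdot> \<zeta>0 \<uplus> e1 \<cdot> \<zeta>1) \<uplus> \<sim> (\<delta> (\<eta> \<cdot> V))"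
      using V(1) dif_in_hom[OF ty(3), of 0] by (intro sum_move) auto
    then have "V = e0 \<cdot> \<beta> \<uplus> \<delta> (e0 \<cdot> \<zeta>0 \<uplus> e1 \<cdot> \<zeta>1 \<uplus> \<sim> (\<eta> \<cdot> V))" by (simp only: diff_add diff_neg add_assoc)
    then show thesis using ty by (intro that[of "e0 \<cdot> \<zeta>0 \<uplus> e1 \<cdot> \<zeta>1 \<uplus> \<sim> (\<eta> \<cdot> V)"]) auto
  qed
  have \<tau>W: "\<tau> \<cdot> W \<in> hom C A (- 1)" "\<delta> (\<tau> \<cdot> W) = \<o> C A (- 2)"
    using cmp_typed[OF \<tau>(1) W(1)] comp_zero'[OF \<tau>(1) obj(3), of _ "- 1"]
    by (simp_all add: dif_closed_left[OF \<tau>(1,2)] W(2))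
  obtain u where u: "u \<in> hom C A 0" "\<tau> \<cdot> W = \<alpha>' \<cdot> c1 \<uplus> \<delta> u"
  proof -
    let ?k = "[(C, 0)]" and ?l = "[(B', 0), (A', 1)]"
    note ss = single_entry[OF obj(3) SA carr(3), of 0] and sa = single_entry[OF obj(1,4) carr(5), of 1]
    note pr = cone_projection_entry[OF obj(4,5)]
    have \<sigma>_entry: "entry [(S A, 0)] [(A, 1)] 0 (\<sigma> A) 0 0 = \<tau>" by (simp add: entry_def \<tau>_def)
    have m1: "matrix_cmp \<C> ?k [(S A, 0)] [(A, 1)] 0 0 (\<sigma> A) (single s) \<in> carrier (matrix_hom \<C> ?k [(A, 1)] 0)"
      using entry_matrix_cmp(1)[of ?k "[(S A, 0)]" "[(A, 1)]" "single s" 0 "\<sigma> A" 0 0] ss \<sigma>c obj SA by simp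
    have m: "matrix_cmp \<C> ?k [(A, 1)] [(A', 1)] 0 0 (single a) (matrix_cmp \<C> ?k [(S A, 0)] [(A, 1)] 0 0 (\<sigma> A) (single s))
        \<in> carrier (matrix_hom \<C> ?k [(A', 1)] 0)"
      "matrix_cmp \<C> ?k ?l [(A', 1)] 0 0 (cone_projection \<C> A' B') c \<in> carrier (matrix_hom \<C> ?k [(A', 1)] 0)"
      using entry_matrix_cmp(1)[OF _ _ _ m1, of "[(A', 1)]" "single a" 0 0] sa m1 obj
        entry_matrix_cmp(1)[of ?k ?l "[(A', 1)]" c 0 "cone_projection \<C> A' B'" 0 0] cc pr by simp_all
    obtain f where f: "f \<in> carrier (matrix_hom \<C> ?k [(A', 1)] 1)"
      "\<And>i j. i < length [(A', 1 :: int)] \<Longrightarrow> j < length ?k \<Longrightarrow> entry ?k [(A', 1)] 0 (matrix_cmp \<C> ?k [(A, 1)] [(A', 1)] 0 0 (single a)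
         (matrix_cmp \<C> ?k [(S A, 0)] [(A, 1)] 0 0 (\<sigma> A) (single s))) i j =
       entry ?k [(A', 1)] 0 (dif Pre (shifted \<C> 0 C) (shifted \<C> 1 A') 1 f) i j \<uplus>
       entry ?k [(A', 1)] 0 (matrix_cmp \<C> ?k ?l [(A', 1)] 0 0 (cone_projection \<C> A' B') c) i j"
      by (rule pretr_hclass_eq[OF graded_twist_shifted[OF obj(3)] graded_twist_shifted[OF obj(4)],
          unfolded parts_shifted parts_cone, OF m _ _ hs[unfolded Pre_simps parts_shifted parts_cone]])
        simp_all
    define \<omega> where "\<omega> = entry ?k [(A', 1)] 1 f 0 0"
    have \<omega>: "\<omega> \<in> hom C A' 0" using entry_in_hom(1)[of ?k "[(A', 1)]" f 1 0 0] f(1) obj by (simp add: \<omega>_def)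
    have oc: "\<o> B' A' (- 1) \<cdot> c0 = \<o> C A' (- 1)" and ic: "\<i> A' \<cdot> c1 = c1"
      using zero_comp'[OF ce(1) obj(4)] ce(2) by simp_all
    have eq: "\<alpha> \<cdot> \<tau> \<cdot> W = \<sim> (\<delta> \<omega>) \<uplus> c1"
      using f(2)[of 0 0] pretr_dif_shifted_shifted[OF obj(3,4) f(1)] ss sa pr \<sigma>c cc obj SA m1 oc ic ce(2)
        entry_matrix_cmp(2)[of ?k "[(A, 1)]" "[(A', 1)]" _ 0 "single a" 0 0 0 0]
        entry_matrix_cmp(2)[of ?k "[(S A, 0)]" "[(A, 1)]" "single s" 0 "\<sigma> A" 0 0 0 0]
        entry_matrix_cmp(3)[of ?k ?l "[(A', 1)]" c 0 "cone_projection \<C> A' B'" 0 0 0 0]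
      by (simp add: c_entry \<sigma>_entry W_def \<alpha>_def \<omega>_def)
    have ty: "\<alpha>' \<cdot> \<omega> \<in> hom C A 0" "\<mu>a \<cdot> \<tau> \<cdot> W \<in> hom C A 0"
      using cmp_typed[OF \<alpha>(3) \<omega>] cmp_typed[OF \<alpha>(5) \<tau>W(1)] by simp_all
    have "\<tau> \<cdot> W \<uplus> \<delta> (\<mu>a \<cdot> \<tau> \<cdot> W) = (\<alpha>' \<cdot> \<alpha>) \<cdot> \<tau> \<cdot> W"
      unfolding \<alpha>(6) using \<tau>W(1) by (simp add: dif_closed_right[OF \<tau>W])
    also have "\<dots> = \<alpha>' \<cdot> c1 \<uplus> \<delta> (\<sim> (\<alpha>' \<cdot> \<omega>))"
      by (simp add: comp_assoc eq dif_closed_left[OF \<alpha>(3,4)] add_commute)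
    finally have "\<tau> \<cdot> W = \<alpha>' \<cdot> c1 \<uplus> \<delta> (\<sim> (\<alpha>' \<cdot> \<omega>)) \<uplus> \<sim> (\<delta> (\<mu>a \<cdot> \<tau> \<cdot> W))"
      using \<tau>W(1) dif_in_hom[OF ty(2), of "- 1"] by (intro sum_move) auto
    then have "\<tau> \<cdot> W = \<alpha>' \<cdot> c1 \<uplus> \<delta> (\<sim> (\<alpha>' \<cdot> \<omega>) \<uplus> \<sim> (\<mu>a \<cdot> \<tau> \<cdot> W))" by (simp only: diff_add diff_neg add_assoc)
    then show thesis using ty by (intro that[of "\<sim> (\<alpha>' \<cdot> \<omega>) \<uplus> \<sim> (\<mu>a \<cdot> \<tau> \<cdot> W)"]) auto
  qed
  (* Vertices and edges are always replaced in first position, hence the rotations. *)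
  have "contractible_triangle \<C> (A, B', C) (0, 0, - 1) (X' \<cdot> \<alpha>, e0, \<alpha>' \<cdot> c1)"
    using contractible_triangle_vertex[OF T0, of \<alpha> A 0 \<alpha>' \<mu>a \<nu>a] \<alpha> by simp
  from contractible_triangle_rotate[OF this]
  have "contractible_triangle \<C> (B, C, A) (0, - 1, 0) (e0 \<cdot> \<beta>, \<alpha>' \<cdot> c1, \<beta>' \<cdot> X' \<cdot> \<alpha>)"
    using contractible_triangle_vertex[of B' C A 0 "- 1" 0 e0 "\<alpha>' \<cdot> c1" "X' \<cdot> \<alpha>" \<beta> B 0 \<beta>' \<mu>b \<nu>b] \<beta> by simp
  from contractible_triangle_edge[OF this _ z(2)] z(1)
  have "contractible_triangle \<C> (B, C, A) (0, - 1, 0) (V, \<alpha>' \<cdot> c1, \<beta>' \<cdot> X' \<cdot> \<alpha>)" by simp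
  from contractible_triangle_edge[OF contractible_triangle_rotate[OF this] _ u(2)] u(1)
  have "contractible_triangle \<C> (C, A, B) (- 1, 0, 0) (\<tau> \<cdot> W, \<beta>' \<cdot> X' \<cdot> \<alpha>, V)" by simp
  from contractible_triangle_edge[OF contractible_triangle_rotate[OF this] _ y(2)] y(1)
  have T: "contractible_triangle \<C> (A, B, C) (0, 0, - 1) (X, V, \<tau> \<cdot> W)" by simp
  then show "contractible_triangle \<C> (A, B, C) (0, 0, - 1)
      (arr \<C> A B 0 x, arr \<C> B C 0 v, arr \<C> (S A) A (- 1) (\<sigma> A 0 0) \<cdot> arr \<C> C (S A) 0 s)"
    by (simp only: X_def V_def W_def \<tau>_def)
  have "contractible_triangle \<C> (S A, B, C) (- 1, 0, 0) (X \<cdot> \<tau>, V, \<tau>' \<cdot> \<tau> \<cdot> W)"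
    using contractible_triangle_vertex[OF T, of \<tau> "S A" "- 1" \<tau>' \<mu>t \<nu>t] \<tau> by simp
  from contractible_triangle_rotate[OF contractible_triangle_rotate[OF this]]
  have T': "contractible_triangle \<C> (C, S A, B) (0, - 1, 0) (\<tau>' \<cdot> \<tau> \<cdot> W, X \<cdot> \<tau>, V)" .
  have \<mu>W: "\<mu>t \<cdot> W \<in> hom C (S A) 1" using cmp_typed[OF \<tau>(5) W(1)] by simp
  have "W = \<tau>' \<cdot> \<tau> \<cdot> W \<uplus> \<delta> (\<sim> (\<mu>t \<cdot> W))"
  proof -
    have "W \<uplus> \<delta> (\<mu>t \<cdot> W) = (\<tau>' \<cdot> \<tau>) \<cdot> W"
      unfolding \<tau>(6) using W(1) by (simp add: dif_closed_right[OF W])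
    then have "W = (\<tau>' \<cdot> \<tau>) \<cdot> W \<uplus> \<sim> (\<delta> (\<mu>t \<cdot> W))"
      using W(1) dif_in_hom[OF \<mu>W, of 0] by (intro sum_move) auto
    then show ?thesis by (simp only: comp_assoc diff_neg)
  qed
  from contractible_triangle_rotate[OF contractible_triangle_edge[OF T' _ this]] neg_in_hom[OF \<mu>W]
  have "contractible_triangle \<C> (S A, B, C) (- 1, 0, 0) (X \<cdot> \<tau>, V, W)" by simp
  then show "contractible_triangle \<C> (S A, B, C) (- 1, 0, 0)
      (arr \<C> A B 0 x \<cdot> arr \<C> (S A) A (- 1) (\<sigma> A 0 0), arr \<C> B C 0 v, arr \<C> C (S A) 0 s)"
    by (simp only: X_def V_def W_def \<tau>_def)
qed

end

section \<open>Equivalent free extensions\<close>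

definition identity_functor :: "('o, 'o, 'm, 'm) dgfun" where
  "identity_functor = \<lparr>on_obj = (\<lambda>X. X), on_mor = (\<lambda>X Y n f. f)\<rparr>"

lemma id_functor_identity: "dg_category k D \<Longrightarrow> id_functor k D D identity_functor"
  by (auto simp: id_functor_def dg_functor_def linear_map_def identity_functor_def)

lemma dg_under_adjoin:
  assumes "dg_category k C"
  shows "dg_under k C (adjoin_under k C G)"
  using dg_category.id_functor_adjoin[OF assms, of G]
  by (simp add: dg_under_def adjoin_under_def id_functor_def)

text \<open>The values \<open>\<eta>\<close> and \<open>\<kappa>\<close> of the new morphisms define functors \<open>H\<close> and \<open>K\<close> in both directions,
  and \<open>\<pi>1\<close>, \<open>\<pi>2\<close> define homotopies from \<open>K H\<close> and \<open>H K\<close> to the identities. Since homotopic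
  functors agree on homology, \<open>H\<close> is a quasi-equivalence.\<close>

lemma extensions_weakly_equivalent:
  fixes G1 G2 :: "('k, 'o, 'm, 'g) generators"
  assumes C: "dg_category k C"
  defines "D1 \<equiv> adjoin k C G1" and "D2 \<equiv> adjoin k C G2"
    and "F1 \<equiv> adjoin_functor k C G1" and "F2 \<equiv> adjoin_functor k C G2"
  assumes \<eta>: "valid_assignment k C G1 D2 F2 \<eta>" and \<kappa>: "valid_assignment k C G2 D1 F1 \<kappa>"
    and \<pi>1: "valid_assignment k C G1 (path_object D1) (constant_path D1 F1) \<pi>1"
    and \<pi>2: "valid_assignment k C G2 (path_object D2) (constant_path D2 F2) \<pi>2"
    and source1: "\<And>g X Y n b. G1 g = Some (X, Y, n, b) \<Longrightarrow>
      amap (path_object D1) path_source (\<pi>1 g) = amap D2 (adjoin_extension C D1 F1 \<kappa>) (\<eta> g)"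
    and target1: "\<And>g X Y n b. G1 g = Some (X, Y, n, b) \<Longrightarrow>
      amap (path_object D1) path_target (\<pi>1 g) = arr D1 X Y n (term_class k C G1 X Y n (Gen g))"
    and source2: "\<And>g X Y n b. G2 g = Some (X, Y, n, b) \<Longrightarrow>
      amap (path_object D2) path_source (\<pi>2 g) = amap D1 (adjoin_extension C D2 F2 \<eta>) (\<kappa> g)"
    and target2: "\<And>g X Y n b. G2 g = Some (X, Y, n, b) \<Longrightarrow>
      amap (path_object D2) path_target (\<pi>2 g) = arr D2 X Y n (term_class k C G2 X Y n (Gen g))"
  shows "weakly_equivalent_under k C (adjoin_under k C G1) (adjoin_under k C G2)"
proof -
  interpret C: dg_category k C by fact
  define H where "H = adjoin_extension C D2 F2 \<eta>"
  define K where "K = adjoin_extension C D1 F1 \<kappa>"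
  have F: "id_functor k C D1 F1" "id_functor k C D2 F2"
    unfolding D1_def D2_def F1_def F2_def by (rule C.id_functor_adjoin)+
  have H: "id_functor k D1 D2 H" and K: "id_functor k D2 D1 K"
    unfolding H_def K_def
    using C.id_functor_extension[OF F(2) \<eta>] C.id_functor_extension[OF F(1) \<kappa>] by (simp_all add: D1_def D2_def)
  have obj: "Obj D1 = Obj C" "Obj D2 = Obj C" by (simp_all add: D1_def D2_def)
  have HF: "on_mor H X Y n (on_mor F1 X Y n f) = on_mor F2 X Y n f"
    and KF: "on_mor K X Y n (on_mor F2 X Y n f) = on_mor F1 X Y n f"
    if "X \<in> Obj C" "Y \<in> Obj C" "f \<in> carrier (Hom C X Y n)" for X Y n f
    unfolding H_def K_def F1_def F2_def
    using C.extension_Base[OF F(2) \<eta> that] C.extension_Base[OF F(1) \<kappa> that] by (simp_all add: F1_def F2_def)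
  have Hg: "arr D2 X Y n (on_mor H X Y n (term_class k C G1 X Y n (Gen g))) = \<eta> g"
    if "G1 g = Some (X, Y, n, b)" "X \<in> Obj C" "Y \<in> Obj C" for g X Y n b
    unfolding H_def using C.arr_extension_cls[OF F(2) \<eta> has_type.Gen[where G = G1 and g = g, OF that]] by simp
  have Kg: "arr D1 X Y n (on_mor K X Y n (term_class k C G2 X Y n (Gen g))) = \<kappa> g"
    if "G2 g = Some (X, Y, n, b)" "X \<in> Obj C" "Y \<in> Obj C" for g X Y n b
    unfolding K_def using C.arr_extension_cls[OF F(1) \<kappa> has_type.Gen[where G = G2 and g = g, OF that]] by simp
  have c1: "term_class k C G1 X Y n (Gen g) \<in> carrier (Hom D1 X Y n)"
    if "G1 g = Some (X, Y, n, b)" "X \<in> Obj C" "Y \<in> Obj C" for g X Y n b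
    using C.cls_closed[OF has_type.Gen[where G = G1 and g = g, OF that]] by (simp add: D1_def)
  have c2: "term_class k C G2 X Y n (Gen g) \<in> carrier (Hom D2 X Y n)"
    if "G2 g = Some (X, Y, n, b)" "X \<in> Obj C" "Y \<in> Obj C" for g X Y n b
    using C.cls_closed[OF has_type.Gen[where G = G2 and g = g, OF that]] by (simp add: D2_def)
  let ?KH = "\<lparr>on_obj = (\<lambda>X. X), on_mor = (\<lambda>X Y n f. on_mor K X Y n (on_mor H X Y n f))\<rparr>"
  let ?HK = "\<lparr>on_obj = (\<lambda>X. X), on_mor = (\<lambda>X Y n f. on_mor H X Y n (on_mor K X Y n f))\<rparr>"
  have KH_h: "hclass D1 X Y n (on_mor K X Y n (on_mor H X Y n c)) = hclass D1 X Y n c"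
    if XY: "X \<in> Obj D1" "Y \<in> Obj D1" and c: "c \<in> cycles D1 X Y n" for X Y n c
  proof -
    have "hclass D1 X Y n (on_mor ?KH X Y n c) = hclass D1 X Y n (on_mor identity_functor X Y n c)"
    proof (rule homotopic_functors_hclass[OF C F(1) _ _ _ _ \<pi>1, where ?E1.0 = ?KH and ?E2.0 = identity_functor, folded D1_def F1_def])
      show "id_functor k D1 D1 ?KH" by (rule id_functor_compose[OF H K])
      show "id_functor k D1 D1 identity_functor" using id_functor_identity id_functorD(1)[OF H] .
      show "arr D1 X Y n (on_mor ?KH X Y n (term_class k C G1 X Y n (Gen g))) =
          amap (path_object D1) path_source (\<pi>1 g)"
        if "G1 g = Some (X, Y, n, b)" "X \<in> Obj C" "Y \<in> Obj C" for g X Y n b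
      proof -
        have "arr D1 X Y n (on_mor K X Y n (on_mor H X Y n (term_class k C G1 X Y n (Gen g)))) = amap D2 K (\<eta> g)"
          using amap_arr[OF K _ _ id_functor_closed[OF H _ _ c1[OF that]]] Hg[OF that] that obj by simp
        then show ?thesis using source1[OF that(1)] by (simp add: K_def)
      qed
    qed (use XY c obj HF KF target1 in \<open>simp_all add: identity_functor_def\<close>)
    then show ?thesis by (simp add: identity_functor_def)
  qed
  have HK_h: "hclass D2 X Y n (on_mor H X Y n (on_mor K X Y n c)) = hclass D2 X Y n c"
    if XY: "X \<in> Obj D2" "Y \<in> Obj D2" and c: "c \<in> cycles D2 X Y n" for X Y n c
  proof -
    have "hclass D2 X Y n (on_mor ?HK X Y n c) = hclass D2 X Y n (on_mor identity_functor X Y n c)"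
    proof (rule homotopic_functors_hclass[OF C F(2) _ _ _ _ \<pi>2, where ?E1.0 = ?HK and ?E2.0 = identity_functor, folded D2_def F2_def])
      show "id_functor k D2 D2 ?HK" by (rule id_functor_compose[OF K H])
      show "id_functor k D2 D2 identity_functor" using id_functor_identity id_functorD(1)[OF K] .
      show "arr D2 X Y n (on_mor ?HK X Y n (term_class k C G2 X Y n (Gen g))) =
          amap (path_object D2) path_source (\<pi>2 g)"
        if "G2 g = Some (X, Y, n, b)" "X \<in> Obj C" "Y \<in> Obj C" for g X Y n b
      proof -
        have "arr D2 X Y n (on_mor H X Y n (on_mor K X Y n (term_class k C G2 X Y n (Gen g)))) = amap D1 H (\<kappa> g)"
          using amap_arr[OF H _ _ id_functor_closed[OF K _ _ c2[OF that]]] Kg[OF that] that obj by simp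
        then show ?thesis using source2[OF that(1)] by (simp add: H_def)
      qed
    qed (use XY c obj HF KF target2 in \<open>simp_all add: identity_functor_def\<close>)
    then show ?thesis by (simp add: identity_functor_def)
  qed
  have "quasi_equivalence k D1 D2 H"
    using quasi_equivalence_of_homology_inverse[OF H K KH_h HK_h] .
  moreover have "on_obj H = (\<lambda>X. X)" "on_obj F1 = (\<lambda>X. X)" "on_obj F2 = (\<lambda>X. X)"
    using H F by (simp_all add: id_functor_def)
  ultimately have "quasi_equivalence_under k C (adjoin_under k C G1) (adjoin_under k C G2)"
    using dg_under_adjoin[OF C, of G1] dg_under_adjoin[OF C, of G2] HF
    unfolding quasi_equivalence_under_def adjoin_under_def D1_def D2_def F1_def F2_def
    by (auto intro!: exI[of _ H])
  then show ?thesis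
    using dg_under_adjoin[OF C] unfolding weakly_equivalent_under_def
    by (auto intro: r_into_equivclp)
qed

definition gen_arrow ::
    "('k, 'z) ring_scheme \<Rightarrow> ('o, 'k, 'm) dgcat \<Rightarrow> ('k, 'o, 'm, 'g) generators \<Rightarrow> 'g \<Rightarrow>
     ('o, ('k, 'o, 'm, 'g) dgterm set) arrow" where
  "gen_arrow k C G g = (case G g of None \<Rightarrow> None
     | Some (X, Y, n, b) \<Rightarrow> arr (adjoin k C G) X Y n (term_class k C G X Y n (Gen g)))"

context dg_category
begin

lemma gen_arrow_in_hom:
  assumes "G g = Some (X, Y, n, b)" "X \<in> Obj \<C>" "Y \<in> Obj \<C>"
  shows "gen_arrow k \<C> G g \<in> arrows (adjoin k \<C> G) X Y n"
proof -
  interpret A: dg_category k "adjoin k \<C> G" by (rule dg_category_adjoin)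
  show ?thesis
    using assms cls_closed[OF has_type.Gen[where G = G and g = g, OF assms]]
    by (auto simp: gen_arrow_def)
qed

text \<open>The relation \<open>Gen_dif\<close>, with its right-hand side evaluated in the free extension itself.\<close>

lemma gen_arrow_dif:
  assumes "G g = Some (X, Y, n, b)" "X \<in> Obj \<C>" "Y \<in> Obj \<C>" "has_type k \<C> G b X Y (n - 1)"
  shows "adif (adjoin k \<C> G) (gen_arrow k \<C> G g) =
    term_eval \<C> (adjoin k \<C> G) (adjoin_functor k \<C> G) (gen_arrow k \<C> G) b"
proof -
  let ?A = "adjoin k \<C> G"
  interpret A: dg_category k ?A by (rule dg_category_adjoin)
  note g = has_type.Gen[where G = G and g = g, OF assms(1-3)]
  have "adif ?A (gen_arrow k \<C> G g) = arr ?A X Y (n - 1) (dif ?A X Y n (term_class k \<C> G X Y n (Gen g)))"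
    using assms(1-3) cls_closed[OF g] by (simp add: gen_arrow_def A.arr_ops)
  also have "\<dots> = arr ?A X Y (n - 1) (term_class k \<C> G X Y (n - 1) b)"
    using cls_dif[OF g] cls_eqI[OF term_eq.Gen_dif[where G = G and g = g, OF assms(1) g assms(4)]] by simp
  also have "\<dots> = term_eval \<C> ?A (adjoin_functor k \<C> G) (gen_arrow k \<C> G) b"
    using functor_on_terms[OF id_functor_identity[OF dg_category_adjoin] id_functor_adjoin _ _ assms(4), of "gen_arrow k \<C> G"]
    by (simp add: identity_functor_def gen_arrow_def)
  finally show ?thesis .
qed

lemma extension_on_arrows:
  assumes F: "id_functor k \<C> D F" and \<gamma>: "valid_assignment k \<C> G D F \<gamma>"
  shows "amap (adjoin k \<C> G) (adjoin_extension \<C> D F \<gamma>) (amap \<C> (adjoin_functor k \<C> G) f) = amap \<C> F f"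
    and "G g = Some (X, Y, n, b) \<Longrightarrow> X \<in> Obj \<C> \<Longrightarrow> Y \<in> Obj \<C> \<Longrightarrow>
      amap (adjoin k \<C> G) (adjoin_extension \<C> D F \<gamma>) (gen_arrow k \<C> G g) = \<gamma> g"
proof -
  let ?A = "adjoin k \<C> G" and ?E = "adjoin_extension \<C> D F \<gamma>"
  note E = id_functor_extension[OF F \<gamma>]
  show "amap ?A ?E (amap \<C> (adjoin_functor k \<C> G) f) = amap \<C> F f"
  proof (cases f rule: arrow_cases)
    case undef
    then show ?thesis by (simp add: amap_def chk_def)
  next
    case (def X Y n f')
    have f: "f = arr \<C> X Y n f'" using def by (simp add: arr_def)
    have c: "on_mor (adjoin_functor k \<C> G) X Y n f' \<in> carrier (Hom ?A X Y n)"
      by (rule id_functor_closed[OF id_functor_adjoin def(1-3)])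
    have XY: "X \<in> Obj ?A" "Y \<in> Obj ?A" using def by simp_all
    show ?thesis
      unfolding f amap_arr[OF id_functor_adjoin def(1-3)] amap_arr[OF E XY c] amap_arr[OF F def(1-3)]
        extension_Base[OF F \<gamma> def(1-3)] ..
  qed
  show "amap ?A ?E (gen_arrow k \<C> G g) = \<gamma> g" if "G g = Some (X, Y, n, b)" "X \<in> Obj \<C>" "Y \<in> Obj \<C>"
  proof -
    note t = has_type.Gen[where G = G and g = g, OF that]
    show ?thesis
      using amap_arr[OF E _ _ , of X Y "term_class k \<C> G X Y n (Gen g)" n] that cls_closed[OF t]
        arr_extension_cls[OF F \<gamma> t] by (simp add: gen_arrow_def)
  qed
qed

end

section \<open>Killing a morphism and one-sided inverses\<close>

text \<open>Composition with \<open>f\<close> on the left or on the right, so that right inverses of \<open>x\<close> and left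
  inverses of \<open>s\<close> can be treated together.\<close>

definition side_cmp :: "bool \<Rightarrow> ('o, 'k, 'm) dgcat \<Rightarrow> ('o, 'm) arrow \<Rightarrow> ('o, 'm) arrow \<Rightarrow> ('o, 'm) arrow" where
  "side_cmp right D f a = (if right then acmp D f a else acmp D a f)"

lemma amap_side_cmp:
  "id_functor k C D F \<Longrightarrow> amap C F (side_cmp e C f a) = side_cmp e D (amap C F f) (amap C F a)"
  by (simp add: side_cmp_def amap_laws)

context dg_category
begin

text \<open>\<open>d (h a - v b) = v x a - v (x a - 1) = v\<close>.\<close>

lemma right_inverse_null_homotopy:
  assumes T: "contracted_triangle \<C> (A, B, C) (0, 0, - 1) (x, v, s) (h, g, t) (\<alpha>, \<beta>, \<gamma>) (p, q, r)"
    and a: "a \<in> hom B A 0" "\<delta> a = \<o> B A (- 1)" and b: "b \<in> hom B B 1" "\<delta> b = x \<cdot> a \<uplus> \<sim> (\<i> B)"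
  shows "h \<cdot> a \<uplus> \<sim> (v \<cdot> b) \<in> hom B C 1" "\<delta> (h \<cdot> a \<uplus> \<sim> (v \<cdot> b)) = v"
proof -
  from T have x: "x \<in> hom A B 0" and v: "v \<in> hom B C 0" "\<delta> v = \<o> B C (- 1)"
    and h: "h \<in> hom A C 1" "\<delta> h = v \<cdot> x"
    unfolding contracted_triangle_def by auto
  have ty: "h \<cdot> a \<in> hom B C 1" "v \<cdot> b \<in> hom B C 1" "v \<cdot> x \<cdot> a \<in> hom B C 0"
    using cmp_typed[OF h(1) a(1)] cmp_typed[OF v(1) b(1)] cmp_typed[OF v(1) cmp_typed[OF x a(1)]] by simp_all
  then show "h \<cdot> a \<uplus> \<sim> (v \<cdot> b) \<in> hom B C 1" by auto
  have "\<delta> (h \<cdot> a \<uplus> \<sim> (v \<cdot> b)) = v \<uplus> (v \<cdot> x \<cdot> a \<uplus> \<sim> (v \<cdot> x \<cdot> a))"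
    using v(1) by (simp add: dif_closed_right[OF a] h(2) dif_closed_left[OF v] b(2) comp_assoc add_ac)
  then show "\<delta> (h \<cdot> a \<uplus> \<sim> (v \<cdot> b)) = v" using add_neg[OF ty(3)] v(1) by simp
qed

text \<open>\<open>d (a g - b v) = a s v - (a s - 1) v = v\<close>.\<close>

lemma left_inverse_null_homotopy:
  assumes T: "contracted_triangle \<C> (A, B, C) (- 1, 0, 0) (x, v, s) (h, g, t) (\<alpha>, \<beta>, \<gamma>) (p, q, r)"
    and a: "a \<in> hom A C 0" "\<delta> a = \<o> A C (- 1)" and b: "b \<in> hom C C 1" "\<delta> b = a \<cdot> s \<uplus> \<sim> (\<i> C)"
  shows "a \<cdot> g \<uplus> \<sim> (b \<cdot> v) \<in> hom B C 1" "\<delta> (a \<cdot> g \<uplus> \<sim> (b \<cdot> v)) = v"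
proof -
  from T have v: "v \<in> hom B C 0" "\<delta> v = \<o> B C (- 1)" and s: "s \<in> hom C A 0"
    and g: "g \<in> hom B A 1" "\<delta> g = s \<cdot> v"
    unfolding contracted_triangle_def by auto
  have ty: "a \<cdot> g \<in> hom B C 1" "b \<cdot> v \<in> hom B C 1" "a \<cdot> s \<cdot> v \<in> hom B C 0"
    using cmp_typed[OF a(1) g(1)] cmp_typed[OF b(1) v(1)] cmp_typed[OF a(1) cmp_typed[OF s v(1)]] by simp_all
  then show "a \<cdot> g \<uplus> \<sim> (b \<cdot> v) \<in> hom B C 1" by auto
  have "\<delta> (a \<cdot> g \<uplus> \<sim> (b \<cdot> v)) = v \<uplus> (a \<cdot> s \<cdot> v \<uplus> \<sim> (a \<cdot> s \<cdot> v))"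
    using v(1) by (simp add: dif_closed_left[OF a] g(2) dif_closed_right[OF v] b(2) comp_assoc add_ac)
  then show "\<delta> (a \<cdot> g \<uplus> \<sim> (b \<cdot> v)) = v" using add_neg[OF ty(3)] v(1) by simp
qed

lemma diff_eqI:
  assumes "a \<in> hom X Y n" "b \<in> hom X Y n" "a = c \<uplus> b" "c \<in> hom X Y n"
  shows "a \<uplus> \<sim> b = c"
  using eq_diff_iff[OF assms(1,2,4)] assms(3) by simp

lemma side_cmp_laws:
  "side_cmp e \<C> f (a \<uplus> b) = side_cmp e \<C> f a \<uplus> side_cmp e \<C> f b"
  "side_cmp e \<C> f (\<sim> a) = \<sim> (side_cmp e \<C> f a)"
  by (simp_all add: side_cmp_def)

lemma side_cmp_in_hom:
  "f \<in> hom Q P 0 \<Longrightarrow> a \<in> hom P Q n \<Longrightarrow> R = (if e then P else Q) \<Longrightarrow> side_cmp e \<C> f a \<in> hom R R n"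
  using cmp_typed[of f Q P 0 a P n] cmp_typed[of a P Q n f Q 0] by (simp add: side_cmp_def)

text \<open>The common part of both equivalences. A homotopy inverse of \<open>f : Q \<rightarrow> P\<close> on the right (\<open>e\<close>)
  or left is a pair \<open>(a, b)\<close> with \<open>d b = f a - 1\<close> on \<open>R = P\<close> or \<open>d b = a f - 1\<close> on \<open>R = Q\<close>.
  The assumptions state that in the dg categories under \<open>\<C>\<close> the formula \<open>h a - v b\<close>, or
  \<open>a h - b v\<close>, is a bijection up to homotopy from such pairs to null homotopies of \<open>v\<close>. It
  suffices to have this in the two free extensions themselves, which explains the type of the
  morphisms of \<open>D\<close>. The generators \<open>G1\<close> and \<open>G2\<close> have the form that \<open>killing\<close> and the
  localizations take in degree \<open>0\<close>.

  The functor \<open>H\<close> sends the universal null homotopy \<open>w1\<close> to the one given by the universal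
  pair \<open>(w2, u2)\<close>; \<open>K\<close> sends \<open>(w2, u2)\<close> to a pair \<open>(a, b)\<close> that induces \<open>w1\<close> up to \<open>d y\<close>. So
  \<open>y\<close> is a homotopy from \<open>K H\<close> to the identity. The image of \<open>(a, b)\<close> under \<open>H\<close> and the pair
  \<open>(w2, u2)\<close> induce null homotopies that differ by \<open>d (H y)\<close>, and uniqueness provides a
  homotopy from \<open>H K\<close> to the identity.\<close>

lemma killing_equivalent_one_sided_inverse:
  fixes e :: bool and P Q B C R :: 'o and f v :: 'm and h :: "('o, 'm) arrow"
  defines "X \<equiv> arr \<C> Q P 0 f" and "V \<equiv> arr \<C> B C 0 v"
    and "G1 \<equiv> [GenW \<mapsto> (B, C, 0 + 1, Base B C 0 v)]"
    and "G2 \<equiv> [GenW \<mapsto> (P, Q, - 0, Base P Q (- 0 - 1) \<zero>\<^bsub>Hom \<C> P Q (- 0 - 1)\<^esub>),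
        GenU \<mapsto> (R, R, 1,
          Add (if e then dgterm.Cmp (Base Q P 0 f) (Gen GenW) else dgterm.Cmp (Gen GenW) (Base Q P 0 f))
            (Smul (\<ominus>\<^bsub>k\<^esub> \<one>\<^bsub>k\<^esub>) (Base R R 0 (idt \<C> R))))]"
  assumes R_def: "R = (if e then P else Q)"
    and obj: "P \<in> Obj \<C>" "Q \<in> Obj \<C>" "B \<in> Obj \<C>" "C \<in> Obj \<C>"
    and fc: "f \<in> carrier (Hom \<C> Q P 0)" and vc: "v \<in> carrier (Hom \<C> B C 0)"
    and null_homotopy: "\<And>(D :: ('o, 'k, ('k, 'o, 'm, new_morphism) dgterm set) dgcat) F a b.
      id_functor k \<C> D F \<Longrightarrow> a \<in> arrows D P Q 0 \<Longrightarrow> adif D a = azero D P Q (- 1) \<Longrightarrow>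
      b \<in> arrows D R R 1 \<Longrightarrow> adif D b = aadd D (side_cmp e D (amap \<C> F X) a) (aneg D (aidt D R)) \<Longrightarrow>
      aadd D (side_cmp e D (amap \<C> F h) a) (aneg D (side_cmp e D (amap \<C> F V) b)) \<in> arrows D B C 1 \<and>
      adif D (aadd D (side_cmp e D (amap \<C> F h) a) (aneg D (side_cmp e D (amap \<C> F V) b))) = amap \<C> F V"
    and inverse_exists: "\<And>(D :: ('o, 'k, ('k, 'o, 'm, new_morphism) dgterm set) dgcat) F w.
      id_functor k \<C> D F \<Longrightarrow> w \<in> arrows D B C 1 \<Longrightarrow> adif D w = amap \<C> F V \<Longrightarrow>
      \<exists>a b y. a \<in> arrows D P Q 0 \<and> adif D a = azero D P Q (- 1) \<and>
        b \<in> arrows D R R 1 \<and> adif D b = aadd D (side_cmp e D (amap \<C> F X) a) (aneg D (aidt D R)) \<and>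
        y \<in> arrows D B C 2 \<and>
        aadd D (side_cmp e D (amap \<C> F h) a) (aneg D (side_cmp e D (amap \<C> F V) b)) = aadd D w (adif D y)"
    and inverse_unique: "\<And>(D :: ('o, 'k, ('k, 'o, 'm, new_morphism) dgterm set) dgcat) F a b y.
      id_functor k \<C> D F \<Longrightarrow> a \<in> arrows D P Q 0 \<Longrightarrow> adif D a = azero D P Q (- 1) \<Longrightarrow>
      b \<in> arrows D R R 1 \<Longrightarrow> adif D b = side_cmp e D (amap \<C> F X) a \<Longrightarrow> y \<in> arrows D B C 2 \<Longrightarrow>
      aadd D (side_cmp e D (amap \<C> F h) a) (aneg D (side_cmp e D (amap \<C> F V) b)) = adif D y \<Longrightarrow>
      \<exists>z y'. z \<in> arrows D P Q 1 \<and> adif D z = a \<and>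
        y' \<in> arrows D R R 2 \<and> b = aadd D (side_cmp e D (amap \<C> F X) z) (adif D y')"
  shows "weakly_equivalent_under k \<C> (adjoin_under k \<C> G1) (adjoin_under k \<C> G2)"
proof -
  have R: "R \<in> Obj \<C>" using obj by (simp add: R_def)
  define D1 D2 F1 F2 where "D1 = adjoin k \<C> G1" and "D2 = adjoin k \<C> G2"
    and "F1 = adjoin_functor k \<C> G1" and "F2 = adjoin_functor k \<C> G2"
  have F1: "id_functor k \<C> D1 F1" and F2: "id_functor k \<C> D2 F2"
    unfolding D1_def D2_def F1_def F2_def by (rule id_functor_adjoin)+
  interpret D1: dg_category k D1 using id_functorD(2)[OF F1] .
  interpret D2: dg_category k D2 using id_functorD(2)[OF F2] .
  interpret P1: dg_category k "path_object D1" by (rule D1.dg_category_path)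
  interpret P2: dg_category k "path_object D2" by (rule D2.dg_category_path)
  let ?t = "if e then dgterm.Cmp (Base Q P 0 f) (Gen GenW) else dgterm.Cmp (Gen GenW) (Base Q P 0 f)"
  have gens: "G1 GenW = Some (B, C, 1, Base B C 0 v)" "G1 GenU = None"
    "G2 GenW = Some (P, Q, 0, Base P Q (- 1) \<zero>\<^bsub>Hom \<C> P Q (- 1)\<^esub>)"
    "G2 GenU = Some (R, R, 1, Add (?t) (Smul (\<ominus>\<^bsub>k\<^esub> \<one>\<^bsub>k\<^esub>) (Base R R 0 (idt \<C> R))))"
    by (simp_all add: G1_def G2_def)
  have G1D: "g = GenW \<and> X = B \<and> Y = C \<and> n = 1 \<and> b = Base B C 0 v" if "G1 g = Some (X, Y, n, b)" for g X Y n b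
    using that gens by (cases g) auto
  have obj1: "P \<in> Obj D1" "Q \<in> Obj D1" "B \<in> Obj D1" "C \<in> Obj D1" "R \<in> Obj D1"
    and obj2: "P \<in> Obj D2" "Q \<in> Obj D2" "B \<in> Obj D2" "C \<in> Obj D2" "R \<in> Obj D2"
    using obj R by (simp_all add: D1_def D2_def)
  have X: "X \<in> hom Q P 0" and V: "V \<in> hom B C 0" using fc vc obj by (auto simp: X_def V_def)
  let ?f1 = "amap \<C> F1" and ?f2 = "amap \<C> F2"
  (* The universal null homotopy of \<open>v\<close> and the universal one-sided inverse of \<open>f\<close>. *)
  define w1 where "w1 = gen_arrow k \<C> G1 GenW"
  define w2 u2 where "w2 = gen_arrow k \<C> G2 GenW" and "u2 = gen_arrow k \<C> G2 GenU"
  have ty2: "has_type k \<C> G2 (Add (?t) (Smul (\<ominus>\<^bsub>k\<^esub> \<one>\<^bsub>k\<^esub>) (Base R R 0 (idt \<C> R)))) R R (1 - 1)"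
    using has_type.Cmp[OF has_type.Base[where k = k and G = G2, OF obj(2,1) fc] has_type.Gen[where G = G2 and g = GenW, OF gens(3) obj(1,2)]]
      has_type.Cmp[OF has_type.Gen[where G = G2 and g = GenW, OF gens(3) obj(1,2)] has_type.Base[where k = k and G = G2, OF obj(2,1) fc]]
      typed_idt[OF R] by (intro has_type.Add has_type.Smul) (auto simp: R_def)
  have w1: "w1 \<in> arrows D1 B C 1" "adif D1 w1 = ?f1 V"
    using gen_arrow_in_hom[where G = G1 and g = GenW, OF gens(1) obj(3,4)] gen_arrow_dif[where G = G1 and g = GenW, OF gens(1) obj(3,4)] has_type.Base[where k = k and G = G1, OF obj(3,4) vc]
    by (simp_all add: w1_def D1_def F1_def V_def)
  have w2: "w2 \<in> arrows D2 P Q 0" "adif D2 w2 = azero D2 P Q (- 1)"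
    using gen_arrow_in_hom[where G = G2 and g = GenW, OF gens(3) obj(1,2)] gen_arrow_dif[where G = G2 and g = GenW, OF gens(3) obj(1,2)] typed_zero[where G = G2, OF obj(1,2)]
      amap_laws(8)[OF F2 obj(1,2)]
    by (simp_all add: w2_def D2_def F2_def arr_zero)
  have u2: "u2 \<in> arrows D2 R R 1" "adif D2 u2 = aadd D2 (side_cmp e D2 (?f2 X) w2) (aneg D2 (aidt D2 R))"
    using gen_arrow_in_hom[where G = G2 and g = GenU, OF gens(4) R R] gen_arrow_dif[where G = G2 and g = GenU, OF gens(4) R R ty2] amap_laws(7)[OF F2 R]
      D2.smul_one_neg_one
    by (auto simp: u2_def w2_def D2_def F2_def X_def arr_idt side_cmp_def)
  (* The value of \<open>H\<close> on \<open>w1\<close>. *)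
  define n2 where "n2 = aadd D2 (side_cmp e D2 (?f2 h) w2) (aneg D2 (side_cmp e D2 (?f2 V) u2))"
  have n2: "n2 \<in> arrows D2 B C 1" "adif D2 n2 = ?f2 V"
    using null_homotopy[OF F2 w2 u2] by (simp_all add: n2_def)
  define \<eta> :: "new_morphism \<Rightarrow> _" where "\<eta> = (\<lambda>_. n2)"
  have \<eta>: "valid_assignment k \<C> G1 D2 F2 \<eta>"
    using n2 by (auto simp: valid_assignment_def \<eta>_def V_def dest!: G1D)
  (* The values of \<open>K\<close> on \<open>w2\<close> and \<open>u2\<close>. *)
  obtain a b y where a: "a \<in> arrows D1 P Q 0" "adif D1 a = azero D1 P Q (- 1)"
    and b: "b \<in> arrows D1 R R 1" "adif D1 b = aadd D1 (side_cmp e D1 (?f1 X) a) (aneg D1 (aidt D1 R))"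
    and y: "y \<in> arrows D1 B C 2"
      "aadd D1 (side_cmp e D1 (?f1 h) a) (aneg D1 (side_cmp e D1 (?f1 V) b)) = aadd D1 w1 (adif D1 y)"
    using inverse_exists[OF F1 w1] by blast
  define \<kappa> where "\<kappa> = (\<lambda>g. case g of GenW \<Rightarrow> a | GenU \<Rightarrow> b)"
  have G2D: "(g = GenW \<and> X = P \<and> Y = Q \<and> n = 0 \<and> c = Base P Q (- 1) \<zero>\<^bsub>Hom \<C> P Q (- 1)\<^esub>) \<or>
      (g = GenU \<and> X = R \<and> Y = R \<and> n = 1 \<and>
        c = Add (?t) (Smul (\<ominus>\<^bsub>k\<^esub> \<one>\<^bsub>k\<^esub>) (Base R R 0 (idt \<C> R))))"
    if "G2 g = Some (X, Y, n, c)" for g X Y n c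
    using that gens by (cases g) auto
  have \<kappa>: "valid_assignment k \<C> G2 D1 F1 \<kappa>"
    using a b amap_laws(7)[OF F1 R] amap_laws(8)[OF F1 obj(1,2)]
    by (auto simp: valid_assignment_def \<kappa>_def X_def arr_zero arr_idt side_cmp_def dest!: G2D)
  let ?H = "adjoin_extension \<C> D2 F2 \<eta>" and ?K = "adjoin_extension \<C> D1 F1 \<kappa>"
  have H: "id_functor k D1 D2 ?H" and K: "id_functor k D2 D1 ?K"
    using id_functor_extension[OF F2 \<eta>] id_functor_extension[OF F1 \<kappa>] by (simp_all add: D1_def D2_def)
  have Hf: "amap D1 ?H (?f1 f) = ?f2 f" and Kf: "amap D2 ?K (?f2 f) = ?f1 f" for f
    using extension_on_arrows(1)[OF F2 \<eta>] extension_on_arrows(1)[OF F1 \<kappa>]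
    by (simp_all add: D1_def D2_def F1_def F2_def)
  have Hw: "amap D1 ?H w1 = n2" and Kw: "amap D2 ?K w2 = a" and Ku: "amap D2 ?K u2 = b"
    using extension_on_arrows(2)[where G = G1 and g = GenW, OF F2 \<eta> gens(1) obj(3,4)] extension_on_arrows(2)[where G = G2 and g = GenW, OF F1 \<kappa> gens(3) obj(1,2)]
      extension_on_arrows(2)[where G = G2 and g = GenU, OF F1 \<kappa> gens(4) R R]
    by (simp_all add: w1_def w2_def u2_def \<eta>_def \<kappa>_def D1_def D2_def)
  (* The homotopy from \<open>K H\<close> to the identity has to be given on \<open>w1\<close> only. *)
  have Kn: "amap D2 ?K n2 = aadd D1 w1 (adif D1 y)"
    using y(2) by (simp add: n2_def amap_laws(1,3)[OF K] amap_side_cmp[OF K] Kf Kw Ku)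
  have dy: "adif D1 y \<in> arrows D1 B C 1" using D1.dif_in_hom[OF y(1)] by simp
  have V1: "?f1 V \<in> arrows D1 B C 0" using amap_in_hom[OF F1 V] .
  obtain p1 where p1: "p1 \<in> arrows (path_object D1) B C 1"
    "amap (path_object D1) path_source p1 = aadd D1 w1 (adif D1 y)" "path_homotopy D1 p1 = y"
    "amap (path_object D1) path_target p1 = w1"
    using D1.path_arrow_exists[of "aadd D1 w1 (adif D1 y)" B C 1 y w1] w1 dy y(1) D1.add_in_hom[OF w1(1) dy] by auto
  have p1d: "adif (path_object D1) p1 = amap \<C> (constant_path D1 F1) V"
  proof (rule D1.path_arrow_eqI[of _ B C 0])
    note c = D1.amap_constant_path[OF F1 V]
    show "adif (path_object D1) p1 \<in> arrows (path_object D1) B C 0" using P1.dif_in_hom[OF p1(1)] by simp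
    show "amap \<C> (constant_path D1 F1) V \<in> arrows (path_object D1) B C 0" by (rule c(1))
    show "amap (path_object D1) path_source (adif (path_object D1) p1) =
        amap (path_object D1) path_source (amap \<C> (constant_path D1 F1) V)"
      using w1 V1 D1.dif_dif_arrow[OF y(1), of 0]
      by (simp add: amap_laws[OF D1.id_functor_path_source] p1 c)
    show "amap (path_object D1) path_target (adif (path_object D1) p1) =
        amap (path_object D1) path_target (amap \<C> (constant_path D1 F1) V)"
      using w1 by (simp add: amap_laws[OF D1.id_functor_path_target] p1 c)
    have "aadd D1 (aadd D1 (aadd D1 w1 (adif D1 y)) (aneg D1 w1)) (aneg D1 (adif D1 y)) = azero D1 B C 1"
      using D1.add_neg[OF D1.add_in_hom[OF w1(1) dy]] by (simp add: D1.add_ac)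
    then show "path_homotopy D1 (adif (path_object D1) p1) = path_homotopy D1 (amap \<C> (constant_path D1 F1) V)"
      by (simp add: D1.path_homotopy_ops(1)[OF p1(1)] p1 c)
  qed
  define \<pi>1 :: "new_morphism \<Rightarrow> _" where "\<pi>1 = (\<lambda>_. p1)"
  have \<pi>1: "valid_assignment k \<C> G1 (path_object D1) (constant_path D1 F1) \<pi>1"
    using p1(1) p1d by (auto simp: valid_assignment_def \<pi>1_def V_def dest!: G1D)
  (* For the homotopy from \<open>H K\<close> to the identity, compare \<open>(w2, u2)\<close> with its image \<open>(a', b')\<close>. *)
  define a' b' where "a' = amap D1 ?H a" and "b' = amap D1 ?H b"
  have a': "a' \<in> arrows D2 P Q 0" "adif D2 a' = azero D2 P Q (- 1)"
    using amap_in_hom[OF H a(1)] arg_cong[OF a(2), of "amap D1 ?H"] amap_laws(8)[OF H obj1(1,2)]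
    by (simp_all add: a'_def amap_laws(5)[OF H])
  have b': "b' \<in> arrows D2 R R 1" "adif D2 b' = aadd D2 (side_cmp e D2 (?f2 X) a') (aneg D2 (aidt D2 R))"
    using amap_in_hom[OF H b(1)] arg_cong[OF b(2), of "amap D1 ?H"] amap_laws(7)[OF H obj1(5)]
    by (simp_all add: a'_def b'_def amap_laws(1-5)[OF H] amap_side_cmp[OF H] Hf)
  define Y where "Y = amap D1 ?H y"
  have Y: "Y \<in> arrows D2 B C 2" using amap_in_hom[OF H y(1)] by (simp add: Y_def)
  have dY: "adif D2 Y \<in> arrows D2 B C 1" using D2.dif_in_hom[OF Y] by simp
  have X2: "?f2 X \<in> arrows D2 Q P 0" using amap_in_hom[OF F2 X] .
  have n': "aadd D2 (side_cmp e D2 (?f2 h) a') (aneg D2 (side_cmp e D2 (?f2 V) b')) = aadd D2 n2 (adif D2 Y)"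
    using arg_cong[OF y(2), of "amap D1 ?H"]
    by (simp add: amap_laws(1-5)[OF H] amap_side_cmp[OF H] Hf Hw a'_def b'_def Y_def)
  define a'' b'' where "a'' = aadd D2 a' (aneg D2 w2)" and "b'' = aadd D2 b' (aneg D2 u2)"
  have a'': "a'' \<in> arrows D2 P Q 0" "adif D2 a'' = azero D2 P Q (- 1)"
    using a' w2 by (auto simp: a''_def)
  have i2: "aneg D2 (aidt D2 R) \<in> arrows D2 R R 0" using D2.idt_in_hom[OF obj2(5)] by auto
  have xx: "side_cmp e D2 (?f2 X) a'' \<in> arrows D2 R R 0" using D2.side_cmp_in_hom[OF X2 a''(1) R_def] by simp
  have b'': "b'' \<in> arrows D2 R R 1" "adif D2 b'' = side_cmp e D2 (?f2 X) a''"
  proof -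
    show "b'' \<in> arrows D2 R R 1" using b' u2 by (auto simp: b''_def)
    have "adif D2 b'' = aadd D2 (side_cmp e D2 (?f2 X) a'') (aadd D2 (aneg D2 (aidt D2 R)) (aneg D2 (aneg D2 (aidt D2 R))))"
      by (simp add: b''_def a''_def b'(2) u2(2) D2.side_cmp_laws D2.add_ac)
    then show "adif D2 b'' = side_cmp e D2 (?f2 X) a''" unfolding D2.add_neg[OF i2] using xx by simp
  qed
  have n'': "aadd D2 (side_cmp e D2 (?f2 h) a'') (aneg D2 (side_cmp e D2 (?f2 V) b'')) = adif D2 Y"
  proof -
    have "aadd D2 (side_cmp e D2 (?f2 h) a'') (aneg D2 (side_cmp e D2 (?f2 V) b'')) =
        aadd D2 (aadd D2 (side_cmp e D2 (?f2 h) a') (aneg D2 (side_cmp e D2 (?f2 V) b'))) (aneg D2 n2)"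
      by (simp add: a''_def b''_def n2_def D2.side_cmp_laws D2.add_ac)
    also have "\<dots> = aadd D2 (adif D2 Y) (aadd D2 n2 (aneg D2 n2))" unfolding n' by (simp add: D2.add_ac)
    finally show ?thesis unfolding D2.add_neg[OF n2(1)] using dY by simp
  qed
  obtain z y' where z: "z \<in> arrows D2 P Q 1" "adif D2 z = a''"
    and y': "y' \<in> arrows D2 R R 2" "b'' = aadd D2 (side_cmp e D2 (?f2 X) z) (adif D2 y')"
    using inverse_unique[OF F2 a'' b'' Y n''] by blast
  obtain p2 where p2: "p2 \<in> arrows (path_object D2) P Q 0"
    "amap (path_object D2) path_source p2 = a'" "path_homotopy D2 p2 = z"
    "amap (path_object D2) path_target p2 = w2"
    using D2.path_arrow_exists[of a' P Q 0 z w2] a' w2 z by auto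
  obtain p3 where p3: "p3 \<in> arrows (path_object D2) R R 1"
    "amap (path_object D2) path_source p3 = b'" "path_homotopy D2 p3 = y'"
    "amap (path_object D2) path_target p3 = u2"
    using D2.path_arrow_exists[of b' R R 1 y' u2] b' u2 y' by auto
  have z0: "\<o> P Q (- 1) \<in> hom P Q (- 1)" using obj by auto
  have p2d: "adif (path_object D2) p2 = amap \<C> (constant_path D2 F2) (\<o> P Q (- 1))"
  proof (rule D2.path_arrow_eqI[of _ P Q "- 1"])
    note c = D2.amap_constant_path[OF F2 z0]
    show "adif (path_object D2) p2 \<in> arrows (path_object D2) P Q (- 1)" using P2.dif_in_hom[OF p2(1)] by simp
    show "amap \<C> (constant_path D2 F2) (\<o> P Q (- 1)) \<in> arrows (path_object D2) P Q (- 1)" by (rule c(1))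
    show "amap (path_object D2) path_source (adif (path_object D2) p2) =
        amap (path_object D2) path_source (amap \<C> (constant_path D2 F2) (\<o> P Q (- 1)))"
      using a' amap_laws(8)[OF F2 obj(1,2)] by (simp add: amap_laws(5)[OF D2.id_functor_path_source] p2 c)
    show "amap (path_object D2) path_target (adif (path_object D2) p2) =
        amap (path_object D2) path_target (amap \<C> (constant_path D2 F2) (\<o> P Q (- 1)))"
      using w2 amap_laws(8)[OF F2 obj(1,2)] by (simp add: amap_laws(5)[OF D2.id_functor_path_target] p2 c)
    show "path_homotopy D2 (adif (path_object D2) p2) = path_homotopy D2 (amap \<C> (constant_path D2 F2) (\<o> P Q (- 1)))"
      using D2.add_neg[OF a''(1)] z(2) by (simp add: D2.path_homotopy_ops(1)[OF p2(1)] p2 c a''_def)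
  qed
  have p3d: "adif (path_object D2) p3 = aadd (path_object D2)
      (side_cmp e (path_object D2) (amap \<C> (constant_path D2 F2) X) p2)
      (aneg (path_object D2) (amap \<C> (constant_path D2 F2) (\<i> R)))" (is "_ = aadd ?P ?l ?r")
  proof (rule D2.path_arrow_eqI[of _ R R 0])
    note c = D2.amap_constant_path[OF F2 X] and ci = D2.amap_constant_path[OF F2 idt_in_hom[OF R]]
    have l: "?l \<in> arrows ?P R R 0" using P2.side_cmp_in_hom[OF c(1) p2(1) R_def] by simp
    have r: "?r \<in> arrows ?P R R 0" using ci(1) by auto
    note ps = amap_laws[OF D2.id_functor_path_source] and pt = amap_laws[OF D2.id_functor_path_target]
    show "adif ?P p3 \<in> arrows ?P R R 0" using P2.dif_in_hom[OF p3(1)] by simp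
    show "aadd ?P ?l ?r \<in> arrows ?P R R 0" using l r by auto
    show "amap ?P path_source (adif ?P p3) = amap ?P path_source (aadd ?P ?l ?r)"
      using b' amap_laws(7)[OF F2 R] by (simp add: ps(1,3,5) amap_side_cmp[OF D2.id_functor_path_source] p3 p2 c ci)
    show "amap ?P path_target (adif ?P p3) = amap ?P path_target (aadd ?P ?l ?r)"
      using u2 amap_laws(7)[OF F2 R] by (simp add: pt(1,3,5) amap_side_cmp[OF D2.id_functor_path_target] p3 p2 c ci)
    have Xz: "side_cmp e D2 (?f2 X) z \<in> arrows D2 R R 1" using D2.side_cmp_in_hom[OF X2 z(1) R_def] by simp
    have dy': "adif D2 y' \<in> arrows D2 R R 1" using D2.dif_in_hom[OF y'(1)] by simp
    have "path_homotopy D2 (adif ?P p3) = aadd D2 b'' (aneg D2 (adif D2 y'))"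
      by (simp add: D2.path_homotopy_ops(1)[OF p3(1)] p3 b''_def)
    also have "\<dots> = side_cmp e D2 (?f2 X) z"
      by (rule D2.diff_eqI[OF b''(1) dy' y'(2) Xz])
    also have "\<dots> = path_homotopy D2 (aadd ?P ?l ?r)"
    proof -
      have "path_homotopy D2 ?r = azero D2 R R 1"
        using D2.path_homotopy_ops(3)[OF ci(1) sign_closed(1)] ci(3) by simp
      moreover have "path_homotopy D2 ?l = side_cmp e D2 (?f2 X) z"
        using D2.path_homotopy_ops(4)[OF p2(1) c(1)] D2.path_homotopy_ops(4)[OF c(1) p2(1)] c(2-4) p2(2-4)
          D2.zero_comp'[OF w2(1) obj2(1), of 1 1] D2.comp_zero'[OF a'(1) obj2(2), of 1 1] Xz
        by (auto simp: side_cmp_def R_def)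
      ultimately show ?thesis using D2.path_homotopy_ops(2)[OF l r] Xz by simp
    qed
    finally show "path_homotopy D2 (adif ?P p3) = path_homotopy D2 (aadd ?P ?l ?r)" .
  qed
  define \<pi>2 where "\<pi>2 = (\<lambda>g. case g of GenW \<Rightarrow> p2 | GenU \<Rightarrow> p3)"
  have \<pi>2: "valid_assignment k \<C> G2 (path_object D2) (constant_path D2 F2) \<pi>2"
    using p2(1) p2d p3(1) p3d
    by (auto simp: valid_assignment_def \<pi>2_def X_def arr_zero arr_idt side_cmp_def dest!: G2D)
  have "weakly_equivalent_under k \<C> (adjoin_under k \<C> G1) (adjoin_under k \<C> G2)"
  proof (rule extensions_weakly_equivalent[where ?G1.0 = G1 and ?G2.0 = G2, OF dg_category_axioms, folded D1_def D2_def F1_def F2_def, OF \<eta> \<kappa> \<pi>1 \<pi>2])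
    show "amap (path_object D1) path_source (\<pi>1 g) = amap D2 ?K (\<eta> g)"
      if "G1 g = Some (X, Y, n, b)" for g X Y n b using Kn p1(2) by (simp add: \<pi>1_def \<eta>_def)
    show "amap (path_object D1) path_target (\<pi>1 g) = arr D1 X Y n (term_class k \<C> G1 X Y n (Gen g))"
      if "G1 g = Some (X, Y, n, b)" for g X Y n b
      using G1D[OF that] gens p1(4) by (simp add: \<pi>1_def w1_def gen_arrow_def D1_def)
    show "amap (path_object D2) path_source (\<pi>2 g) = amap D1 ?H (\<kappa> g)"
      if "G2 g = Some (X, Y, n, b)" for g X Y n b
      using p2 p3 by (cases g) (simp_all add: \<pi>2_def \<kappa>_def a'_def b'_def)
    show "amap (path_object D2) path_target (\<pi>2 g) = arr D2 X Y n (term_class k \<C> G2 X Y n (Gen g))"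
      if "G2 g = Some (X, Y, n, b)" for g X Y n b
      using G2D[OF that] gens p2(4) p3(4) by (auto simp: \<pi>2_def w2_def u2_def gen_arrow_def D2_def)
  qed
  then show ?thesis .
qed

lemma killing_equivalent_right_localization:
  assumes T: "contracted_triangle \<C> (A, B, C) (0, 0, - 1) (arr \<C> A B 0 x, arr \<C> B C 0 v, s)
      (h, g, t) (\<alpha>, \<beta>, \<gamma>) (p, q, r)"
    and xc: "x \<in> carrier (Hom \<C> A B 0)" and vc: "v \<in> carrier (Hom \<C> B C 0)"
    and obj: "A \<in> Obj \<C>" "B \<in> Obj \<C>" "C \<in> Obj \<C>"
  shows "weakly_equivalent_under k \<C> (killing k \<C> B C 0 v) (right_localization k \<C> A B 0 x)"
proof -
  note T' = contracted_triangle_functor[OF _ T] and cat = id_functorD(2)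
  show ?thesis
    unfolding killing_def right_localization_def
  proof (rule killing_equivalent_one_sided_inverse[where e = True and P = B and Q = A and R = B and
        B = B and C = C and f = x and v = v and h = h, unfolded side_cmp_def if_True if_False], goal_cases)
    case (8 D F a b)
    then show ?case using dg_category.right_inverse_null_homotopy[OF cat T'] by blast
  next
    case (9 D F w)
    show ?case by (rule dg_category.right_inverse_exists[OF cat[OF 9(1)] T'[OF 9(1)] 9(2,3)]) blast
  next
    case (10 D F a b y)
    show ?case by (rule dg_category.right_inverse_unique[OF cat[OF 10(1)] T'[OF 10(1)] 10(2-7)]) blast
  qed (simp_all add: obj xc vc)
qed

lemma killing_equivalent_left_localization:
  assumes T: "contracted_triangle \<C> (A, B, C) (- 1, 0, 0) (x, arr \<C> B C 0 v, arr \<C> C A 0 s)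
      (h, g, t) (\<alpha>, \<beta>, \<gamma>) (p, q, r)"
    and sc: "s \<in> carrier (Hom \<C> C A 0)" and vc: "v \<in> carrier (Hom \<C> B C 0)"
    and obj: "A \<in> Obj \<C>" "B \<in> Obj \<C>" "C \<in> Obj \<C>"
  shows "weakly_equivalent_under k \<C> (killing k \<C> B C 0 v) (left_localization k \<C> C A 0 s)"
proof -
  note T' = contracted_triangle_functor[OF _ T] and cat = id_functorD(2)
  show ?thesis
    unfolding killing_def left_localization_def
  proof (rule killing_equivalent_one_sided_inverse[where e = False and P = A and Q = C and R = C and
        B = B and C = C and f = s and v = v and h = g, unfolded side_cmp_def if_True if_False], goal_cases)
    case (8 D F a b)
    then show ?case using dg_category.left_inverse_null_homotopy[OF cat T'] by blast
  next
    case (9 D F w)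
    show ?case by (rule dg_category.left_inverse_exists[OF cat[OF 9(1)] T'[OF 9(1)] 9(2,3)]) blast
  next
    case (10 D F a b y)
    show ?case by (rule dg_category.left_inverse_unique[OF cat[OF 10(1)] T'[OF 10(1)] 10(2-7)]) blast
  qed (simp_all add: obj sc vc)
qed

end

theorem theorem6p1:
  fixes k :: "('k, 'z) ring_scheme"
    and \<C> :: "('o, 'k, 'm) dgcat"
    and S :: "'o \<Rightarrow> 'o"
    and \<sigma> :: "'o \<Rightarrow> nat \<Rightarrow> nat \<Rightarrow> 'm"
    and A B C :: 'o
    and x v s :: 'm
  assumes "cring k"
    and "dg_category k \<C>"
    and "dg_flat k \<C>"
    and "pretriangulated \<C>"
    and "suspension \<C> S \<sigma>"
    and "exact_triangle \<C> S \<sigma> A B C x v s"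
  shows "weakly_equivalent_under k \<C> (killing k \<C> B C 0 v) (right_localization k \<C> A B 0 x) \<and>
         weakly_equivalent_under k \<C> (killing k \<C> B C 0 v) (left_localization k \<C> C (S A) 0 s)"
proof -
  interpret dg_category k \<C> by fact
  have obj: "A \<in> Obj \<C>" "B \<in> Obj \<C>" "C \<in> Obj \<C>" and SA: "S A \<in> Obj \<C>"
    and c: "x \<in> carrier (Hom \<C> A B 0)" "v \<in> carrier (Hom \<C> B C 0)" "s \<in> carrier (Hom \<C> C (S A) 0)"
    using assms(5,6) unfolding exact_triangle_def suspension_def cycles_def by auto
  note T = exact_triangle_contractible[OF assms(5,6)]
  from T(1) obtain h g t \<alpha> \<beta> \<gamma> p q r where
    "contracted_triangle \<C> (A, B, C) (0, 0, - 1)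
      (arr \<C> A B 0 x, arr \<C> B C 0 v, arr \<C> (S A) A (- 1) (\<sigma> A 0 0) \<cdot> arr \<C> C (S A) 0 s)
      (h, g, t) (\<alpha>, \<beta>, \<gamma>) (p, q, r)"
    unfolding contractible_triangle_def by (metis prod_cases3)
  from killing_equivalent_right_localization[OF this c(1,2) obj]
  have 1: "weakly_equivalent_under k \<C> (killing k \<C> B C 0 v) (right_localization k \<C> A B 0 x)" .
  from T(2) obtain h g t \<alpha> \<beta> \<gamma> p q r where
    "contracted_triangle \<C> (S A, B, C) (- 1, 0, 0)
      (arr \<C> A B 0 x \<cdot> arr \<C> (S A) A (- 1) (\<sigma> A 0 0), arr \<C> B C 0 v, arr \<C> C (S A) 0 s)
      (h, g, t) (\<alpha>, \<beta>, \<gamma>) (p, q, r)"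
    unfolding contractible_triangle_def by (metis prod_cases3)
  from killing_equivalent_left_localization[OF this c(3,2) SA obj(2,3)]
  have 2: "weakly_equivalent_under k \<C> (killing k \<C> B C 0 v) (left_localization k \<C> C (S A) 0 s)" .
  from 1 2 show ?thesis ..
qed

end
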